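(* Let $m\in\mathbb{N}$, $S=\{1,\ldots,m\}$, $S'\subseteq S$, and let $\lambda_1,\ldots,\lambda_m\in\mathbb{C}^*$ be pairwise distinct. Let $\alpha_i,\beta_i\in\mathbb{C}$ ($i\in S$) be such that $\beta_i\neq 0$ for $i\in S'$, and $\alpha_j\neq0$, $\beta_j=0$ for $j\in S\setminus S'$. Let $e\in\mathbb{Z}_+$ and let $M$ be a simple $\mathcal{H}_e$-module on which $I_0,C_1,C_2,C_3$ act as scalars $c_0,c_1,c_2,c_3$ respectively, with $c_3=0$. Assume there exists $k\in\mathbb{Z}_+$ such that (a) if $k\neq0$, the action of $I_k$ on $M$ is injective; if $k=0$, $c_0+(n-1)c_2\neq0$ for all $n\in\mathbb{Z}\setminus\{0\}$; (b) $I_nM=L_{n'}M=0$ for all $n>k$ and $n'>k+e$. Then the tensor product $\big(\bigotimes_{i=1}^m\Omega(\lambda_i,\alpha_i,\beta_i)\big)\otimes\mathrm{Ind}(M)$ is an irreducible $\mathcal{H}$-module.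
   Context: $\mathbb{C}^*$, $\mathbb{Z}_+$, $\mathbb{N}$ denote the nonzero complex numbers, nonnegative integers and positive integers. All vector spaces are over $\mathbb{C}$. The twisted Heisenberg-Virasoro algebra $\mathcal{H}$ is the complex Lie algebra with basis $\{L_m,I_m,C_1,C_2,C_3\mid m\in\mathbb{Z}\}$ and brackets $$[L_m,L_n]=(n-m)L_{m+n}+\delta_{m+n,0}\tfrac{m^3-m}{12}C_1,\quad [L_m,I_n]=nI_{m+n}+\delta_{m+n,0}(m^2+m)C_2,\quad [I_m,I_n]=n\delta_{m+n,0}C_3,$$ with $C_1,C_2,C_3$ central. For $\lambda\in\mathbb{C}^*$, $\alpha,\beta\in\mathbb{C}$, $\Omega(\lambda,\alpha,\beta)$ is the $\mathcal{H}$-module with underlying space the polynomial algebra $\mathbb{C}[\partial]$ and action $L_k\partial^n=\lambda^k(\partial+k\alpha)(\partial-k)^n$, $I_k\partial^n=\lambda^k\beta(\partial-k)^n$, $C_j\partial^n=0$ for $k\in\mathbb{Z}$, $n\in\mathbb{Z}_+$, $j=1,2,3$. For $e\in\mathbb{Z}_+$, $\mathcal{H}_e$ is the subalgebra $\sum_{m\in\mathbb{Z}_+}(\mathbb{C}L_m\oplus\mathbb{C}I_{m-e})\oplus\mathbb{C}C_1\oplus\mathbb{C}C_2\oplus\mathbb{C}C_3$ of $\mathcal{H}$. For an $\mathcal{H}_e$-module $M$, $\mathrm{Ind}(M)=\mathcal{U}(\mathcal{H})\otimes_{\mathcal{U}(\mathcal{H}_e)}M$ is the induced $\mathcal{H}$-module.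 Tensor products of $\mathcal{H}$-modules are over $\mathbb{C}$ with the usual Lie algebra action. *)

theory Defs
  imports
    "HOL-Library.Poly_Mapping"
    "HOL-Computational_Algebra.Polynomial"
    "HOL.Complex"
    "HOL-Algebra.QuotRing"
    "HOL-Algebra.Module"
begin

section \<open>Complex vector spaces, free spaces and quotients\<close>

definition complex_field :: "complex ring" where
  "complex_field = \<lparr>carrier = UNIV, mult = (*), one = 1, zero = 0, add = (+)\<rparr>"

text \<open>
  Complex vector spaces are modules over \<^const>\<open>complex_field\<close>. The record \<^typ>\<open>('a, 'b) module\<close>
  extends the ring record, so for a space without a product the fields \<^const>\<open>mult\<close> and
  \<^const>\<open>one\<close> are left unspecified.
\<close>

definition scale :: "complex \<Rightarrow> ('x \<Rightarrow>\<^sub>0 complex) \<Rightarrow> ('x \<Rightarrow>\<^sub>0 complex)" where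
  "scale c p = Poly_Mapping.map ((*) c) p"

abbreviation gen :: "'x \<Rightarrow> ('x \<Rightarrow>\<^sub>0 complex)" where
  "gen x \<equiv> Poly_Mapping.single x 1"

definition lin_ext :: "('x \<Rightarrow> ('y \<Rightarrow>\<^sub>0 complex)) \<Rightarrow> ('x \<Rightarrow>\<^sub>0 complex) \<Rightarrow> ('y \<Rightarrow>\<^sub>0 complex)" where
  "lin_ext f p = (\<Sum>x\<in>Poly_Mapping.keys p. scale (Poly_Mapping.lookup p x) (f x))"

definition free_space :: "'x set \<Rightarrow> (complex, 'x \<Rightarrow>\<^sub>0 complex) module" where
  "free_space X = \<lparr>carrier = {p. Poly_Mapping.keys p \<subseteq> X}, mult = undefined, one = undefined,
     zero = 0, add = (+), smult = scale\<rparr>"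

definition subspace_gen :: "(complex, 'v, 'm) module_scheme \<Rightarrow> 'v set \<Rightarrow> 'v set" where
  "subspace_gen V A = (\<lambda>N. submodule N complex_field V) hull A"


section \<open>Lie algebras and their modules\<close>

record 'g lie_alg = "(complex, 'g) module" +
  bracket :: "'g \<Rightarrow> 'g \<Rightarrow> 'g"

record ('g, 'v) lie_mod = "(complex, 'v) module" +
  act :: "'g \<Rightarrow> 'v \<Rightarrow> 'v"

definition is_lie_module :: "('g, 'a) lie_alg_scheme \<Rightarrow> ('g, 'v, 'b) lie_mod_scheme \<Rightarrow> bool" where
  "is_lie_module g V \<longleftrightarrow> module complex_field V \<and>
     (\<forall>x\<in>carrier g. \<forall>v\<in>carrier V. act V x v \<in> carrier V) \<and>
     (\<forall>x\<in>carrier g. \<forall>v\<in>carrier V. \<forall>w\<in>carrier V.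
        act V x (v \<oplus>\<^bsub>V\<^esub> w) = act V x v \<oplus>\<^bsub>V\<^esub> act V x w) \<and>
     (\<forall>x\<in>carrier g. \<forall>c. \<forall>v\<in>carrier V. act V x (c \<odot>\<^bsub>V\<^esub> v) = c \<odot>\<^bsub>V\<^esub> act V x v) \<and>
     (\<forall>x\<in>carrier g. \<forall>y\<in>carrier g. \<forall>v\<in>carrier V.
        act V (x \<oplus>\<^bsub>g\<^esub> y) v = act V x v \<oplus>\<^bsub>V\<^esub> act V y v) \<and>
     (\<forall>x\<in>carrier g. \<forall>c. \<forall>v\<in>carrier V. act V (c \<odot>\<^bsub>g\<^esub> x) v = c \<odot>\<^bsub>V\<^esub> act V x v) \<and>
     (\<forall>x\<in>carrier g. \<forall>y\<in>carrier g. \<forall>v\<in>carrier V.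
        act V (bracket g x y) v = act V x (act V y v) \<ominus>\<^bsub>V\<^esub> act V y (act V x v))"

definition is_lie_submodule :: "('g, 'a) lie_alg_scheme \<Rightarrow> ('g, 'v, 'b) lie_mod_scheme \<Rightarrow> 'v set \<Rightarrow> bool" where
  "is_lie_submodule g V N \<longleftrightarrow> submodule N complex_field V \<and>
     (\<forall>x\<in>carrier g. \<forall>v\<in>N. act V x v \<in> N)"

definition simple_lie_module :: "('g, 'a) lie_alg_scheme \<Rightarrow> ('g, 'v, 'b) lie_mod_scheme \<Rightarrow> bool" where
  "simple_lie_module g V \<longleftrightarrow> is_lie_module g V \<and> carrier V \<noteq> {\<zero>\<^bsub>V\<^esub>} \<and>
     (\<forall>N. is_lie_submodule g V N \<longrightarrow> N = {\<zero>\<^bsub>V\<^esub>} \<or> N = carrier V)"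

text \<open>
  The vector space with generators \<open>X\<close> and relations \<open>R\<close>, on which \<open>x\<close> acts as induced by
  \<^term>\<open>lin_ext (f x)\<close> on cosets of \<^term>\<open>subspace_gen (free_space X) R\<close>. It is used only where
  \<^term>\<open>lin_ext (f x)\<close> preserves that subspace.
\<close>
definition presented_module ::
  "'x set \<Rightarrow> ('x \<Rightarrow>\<^sub>0 complex) set \<Rightarrow> ('g \<Rightarrow> 'x \<Rightarrow> ('x \<Rightarrow>\<^sub>0 complex)) \<Rightarrow>
    ('g, ('x \<Rightarrow>\<^sub>0 complex) set) lie_mod" where
  "presented_module X R f =
     (let F = free_space X; N = subspace_gen F R in
      \<lparr>carrier = a_rcosets\<^bsub>F\<^esub> N, mult = undefined, one = undefined, zero = N, add = set_add F,
       smult = (\<lambda>c A. N <+>\<^bsub>F\<^esub> (scale c ` A)),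
       act = (\<lambda>x A. N <+>\<^bsub>F\<^esub> (lin_ext (f x) ` A))\<rparr>)"


section \<open>Tensor products\<close>

definition bilinear_relations ::
  "(complex, 'v, 'a) module_scheme \<Rightarrow> (complex, 'w, 'b) module_scheme \<Rightarrow> ('v \<times> 'w \<Rightarrow>\<^sub>0 complex) set" where
  "bilinear_relations V W =
     {gen (v \<oplus>\<^bsub>V\<^esub> v', w) - gen (v, w) - gen (v', w) | v v' w.
        v \<in> carrier V \<and> v' \<in> carrier V \<and> w \<in> carrier W} \<union>
     {gen (v, w \<oplus>\<^bsub>W\<^esub> w') - gen (v, w) - gen (v, w') | v w w'.
        v \<in> carrier V \<and> w \<in> carrier W \<and> w' \<in> carrier W} \<union>
     {gen (c \<odot>\<^bsub>V\<^esub> v, w) - scale c (gen (v, w)) | c v w. v \<in> carrier V \<and> w \<in> carrier W} \<union>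
     {gen (v, c \<odot>\<^bsub>W\<^esub> w) - scale c (gen (v, w)) | c v w. v \<in> carrier V \<and> w \<in> carrier W}"

definition tensor ::
  "('g, 'v, 'a) lie_mod_scheme \<Rightarrow> ('g, 'w, 'b) lie_mod_scheme \<Rightarrow> ('g, ('v \<times> 'w \<Rightarrow>\<^sub>0 complex) set) lie_mod" where
  "tensor V W = presented_module (carrier V \<times> carrier W) (bilinear_relations V W)
     (\<lambda>x (v, w). gen (act V x v, w) + gen (v, act W x w))"

text \<open>A family \<open>v\<close> in the extensional product stands for the pure tensor of its entries.\<close>

definition multilinear_relations ::
  "'i set \<Rightarrow> ('i \<Rightarrow> (complex, 'v, 'a) module_scheme) \<Rightarrow> (('i \<Rightarrow> 'v) \<Rightarrow>\<^sub>0 complex) set" where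
  "multilinear_relations J V =
     {gen (v(j := u \<oplus>\<^bsub>V j\<^esub> u')) - gen (v(j := u)) - gen (v(j := u')) | v j u u'.
        v \<in> (\<Pi>\<^sub>E i\<in>J. carrier (V i)) \<and> j \<in> J \<and> u \<in> carrier (V j) \<and> u' \<in> carrier (V j)} \<union>
     {gen (v(j := c \<odot>\<^bsub>V j\<^esub> u)) - scale c (gen (v(j := u))) | v j c u.
        v \<in> (\<Pi>\<^sub>E i\<in>J. carrier (V i)) \<and> j \<in> J \<and> u \<in> carrier (V j)}"

definition tensor_family ::
  "'i set \<Rightarrow> ('i \<Rightarrow> ('g, 'v, 'a) lie_mod_scheme) \<Rightarrow> ('g, (('i \<Rightarrow> 'v) \<Rightarrow>\<^sub>0 complex) set) lie_mod" where
  "tensor_family J V = presented_module (\<Pi>\<^sub>E i\<in>J. carrier (V i)) (multilinear_relations J V)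
     (\<lambda>x v. \<Sum>j\<in>J. gen (v(j := act (V j) x (v j))))"


section \<open>Universal enveloping algebras and induced modules\<close>

text \<open>Words under concatenation, written additively so that finitely supported functions on words
  form the free associative algebra under the convolution product of \<^typ>\<open>'a \<Rightarrow>\<^sub>0 'b\<close>.\<close>

datatype 'a word = Word (letters: "'a list")

instantiation word :: (type) monoid_add
begin

definition zero_word :: "'a word" where "0 = Word []"

definition plus_word :: "'a word \<Rightarrow> 'a word \<Rightarrow> 'a word" where
  "u + v = Word (letters u @ letters v)"

instance by standard (simp_all add: zero_word_def plus_word_def)

end

definition free_algebra :: "'x set \<Rightarrow> (complex, 'x word \<Rightarrow>\<^sub>0 complex) module" where
  "free_algebra X = \<lparr>carrier = {p. \<forall>w\<in>Poly_Mapping.keys p. set (letters w) \<subseteq> X},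
     mult = (*), one = 1, zero = 0, add = (+), smult = scale\<rparr>"

abbreviation letter :: "'x \<Rightarrow> ('x word \<Rightarrow>\<^sub>0 complex)" where
  "letter x \<equiv> gen (Word [x])"

text \<open>
  The free algebra is taken on the underlying set of \<open>g\<close>, so the linearity relations are needed to
  pass from it to the tensor algebra of \<open>g\<close>.
\<close>
definition env_ideal :: "('g, 'a) lie_alg_scheme \<Rightarrow> ('g word \<Rightarrow>\<^sub>0 complex) set" where
  "env_ideal g = genideal (free_algebra (carrier g))
     ({letter (x \<oplus>\<^bsub>g\<^esub> y) - letter x - letter y | x y. x \<in> carrier g \<and> y \<in> carrier g} \<union>
      {letter (c \<odot>\<^bsub>g\<^esub> x) - scale c (letter x) | c x. x \<in> carrier g} \<union>
      {letter x * letter y - letter y * letter x - letter (bracket g x y) | x y.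
         x \<in> carrier g \<and> y \<in> carrier g})"

definition env :: "('g, 'a) lie_alg_scheme \<Rightarrow> (complex, ('g word \<Rightarrow>\<^sub>0 complex) set) module" where
  "env g = (let T = free_algebra (carrier g) in
     ring.extend (T Quot env_ideal g)
       (module.fields (\<lambda>c A. env_ideal g <+>\<^bsub>T\<^esub> (scale c ` A))))"

definition env_of :: "('g, 'a) lie_alg_scheme \<Rightarrow> 'g \<Rightarrow> ('g word \<Rightarrow>\<^sub>0 complex) set" where
  "env_of g x = env_ideal g +>\<^bsub>free_algebra (carrier g)\<^esub> letter x"

text \<open>The homomorphism from the enveloping algebra of a subalgebra of \<open>g\<close> to that of \<open>g\<close> sends the
  class of \<open>p\<close> to the class of \<open>p\<close>.\<close>
definition env_incl ::
  "('g, 'a) lie_alg_scheme \<Rightarrow> ('g word \<Rightarrow>\<^sub>0 complex) set \<Rightarrow> ('g word \<Rightarrow>\<^sub>0 complex) set" where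
  "env_incl g A = env_ideal g <+>\<^bsub>free_algebra (carrier g)\<^esub> A"

definition free_act :: "('g, 'v, 'b) lie_mod_scheme \<Rightarrow> ('g word \<Rightarrow>\<^sub>0 complex) \<Rightarrow> 'v \<Rightarrow> 'v" where
  "free_act V p v = (\<Oplus>\<^bsub>V\<^esub>w\<in>Poly_Mapping.keys p.
     Poly_Mapping.lookup p w \<odot>\<^bsub>V\<^esub> foldr (act V) (letters w) v)"

definition env_act :: "('g, 'v, 'b) lie_mod_scheme \<Rightarrow> ('g word \<Rightarrow>\<^sub>0 complex) set \<Rightarrow> 'v \<Rightarrow> 'v" where
  "env_act V A v = the_elem ((\<lambda>p. free_act V p v) ` A)"

definition induced_module ::
  "('g, 'a) lie_alg_scheme \<Rightarrow> ('g, 'b) lie_alg_scheme \<Rightarrow> ('g, 'v, 'c) lie_mod_scheme \<Rightarrow>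
    ('g, (('g word \<Rightarrow>\<^sub>0 complex) set \<times> 'v \<Rightarrow>\<^sub>0 complex) set) lie_mod" where
  "induced_module g h V = presented_module (carrier (env g) \<times> carrier V)
     (bilinear_relations (env g) V \<union>
      {gen (u \<otimes>\<^bsub>env g\<^esub> env_incl g a, v) - gen (u, env_act V a v) | u a v.
         u \<in> carrier (env g) \<and> a \<in> carrier (env h) \<and> v \<in> carrier V})
     (\<lambda>x (u, v). gen (env_of g x \<otimes>\<^bsub>env g\<^esub> u, v))"


section \<open>The twisted Heisenberg-Virasoro algebra\<close>

datatype hv_basis = BL int | BI int | BC1 | BC2 | BC3

type_synonym hv = "hv_basis \<Rightarrow>\<^sub>0 complex"

abbreviation L_elt :: "int \<Rightarrow> hv" where "L_elt m \<equiv> gen (BL m)"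
abbreviation I_elt :: "int \<Rightarrow> hv" where "I_elt m \<equiv> gen (BI m)"
abbreviation C1_elt :: hv where "C1_elt \<equiv> gen BC1"
abbreviation C2_elt :: hv where "C2_elt \<equiv> gen BC2"
abbreviation C3_elt :: hv where "C3_elt \<equiv> gen BC3"

fun basis_bracket :: "hv_basis \<Rightarrow> hv_basis \<Rightarrow> hv" where
  "basis_bracket (BL m) (BL n) = scale (of_int (n - m)) (L_elt (m + n)) +
     (if m + n = 0 then scale ((of_int m ^ 3 - of_int m) / 12) C1_elt else 0)"
| "basis_bracket (BL m) (BI n) = scale (of_int n) (I_elt (m + n)) +
     (if m + n = 0 then scale (of_int m ^ 2 + of_int m) C2_elt else 0)"
| "basis_bracket (BI n) (BL m) = - (scale (of_int n) (I_elt (m + n)) +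
     (if m + n = 0 then scale (of_int m ^ 2 + of_int m) C2_elt else 0))"
| "basis_bracket (BI m) (BI n) = (if m + n = 0 then scale (of_int n) C3_elt else 0)"
| "basis_bracket _ _ = 0"

definition hv_alg :: "hv lie_alg" where
  "hv_alg = \<lparr>carrier = UNIV, mult = undefined, one = undefined, zero = 0, add = (+), smult = scale,
     bracket = (\<lambda>x y. lin_ext (\<lambda>a. lin_ext (basis_bracket a) y) x)\<rparr>"

definition hv_sub :: "nat \<Rightarrow> hv lie_alg" where
  "hv_sub e = hv_alg\<lparr>carrier :=
     {x. Poly_Mapping.keys x \<subseteq> {BL m | m. 0 \<le> m} \<union> {BI (m - int e) | m. 0 \<le> m} \<union> {BC1, BC2, BC3}}\<rparr>"

text \<open>The images of \<open>\<partial> ^ n\<close> under the basis elements; the polynomial variable plays the role of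
  \<open>\<partial>\<close>.\<close>
fun omega_monom :: "complex \<Rightarrow> complex \<Rightarrow> complex \<Rightarrow> hv_basis \<Rightarrow> nat \<Rightarrow> complex poly" where
  "omega_monom lam \<alpha> \<beta> (BL k) n =
     Polynomial.smult (lam powi k) ([:of_int k * \<alpha>, 1:] * [:- of_int k, 1:] ^ n)"
| "omega_monom lam \<alpha> \<beta> (BI k) n = Polynomial.smult (lam powi k * \<beta>) ([:- of_int k, 1:] ^ n)"
| "omega_monom lam \<alpha> \<beta> _ n = 0"

definition omega :: "complex \<Rightarrow> complex \<Rightarrow> complex \<Rightarrow> (hv, complex poly) lie_mod" where
  "omega lam \<alpha> \<beta> = \<lparr>carrier = UNIV, mult = undefined, one = undefined, zero = 0, add = (+),
     smult = Polynomial.smult,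
     act = (\<lambda>x p. \<Sum>b\<in>Poly_Mapping.keys x. \<Sum>n\<le>Polynomial.degree p.
       Polynomial.smult (Poly_Mapping.lookup x b * Polynomial.coeff p n) (omega_monom lam \<alpha> \<beta> b n))\<rparr>"

end

theory Submission
  imports Defs
begin

text \<open>
  The theorem combines two facts: a submodule of the tensor product can tell the factors
  \<open>\<Omega>(\<lambda>\<^sub>i, \<alpha>\<^sub>i, \<beta>\<^sub>i)\<close> from each other and from \<open>Ind(M)\<close>, and \<open>Ind(M)\<close> is itself simple.
  
  Separation. Every vector of \<open>Ind(M)\<close> is killed by \<open>L\<^sub>n\<close> and \<open>I\<^sub>n\<close> for all large \<open>n\<close>
  (\<open>induced_locally_killed\<close>), so for large \<open>n\<close> these operators see only the polynomial factors of a
  given element of the tensor product. There they produce a sum of fixed vectors with coefficients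
  \<open>\<lambda>\<^sub>i\<^sup>n n\<^sup>t\<close>. As the \<open>\<lambda>\<^sub>i\<close> are distinct and nonzero, these sequences are linearly independent
  (\<open>exponential_polynomial_zero\<close>), so a submodule that contains the element contains each of the
  fixed vectors. Two of them matter. The one for \<open>\<lambda>\<^sub>i\<^sup>n n\<^sup>0\<close> in \<open>L\<^sub>n\<close> is the product of the element with the
  \<open>i\<close>-th variable (\<open>raise_exponent\<close>). The one for the highest power of \<open>n\<close> keeps the terms of highest degree in
  the \<open>i\<close>-th variable and turns that degree into \<open>0\<close> (\<open>top_exponent\<close>); it comes from \<open>I\<^sub>n\<close> with
  coefficient \<open>\<beta>\<^sub>i\<close> or, when \<open>\<beta>\<^sub>i = 0\<close>, from \<open>L\<^sub>n\<close> with coefficient \<open>\<alpha>\<^sub>i\<close>. So a nonzero submodule contains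
  some \<open>1 \<otimes> v\<close> with \<open>v \<noteq> 0\<close>, and then all \<open>f \<otimes> v\<close>. The vectors \<open>v\<close> of this kind form a submodule of
  \<open>Ind(M)\<close>, which is everything (\<open>relation_forces_zero\<close>, \<open>simple_tensor\<close>).
  
  Simplicity of \<open>Ind(M)\<close>. The module is exhausted by spans of monomials \<open>L\<dots>L I\<dots>I v\<close> with \<open>v\<close> in \<open>M\<close>
  and negative indices. Commuting \<open>L\<^bsub>k+e+j\<^esub>\<close> past \<open>I\<^bsub>-e-j\<^esub>\<close>, or \<open>I\<^bsub>k+j\<^esub>\<close> past \<open>L\<^bsub>-j\<^esub>\<close>, leaves a nonzero multiple of \<open>I\<^sub>k\<close>,
  or for \<open>k = 0\<close> a number \<open>n (c\<^sub>0 + (n - 1) c\<^sub>2)\<close> with \<open>n \<noteq> 0\<close>; by assumption this is injective on \<open>M\<close>. So these operators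
  lower the degree of a monomial without killing its leading part, and a nonzero submodule descends first to
  the span of the monomials without \<open>L\<close> (\<open>lowering_detects\<close>) and then to \<open>M\<close> (\<open>M0_meets_E\<close>), where it
  is everything because \<open>M\<close> is simple (\<open>invariant_subspace_meets_M0\<close>, \<open>simple_induced\<close>).
  
  What remains is that \<open>M\<close> embeds into \<open>Ind(M)\<close>, the Poincare-Birkhoff-Witt part of the argument. A linear functional
  on \<open>M\<close> is extended to words in the basis of the algebra by sorting a word with the commutation rules
  and letting the letters of the subalgebra at its right end act on \<open>M\<close>. The value does not depend on
  the order of the rewriting steps (\<open>all_good\<close>), because two descents can overlap only in three letters, where
  the Jacobi identity applies, or at the right end, where \<open>M\<close> being a module applies. It follows that the extended functional
  vanishes on the relations that define \<open>Ind(M)\<close> (\<open>nonvanishing\<close>).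
  
  All modules involved are given by generators and relations. A submodule of such a quotient is a
  subspace between the relations and the free space, and a projection along the relations turns
  congruences into equations (locale \<open>presentation\<close>).
\<close>

section \<open>Formal linear combinations as a vector space\<close>

lemma lookup_scale [simp]: "Poly_Mapping.lookup (scale c p) x = c * Poly_Mapping.lookup p x"
  by (simp add: scale_def Poly_Mapping.map.rep_eq when_def)

interpretation pm: vector_space "scale :: complex \<Rightarrow> ('x \<Rightarrow>\<^sub>0 complex) \<Rightarrow> ('x \<Rightarrow>\<^sub>0 complex)"
  by unfold_locales (auto intro!: poly_mapping_eqI simp: lookup_add algebra_simps)

interpretation pm2: vector_space_pair "scale :: complex \<Rightarrow> ('x \<Rightarrow>\<^sub>0 complex) \<Rightarrow> ('x \<Rightarrow>\<^sub>0 complex)"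
    "scale :: complex \<Rightarrow> ('y \<Rightarrow>\<^sub>0 complex) \<Rightarrow> ('y \<Rightarrow>\<^sub>0 complex)"
  by unfold_locales

interpretation cx: vector_space "(*) :: complex \<Rightarrow> complex \<Rightarrow> complex"
  by unfold_locales (auto simp: algebra_simps)

interpretation pmc: vector_space_pair "scale :: complex \<Rightarrow> ('x \<Rightarrow>\<^sub>0 complex) \<Rightarrow> ('x \<Rightarrow>\<^sub>0 complex)"
    "(*) :: complex \<Rightarrow> complex \<Rightarrow> complex"
  by unfold_locales

declare cx.scale_scale [simp del]

abbreviation plinear :: "(('x \<Rightarrow>\<^sub>0 complex) \<Rightarrow> ('y \<Rightarrow>\<^sub>0 complex)) \<Rightarrow> bool" where
  "plinear f \<equiv> Vector_Spaces.linear scale scale f"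

abbreviation functional :: "(('x \<Rightarrow>\<^sub>0 complex) \<Rightarrow> complex) \<Rightarrow> bool" where
  "functional f \<equiv> Vector_Spaces.linear scale (*) f"

lemma plinearI:
  assumes "\<And>p q. f (p + q) = f p + f q" "\<And>c p. f (scale c p) = scale c (f p)"
  shows "plinear f"
  using assms by (simp add: Vector_Spaces.linear_iff pm.vector_space_axioms)

lemma functionalI:
  assumes "\<And>p q. f (p + q) = f p + f q" "\<And>c p. f (scale c p) = c * f p"
  shows "functional f"
  using assms by (simp add: Vector_Spaces.linear_iff pm.vector_space_axioms cx.vector_space_axioms)

lemma scale_gen: "scale c (gen x) = Poly_Mapping.single x c"
  by (rule poly_mapping_eqI) (simp add: lookup_single when_def)

lemma keys_scale: "Poly_Mapping.keys (scale c p) \<subseteq> Poly_Mapping.keys p"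
  by (auto simp: in_keys_iff)

lemma sum_gens: "p = (\<Sum>x\<in>Poly_Mapping.keys p. scale (Poly_Mapping.lookup p x) (gen x))"
  by (rule poly_mapping_eqI)
     (simp add: lookup_sum lookup_single when_def if_distrib[of "\<lambda>x. _ * x"] in_keys_iff cong: if_cong)

lemma in_span_gens: "Poly_Mapping.keys p \<subseteq> X \<Longrightarrow> p \<in> pm.span (gen ` X)"
  by (subst sum_gens[of p], rule pm.span_sum, rule pm.span_scale, rule pm.span_base) auto

lemma span_gens: "pm.span (gen ` X) = {p. Poly_Mapping.keys p \<subseteq> X}"
proof
  have "pm.subspace {p :: 'a \<Rightarrow>\<^sub>0 complex. Poly_Mapping.keys p \<subseteq> X}"
    by (rule pm.subspaceI)
       (auto dest!: subsetD[OF Poly_Mapping.keys_add] subsetD[OF keys_scale])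
  then show "pm.span (gen ` X) \<subseteq> {p. Poly_Mapping.keys p \<subseteq> X}"
    by (intro pm.span_minimal) auto
qed (auto intro: in_span_gens)

lemma subspace_keys: "pm.subspace {p :: 'a \<Rightarrow>\<^sub>0 complex. Poly_Mapping.keys p \<subseteq> X}"
  by (metis span_gens pm.subspace_span)

lemma lin_ext_eq_sum:
  assumes "finite S" "Poly_Mapping.keys p \<subseteq> S"
  shows "lin_ext f p = (\<Sum>x\<in>S. scale (Poly_Mapping.lookup p x) (f x))"
  unfolding lin_ext_def by (rule sum.mono_neutral_left) (use assms in \<open>auto simp: in_keys_iff\<close>)

lemma plinear_lin_ext: "plinear (lin_ext f)"
proof (rule plinearI)
  fix p q :: "'a \<Rightarrow>\<^sub>0 complex" and c
  let ?S = "Poly_Mapping.keys p \<union> Poly_Mapping.keys q"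
  have s: "Poly_Mapping.keys (p + q) \<subseteq> ?S" by (rule Poly_Mapping.keys_add)
  show "lin_ext f (p + q) = lin_ext f p + lin_ext f q"
    by (simp add: lin_ext_eq_sum[OF _ s] lin_ext_eq_sum[of ?S p] lin_ext_eq_sum[of ?S q]
        lookup_add pm.scale_left_distrib sum.distrib)
  show "lin_ext f (scale c p) = scale c (lin_ext f p)"
    by (subst lin_ext_eq_sum[OF finite_keys keys_scale[of c p]]) (simp add: lin_ext_def pm.scale_sum_right)
qed

lemma lin_ext_gen [simp]: "lin_ext f (gen x) = f x"
  by (simp add: lin_ext_def)

lemmas lin_ext_add = pm2.linear_add[OF plinear_lin_ext]
lemmas lin_ext_scale = pm2.linear_scale[OF plinear_lin_ext]
lemmas lin_ext_diff = pm2.linear_diff[OF plinear_lin_ext]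
lemmas lin_ext_neg = pm2.linear_neg[OF plinear_lin_ext]
lemmas lin_ext_0 [simp] = pm2.linear_0[OF plinear_lin_ext]
lemmas lin_ext_sum = pm2.linear_sum[OF plinear_lin_ext]

lemma plinear_eqI:
  assumes "plinear f" "plinear g" "\<And>x. x \<in> X \<Longrightarrow> f (gen x) = g (gen x)" "Poly_Mapping.keys p \<subseteq> X"
  shows "f p = g p"
  by (rule pm2.linear_eq_on[OF assms(1,2) in_span_gens[OF assms(4)]]) (use assms(3) in auto)

definition fun_ext :: "('x \<Rightarrow> complex) \<Rightarrow> ('x \<Rightarrow>\<^sub>0 complex) \<Rightarrow> complex" where
  "fun_ext f p = (\<Sum>x\<in>Poly_Mapping.keys p. Poly_Mapping.lookup p x * f x)"

lemma fun_ext_eq_sum: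
  assumes "finite S" "Poly_Mapping.keys p \<subseteq> S"
  shows "fun_ext f p = (\<Sum>x\<in>S. Poly_Mapping.lookup p x * f x)"
  unfolding fun_ext_def by (rule sum.mono_neutral_left) (use assms in \<open>auto simp: in_keys_iff\<close>)

lemma functional_fun_ext: "functional (fun_ext f)"
proof (rule functionalI)
  fix p q :: "'a \<Rightarrow>\<^sub>0 complex" and c
  let ?S = "Poly_Mapping.keys p \<union> Poly_Mapping.keys q"
  have s: "Poly_Mapping.keys (p + q) \<subseteq> ?S" by (rule Poly_Mapping.keys_add)
  show "fun_ext f (p + q) = fun_ext f p + fun_ext f q"
    by (simp add: fun_ext_eq_sum[OF _ s] fun_ext_eq_sum[of ?S p] fun_ext_eq_sum[of ?S q]
        lookup_add distrib_right sum.distrib)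
  show "fun_ext f (scale c p) = c * (fun_ext f p)"
    by (subst fun_ext_eq_sum[OF finite_keys keys_scale[of c p]]) (simp add: fun_ext_def sum_distrib_left mult.assoc)
qed

lemma fun_ext_gen [simp]: "fun_ext f (gen x) = f x"
  by (simp add: fun_ext_def)

lemmas fun_ext_add = pmc.linear_add[OF functional_fun_ext]
lemmas fun_ext_scale = pmc.linear_scale[OF functional_fun_ext]
lemmas fun_ext_diff = pmc.linear_diff[OF functional_fun_ext]
lemmas fun_ext_neg = pmc.linear_neg[OF functional_fun_ext]
lemmas fun_ext_0 [simp] = pmc.linear_0[OF functional_fun_ext]

lemma functional_eqI:
  assumes "functional f" "functional g" "\<And>x. x \<in> X \<Longrightarrow> f (gen x) = g (gen x)" "Poly_Mapping.keys p \<subseteq> X"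
  shows "f p = g p"
  by (rule pmc.linear_eq_on[OF assms(1,2) in_span_gens[OF assms(4)]]) (use assms(3) in auto)

lemma subspace_preimage: "plinear f \<Longrightarrow> pm.subspace S \<Longrightarrow> pm.subspace {p. f p \<in> S}"
  by (rule pm2.linear_subspace_linear_preimage)

text \<open>
  A projection along \<open>N\<close> onto some complement turns congruences modulo \<open>N\<close> into equations in a
  type on which all linear algebra is available. Sending a basis of \<open>N\<close> to \<open>0\<close> and fixing the other
  members of an extended basis gives one.
\<close>
lemma projection_exists:
  assumes "pm.subspace N"
  shows "\<exists>\<pi>. plinear \<pi> \<and> (\<forall>p. \<pi> p = 0 \<longleftrightarrow> p \<in> N) \<and> (\<forall>p. p - \<pi> p \<in> N)"
proof -
  obtain B where B: "B \<subseteq> N" "pm.independent B" "N \<subseteq> pm.span B"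
    using pm.maximal_independent_subset[of N] by blast
  let ?E = "pm.extend_basis B"
  have E: "B \<subseteq> ?E" "pm.independent ?E" "pm.span ?E = UNIV"
    using pm.extend_basis_superset pm.independent_extend_basis pm.span_extend_basis B(2) by auto
  obtain g where g: "plinear g" "\<And>x. x \<in> ?E \<Longrightarrow> g x = (if x \<in> B then 0 else x)"
    using pm2.linear_independent_extend[OF E(2), of "\<lambda>x. if x \<in> B then 0 else x"] by blast
  have d: "p - g p \<in> N" for p
  proof -
    have "p \<in> pm.span ?E" using E by simp
    then show ?thesis
    proof (induction rule: pm.span_induct)
      case base
      show ?case
      proof (rule pm.subspaceI)
        show "0 \<in> {p. p - g p \<in> N}"
          by (simp add: pm2.linear_0[OF g(1)] pm.subspace_0[OF assms])
        show "p + q \<in> {p. p - g p \<in> N}" if "p \<in> {p. p - g p \<in> N}" "q \<in> {p. p - g p \<in> N}" for p q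
          using that pm.subspace_add[OF assms, of "p - g p" "q - g q"]
          by (simp add: pm2.linear_add[OF g(1)] algebra_simps)
        show "scale c p \<in> {p. p - g p \<in> N}" if "p \<in> {p. p - g p \<in> N}" for c p
          using that pm.subspace_scale[OF assms, of "p - g p" c]
          by (simp add: pm2.linear_scale[OF g(1)] pm.scale_right_diff_distrib)
      qed
    next
      case (step x)
      then show ?case using g(2)[of x] B(1) assms by (auto simp: pm.subspace_0)
    qed
  qed
  have "g p = 0" if "p \<in> N" for p
    by (rule pm2.linear_eq_0_on_span[OF g(1), of B]) (use g(2) E(1) B(3) that in auto)
  then show ?thesis using g(1) d by (metis diff_zero)
qed

definition proj :: "('x \<Rightarrow>\<^sub>0 complex) set \<Rightarrow> ('x \<Rightarrow>\<^sub>0 complex) \<Rightarrow> ('x \<Rightarrow>\<^sub>0 complex)" where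
  "proj N = (SOME \<pi>. plinear \<pi> \<and> (\<forall>p. \<pi> p = 0 \<longleftrightarrow> p \<in> N) \<and> (\<forall>p. p - \<pi> p \<in> N))"

lemma
  assumes "pm.subspace N"
  shows plinear_proj: "plinear (proj N)"
    and proj_eq_0_iff: "proj N p = 0 \<longleftrightarrow> p \<in> N"
    and diff_proj: "p - proj N p \<in> N"
  using someI_ex[OF projection_exists[OF assms]] unfolding proj_def by auto

lemma proj_eq_iff:
  assumes "pm.subspace N"
  shows "proj N p = proj N q \<longleftrightarrow> p - q \<in> N"
  using proj_eq_0_iff[OF assms, of "p - q"] pm2.linear_diff[OF plinear_proj[OF assms], of p q] by simp

text \<open>
  A nonzero coordinate of the projection of \<open>p\<close> along \<open>N\<close> is such a functional.
\<close>
lemma functional_separates: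
  assumes "pm.subspace N" "p \<notin> N"
  shows "\<exists>\<phi>. functional \<phi> \<and> (\<forall>q\<in>N. \<phi> q = 0) \<and> \<phi> p \<noteq> 0"
proof -
  let ?r = "proj N p"
  have "?r \<noteq> 0" using assms proj_eq_0_iff by blast
  then obtain x where x: "Poly_Mapping.lookup ?r x \<noteq> 0"
    by (metis poly_mapping_eqI lookup_zero)
  define \<phi> where "\<phi> q = Poly_Mapping.lookup (proj N q) x" for q
  have "functional \<phi>"
    by (rule functionalI)
       (simp_all add: \<phi>_def pm2.linear_add[OF plinear_proj[OF assms(1)]]
          pm2.linear_scale[OF plinear_proj[OF assms(1)]] lookup_add)
  moreover have "\<phi> q = 0" if "q \<in> N" for q
    using that proj_eq_0_iff[OF assms(1), of q] by (simp add: \<phi>_def)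
  ultimately show ?thesis using x \<phi>_def by auto
qed

section \<open>Presented modules\<close>

lemma cring_complex_field: "cring complex_field"
proof (rule cringI)
  show "abelian_group complex_field"
    by (rule abelian_groupI) (auto simp: complex_field_def algebra_simps intro: exI[of _ "- _"])
  show "Group.comm_monoid complex_field"
    by (rule comm_monoidI) (auto simp: complex_field_def algebra_simps)
qed (auto simp: complex_field_def algebra_simps)

lemma complex_field_simps [simp]:
  "carrier complex_field = UNIV" "mult complex_field = (*)" "one complex_field = 1"
  "zero complex_field = 0" "add complex_field = (+)"
  by (simp_all add: complex_field_def)

lemma free_space_simps [simp]:
  "carrier (free_space X) = {p. Poly_Mapping.keys p \<subseteq> X}" "zero (free_space X) = 0"
  "add (free_space X) = (+)" "smult (free_space X) = scale"
  by (simp_all add: free_space_def)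

lemma abelian_group_free_space: "abelian_group (free_space X)"
proof (rule abelian_groupI)
  fix p q assume "p \<in> carrier (free_space X)" "q \<in> carrier (free_space X)"
  then show "p \<oplus>\<^bsub>free_space X\<^esub> q \<in> carrier (free_space X)"
    using pm.subspace_add[OF subspace_keys, of p X q] by simp
next
  fix p assume "p \<in> carrier (free_space X)"
  then have "- p \<in> carrier (free_space X)" "- p + p = 0" by auto
  then show "\<exists>y\<in>carrier (free_space X). y \<oplus>\<^bsub>free_space X\<^esub> p = \<zero>\<^bsub>free_space X\<^esub>"
    unfolding free_space_simps by blast
qed auto

lemma module_free_space: "module complex_field (free_space X)"
  by (rule moduleI[OF cring_complex_field abelian_group_free_space])
     (auto simp: pm.scale_left_distrib pm.scale_right_distrib dest: subsetD[OF keys_scale])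

lemma a_inv_free_space:
  "Poly_Mapping.keys p \<subseteq> X \<Longrightarrow> \<ominus>\<^bsub>free_space X\<^esub> p = - p"
  by (rule abelian_group.minus_equality[OF abelian_group_free_space]) auto

lemma submodule_free_space_iff:
  "submodule N complex_field (free_space X) \<longleftrightarrow> pm.subspace N \<and> N \<subseteq> {p. Poly_Mapping.keys p \<subseteq> X}"
proof
  assume N: "submodule N complex_field (free_space X)"
  interpret F: module complex_field "free_space X" by (rule module_free_space)
  have s: "N \<subseteq> {p. Poly_Mapping.keys p \<subseteq> X}" using F.submoduleE(1)[OF N] by simp
  have sc: "scale c p \<in> N" if "p \<in> N" for c p
    using F.submoduleE(4)[OF N, of c p] that by simp
  obtain p where "p \<in> N" using F.submoduleE(2)[OF N] by blast
  from sc[OF this, of 0] have "0 \<in> N" by simp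
  then have "pm.subspace N"
    using F.submoduleE(5)[OF N] sc by (intro pm.subspaceI) auto
  then show "pm.subspace N \<and> N \<subseteq> {p. Poly_Mapping.keys p \<subseteq> X}" using s by blast
next
  assume N: "pm.subspace N \<and> N \<subseteq> {p. Poly_Mapping.keys p \<subseteq> X}"
  show "submodule N complex_field (free_space X)"
  proof (rule module.submoduleI[OF module_free_space])
    fix a assume "a \<in> N"
    then show "\<ominus>\<^bsub>free_space X\<^esub> a \<in> N"
      using N pm.subspace_neg by (subst a_inv_free_space) auto
  qed (use N pm.subspace_0 pm.subspace_add pm.subspace_scale in auto)
qed

lemma subspace_gen_eq_span:
  assumes "R \<subseteq> {p. Poly_Mapping.keys p \<subseteq> X}"
  shows "subspace_gen (free_space X) R = pm.span R"
  unfolding subspace_gen_def submodule_free_space_iff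
proof (rule hull_unique)
  show "R \<subseteq> pm.span R" by (rule pm.span_superset)
  show "pm.subspace (pm.span R) \<and> pm.span R \<subseteq> {p. Poly_Mapping.keys p \<subseteq> X}"
    using pm.span_minimal[OF assms subspace_keys] by simp
qed (use pm.span_minimal in blast)

definition coset_of :: "('x \<Rightarrow>\<^sub>0 complex) set \<Rightarrow> ('x \<Rightarrow>\<^sub>0 complex) \<Rightarrow> ('x \<Rightarrow>\<^sub>0 complex) set" where
  "coset_of N p = {q. q - p \<in> N}"

lemma coset_of_eq_iff:
  assumes "pm.subspace N"
  shows "coset_of N p = coset_of N q \<longleftrightarrow> p - q \<in> N"
proof
  assume "coset_of N p = coset_of N q"
  moreover have "p \<in> coset_of N p" using pm.subspace_0[OF assms] by (simp add: coset_of_def)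
  ultimately show "p - q \<in> N" by (simp add: coset_of_def)
next
  assume *: "p - q \<in> N"
  have "r - p \<in> N \<longleftrightarrow> r - q \<in> N" for r
    using pm.subspace_add[OF assms *, of "r - p"] pm.subspace_diff[OF assms _ *, of "r - q"]
    by (auto simp: algebra_simps)
  then show "coset_of N p = coset_of N q" by (simp add: coset_of_def)
qed

lemma self_in_coset: "pm.subspace N \<Longrightarrow> p \<in> coset_of N p"
  by (simp add: coset_of_def pm.subspace_0)

lemma coset_of_0: "coset_of N 0 = N"
  by (simp add: coset_of_def)

lemma coset_add_image:
  assumes "pm.subspace N" "\<And>q. q \<in> N \<Longrightarrow> h q \<in> N" "plinear h"
  shows "{n + q |n q. n \<in> N \<and> q \<in> h ` coset_of N p} = coset_of N (h p)" (is "?A = _")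
proof
  show "?A \<subseteq> coset_of N (h p)"
  proof
    fix y assume "y \<in> ?A"
    then obtain n q where *: "y = n + h q" "n \<in> N" "q - p \<in> N" by (auto simp: coset_of_def)
    then have "n + h (q - p) \<in> N" using assms pm.subspace_add by blast
    then show "y \<in> coset_of N (h p)"
      by (simp add: *(1) coset_of_def pm2.linear_diff[OF assms(3)] algebra_simps)
  qed
  show "coset_of N (h p) \<subseteq> ?A"
  proof
    fix y assume "y \<in> coset_of N (h p)"
    then have "y = (y - h p) + h p" "y - h p \<in> N" by (auto simp: coset_of_def)
    moreover have "h p \<in> h ` coset_of N p" using self_in_coset[OF assms(1)] by blast
    ultimately show "y \<in> ?A" by blast
  qed
qed

text \<open>
  \<open>F\<close> is the free space on the generators, \<open>N\<close> the span of the relations, \<open>P\<close> the quotient and \<open>cs\<close> the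
  class map. Working with representatives in \<open>F\<close> moves every question about \<open>P\<close> into a single
  vector space.
\<close>
locale presentation =
  fixes g :: "'g lie_alg" and X :: "'x set" and R :: "('x \<Rightarrow>\<^sub>0 complex) set"
    and f :: "'g \<Rightarrow> 'x \<Rightarrow> ('x \<Rightarrow>\<^sub>0 complex)"
  assumes R_keys: "r \<in> R \<Longrightarrow> Poly_Mapping.keys r \<subseteq> X"
    and f_keys: "a \<in> carrier g \<Longrightarrow> x \<in> X \<Longrightarrow> Poly_Mapping.keys (f a x) \<subseteq> X"
    and f_R: "a \<in> carrier g \<Longrightarrow> r \<in> R \<Longrightarrow> lin_ext (f a) r \<in> pm.span R"
begin

abbreviation "F \<equiv> {p :: 'x \<Rightarrow>\<^sub>0 complex. Poly_Mapping.keys p \<subseteq> X}"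
abbreviation "N \<equiv> pm.span R"
abbreviation "P \<equiv> presented_module X R f"
abbreviation "cs \<equiv> coset_of N"

lemma N_sub: "N \<subseteq> F"
  using R_keys by (intro pm.span_minimal[OF _ subspace_keys]) auto

lemma f_F: "a \<in> carrier g \<Longrightarrow> p \<in> F \<Longrightarrow> lin_ext (f a) p \<in> F"
  unfolding lin_ext_def
  by (rule pm.subspace_sum[OF subspace_keys], rule pm.subspace_scale[OF subspace_keys])
     (use f_keys in auto)

lemma f_N: "a \<in> carrier g \<Longrightarrow> p \<in> N \<Longrightarrow> lin_ext (f a) p \<in> N"
  using pm.span_minimal[OF _ subspace_preimage[OF plinear_lin_ext pm.subspace_span], of R "f a" R] f_R
  by blast

lemma P_unfold:
  "P = \<lparr>carrier = a_rcosets\<^bsub>free_space X\<^esub> N, mult = undefined, one = undefined, zero = N,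
       add = set_add (free_space X),
       smult = (\<lambda>c A. N <+>\<^bsub>free_space X\<^esub> (scale c ` A)),
       act = (\<lambda>x A. N <+>\<^bsub>free_space X\<^esub> (lin_ext (f x) ` A))\<rparr>"
proof -
  have "subspace_gen (free_space X) R = N"
    using R_keys by (intro subspace_gen_eq_span) auto
  then show ?thesis by (simp add: presented_module_def Let_def)
qed

lemma set_add_F: "set_add (free_space X) A B = {n + q |n q. n \<in> A \<and> q \<in> B}"
  unfolding set_add_def' free_space_simps by blast

lemma zero_P: "\<zero>\<^bsub>P\<^esub> = cs 0"
  by (simp add: P_unfold coset_of_0)

lemma carrier_P: "carrier P = cs ` F"
proof -
  have "a_r_coset (free_space X) N p = cs p" for p
    by (auto simp: a_r_coset_def' coset_of_def intro!: bexI[of _ "_ - p"])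
  then show ?thesis by (auto simp: P_unfold A_RCOSETS_def')
qed

lemma add_P: "cs p \<oplus>\<^bsub>P\<^esub> cs q = cs (p + q)"
proof -
  have "cs p \<oplus>\<^bsub>P\<^esub> cs q = {n + q' |n q'. n \<in> cs p \<and> q' \<in> cs q}"
    by (simp add: P_unfold set_add_F)
  also have "\<dots> = cs (p + q)"
  proof (rule Set.set_eqI, rule iffI)
    fix y assume "y \<in> {n + q' |n q'. n \<in> cs p \<and> q' \<in> cs q}"
    then obtain a b where y: "y = a + b" "a - p \<in> N" "b - q \<in> N" by (auto simp: coset_of_def)
    from pm.span_add[OF y(2,3)] show "y \<in> cs (p + q)"
      by (simp add: coset_of_def y(1) algebra_simps)
  next
    fix y assume "y \<in> cs (p + q)"
    then have "y - q \<in> cs p" by (simp add: coset_of_def algebra_simps)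
    moreover have "q \<in> cs q" by (simp add: coset_of_def pm.span_zero)
    ultimately show "y \<in> {n + q' |n q'. n \<in> cs p \<and> q' \<in> cs q}"
      by (metis (mono_tags, lifting) diff_add_cancel mem_Collect_eq)
  qed
  finally show ?thesis .
qed

lemma smult_P: "c \<odot>\<^bsub>P\<^esub> cs p = cs (scale c p)"
  using coset_add_image[OF pm.subspace_span, of R "scale c" p]
  by (simp add: P_unfold set_add_F pm.span_scale pm.linear_scale_self)

lemma act_P: "a \<in> carrier g \<Longrightarrow> act P a (cs p) = cs (lin_ext (f a) p)"
  using coset_add_image[OF pm.subspace_span, of R "lin_ext (f a)" p] f_N
  by (simp add: P_unfold set_add_F plinear_lin_ext)

lemma cs_eq_iff: "cs p = cs q \<longleftrightarrow> p - q \<in> N"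
  by (rule coset_of_eq_iff) simp

lemma cs_in_P [simp]: "p \<in> F \<Longrightarrow> cs p \<in> carrier P"
  by (simp add: carrier_P)

lemma abelian_group_P: "abelian_group P"
proof (rule abelian_groupI)
  fix u v w assume uvw: "u \<in> carrier P" "v \<in> carrier P" "w \<in> carrier P"
  then obtain p q r where *: "u = cs p" "v = cs q" "w = cs r" "p \<in> F" "q \<in> F" "r \<in> F"
    unfolding carrier_P by blast
  show "u \<oplus>\<^bsub>P\<^esub> v \<oplus>\<^bsub>P\<^esub> w = u \<oplus>\<^bsub>P\<^esub> (v \<oplus>\<^bsub>P\<^esub> w)"
    by (simp add: * add_P add.assoc)
next
  fix u v assume "u \<in> carrier P" "v \<in> carrier P"
  then obtain p q where *: "u = cs p" "v = cs q" "p \<in> F" "q \<in> F"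
    unfolding carrier_P by blast
  show "u \<oplus>\<^bsub>P\<^esub> v \<in> carrier P"
    using pm.subspace_add[OF subspace_keys *(3,4)] * by (simp add: add_P)
  show "u \<oplus>\<^bsub>P\<^esub> v = v \<oplus>\<^bsub>P\<^esub> u"
    by (simp add: * add_P add.commute)
next
  show "\<zero>\<^bsub>P\<^esub> \<in> carrier P" by (simp add: zero_P)
next
  fix u assume "u \<in> carrier P"
  then obtain p where *: "u = cs p" "p \<in> F"
    unfolding carrier_P by blast
  show "\<zero>\<^bsub>P\<^esub> \<oplus>\<^bsub>P\<^esub> u = u" by (simp add: * zero_P add_P)
  show "\<exists>y\<in>carrier P. y \<oplus>\<^bsub>P\<^esub> u = \<zero>\<^bsub>P\<^esub>"
    using pm.subspace_neg[OF subspace_keys *(2)]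
    by (intro bexI[of _ "cs (- p)"]) (auto simp: * zero_P add_P)
qed

lemma a_inv_P: "p \<in> F \<Longrightarrow> \<ominus>\<^bsub>P\<^esub> cs p = cs (- p)"
  by (rule abelian_group.minus_equality[OF abelian_group_P])
     (auto simp: add_P zero_P)

lemma minus_P: "q \<in> F \<Longrightarrow> cs p \<ominus>\<^bsub>P\<^esub> cs q = cs (p - q)"
  by (simp add: a_minus_def a_inv_P add_P)

lemma module_P: "module complex_field P"
proof (rule moduleI[OF cring_complex_field abelian_group_P])
  fix c u assume "u \<in> carrier P"
  then obtain p where *: "u = cs p" "p \<in> F"
    unfolding carrier_P by blast
  show "c \<odot>\<^bsub>P\<^esub> u \<in> carrier P"
    using pm.subspace_scale[OF subspace_keys *(2)] by (simp add: * smult_P)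
qed (auto simp: carrier_P smult_P add_P pm.scale_left_distrib pm.scale_right_distrib)

text \<open>
  Each module law says that two linear maps agree modulo \<open>N\<close>, so it is enough to have it on the
  generators.
\<close>
lemma is_lie_module_P:
  assumes add_g: "\<And>a b. a \<in> carrier g \<Longrightarrow> b \<in> carrier g \<Longrightarrow> a \<oplus>\<^bsub>g\<^esub> b \<in> carrier g"
    and smult_g: "\<And>a c. a \<in> carrier g \<Longrightarrow> c \<odot>\<^bsub>g\<^esub> a \<in> carrier g"
    and bracket_g: "\<And>a b. a \<in> carrier g \<Longrightarrow> b \<in> carrier g \<Longrightarrow> bracket g a b \<in> carrier g"
    and f_add: "\<And>a b x. a \<in> carrier g \<Longrightarrow> b \<in> carrier g \<Longrightarrow> x \<in> X \<Longrightarrow> f (a \<oplus>\<^bsub>g\<^esub> b) x - (f a x + f b x) \<in> N"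
    and f_smult: "\<And>a c x. a \<in> carrier g \<Longrightarrow> x \<in> X \<Longrightarrow> f (c \<odot>\<^bsub>g\<^esub> a) x - scale c (f a x) \<in> N"
    and f_bracket: "\<And>a b x. a \<in> carrier g \<Longrightarrow> b \<in> carrier g \<Longrightarrow> x \<in> X \<Longrightarrow>
      f (bracket g a b) x - (lin_ext (f a) (f b x) - lin_ext (f b) (f a x)) \<in> N"
  shows "is_lie_module g P"
proof -
  have ext: "h p \<in> N" if "plinear h" "\<And>x. x \<in> X \<Longrightarrow> h (gen x) \<in> N" "p \<in> F" for h :: "('x \<Rightarrow>\<^sub>0 complex) \<Rightarrow> _" and p
    using pm.span_minimal[OF _ subspace_preimage[OF that(1) pm.subspace_span[of R]], of "gen ` X"]
      that(2) in_span_gens[of p X] that(3) by blast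
  note L = lin_ext_add lin_ext_scale lin_ext_diff
  note A = pm.scale_right_distrib pm.scale_right_diff_distrib
  have 1: "lin_ext (f (a \<oplus>\<^bsub>g\<^esub> b)) p - (lin_ext (f a) p + lin_ext (f b) p) \<in> N"
    if "a \<in> carrier g" "b \<in> carrier g" "p \<in> F" for a b p
    by (rule ext[of "\<lambda>p. lin_ext (f (a \<oplus>\<^bsub>g\<^esub> b)) p - (lin_ext (f a) p + lin_ext (f b) p)"])
       (use that in \<open>auto intro!: plinearI simp: L A f_add\<close>)
  have 2: "lin_ext (f (c \<odot>\<^bsub>g\<^esub> a)) p - scale c (lin_ext (f a) p) \<in> N"
    if "a \<in> carrier g" "p \<in> F" for a c p
    by (rule ext[of "\<lambda>p. lin_ext (f (c \<odot>\<^bsub>g\<^esub> a)) p - scale c (lin_ext (f a) p)"])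
       (use that in \<open>auto intro!: plinearI simp: L A f_smult mult.commute\<close>)
  have 3: "lin_ext (f (bracket g a b)) p - (lin_ext (f a) (lin_ext (f b) p) - lin_ext (f b) (lin_ext (f a) p)) \<in> N"
    if "a \<in> carrier g" "b \<in> carrier g" "p \<in> F" for a b p
    by (rule ext[of "\<lambda>p. lin_ext (f (bracket g a b)) p - (lin_ext (f a) (lin_ext (f b) p) - lin_ext (f b) (lin_ext (f a) p))"])
       (use that in \<open>auto intro!: plinearI simp: L A f_bracket\<close>)
  have closed: "act P a u \<in> carrier P" if "a \<in> carrier g" "u \<in> carrier P" for a u
    using that f_F unfolding carrier_P by (auto simp: act_P)
  show ?thesis
    unfolding is_lie_module_def
  proof (intro conjI ballI allI module_P closed)
    fix a b u v c
    assume a: "a \<in> carrier g" and b: "b \<in> carrier g" and "u \<in> carrier P" "v \<in> carrier P"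
    then obtain p q where *: "u = cs p" "v = cs q" "p \<in> F" "q \<in> F"
      unfolding carrier_P by blast
    show "act P a (u \<oplus>\<^bsub>P\<^esub> v) = act P a u \<oplus>\<^bsub>P\<^esub> act P a v"
      by (simp only: * add_P act_P a lin_ext_add)
    show "act P a (c \<odot>\<^bsub>P\<^esub> u) = c \<odot>\<^bsub>P\<^esub> act P a u"
      by (simp only: * smult_P act_P a lin_ext_scale)
    show "act P (a \<oplus>\<^bsub>g\<^esub> b) u = act P a u \<oplus>\<^bsub>P\<^esub> act P b u"
      by (simp only: * add_P act_P a b add_g cs_eq_iff 1)
    show "act P (c \<odot>\<^bsub>g\<^esub> a) u = c \<odot>\<^bsub>P\<^esub> act P a u"
      by (simp only: * smult_P act_P a smult_g cs_eq_iff 2)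
    show "act P (bracket g a b) u = act P a (act P b u) \<ominus>\<^bsub>P\<^esub> act P b (act P a u)"
      using 3[OF a b *(3)]
      by (simp only: * minus_P f_F act_P a b bracket_g cs_eq_iff)
  qed
qed

text \<open>
  The submodules of \<open>P\<close> correspond to the invariant subspaces between \<open>N\<close> and \<open>F\<close>.
\<close>
lemma simple_P:
  assumes "is_lie_module g P" "\<not> F \<subseteq> N"
    and inv: "\<And>S. pm.subspace S \<Longrightarrow> N \<subseteq> S \<Longrightarrow> S \<subseteq> F \<Longrightarrow>
      (\<And>a p. a \<in> carrier g \<Longrightarrow> p \<in> S \<Longrightarrow> lin_ext (f a) p \<in> S) \<Longrightarrow> S \<subseteq> N \<or> F \<subseteq> S"
  shows "simple_lie_module g P"
  unfolding simple_lie_module_def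
proof (intro conjI allI impI assms(1))
  obtain p where "p \<in> F" "p \<notin> N" using assms(2) by blast
  then have "cs p \<in> carrier P" "cs p \<noteq> \<zero>\<^bsub>P\<^esub>" by (auto simp: zero_P cs_eq_iff)
  then show "carrier P \<noteq> {\<zero>\<^bsub>P\<^esub>}" by blast
next
  fix M assume M: "is_lie_submodule g P M"
  then have sub: "submodule M complex_field P" by (simp add: is_lie_submodule_def)
  note E = module.submoduleE[OF module_P sub]
  let ?S = "{p \<in> F. cs p \<in> M}"
  have sc: "cs (scale c p) \<in> M" if "cs p \<in> M" for c p
    using E(4)[of c "cs p"] that by (simp add: smult_P)
  obtain p where p: "p \<in> F" "cs p \<in> M" using E(1,2) unfolding carrier_P by blast
  have zero: "cs 0 \<in> M" using sc[OF p(2), of 0] by simp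
  have S: "pm.subspace ?S"
    using zero sc E(5) pm.subspace_add[OF subspace_keys[of X]] pm.subspace_scale[OF subspace_keys[of X]]
    by (intro pm.subspaceI) (auto simp flip: add_P)
  have NS: "N \<subseteq> ?S"
    using N_sub zero by (auto simp: cs_eq_iff[of _ 0, simplified, THEN iffD2])
  have "lin_ext (f a) p \<in> ?S" if "a \<in> carrier g" "p \<in> ?S" for a p
    using M that f_F[of a p] act_P[of a p, symmetric] unfolding is_lie_submodule_def by simp
  from inv[OF S NS _ this] consider "?S \<subseteq> N" | "F \<subseteq> ?S" by blast
  then show "M = {\<zero>\<^bsub>P\<^esub>} \<or> M = carrier P"
  proof cases
    case 1
    have "M = {\<zero>\<^bsub>P\<^esub>}"
    proof
      show "{\<zero>\<^bsub>P\<^esub>} \<subseteq> M" using zero by (simp add: zero_P)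
      show "M \<subseteq> {\<zero>\<^bsub>P\<^esub>}"
      proof
        fix u assume u: "u \<in> M"
        then obtain p where "u = cs p" "p \<in> F" using E(1) unfolding carrier_P by blast
        then show "u \<in> {\<zero>\<^bsub>P\<^esub>}" using 1 u by (auto simp: zero_P cs_eq_iff)
      qed
    qed
    then show ?thesis ..
  next
    case 2
    then have "carrier P \<subseteq> M" unfolding carrier_P by blast
    then show ?thesis using E(1) by blast
  qed
qed

end

section \<open>A Poincare-Birkhoff-Witt functional\<close>

abbreviation word :: "'b list \<Rightarrow> ('b word \<Rightarrow>\<^sub>0 complex)" where "word u \<equiv> gen (Word u)"

lemma word_mult: "word u * word w = word (u @ w)"
  by (simp add: mult_single plus_word_def)

lemma word_Nil: "word [] = 1"
  by (simp add: zero_word_def[symmetric])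

definition emb :: "('b \<Rightarrow>\<^sub>0 complex) \<Rightarrow> ('b word \<Rightarrow>\<^sub>0 complex)" where
  "emb = lin_ext (\<lambda>b. word [b])"

lemma emb_gen [simp]: "emb (gen b) = word [b]"
  by (simp add: emb_def)

lemma plinear_emb: "plinear emb"
  by (simp add: emb_def plinear_lin_ext)

lemma scale_eq_mult: "scale c p = Poly_Mapping.single 0 c * (p :: 'b word \<Rightarrow>\<^sub>0 complex)"
  by (simp add: scale_def mult_map_scale_conv_mult)

lemma single_0_commute: "p * Poly_Mapping.single 0 c = Poly_Mapping.single 0 c * (p :: 'b word \<Rightarrow>\<^sub>0 complex)"
proof -
  have "lin_ext (\<lambda>w. gen w * Poly_Mapping.single 0 c) p = lin_ext (\<lambda>w. Poly_Mapping.single 0 c * gen w) p"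
    by (simp add: mult_single mult.commute)
  moreover have "p * q = (\<Sum>w\<in>Poly_Mapping.keys p. scale (Poly_Mapping.lookup p w) (gen w) * q)" for q
    by (subst sum_gens[of p]) (rule sum_distrib_right)
  moreover have "q * p = (\<Sum>w\<in>Poly_Mapping.keys p. q * scale (Poly_Mapping.lookup p w) (gen w))" for q
    by (subst sum_gens[of p]) (rule sum_distrib_left)
  ultimately show ?thesis
    by (simp add: scale_gen mult_single mult.commute)
qed

lemma scale_mult_left: "scale c p * q = scale c (p * q :: 'b word \<Rightarrow>\<^sub>0 complex)"
  by (simp add: scale_eq_mult mult.assoc)

lemma scale_mult_right: "p * scale c q = scale c (p * q :: 'b word \<Rightarrow>\<^sub>0 complex)"
  by (metis scale_eq_mult mult.assoc single_0_commute)

text \<open>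
  The number of inversions is the termination measure of sorting: exchanging two adjacent letters of a
  descent lowers it, and the commutator term that appears at the same time is shorter.
\<close>
fun inversions :: "('b \<Rightarrow> int) \<Rightarrow> 'b list \<Rightarrow> nat" where
  "inversions r [] = 0"
| "inversions r (x # xs) = length (filter (\<lambda>y. r y < r x) xs) + inversions r xs"

lemma inversions_swap:
  "r a < r b \<Longrightarrow> inversions r (u @ a # b # w) < inversions r (u @ b # a # w)"
  by (induction u) auto

text \<open>
  The basis of the algebra is ordered by \<open>rank\<close>, and the letters of nonnegative rank span the
  subalgebra, which acts on \<open>C\<close> by \<open>ac\<close>. The set \<open>Fn\<close> stands for the linear functionals on \<open>C\<close>: closure
  under linear combinations and under the action, with the compatibility \<open>Fn_br\<close>, is what the rewriting
  argument uses about them. The aim is to extend \<open>\<xi>\<close> to a function of a word and a vector that respects the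
  commutation rules inside the word and the action at its right end.
\<close>
locale pbw =
  fixes br :: "'b \<Rightarrow> 'b \<Rightarrow> ('b \<Rightarrow>\<^sub>0 complex)" and rank :: "'b \<Rightarrow> int"
    and C :: "'v set" and ac :: "'b \<Rightarrow> 'v \<Rightarrow> 'v" and Fn :: "('v \<Rightarrow> complex) set" and \<xi> :: "'v \<Rightarrow> complex"
  assumes rank_inj: "rank a = rank b \<Longrightarrow> a = b"
    and br_anti: "br a b = - br b a"
    and jacobi: "lin_ext (\<lambda>d. br d a) (br c b) - lin_ext (\<lambda>d. br d b) (br c a) + lin_ext (\<lambda>d. br d c) (br b a) = 0"
    and br_sub: "rank a \<ge> 0 \<Longrightarrow> rank b \<ge> 0 \<Longrightarrow> d \<in> Poly_Mapping.keys (br a b) \<Longrightarrow> rank d \<ge> 0"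
    and ac_C: "v \<in> C \<Longrightarrow> rank c \<ge> 0 \<Longrightarrow> ac c v \<in> C"
    and Fn_0: "(\<lambda>_. 0) \<in> Fn"
    and Fn_add: "\<phi> \<in> Fn \<Longrightarrow> \<psi> \<in> Fn \<Longrightarrow> (\<lambda>v. \<phi> v + \<psi> v) \<in> Fn"
    and Fn_scale: "\<phi> \<in> Fn \<Longrightarrow> (\<lambda>v. t * \<phi> v) \<in> Fn"
    and Fn_ac: "\<phi> \<in> Fn \<Longrightarrow> rank c \<ge> 0 \<Longrightarrow> (\<lambda>v. \<phi> (ac c v)) \<in> Fn"
    and Fn_br: "\<phi> \<in> Fn \<Longrightarrow> rank a \<ge> 0 \<Longrightarrow> rank b \<ge> 0 \<Longrightarrow> v \<in> C \<Longrightarrow>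
        \<phi> (ac b (ac a v)) - \<phi> (ac a (ac b v)) = fun_ext (\<lambda>d. \<phi> (ac d v)) (br b a)"
    and \<xi>_Fn: "\<xi> \<in> Fn"
begin

text \<open>
  A descent is a pair of adjacent letters in the wrong order, given with the words to its left and to its right.
\<close>
definition is_descent :: "'b list \<Rightarrow> 'b list \<times> 'b \<times> 'b \<times> 'b list \<Rightarrow> bool" where
  "is_descent w t \<longleftrightarrow> (case t of (u, b, a, u') \<Rightarrow> w = u @ b # a # u' \<and> rank a < rank b)"

definition descent :: "'b list \<Rightarrow> 'b list \<times> 'b \<times> 'b \<times> 'b list" where
  "descent w = (SOME t. is_descent w t)"

lemma is_descent_descent: "is_descent w t \<Longrightarrow> is_descent w (descent w)"
  unfolding descent_def by (rule someI)

lemma descent_eqD: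
  "is_descent w t \<Longrightarrow> (u, b, a, u') = descent w \<Longrightarrow> w = u @ b # a # u' \<and> rank a < rank b"
  using is_descent_descent[of w t] by (auto simp: is_descent_def dest: sym)

text \<open>
  The value of a word applied to \<open>v\<close>. An arbitrarily chosen descent is exchanged at the cost of the
  commutator term. A sorted word has its letters of nonnegative rank at the right end; they act on
  \<open>v\<close>, and a sorted word with only negative letters left gets the value \<open>0\<close> unless it is empty.
\<close>
function Xi :: "'b list \<Rightarrow> 'v \<Rightarrow> complex" where
  "Xi w v = (if \<exists>t. is_descent w t then
       (case descent w of (u, b, a, u') \<Rightarrow> Xi (u @ a # b # u') v + fun_ext (\<lambda>d. Xi (u @ d # u') v) (br b a))
     else if w \<noteq> [] \<and> rank (last w) \<ge> 0 then Xi (butlast w) (ac (last w) v)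
     else if w = [] then \<xi> v else 0)"
  by auto
termination
  by (relation "measures [\<lambda>(w, v). length w, \<lambda>(w, v). inversions rank w]")
     (auto dest!: descent_eqD simp: inversions_swap)

declare Xi.simps [simp del]

definition EE :: "('b word \<Rightarrow>\<^sub>0 complex) \<Rightarrow> 'v \<Rightarrow> complex" where
  "EE p v = fun_ext (\<lambda>w. Xi (letters w) v) p"

lemma functional_EE: "functional (\<lambda>p. EE p v)"
  unfolding EE_def by (rule functional_fun_ext)

lemmas EE_simps = pmc.linear_add[OF functional_EE] pmc.linear_diff[OF functional_EE]
  pmc.linear_0[OF functional_EE] pmc.linear_neg[OF functional_EE]  pmc.linear_scale[OF functional_EE]

lemma EE_word: "EE (word u) v = Xi u v"
  by (simp add: EE_def)

lemma functional_slot: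
  "functional (\<lambda>x. EE (p * emb x * q) v)"
  by (rule functionalI)
     (simp_all add: pm2.linear_add[OF plinear_emb] pm2.linear_scale[OF plinear_emb] distrib_left
       distrib_right scale_mult_left scale_mult_right EE_simps)

lemma EE_slot: "EE (word u * emb x * word u') v = fun_ext (\<lambda>d. Xi (u @ d # u') v) x"
  by (rule functional_eqI[OF functional_slot functional_fun_ext, of UNIV])
     (auto simp: word_mult EE_word)

text \<open>
  \<open>Xi\<close> satisfies the exchange rule by construction for the chosen descent; \<open>swap_rel\<close> demands it for
  every descent.
\<close>
definition swap_rel :: "'b list \<Rightarrow> bool" where
  "swap_rel w \<longleftrightarrow> (\<forall>u b a u' v. w = u @ b # a # u' \<and> rank a < rank b \<and> v \<in> C \<longrightarrow>
     Xi w v = Xi (u @ a # b # u') v + EE (word u * emb (br b a) * word u') v)"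

definition end_rel :: "'b list \<Rightarrow> bool" where
  "end_rel w \<longleftrightarrow> (\<forall>u c v. w = u @ [c] \<and> rank c \<ge> 0 \<and> v \<in> C \<longrightarrow> Xi w v = Xi u (ac c v))"

lemma fun_ext_Fn: "(\<And>d. (\<lambda>v. h d v) \<in> Fn) \<Longrightarrow> (\<lambda>v. fun_ext (\<lambda>d. h d v) x) \<in> Fn"
proof -
  assume h: "\<And>d. (\<lambda>v. h d v) \<in> Fn"
  have "(\<lambda>v. \<Sum>d\<in>S. Poly_Mapping.lookup x d * h d v) \<in> Fn" if "finite S" for S
    using that
  proof induction
    case (insert d S)
    show ?case using Fn_add[OF Fn_scale[OF h, of "Poly_Mapping.lookup x d" d] insert(3)] insert(1,2) by simp
  qed (simp add: Fn_0)
  then show ?thesis unfolding fun_ext_def by simp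
qed

abbreviation "commutator b a \<equiv> word [b] * word [a] - word [a] * word [b] - emb (br b a)"

text \<open>
  The exchange rule for descents gives it for all pairs of letters, since the bracket is antisymmetric
  and distinct letters have distinct ranks.
\<close>
lemma EE_commutator:
  assumes "\<And>w. length w = length u + length u' + 2 \<Longrightarrow> swap_rel w" "v \<in> C"
  shows "EE (word u * commutator b a * word u') v = 0"
proof -
  have *: "EE (word u * commutator b a * word u') v = 0" if "rank a < rank b" for a b
  proof -
    have "swap_rel (u @ b # a # u')" using assms by simp
    then have "Xi (u @ b # a # u') v = Xi (u @ a # b # u') v + EE (word u * emb (br b a) * word u') v"
      using that assms(2) unfolding swap_rel_def by blast
    then show ?thesis by (simp add: algebra_simps word_mult EE_simps EE_word)
  qed
  consider "rank a < rank b" | "rank b < rank a" | "a = b" using rank_inj by force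
  then show ?thesis
  proof cases
    case 2
    have "commutator b a = - commutator a b"
      using br_anti[of b a] by (simp add: pm2.linear_neg[OF plinear_emb])
    then show ?thesis using *[OF 2] by (simp only: EE_simps mult_minus_left mult_minus_right neg_equal_0_iff_equal)
  next
    case 3
    have "br a a = 0" using br_anti[of a a] by (simp add: poly_mapping_eq_iff fun_eq_iff)
    then show ?thesis using 3 by (simp add: pm2.linear_0[OF plinear_emb] EE_simps)
  qed (rule *)
qed

lemma EE_commutator_emb:
  assumes "\<And>w. length w = length u + length u' + 2 \<Longrightarrow> swap_rel w" "v \<in> C"
  shows "EE (word u * (emb x * word [a] - word [a] * emb x - emb (lin_ext (\<lambda>d. br d a) x)) * word u') v = 0"
proof (rule functional_eqI[of "\<lambda>x. EE (word u * (emb x * word [a] - word [a] * emb x - emb (lin_ext (\<lambda>d. br d a) x)) * word u') v" "\<lambda>_. 0" UNIV])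
  show "functional (\<lambda>x. EE (word u * (emb x * word [a] - word [a] * emb x - emb (lin_ext (\<lambda>d. br d a) x)) * word u') v)"
    by (rule functionalI)
     (simp_all add: pm2.linear_add[OF plinear_emb] pm2.linear_scale[OF plinear_emb]
       lin_ext_add lin_ext_scale distrib_left right_diff_distrib left_diff_distrib
       distrib_right scale_mult_left scale_mult_right EE_simps)
  show "functional (\<lambda>x. 0)" by (rule functionalI) auto
qed (use EE_commutator[OF assms] in auto)

lemma EE_commutator_far_right:
  assumes "\<And>w. length w = length u + length t + length u' + 3 \<Longrightarrow> swap_rel w" "v \<in> C"
  shows "EE (word u * emb x * word t * commutator b a * word u') v = 0"
proof (rule functional_eqI[of "\<lambda>x. EE (word u * emb x * word t * commutator b a * word u') v" "\<lambda>_. 0" UNIV])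
  show "functional (\<lambda>x. EE (word u * emb x * word t * commutator b a * word u') v)"
    using functional_slot[of "word u" "word t * commutator b a * word u'" v] by (simp add: mult.assoc)
  show "functional (\<lambda>x. 0)" by (rule functionalI) auto
  fix d
  show "EE (word u * emb (gen d) * word t * commutator b a * word u') v = 0"
    using EE_commutator[of "u @ d # t" u' v b a] assms by (simp add: word_mult)
qed auto

lemma EE_commutator_far_left:
  assumes "\<And>w. length w = length u + length t + length u' + 3 \<Longrightarrow> swap_rel w" "v \<in> C"
  shows "EE (word u * commutator b a * word t * emb x * word u') v = 0"
proof (rule functional_eqI[of "\<lambda>x. EE (word u * commutator b a * word t * emb x * word u') v" "\<lambda>_. 0" UNIV])
  show "functional (\<lambda>x. EE (word u * commutator b a * word t * emb x * word u') v)"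
    using functional_slot[of "word u * commutator b a * word t" "word u'" v] by (simp add: mult.assoc)
  show "functional (\<lambda>x. 0)" by (rule functionalI) auto
  fix d
  show "EE (word u * commutator b a * word t * emb (gen d) * word u') v = 0"
    using EE_commutator[of u "t @ d # u'" v b a] assms by (simp add: word_mult mult.assoc)
qed auto

definition good :: "'b list \<Rightarrow> bool" where
  "good w \<longleftrightarrow> swap_rel w \<and> end_rel w \<and> Xi w \<in> Fn"

text \<open>
  The right hand side of the exchange rule for the descent \<open>b, a\<close> between \<open>u\<close> and \<open>u'\<close>.
\<close>
definition swap_value :: "'b list \<Rightarrow> 'b \<Rightarrow> 'b \<Rightarrow> 'b list \<Rightarrow> 'v \<Rightarrow> complex" where
  "swap_value u b a u' v = EE (word u * word [a] * word [b] * word u') v + EE (word u * emb (br b a) * word u') v"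

lemma swap_relD:
  assumes "swap_rel (u @ b # a # u')" "rank a < rank b" "v \<in> C"
  shows "EE (word u * word [b] * word [a] * word u') v = swap_value u b a u' v"
  using assms unfolding swap_rel_def swap_value_def by (simp add: word_mult EE_word)

text \<open>
  Descents at disjoint places: both values are reduced further at the other place, and the results
  agree because commutator terms can be moved past each other in shorter words.
\<close>
lemma swap_value_disjoint:
  assumes IH: "\<And>w'. (w', u @ b # a # t @ d # c # s) \<in> measures [length, inversions rank] \<Longrightarrow> good w'"
    and "rank a < rank b" "rank c < rank d" "v \<in> C"
  shows "swap_value u b a (t @ d # c # s) v = swap_value (u @ b # a # t) d c s v"
proof -
  note A = word_mult mult.assoc
  have sw: "swap_rel w" if "(w, u @ b # a # t @ d # c # s) \<in> measures [length, inversions rank]" for w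
    using IH[OF that] by (simp add: good_def)
  have 1: "EE (word (u @ a # b # t) * word [d] * word [c] * word s) v = swap_value (u @ a # b # t) d c s v"
    by (rule swap_relD[OF sw]) (use assms inversions_swap[of rank a b u "t @ d # c # s"] in auto)
  have 2: "EE (word u * word [b] * word [a] * word (t @ c # d # s)) v = swap_value u b a (t @ c # d # s) v"
    by (rule swap_relD[OF sw]) (use assms inversions_swap[of rank c d "u @ b # a # t" s] in auto)
  have 3: "EE (word u * emb (br b a) * word t * commutator d c * word s) v = 0"
    by (rule EE_commutator_far_right[OF sw]) (use assms in auto)
  have 4: "EE (word u * commutator b a * word t * emb (br d c) * word s) v = 0"
    by (rule EE_commutator_far_left[OF sw]) (use assms in auto)
  show ?thesis
    using 1 2 3 4 by (simp add: swap_value_def algebra_simps EE_simps word_mult)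
qed

text \<open>
  Descents that share a letter, in \<open>c b a\<close> with falling ranks. Both ways of sorting these three letters lead to
  \<open>a b c\<close>, and the two collections of commutator terms differ by the Jacobi expression.
\<close>
lemma swap_value_overlap:
  assumes IH: "\<And>w'. (w', u @ c # b # a # s) \<in> measures [length, inversions rank] \<Longrightarrow> good w'"
    and "rank a < rank b" "rank b < rank c" "v \<in> C"
  shows "swap_value u c b (a # s) v = swap_value (u @ [c]) b a s v"
proof -
  have sw: "swap_rel w" if "(w, u @ c # b # a # s) \<in> measures [length, inversions rank]" for w
    using IH[OF that] by (simp add: good_def)
  note I = inversions_swap[of rank b c u "a # s"] inversions_swap[of rank a c "u @ [b]" s]
    inversions_swap[of rank a b u "c # s"]  inversions_swap[of rank a b "u @ [c]" s]
    inversions_swap[of rank a c u "b # s"] inversions_swap[of rank b c "u @ [a]" s]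
  have 1: "EE (word (u @ [b]) * word [c] * word [a] * word s) v = swap_value (u @ [b]) c a s v"
    by (rule swap_relD[OF sw]) (use assms I in auto)
  have 2: "EE (word u * word [b] * word [a] * word (c # s)) v = swap_value u b a (c # s) v"
    by (rule swap_relD[OF sw]) (use assms I in auto)
  have 3: "EE (word u * word [c] * word [a] * word (b # s)) v = swap_value u c a (b # s) v"
    by (rule swap_relD[OF sw]) (use assms I in auto)
  have 4: "EE (word (u @ [a]) * word [c] * word [b] * word s) v = swap_value (u @ [a]) c b s v"
    by (rule swap_relD[OF sw]) (use assms I in auto)
  have c: "EE (word u * (emb x * word [d] - word [d] * emb x - emb (lin_ext (\<lambda>d'. br d' d) x)) * word s) v = 0" for x d
    by (rule EE_commutator_emb[OF sw]) (use assms in auto)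
  have j: "emb (lin_ext (\<lambda>d. br d a) (br c b)) - emb (lin_ext (\<lambda>d. br d b) (br c a)) + emb (lin_ext (\<lambda>d. br d c) (br b a)) = 0"
    using jacobi[of a c b]
    by (simp flip: pm2.linear_add[OF plinear_emb] pm2.linear_diff[OF plinear_emb]) (simp add: pm2.linear_0[OF plinear_emb])
  have m: "word (x # xs) = word [x] * word xs" "word (xs @ [x]) = word xs * word [x]" for x :: 'b and xs
    by (simp_all add: word_mult)
  have j': "EE (word u * (emb (lin_ext (\<lambda>d. br d a) (br c b)) - emb (lin_ext (\<lambda>d. br d b) (br c a)) + emb (lin_ext (\<lambda>d. br d c) (br b a))) * word s) v = 0"
    unfolding j by (simp add: EE_simps)
  have s1: "swap_value u c b (a # s) v = EE (word u * word [b] * word [c] * word [a] * word s) v + EE (word u * emb (br c b) * word [a] * word s) v"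
    unfolding swap_value_def by (simp only: m(1)[of a s] mult.assoc)
  have s2: "swap_value (u @ [c]) b a s v = EE (word u * word [c] * word [a] * word [b] * word s) v + EE (word u * word [c] * emb (br b a) * word s) v"
    unfolding swap_value_def by (simp only: m(2)[of u c] mult.assoc)
  have 1: "EE (word u * word [b] * word [c] * word [a] * word s) v = EE (word u * word [b] * word [a] * word [c] * word s) v + EE (word u * word [b] * emb (br c a) * word s) v"
    using 1 unfolding swap_value_def by (simp only: m(2)[of u b] mult.assoc)
  have 2: "EE (word u * word [b] * word [a] * word [c] * word s) v = EE (word u * word [a] * word [b] * word [c] * word s) v + EE (word u * emb (br b a) * word [c] * word s) v"
    using 2 unfolding swap_value_def by (simp only: m(1)[of c s] mult.assoc)
  have 3: "EE (word u * word [c] * word [a] * word [b] * word s) v = EE (word u * word [a] * word [c] * word [b] * word s) v + EE (word u * emb (br c a) * word [b] * word s) v"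
    using 3 unfolding swap_value_def by (simp only: m(1)[of b s] mult.assoc)
  have 4: "EE (word u * word [a] * word [c] * word [b] * word s) v = EE (word u * word [a] * word [b] * word [c] * word s) v + EE (word u * word [a] * emb (br c b) * word s) v"
    using 4 unfolding swap_value_def by (simp only: m(2)[of u a] mult.assoc)
  have c': "EE (word u * emb x * word [d] * word s) v = EE (word u * word [d] * emb x * word s) v + EE (word u * emb (lin_ext (\<lambda>d'. br d' d) x) * word s) v" for x d
    using c[of x d] by (simp only: right_diff_distrib left_diff_distrib mult.assoc EE_simps) (simp add: diff_eq_eq add.commute)
  have j'': "EE (word u * emb (lin_ext (\<lambda>d. br d a) (br c b)) * word s) v - EE (word u * emb (lin_ext (\<lambda>d. br d b) (br c a)) * word s) v + EE (word u * emb (lin_ext (\<lambda>d. br d c) (br b a)) * word s) v = 0"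
    using j' by (simp only: right_diff_distrib left_diff_distrib distrib_left distrib_right mult.assoc EE_simps)
  have j3: "EE (word u * emb (lin_ext (\<lambda>d. br d b) (br c a)) * word s) v = EE (word u * emb (lin_ext (\<lambda>d. br d a) (br c b)) * word s) v + EE (word u * emb (lin_ext (\<lambda>d. br d c) (br b a)) * word s) v"
  proof -
    have "B = A + C" if "A - B + C = 0" for A B C :: complex
    proof -
      have "B = A + C - (A - B + C)" by simp
      then show ?thesis using that by simp
    qed
    then show ?thesis using j'' by blast
  qed
  show ?thesis
    using c'[of "br c b" a] c'[of "br c a" b] c'[of "br b a" c] j3 unfolding s1 s2 1 2 3 4 by simp
qed

text \<open>
  A descent in a word whose last letter may act on \<open>v\<close>. If the last letter belongs to the descent, then
  both of its letters act on \<open>v\<close>, and the claim is the bracket law of the module; otherwise exchanging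
  and acting take place at disjoint positions.
\<close>
lemma swap_value_end:
  assumes IH: "\<And>w'. (w', u @ b # a # u') \<in> measures [length, inversions rank] \<Longrightarrow> good w'"
    and "rank a < rank b" "u @ b # a # u' = s @ [c]" "rank c \<ge> 0" "v \<in> C"
  shows "swap_value u b a u' v = Xi s (ac c v)"
proof (cases u' rule: rev_cases)
  case Nil
  then have ac: "a = c" "s = u @ [b]" using assms(3) by auto
  have g: "good w'" if "length w' < length u + 2" for w'
    by (rule IH) (use that Nil in auto)
  have g2: "good (u @ [a, b])"
    by (rule IH) (use inversions_swap[of rank a b u "[]"] assms(2) Nil in auto)
  have b: "rank b \<ge> 0" "rank a \<ge> 0" using assms ac by auto
  have "Xi u \<in> Fn" using g[of u] by (simp add: good_def)
  from Fn_br[OF this b(2) b(1) assms(5)]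
  have *: "Xi u (ac b (ac a v)) = Xi u (ac a (ac b v)) + fun_ext (\<lambda>d. Xi u (ac d v)) (br b a)"
    by (simp add: diff_eq_eq add.commute)
  have e1: "Xi (u @ [x]) v' = Xi u (ac x v')" if "rank x \<ge> 0" "v' \<in> C" for x v'
    using g[of "u @ [x]"] that unfolding good_def end_rel_def by auto
  have "Xi ((u @ [a]) @ [b]) v = Xi (u @ [a]) (ac b v)"
    using g2 b(1) assms(5) unfolding good_def end_rel_def by simp
  also have "\<dots> = Xi u (ac a (ac b v))" using e1 b ac_C assms(5) by simp
  finally have "EE (word u * word [a] * word [b] * word u') v = Xi u (ac a (ac b v))"
    by (simp add: Nil word_mult EE_word)
  moreover have "EE (word u * emb (br b a) * word u') v = fun_ext (\<lambda>d. Xi u (ac d v)) (br b a)"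
    unfolding EE_slot Nil fun_ext_def
    by (rule sum.cong[OF refl]) (use e1 br_sub[OF b] assms(5) in auto)
  moreover have "Xi s (ac c v) = Xi u (ac b (ac a v))"
    unfolding ac using e1 b ac_C assms(5) ac by simp
  ultimately show ?thesis using * by (simp add: swap_value_def)
next
  case (snoc t c')
  then have s: "c' = c" "s = u @ b # a # t" using assms(3) by auto
  have g: "good w'" if "length w' < length u + length t + 3" for w'
    by (rule IH) (use that snoc in auto)
  have g2: "good (u @ a # b # t @ [c])"
    by (rule IH) (use inversions_swap[of rank a b u u'] assms(2) snoc s in auto)
  have "Xi ((u @ a # b # t) @ [c]) v = Xi (u @ a # b # t) (ac c v)"
    using g2 assms(4,5) unfolding good_def end_rel_def by simp
  then have "EE (word u * word [a] * word [b] * word u') v = EE (word u * word [a] * word [b] * word t) (ac c v)"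
    by (simp add: snoc s word_mult EE_word)
  moreover have "EE (word u * emb (br b a) * word u') v = EE (word u * emb (br b a) * word t) (ac c v)"
  proof -
    have "Xi (u @ d # t @ [c]) v = Xi (u @ d # t) (ac c v)" for d
      using g[of "u @ d # t @ [c]"] assms(4,5) unfolding good_def end_rel_def by simp
    then show ?thesis by (simp add: EE_slot snoc s)
  qed
  moreover have "swap_value u b a t (ac c v) = EE (word u * word [b] * word [a] * word t) (ac c v)"
    by (rule swap_relD[symmetric]) (use g[of "u @ b # a # t"] assms(2,4,5) ac_C in \<open>auto simp: good_def\<close>)
  ultimately show ?thesis by (simp add: swap_value_def s word_mult EE_word)
qed

text \<open>
  Two descents of a word are equal, overlap in one letter, or are disjoint. Reducing at either gives the
  same value once all smaller words are known to be well behaved.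
\<close>
lemma swap_value_unique:
  assumes IH: "\<And>w'. (w', w) \<in> measures [length, inversions rank] \<Longrightarrow> good w'"
    and w: "w = u @ b # a # u'" "w = s @ d # c # s'" and r: "rank a < rank b" "rank c < rank d"
    and v: "v \<in> C" and len: "length u \<le> length s"
  shows "swap_value u b a u' v = swap_value s d c s' v"
proof -
  obtain t where t: "s = u @ t" "b # a # u' = t @ d # c # s'"
    using w len by (auto simp: append_eq_append_conv2)
  consider "t = []" | "t = [b]" | t' where "t = b # a # t'"
    using t(2) by (cases t; cases "tl t") auto
  then show ?thesis
  proof cases
    case 1 then show ?thesis using t by auto
  next
    case 2
    then have "a = d" "u' = c # s'" using t by auto
    then show ?thesis using swap_value_overlap[of u b d c s' v] IH w r v t 2 by auto
  next
    case 3
    then show ?thesis using swap_value_disjoint[of u b a t' d c s' v] IH w r v t by auto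
  qed
qed

text \<open>
  Confluence of the rewriting: an instance of the diamond lemma, by induction on the length and the number of
  inversions.
\<close>
theorem all_good: "good w"
proof (induction w rule: wf_induct_rule[OF wf_measures[of "[length, inversions rank]"]])
  case (1 w)
  note IH = this
  have uniq: "swap_value u b a u' v = swap_value s d c s' v"
    if "w = u @ b # a # u'" "w = s @ d # c # s'" "rank a < rank b" "rank c < rank d" "v \<in> C" for u b a u' s d c s' v
    using swap_value_unique[OF IH, of w u b a u' s d c s' v] swap_value_unique[OF IH, of w s d c s' u b a u' v] that
    by (metis nle_le)
  have FnXi: "Xi w' \<in> Fn" if "(w', w) \<in> measures [length, inversions rank]" for w'
    using IH[OF that] by (simp add: good_def)
  show ?case
  proof (cases "\<exists>t. is_descent w t")
    case True
    obtain s d c s' where desc1: "descent w = (s, d, c, s')" by (cases "descent w")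
    then have desc: "descent w = (s, d, c, s')" "w = s @ d # c # s'" "rank c < rank d"
      using True descent_eqD[OF _ desc1[symmetric]] by auto
    have Xi: "Xi w v = swap_value s d c s' v" for v
      using True desc(1) by (subst Xi.simps) (simp add: swap_value_def EE_slot word_mult EE_word)
    have "swap_rel w"
      unfolding swap_rel_def
    proof (intro allI impI)
      fix u b a u' v assume a: "w = u @ b # a # u' \<and> rank a < rank b \<and> v \<in> C"
      then show "Xi w v = Xi (u @ a # b # u') v + EE (word u * emb (br b a) * word u') v"
        using Xi[of v] uniq[of u b a u' s d c s' v] desc by (simp add: swap_value_def word_mult EE_word)
    qed
    moreover have "end_rel w"
      unfolding end_rel_def
    proof (intro allI impI)
      fix u c0 v assume a: "w = u @ [c0] \<and> 0 \<le> rank c0 \<and> v \<in> C"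
      show "Xi w v = Xi u (ac c0 v)"
        unfolding Xi
      proof (rule swap_value_end)
        show "good w'" if "(w', s @ d # c # s') \<in> measures [length, inversions rank]" for w'
          using IH[of w'] that desc(2) by simp
        show "s @ d # c # s' = u @ [c0]" using a desc(2) by simp
      qed (use a desc in auto)
    qed
    moreover have "Xi w \<in> Fn"
    proof -
      have "Xi w = (\<lambda>v. Xi (s @ c # d # s') v + fun_ext (\<lambda>x. Xi (s @ x # s') v) (br d c))"
        unfolding Xi by (simp add: swap_value_def EE_slot word_mult EE_word fun_eq_iff Xi)
      also have "\<dots> \<in> Fn"
        using desc inversions_swap[of rank c d s s'] by (intro Fn_add fun_ext_Fn FnXi) auto
      finally show ?thesis .
    qed
    ultimately show ?thesis by (simp add: good_def)
  next
    case False
    then have nd: "\<not> (rank a < rank b)" if "w = u @ b # a # u'" for u b a u'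
      using that False by (auto simp: is_descent_def)
    have "swap_rel w" using nd by (auto simp: swap_rel_def)
    moreover have "end_rel w"
      unfolding end_rel_def
    proof (intro allI impI)
      fix u c v assume a: "w = u @ [c] \<and> rank c \<ge> 0 \<and> v \<in> C"
      have "Xi w v = Xi (butlast w) (ac (last w) v)"
        using Xi.simps[of w v] False a by simp
      then show "Xi w v = Xi u (ac c v)" using a by simp
    qed
    moreover have "Xi w \<in> Fn"
    proof (cases "w \<noteq> [] \<and> rank (last w) \<ge> 0")
      case True
      then have "Xi w = (\<lambda>v. Xi (butlast w) (ac (last w) v))" using False by (auto simp: Xi.simps[of w] fun_eq_iff)
      then show ?thesis using True by (auto intro!: Fn_ac FnXi)
    next
      case F: False
      then have "Xi w = (if w = [] then \<xi> else (\<lambda>_. 0))" using False by (auto simp: Xi.simps[of w] fun_eq_iff)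
      then show ?thesis using \<xi>_Fn Fn_0 by simp
    qed
    ultimately show ?thesis by (simp add: good_def)
  qed
qed

end

section \<open>Simplicity by lowering\<close>

lemma subspace_increasing_Union:
  fixes S :: "nat \<Rightarrow> ('x \<Rightarrow>\<^sub>0 complex) set"
  assumes "\<And>n. pm.subspace (S n)" "\<And>n. S n \<subseteq> S (Suc n)"
  shows "pm.subspace (\<Union>n. S n)"
proof (rule pm.subspaceI)
  show "0 \<in> (\<Union>n. S n)" using pm.subspace_0[OF assms(1)] by blast
  fix x y c assume "x \<in> (\<Union>n. S n)"
  then obtain m where m: "x \<in> S m" by blast
  show "scale c x \<in> (\<Union>n. S n)" using pm.subspace_scale[OF assms(1) m] by blast
  assume "y \<in> (\<Union>n. S n)"
  then obtain n where n: "y \<in> S n" by blast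
  have mono: "S a \<subseteq> S b" if "a \<le> b" for a b
    using lift_Suc_mono_le[of S, OF assms(2) that] .
  have "x \<in> S (max m n)" "y \<in> S (max m n)"
    using m n mono[of m "max m n"] mono[of n "max m n"] by auto
  then show "x + y \<in> (\<Union>n. S n)" using pm.subspace_add[OF assms(1)] by blast
qed

lemma subspace_sum_image:
  assumes "pm.subspace A" "pm.subspace B" "plinear h"
  shows "pm.subspace {a + h b |a b. a \<in> A \<and> b \<in> B}"
proof -
  have "{a + h b |a b. a \<in> A \<and> b \<in> B} = {a + b |a b. a \<in> A \<and> b \<in> h ` B}" by blast
  then show ?thesis
    using pm.subspace_sums[OF assms(1) pm2.linear_subspace_image[OF assms(3,2)]] by simp
qed

text \<open>
  The abstract situation of \<open>Ind(M)\<close> inside one vector space: \<open>U\<close> is the module, \<open>M0\<close> the image of \<open>M\<close>, and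
  \<open>l n\<close>, \<open>i n\<close> are the actions of \<open>L\<^sub>n\<close> and \<open>I\<^sub>n\<close>. The central elements act as scalars,
  with \<open>c\<^sub>3 = 0\<close>, so that the \<open>i n\<close> commute with each other.
\<close>
locale lowering =
  fixes U M0 :: "('x \<Rightarrow>\<^sub>0 complex) set"
    and l i :: "int \<Rightarrow> ('x \<Rightarrow>\<^sub>0 complex) \<Rightarrow> ('x \<Rightarrow>\<^sub>0 complex)"
    and k e :: nat and c0 c1 c2 :: complex
  assumes sub_U: "pm.subspace U"
    and lin_l: "plinear (l n)" and lin_i: "plinear (i n)"
    and l_U: "x \<in> U \<Longrightarrow> l n x \<in> U" and i_U: "x \<in> U \<Longrightarrow> i n x \<in> U"
    and ll: "x \<in> U \<Longrightarrow> l a (l b x) = l b (l a x) + scale (of_int (b - a)) (l (a + b) x)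
              + (if a + b = 0 then scale ((of_int a ^ 3 - of_int a) / 12 * c1) x else 0)"
    and li: "x \<in> U \<Longrightarrow> l a (i b x) = i b (l a x) + scale (of_int b) (i (a + b) x)
              + (if a + b = 0 then scale ((of_int a ^ 2 + of_int a) * c2) x else 0)"
    and ii: "x \<in> U \<Longrightarrow> i a (i b x) = i b (i a x)"
    and i0: "x \<in> U \<Longrightarrow> i 0 x = scale c0 x"
    and sub_M0: "pm.subspace M0" and M0_U: "M0 \<subseteq> U"
    and l_M0: "v \<in> M0 \<Longrightarrow> n \<ge> 0 \<Longrightarrow> l n v \<in> M0"
    and i_M0: "v \<in> M0 \<Longrightarrow> n \<ge> - int e \<Longrightarrow> i n v \<in> M0"
    and i_kills: "v \<in> M0 \<Longrightarrow> n > int k \<Longrightarrow> i n v = 0"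
    and l_kills: "v \<in> M0 \<Longrightarrow> n > int k + int e \<Longrightarrow> l n v = 0"
    and inj_k: "k \<noteq> 0 \<Longrightarrow> v \<in> M0 \<Longrightarrow> i (int k) v = 0 \<Longrightarrow> v = 0"
    and nonzero_0: "k = 0 \<Longrightarrow> n \<noteq> (0 :: int) \<Longrightarrow> c0 + (of_int n - 1) * c2 \<noteq> 0"
    and generated: "pm.subspace Z \<Longrightarrow> M0 \<subseteq> Z \<Longrightarrow> (\<And>n x. x \<in> Z \<Longrightarrow> x \<in> U \<Longrightarrow> l n x \<in> Z) \<Longrightarrow>
       (\<And>n x. x \<in> Z \<Longrightarrow> x \<in> U \<Longrightarrow> i n x \<in> Z) \<Longrightarrow> U \<subseteq> Z"
begin

lemmas l_simps = pm2.linear_add[OF lin_l] pm2.linear_scale[OF lin_l] pm2.linear_0[OF lin_l]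
  pm2.linear_diff[OF lin_l] pm2.linear_neg[OF lin_l]
lemmas i_simps = pm2.linear_add[OF lin_i] pm2.linear_scale[OF lin_i] pm2.linear_0[OF lin_i]
  pm2.linear_diff[OF lin_i] pm2.linear_neg[OF lin_i]
lemmas U_simps = pm.subspace_add[OF sub_U] pm.subspace_scale[OF sub_U] pm.subspace_0[OF sub_U]
  pm.subspace_diff[OF sub_U] l_U i_U

lemma il: "x \<in> U \<Longrightarrow> i b (l a x) = l a (i b x) - scale (of_int b) (i (a + b) x)
              - (if a + b = 0 then scale ((of_int a ^ 2 + of_int a) * c2) x else 0)"
  using li[of x a b] by (simp add: algebra_simps)

text \<open>
  \<open>y j\<close> creates a monomial factor outside the subalgebra and \<open>z j\<close> is the operator that
  removes it: up to a scalar, \<open>[L\<^bsub>k+e+j\<^esub>, I\<^bsub>-e-j\<^esub>]\<close> is \<open>I\<^sub>k\<close>.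
\<close>
definition y :: "nat \<Rightarrow> ('x \<Rightarrow>\<^sub>0 complex) \<Rightarrow> ('x \<Rightarrow>\<^sub>0 complex)" where "y j = i (- int e - int j)"
definition z :: "nat \<Rightarrow> ('x \<Rightarrow>\<^sub>0 complex) \<Rightarrow> ('x \<Rightarrow>\<^sub>0 complex)" where "z j = l (int k + int e + int j)"

text \<open>
  The commutator of \<open>z j\<close> and \<open>y j\<close>. For \<open>k = 0\<close> the central term contributes and \<open>q'\<close> is a nonzero scalar.
\<close>
definition q' :: "nat \<Rightarrow> ('x \<Rightarrow>\<^sub>0 complex) \<Rightarrow> ('x \<Rightarrow>\<^sub>0 complex)" where
  "q' j x = scale (- of_nat (e + j)) (i (int k) x)
     + scale (if k = 0 then (of_nat (e + j) ^ 2 + of_nat (e + j)) * c2 else 0) x"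

text \<open>
  \<open>E J C\<close> is the span of the monomials in \<open>y 1, \<dots>, y J\<close> applied to \<open>M0\<close> in which \<open>y J\<close> occurs at
  most \<open>C\<close> times.
\<close>
fun E :: "nat \<Rightarrow> nat \<Rightarrow> ('x \<Rightarrow>\<^sub>0 complex) set" where
  "E 0 C = M0"
| "E (Suc J) 0 = (\<Union>C. E J C)"
| "E (Suc J) (Suc C) = {a + y (Suc J) b |a b. a \<in> (\<Union>C. E J C) \<and> b \<in> E (Suc J) C}"

lemma lin_y: "plinear (y j)" and lin_z: "plinear (z j)"
  using lin_l lin_i by (simp_all add: y_def z_def)
lemmas y_simps = pm2.linear_add[OF lin_y] pm2.linear_scale[OF lin_y] pm2.linear_0[OF lin_y]
lemmas z_simps = pm2.linear_add[OF lin_z] pm2.linear_scale[OF lin_z] pm2.linear_0[OF lin_z]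

lemma E_basic: "pm.subspace (E J C) \<and> E J C \<subseteq> E J (Suc C) \<and> E J C \<subseteq> U"
proof (induction J C rule: E.induct)
  case (1 C)
  then show ?case using sub_M0 M0_U by simp
next
  case (2 J)
  have s: "pm.subspace (\<Union>C. E J C)" using 2 by (intro subspace_increasing_Union) auto
  moreover have "a \<in> E (Suc J) (Suc 0)" if "a \<in> (\<Union>C. E J C)" for a
  proof -
    have "a = a + y (Suc J) 0" by (simp add: y_simps)
    then show ?thesis using that pm.subspace_0[OF s] unfolding E.simps by blast
  qed
  ultimately show ?case using 2 by auto
next
  case (3 J C)
  have s: "pm.subspace (\<Union>C. E J C)" using 3(1) by (intro subspace_increasing_Union) auto
  have "E (Suc J) (Suc C) \<subseteq> U" using 3 by (auto intro!: U_simps simp: y_def)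
  moreover have "E (Suc J) (Suc C) \<subseteq> E (Suc J) (Suc (Suc C))"
    using 3(2) unfolding E.simps(3)[of J C] E.simps(3)[of J "Suc C"] by blast
  ultimately show ?case
    unfolding E.simps(3)[of J C] using subspace_sum_image[OF s _ lin_y] 3(2) by auto
qed

lemma sub_E: "pm.subspace (E J C)" and E_Suc: "E J C \<subseteq> E J (Suc C)" and E_U: "E J C \<subseteq> U"
  using E_basic by blast+

lemma sub_EE: "pm.subspace (\<Union>C. E J C)"
  using sub_E E_Suc by (intro subspace_increasing_Union) blast+

lemma i_E: "x \<in> E J C \<Longrightarrow> n \<ge> - int e \<Longrightarrow> i n x \<in> E J C"
proof (induction J C arbitrary: x rule: E.induct)
  case (3 J C)
  then obtain a b where x: "x = a + y (Suc J) b" "a \<in> (\<Union>C. E J C)" "b \<in> E (Suc J) C" by auto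
  have "i n x = i n a + y (Suc J) (i n b)"
    using x E_U ii[of b n] by (auto simp: i_simps y_def)
  moreover have "i n a \<in> (\<Union>C. E J C)" "i n b \<in> E (Suc J) C" using x 3 by auto
  ultimately show ?case by auto
qed (auto simp: i_M0)

lemma i_kills_E: "x \<in> E J C \<Longrightarrow> n > int k \<Longrightarrow> i n x = 0"
proof (induction J C arbitrary: x rule: E.induct)
  case (3 J C)
  then obtain a b where x: "x = a + y (Suc J) b" "a \<in> (\<Union>C. E J C)" "b \<in> E (Suc J) C" by auto
  have "i n x = i n a + y (Suc J) (i n b)"
    using x E_U ii[of b n] by (auto simp: i_simps y_def)
  then show ?case using x 3 by (auto simp: y_simps)
qed (auto simp: i_kills)

text \<open>
  The operator \<open>z j\<close> behaves like a derivation that is dual to \<open>y j\<close>: it kills the smaller \<open>y\<close>'s and lowers the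
  degree in \<open>y j\<close> by one.
\<close>
lemma zy: "x \<in> U \<Longrightarrow> z j (y j x) = y j (z j x) + q' j x"
  by (auto simp: li y_def z_def q'_def algebra_simps power2_eq_square)

lemma z_kills_E: "x \<in> E J C \<Longrightarrow> J < j \<Longrightarrow> z j x = 0"
proof (induction J C arbitrary: x rule: E.induct)
  case (1 C)
  then show ?case by (simp add: z_def l_kills)
next
  case (3 J C)
  then obtain a b where x: "x = a + y (Suc J) b" "a \<in> (\<Union>C. E J C)" "b \<in> E (Suc J) C" by auto
  have b: "b \<in> U" "z j b = 0" "z j a = 0" "i (int k + int j - int (Suc J)) b = 0"
    using x 3 E_U i_kills_E[OF x(3), of "int k + int j - int (Suc J)"] by (blast, auto)
  have "z j (y (Suc J) b) = y (Suc J) (z j b)"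
    using b(1,4) 3(4) by (simp add: y_def z_def li algebra_simps)
  then show ?case by (simp add: x(1) z_simps y_simps b)
qed auto

lemma q'_E: "x \<in> E J C \<Longrightarrow> q' j x \<in> E J C"
  unfolding q'_def using pm.subspace_add[OF sub_E] pm.subspace_scale[OF sub_E] pm.subspace_0[OF sub_E]
  by (auto simp: i_E)

lemma z_E: "x \<in> E (Suc J) (Suc C) \<Longrightarrow> z (Suc J) x \<in> E (Suc J) C"
proof (induction C arbitrary: x)
  case 0
  then obtain a b where x: "x = a + y (Suc J) b" "a \<in> (\<Union>C. E J C)" "b \<in> (\<Union>C. E J C)" by auto
  have "b \<in> U" "z (Suc J) a = 0" "z (Suc J) b = 0" using x E_U z_kills_E[of _ J _ "Suc J", OF _ lessI] by blast+
  then have "z (Suc J) x = q' (Suc J) b" by (simp add: x(1) z_simps zy y_simps)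
  moreover have "q' (Suc J) b \<in> (\<Union>C. E J C)" using x(3) q'_E by blast
  ultimately show ?case by simp
next
  case (Suc C)
  then obtain a b where x: "x = a + y (Suc J) b" "a \<in> (\<Union>C. E J C)" "b \<in> E (Suc J) (Suc C)"
    unfolding E.simps(3)[of J "Suc C"] by blast
  have "b \<in> U" using x E_U by blast
  then have "z (Suc J) x = (0 + y (Suc J) (z (Suc J) b)) + q' (Suc J) b"
    using x(2) z_kills_E[of a J _ "Suc J", OF _ lessI] by (auto simp: x(1) z_simps zy simp del: E.simps)
  moreover have "0 + y (Suc J) (z (Suc J) b) \<in> E (Suc J) (Suc C)"
    using Suc.IH[OF x(3)] pm.subspace_0[OF sub_EE] unfolding E.simps(3) by blast
  ultimately show ?case
    using pm.subspace_add[OF sub_E] q'_E[OF x(3)] by metis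
qed

lemma z_E_0: "x \<in> E (Suc J) 0 \<Longrightarrow> z (Suc J) x = 0"
  using z_kills_E[of x J] by auto

lemma i_k_z: "x \<in> E J C \<Longrightarrow> z (Suc j) (i (int k) x) = i (int k) (z (Suc j) x)"
  using E_U i_kills_E[of x J C] by (subst z_def, subst li) (auto simp: z_def)

lemma z_q': "x \<in> E J C \<Longrightarrow> z (Suc j) (q' (Suc j) x) = q' (Suc j) (z (Suc j) x)"
  by (simp add: q'_def z_simps i_k_z)

text \<open>
  On leading terms \<open>z y\<close> is a positive integer multiple of \<open>q'\<close>, as for \<open>d/dx x\<close> on polynomials. Applying
  \<open>z\<close> to the equation gives an equation of the same shape for \<open>z b\<close>, with \<open>t\<close> increased and the degree
  lowered, so \<open>z b = 0\<close> by induction; then \<open>q' b = 0\<close>.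
\<close>
lemma triangular_E:
  assumes "\<And>x. x \<in> E (Suc J) C \<Longrightarrow> q' (Suc J) x = 0 \<Longrightarrow> x = 0"
    and "b \<in> E (Suc J) C" "scale (of_nat (Suc t)) (q' (Suc J) b) + y (Suc J) (z (Suc J) b) = 0"
  shows "b = 0"
  using assms
proof (induction C arbitrary: b t)
  case 0
  then have "scale (of_nat (Suc t)) (q' (Suc J) b) = 0" using z_E_0 by (simp add: y_simps del: E.simps)
  then have "q' (Suc J) b = 0" by (metis pm.scale_eq_0_iff of_nat_neq_0)
  then show ?case using 0 by blast
next
  case (Suc C)
  let ?u = "z (Suc J) b"
  have u: "?u \<in> E (Suc J) C" by (rule z_E) fact
  then have uU: "?u \<in> U" using E_U by blast
  have "0 = z (Suc J) (scale (of_nat (Suc t)) (q' (Suc J) b) + y (Suc J) ?u)"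
    using Suc.prems(3) by (simp add: z_simps)
  also have "\<dots> = scale (of_nat (Suc t)) (q' (Suc J) ?u) + (y (Suc J) (z (Suc J) ?u) + q' (Suc J) ?u)"
    using z_q'[OF Suc.prems(2)] uU by (simp add: z_simps zy)
  also have "\<dots> = scale (of_nat (Suc (Suc t))) (q' (Suc J) ?u) + y (Suc J) (z (Suc J) ?u)"
    unfolding of_nat_Suc[of "Suc t"] pm.scale_left_distrib by simp
  finally have *: "scale (of_nat (Suc (Suc t))) (q' (Suc J) ?u) + y (Suc J) (z (Suc J) ?u) = 0" by simp
  have "?u = 0"
  proof (rule Suc.IH[OF _ u *])
    show "x = 0" if "x \<in> E (Suc J) C" "q' (Suc J) x = 0" for x
      using Suc.prems(1) E_Suc[of "Suc J" C] that by blast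
  qed
  then have "scale (of_nat (Suc t)) (q' (Suc J) b) = 0" using Suc.prems(3) by (simp add: y_simps)
  then have "q' (Suc J) b = 0" by (metis pm.scale_eq_0_iff of_nat_neq_0)
  then show ?case using Suc.prems by blast
qed

text \<open>
  The assumption on \<open>c\<^sub>0\<close> and \<open>c\<^sub>2\<close> enters here, with \<open>n = -(e + j)\<close>.
\<close>
lemma q'_0_imp:
  assumes "x \<in> U" "q' (Suc j) x = 0"
  shows "if k = 0 then x = 0 else i (int k) x = 0"
proof (cases "k = 0")
  case False
  then have "scale (- of_nat (e + Suc j)) (i (int k) x) = 0" using assms by (simp add: q'_def)
  then show ?thesis using False by (metis pm.scale_eq_0_iff neg_equal_0_iff_equal of_nat_eq_0_iff add_Suc_right nat.simps(3))
next
  case True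
  let ?n = "- int (e + Suc j)"
  have "i (int k) x = scale c0 x" using True i0[OF assms(1)] by simp
  then have "q' (Suc j) x = scale (of_int ?n * (c0 + (of_int ?n - 1) * c2)) x"
    unfolding q'_def if_P[OF True] by (simp add: algebra_simps power2_eq_square flip: pm.scale_left_distrib)
  moreover have "of_int ?n * (c0 + (of_int ?n - 1) * c2) \<noteq> 0"
  proof -
    have "?n \<noteq> 0" by simp
    then show ?thesis using nonzero_0[OF True, of ?n] of_int_eq_0_iff[of ?n] mult_eq_0_iff by blast
  qed
  ultimately show ?thesis using True assms(2) by (metis pm.scale_eq_0_iff)
qed

text \<open>
  If \<open>x = a + y b\<close> lies in \<open>N\<close>, then so does \<open>z x\<close>, which has smaller degree and hence is \<open>0\<close>; by
  \<open>triangular_E\<close> this forces \<open>b = 0\<close>. The injectivity of \<open>q'\<close> that is needed for \<open>k \<noteq> 0\<close> is the same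
  statement for the subspace killed by all \<open>i n\<close> with \<open>n \<ge> k\<close>.
\<close>
lemma M0_meets_E:
  assumes "pm.subspace N" "\<And>j x. x \<in> N \<Longrightarrow> z (Suc j) x \<in> N" "N \<inter> M0 \<subseteq> {0}"
  shows "N \<inter> E J C \<subseteq> {0}"
  using assms
proof (induction J C arbitrary: N rule: E.induct)
  case (1 C)
  then show ?case by simp
next
  case (2 J)
  have "N \<inter> E J C \<subseteq> {0}" for C by (rule 2(1)) (use 2 in auto)
  then show ?case by auto
next
  case (3 J C)
  \<comment> \<open>\<open>?K\<close> is stable under \<open>z\<close> and, for \<open>k \<noteq> 0\<close>, meets \<open>M0\<close> only in \<open>0\<close>, so the induction hypothesis applies to it.\<close>
  let ?K = "{x \<in> U. i (int k) x = 0 \<and> (\<forall>n > int k. i n x = 0)}"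
  have subK: "pm.subspace ?K"
    using sub_U by (intro pm.subspaceI) (auto simp: i_simps intro: U_simps)
  have zK: "z (Suc j) x \<in> ?K" if "x \<in> ?K" for j x
    using that by (auto simp: z_def il U_simps l_simps)
  have inj: "x = 0" if x: "x \<in> E (Suc J) C" "q' (Suc J) x = 0" for x
  proof (cases "k = 0")
    case True
    then show ?thesis using q'_0_imp[of x J] x E_U by auto
  next
    case False
    then have "x \<in> ?K" using q'_0_imp[of x J] x E_U i_kills_E by auto
    moreover have "?K \<inter> E (Suc J) C \<subseteq> {0}"
      by (rule 3(2)[OF subK zK]) (use inj_k[OF False] in auto)
    ultimately show ?thesis using x by blast
  qed
  show ?case
  proof
    fix x assume x: "x \<in> N \<inter> E (Suc J) (Suc C)"
    then obtain a b where ab: "x = a + y (Suc J) b" "a \<in> (\<Union>C. E J C)" "b \<in> E (Suc J) C"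
      unfolding E.simps(3)[of J C] by blast
    have bU: "b \<in> U" using ab E_U by blast
    have zx: "z (Suc J) x = y (Suc J) (z (Suc J) b) + q' (Suc J) b"
      using ab(2) z_kills_E[of a J _ "Suc J"] bU by (auto simp: ab(1) z_simps zy)
    have "z (Suc J) x \<in> N \<inter> E (Suc J) C" using x 3(4) z_E by blast
    then have "z (Suc J) x = 0" using 3(2)[OF 3(3) 3(4) 3(5)] by blast
    then have "b = 0"
      by (intro triangular_E[OF inj ab(3), of 0]) (simp_all add: zx add.commute)
    then have "x = a" by (simp add: ab y_simps)
    then show "x \<in> {0}" using ab(2) x 3(1)[OF _ 3(3) 3(4) 3(5)] by blast
  qed
qed

text \<open>
  \<open>D0\<close> is the submodule for the subalgebra of all \<open>I\<^sub>n\<close> and the \<open>L\<^sub>n\<close> with \<open>n \<ge> 0\<close> that is generated by \<open>M0\<close>.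
\<close>
definition D0 :: "('x \<Rightarrow>\<^sub>0 complex) set" where "D0 = (\<Union>J. \<Union>C. E J C)"

lemma EE_Suc: "(\<Union>C. E J C) \<subseteq> (\<Union>C. E (Suc J) C)"
  using E.simps(2)[of J] by blast

lemma EE_increasing: "J \<le> J' \<Longrightarrow> (\<Union>C. E J C) \<subseteq> (\<Union>C. E J' C)"
  using lift_Suc_mono_le[of "\<lambda>J. \<Union>C. E J C", OF EE_Suc] by blast

lemma sub_D0: "pm.subspace D0"
  unfolding D0_def by (rule subspace_increasing_Union[where S="\<lambda>J. \<Union>C. E J C"]) (fact sub_EE EE_Suc)+

lemma D0_U: "D0 \<subseteq> U" using E_U by (auto simp: D0_def)

lemma M0_D0: "M0 \<subseteq> D0" unfolding D0_def using E.simps(1) by blast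

lemma y_E:
  assumes "x \<in> E (Suc J) C"
  shows "y (Suc J) x \<in> (\<Union>C. E (Suc J) C)"
proof -
  have "0 + y (Suc J) x \<in> E (Suc J) (Suc C)"
    using pm.subspace_0[OF sub_EE] assms unfolding E.simps(3)[of J C] by blast
  then show ?thesis unfolding add_0 by blast
qed

lemma y_EE: "x \<in> E J C \<Longrightarrow> 1 \<le> j \<Longrightarrow> j \<le> J \<Longrightarrow> y j x \<in> (\<Union>C. E J C)"
proof (induction J C arbitrary: x rule: E.induct)
  case (2 J)
  show ?case
  proof (cases "j = Suc J")
    case True
    then show ?thesis using y_E 2(2) by blast
  next
    case False
    then have "y j x \<in> (\<Union>C. E J C)" using 2 by auto
    then show ?thesis using EE_Suc by blast
  qed
next
  case (3 J C)
  show ?case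
  proof (cases "j = Suc J")
    case True
    then show ?thesis using y_E 3(3) by blast
  next
    case False
    obtain a b where x: "x = a + y (Suc J) b" "a \<in> (\<Union>C. E J C)" "b \<in> E (Suc J) C" using 3 by auto
    have "y j a \<in> (\<Union>C. E J C)" using 3 False x by auto
    then have 1: "y j a \<in> (\<Union>C. E (Suc J) C)" using EE_Suc by blast
    have "y j b \<in> (\<Union>C. E (Suc J) C)" using 3 False x by auto
    then have 2: "y (Suc J) (y j b) \<in> (\<Union>C. E (Suc J) C)" using y_E by blast
    have "y j x = y j a + y (Suc J) (y j b)"
      using x E_U ii[of b "- int e - int j"] by (auto simp: y_simps y_def i_simps)
    then show ?thesis using pm.subspace_add[OF sub_EE 1 2] by simp
  qed
qed auto

lemma y_D0:
  assumes "x \<in> D0" "1 \<le> j"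
  shows "y j x \<in> D0"
proof -
  obtain J where "x \<in> (\<Union>C. E J C)" using assms(1) unfolding D0_def by blast
  then have "x \<in> (\<Union>C. E (max J j) C)" using EE_increasing[of J "max J j"] by (meson max.cobounded1 subsetD)
  then obtain C where C: "x \<in> E (max J j) C" by blast
  have "y j x \<in> (\<Union>C. E (max J j) C)" by (rule y_EE[OF C assms(2)]) simp
  then show ?thesis unfolding D0_def by (rule UN_I[OF UNIV_I])
qed

lemma i_D0:
  assumes "x \<in> D0"
  shows "i n x \<in> D0"
proof (cases "n \<ge> - int e")
  case True
  obtain J C where "x \<in> E J C" using assms unfolding D0_def by blast
  then have "i n x \<in> E J C" using i_E True by blast
  then show ?thesis unfolding D0_def by blast
next
  case False
  then have "i n = y (nat (- n - int e))" by (simp add: y_def)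
  then show ?thesis using y_D0[OF assms, of "nat (- n - int e)"] False by simp
qed

lemma l_D0: "x \<in> D0 \<Longrightarrow> n \<ge> 0 \<Longrightarrow> l n x \<in> D0"
proof -
  have "l n x \<in> D0" if "x \<in> E J C" "n \<ge> 0" for J C x
    using that
  proof (induction J C arbitrary: x rule: E.induct)
    case (1 C)
    then show ?case using l_M0 M0_D0 by auto
  next
    case (3 J C)
    then obtain a b where x: "x = a + y (Suc J) b" "a \<in> (\<Union>C. E J C)" "b \<in> E (Suc J) C" by auto
    have b: "b \<in> U" "b \<in> D0" using x E_U unfolding D0_def by blast+
    have "l n a \<in> D0" "l n b \<in> D0" using x 3 by auto
    then show ?case
      using b i_D0[OF b(2)] i_D0[of "l n b"] pm.subspace_0[OF sub_D0]
      by (auto simp: x(1) l_simps y_def li intro!: pm.subspace_add[OF sub_D0] pm.subspace_scale[OF sub_D0])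
  qed auto
  then show "x \<in> D0 \<Longrightarrow> n \<ge> 0 \<Longrightarrow> l n x \<in> D0" unfolding D0_def by blast
qed

lemma i_kills_D0: "x \<in> D0 \<Longrightarrow> n > int k \<Longrightarrow> i n x = 0"
  using i_kills_E unfolding D0_def by blast

lemma inj_k_D0: "k \<noteq> 0 \<Longrightarrow> x \<in> D0 \<Longrightarrow> i (int k) x = 0 \<Longrightarrow> x = 0"
proof -
  assume k: "k \<noteq> 0" and x: "x \<in> D0" "i (int k) x = 0"
  let ?K = "{x \<in> U. i (int k) x = 0 \<and> (\<forall>n > int k. i n x = 0)}"
  have subK: "pm.subspace ?K"
    using sub_U by (intro pm.subspaceI) (auto simp: i_simps intro: U_simps)
  have zK: "z (Suc j) x \<in> ?K" if "x \<in> ?K" for j x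
    using that by (auto simp: z_def il U_simps l_simps)
  have "?K \<inter> E J C \<subseteq> {0}" for J C
    by (rule M0_meets_E[OF subK zK]) (use inj_k[OF k] in auto)
  moreover have "x \<in> ?K" using x D0_U i_kills_D0 by auto
  ultimately show "x = 0" using x unfolding D0_def by blast
qed

text \<open>
  \<open>Dt r J\<close> is the part of degree less than \<open>r\<close> in the negative \<open>L\<close>'s, with \<open>D0\<close> as coefficients: in the terms of
  top degree the indices of the \<open>L\<close>'s are at least \<open>-J\<close>, and all terms of smaller degree are
  included. \<open>FF r\<close> drops the bound on the indices; the shift of \<open>r\<close> by one makes \<open>FF 0\<close> the zero
  space.
\<close>
fun Dt :: "nat \<Rightarrow> nat \<Rightarrow> ('x \<Rightarrow>\<^sub>0 complex) set" where
  "Dt 0 J = {0}"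
| "Dt (Suc r) 0 = D0 \<union> (\<Union>J. Dt r J)"
| "Dt (Suc r) (Suc J) = {a + l (- int (Suc J)) b |a b. a \<in> Dt (Suc r) J \<and> b \<in> Dt r (Suc J)}"

definition FF :: "nat \<Rightarrow> ('x \<Rightarrow>\<^sub>0 complex) set" where "FF r = (\<Union>J. Dt r J)"

lemma FF_0: "FF 0 = {0}" by (simp add: FF_def)

lemma FF_in_Dt: "FF r \<subseteq> Dt (Suc r) J"
  and D0_in_Dt: "D0 \<subseteq> Dt (Suc r) J"
  and Dt_mono: "Dt r J \<subseteq> Dt r (Suc J)"
proof -
  have *: "0 \<in> Dt r J" for r J
  proof (induction r J rule: Dt.induct)
    case (3 r J)
    have "0 = 0 + l (- int (Suc J)) 0" by (simp add: l_simps)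
    then show ?case using 3 unfolding Dt.simps(3) by blast
  qed (use pm.subspace_0[OF sub_D0] in auto)
  have step: "Dt (Suc r) J \<subseteq> Dt (Suc r) (Suc J)" for r J
  proof
    fix x assume "x \<in> Dt (Suc r) J"
    then have "x + l (- int (Suc J)) 0 \<in> Dt (Suc r) (Suc J)" using * unfolding Dt.simps(3) by blast
    then show "x \<in> Dt (Suc r) (Suc J)" by (simp only: l_simps add_0_right)
  qed
  have "Dt (Suc r) 0 \<subseteq> Dt (Suc r) J" for r J
    by (induction J) (use step in blast)+
  then have "D0 \<union> FF r \<subseteq> Dt (Suc r) J" for r J
    unfolding FF_def Dt.simps(2) by blast
  then show "FF r \<subseteq> Dt (Suc r) J" "D0 \<subseteq> Dt (Suc r) J" for r J
    by blast+
  show "Dt r J \<subseteq> Dt r (Suc J)" using step by (cases r) auto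
qed

lemma FF_Suc: "FF r \<subseteq> FF (Suc r)"
  using FF_in_Dt[of r 0] unfolding FF_def by blast

lemma FF_Suc_0: "FF (Suc 0) = D0"
proof -
  have "Dt (Suc 0) J = D0" for J
  proof (induction J)
    case 0
    then show ?case using pm.subspace_0[OF sub_D0] by auto
  next
    case (Suc J)
    then show ?case unfolding Dt.simps by (simp add: l_simps)
  qed
  then show ?thesis by (simp add: FF_def)
qed

lemma D0_FF: "D0 \<subseteq> FF (Suc r)"
  using D0_in_Dt[of r 0] unfolding FF_def by blast

lemma Dt_basic: "pm.subspace (Dt r J) \<and> Dt r J \<subseteq> U"
proof (induction r J rule: Dt.induct)
  case (1 J)
  then show ?case using pm.subspace_0[OF sub_U] by simp
next
  case (2 r)
  have "pm.subspace (Dt (Suc r) 0)"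
  proof (cases r)
    case 0
    then have "Dt (Suc r) 0 = D0" using pm.subspace_0[OF sub_D0] by auto
    then show ?thesis using sub_D0 by simp
  next
    case (Suc r')
    then have "D0 \<subseteq> Dt r 0" using D0_in_Dt[of r' 0] by simp
    then have "D0 \<subseteq> (\<Union>J. Dt r J)" by (rule subset_trans) (rule UN_upper[OF UNIV_I])
    then have "Dt (Suc r) 0 = (\<Union>J. Dt r J)" unfolding Dt.simps(2) by (rule Un_absorb1)
    moreover have "pm.subspace (\<Union>J. Dt r J)"
      by (rule subspace_increasing_Union[of "Dt r"]) (use 2 Dt_mono in blast)+
    ultimately show ?thesis by simp
  qed
  then show ?case using 2 D0_U by auto
next
  case (3 r J)
  have "Dt (Suc r) (Suc J) \<subseteq> U" using 3 by (auto intro!: U_simps)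
  then show ?case
    unfolding Dt.simps(3)[of r J] using 3 subspace_sum_image[OF _ _ lin_l] by auto
qed

lemma sub_Dt: "pm.subspace (Dt r J)" and Dt_U: "Dt r J \<subseteq> U"
  using Dt_basic by blast+

lemma sub_FF: "pm.subspace (FF r)"
  unfolding FF_def by (rule subspace_increasing_Union[of "Dt r"]) (fact sub_Dt Dt_mono)+

lemma FF_U: "FF r \<subseteq> U" using Dt_U unfolding FF_def by blast

lemmas FF_simps = pm.subspace_add[OF sub_FF] pm.subspace_scale[OF sub_FF] pm.subspace_0[OF sub_FF]
  pm.subspace_diff[OF sub_FF]

lemma Dt_le: "J \<le> J' \<Longrightarrow> Dt r J \<subseteq> Dt r J'"
  using lift_Suc_mono_le[of "Dt r", OF Dt_mono] .

lemma l_Dt_top: "x \<in> Dt r (Suc J) \<Longrightarrow> l (- int (Suc J)) x \<in> Dt (Suc r) (Suc J)"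
proof -
  assume "x \<in> Dt r (Suc J)"
  then have "0 + l (- int (Suc J)) x \<in> Dt (Suc r) (Suc J)"
    using pm.subspace_0[OF sub_Dt] unfolding Dt.simps(3)[of r J] by blast
  then show ?thesis by simp
qed

declare Dt.simps(2,3) [simp del]

text \<open>
  Moving a new factor \<open>L\<^bsub>-j\<^esub>\<close> to its place in a monomial costs commutators \<open>L\<^bsub>-j-J\<^esub>\<close> with a new index but one factor fewer.
  Therefore the bound on the indices and the statement for \<open>FF\<close> have to be proved together,
  by induction on the degree.
\<close>
lemma l_neg_Dt:
  assumes "\<And>x j r'. x \<in> FF r' \<Longrightarrow> r' < r \<Longrightarrow> 1 \<le> j \<Longrightarrow> l (- int j) x \<in> FF (Suc r')"
    and "\<And>x j J r'. x \<in> Dt r' J \<Longrightarrow> r' < r \<Longrightarrow> 1 \<le> j \<Longrightarrow> j \<le> J \<Longrightarrow> l (- int j) x \<in> Dt (Suc r') J"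
    and "x \<in> Dt r J" "1 \<le> j" "j \<le> J"
  shows "l (- int j) x \<in> Dt (Suc r) J"
  using assms(3-5)
proof (induction J arbitrary: x)
  case (Suc J)
  show ?case
  proof (cases "j = Suc J")
    case True
    then show ?thesis using l_Dt_top Suc.prems by blast
  next
    case False
    show ?thesis
    proof (cases r)
      case 0
      then show ?thesis using Suc.prems pm.subspace_0[OF sub_Dt] by (simp add: l_simps)
    next
      case (Suc r')
      then obtain a b where x: "x = a + l (- int (Suc J)) b" "a \<in> Dt r J" "b \<in> Dt r' (Suc J)"
        using Suc.prems(1) unfolding \<open>r = Suc r'\<close> Dt.simps(3)[of r' J] by blast
      have bU: "b \<in> U" using x Dt_U by blast
      have 1: "l (- int j) a \<in> Dt (Suc r) (Suc J)"
        using Suc.IH[OF x(2)] Suc.prems False Dt_mono by auto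
      have "l (- int j) b \<in> Dt r (Suc J)"
        using assms(2)[OF x(3), of j] Suc Suc.prems by simp
      then have 2: "l (- int (Suc J)) (l (- int j) b) \<in> Dt (Suc r) (Suc J)" by (rule l_Dt_top)
      have "l (- int (j + Suc J)) b \<in> FF r"
        using assms(1)[of b r' "j + Suc J"] x(3) Suc unfolding FF_def by auto
      moreover have e: "- int j + - int (Suc J) = - int j - int (Suc J)" by simp
      moreover have "- int (j + Suc J) = - int j - int (Suc J)" by simp
      ultimately have 3: "l (- int j - int (Suc J)) b \<in> Dt (Suc r) (Suc J)"
        using FF_in_Dt[of r "Suc J"] by (metis subsetD)
      have "l (- int j) x = l (- int j) a + l (- int (Suc J)) (l (- int j) b)
          + scale (of_int (- int (Suc J) + int j)) (l (- int j - int (Suc J)) b)"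
        using ll[OF bU, of "- int j" "- int (Suc J)", unfolded e] by (simp add: x(1) l_simps)
      then show ?thesis
        using pm.subspace_add[OF sub_Dt pm.subspace_add[OF sub_Dt 1 2] pm.subspace_scale[OF sub_Dt 3]]
        by metis
    qed
  qed
qed auto

lemma l_neg_both:
  "(\<forall>x J j. x \<in> Dt r J \<longrightarrow> 1 \<le> j \<longrightarrow> j \<le> J \<longrightarrow> l (- int j) x \<in> Dt (Suc r) J) \<and>
   (\<forall>x j. x \<in> FF r \<longrightarrow> 1 \<le> j \<longrightarrow> l (- int j) x \<in> FF (Suc r))"
proof (induction r rule: less_induct)
  case (less r)
  have 1: "l (- int j) x \<in> Dt (Suc r) J" if "x \<in> Dt r J" "1 \<le> j" "j \<le> J" for x J j
    by (rule l_neg_Dt[OF _ _ that]) (use less in blast)+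
  have "l (- int j) x \<in> FF (Suc r)" if x: "x \<in> FF r" and j: "1 \<le> j" for x j
  proof -
    obtain J where "x \<in> Dt r J" using x unfolding FF_def by blast
    then have "x \<in> Dt r (max J j)" using Dt_le[of J "max J j"] by auto
    then have "l (- int j) x \<in> Dt (Suc r) (max J j)" using 1 j by simp
    then show ?thesis unfolding FF_def by blast
  qed
  then show ?case using 1 by blast
qed

lemma l_neg_FF: "x \<in> FF r \<Longrightarrow> 1 \<le> j \<Longrightarrow> l (- int j) x \<in> FF (Suc r)"
  using l_neg_both by blast

lemma l_negative_FF:
  assumes "x \<in> FF r" "n < 0"
  shows "l n x \<in> FF (Suc r)"
proof -
  have "l (- int (nat (- n))) x \<in> FF (Suc r)"
    by (rule l_neg_FF[OF assms(1)]) (use assms(2) in auto)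
  then show ?thesis using assms(2) by simp
qed

lemma Dt_FF: "Dt r J \<subseteq> FF r" unfolding FF_def by blast

lemma i_FF: "x \<in> FF r \<Longrightarrow> i n x \<in> FF r"
proof -
  have "i n x \<in> FF r" if "x \<in> Dt r J" for x r J n
    using that
  proof (induction r J arbitrary: x n rule: Dt.induct)
    case (1 J)
    then show ?case by (simp add: i_simps FF_0)
  next
    case (2 r)
    then show ?case using i_D0 D0_FF FF_Suc unfolding Dt.simps(2) by blast
  next
    case (3 r J)
    then obtain a b where x: "x = a + l (- int (Suc J)) b" "a \<in> Dt (Suc r) J" "b \<in> Dt r (Suc J)"
    unfolding Dt.simps(3)[of r J] by blast
    have bU: "b \<in> U" and bF: "b \<in> FF (Suc r)" using x Dt_U Dt_FF FF_Suc by blast+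
    have "i n a \<in> FF (Suc r)" using 3 x by blast
    moreover have "l (- int (Suc J)) (i n b) \<in> FF (Suc r)"
    proof (rule l_neg_FF)
      show "i n b \<in> FF r" using 3(2) x(3) by blast
    qed simp
    moreover have "i m b \<in> FF (Suc r)" for m using 3 x FF_Suc by blast
    ultimately show ?case
      using bF il[OF bU] by (auto simp: x(1) i_simps intro!: FF_simps)
  qed
  then show "x \<in> FF r \<Longrightarrow> i n x \<in> FF r" unfolding FF_def by blast
qed

lemma l_pos_FF: "x \<in> FF r \<Longrightarrow> n \<ge> 0 \<Longrightarrow> l n x \<in> FF r"
proof -
  have "l n x \<in> FF r" if "x \<in> Dt r J" "n \<ge> 0" for x r J n
    using that
  proof (induction r J arbitrary: x n rule: Dt.induct)
    case (1 J)
    then show ?case by (simp add: l_simps FF_0)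
  next
    case (2 r)
    then show ?case using l_D0 D0_FF FF_Suc unfolding Dt.simps(2) by blast
  next
    case (3 r J)
    then obtain a b where x: "x = a + l (- int (Suc J)) b" "a \<in> Dt (Suc r) J" "b \<in> Dt r (Suc J)"
    unfolding Dt.simps(3)[of r J] by blast
    have bU: "b \<in> U" and bF: "b \<in> FF (Suc r)" using x Dt_U Dt_FF FF_Suc by blast+
    have 1: "l n a \<in> FF (Suc r)" using 3 x by blast
    have 2: "l (- int (Suc J)) (l n b) \<in> FF (Suc r)"
    proof (rule l_neg_FF)
      show "l n b \<in> FF r" using 3(2)[OF x(3) 3(4)] .
    qed simp
    have 3: "l (n + - int (Suc J)) b \<in> FF (Suc r)"
    proof (cases "n + - int (Suc J) \<ge> 0")
      case True
      then show ?thesis using 3(2)[OF x(3) True] FF_Suc by blast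
    next
      case False
      then show ?thesis using l_negative_FF[of b r "n + - int (Suc J)"] x(3) Dt_FF by auto
    qed
    have 4: "(if n + - int (Suc J) = 0 then scale c b else 0) \<in> FF (Suc r)" for c
      using bF FF_simps by simp
    show ?case unfolding x(1) l_simps ll[OF bU, of n "- int (Suc J)"] by (intro FF_simps(1,2) 1 2 3 4)
  qed
  then show "x \<in> FF r \<Longrightarrow> n \<ge> 0 \<Longrightarrow> l n x \<in> FF r" unfolding FF_def by blast
qed

lemma l_FF: "x \<in> FF r \<Longrightarrow> l n x \<in> FF (Suc r)"
  using l_pos_FF[of x r n] FF_Suc[of r] l_negative_FF[of x r n] by (cases "n \<ge> 0") auto

lemma U_eq: "U \<subseteq> (\<Union>r. FF r)"
proof (rule generated)
  show "pm.subspace (\<Union>r. FF r)" by (rule subspace_increasing_Union[of FF]) (fact sub_FF FF_Suc)+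
  show "M0 \<subseteq> (\<Union>r. FF r)" using M0_D0 D0_FF[of 0] by blast
  fix n x assume "x \<in> (\<Union>r. FF r)"
  then obtain r where r: "x \<in> FF r" by blast
  show "l n x \<in> (\<Union>r. FF r)" using l_FF[OF r] by blast
  show "i n x \<in> (\<Union>r. FF r)" using i_FF[OF r] by blast
qed

text \<open>
  Commuting \<open>I\<^sub>n\<close> through a monomial replaces some \<open>L\<close> by another \<open>I\<close>, which loses one degree; the term
  without a commutator dies since \<open>I\<^sub>n\<close> kills \<open>D0\<close>.
\<close>
lemma i_lowers: "x \<in> FF r \<Longrightarrow> n > int k \<Longrightarrow> i n x \<in> FF (r - 1)"
proof -
  have "i n x \<in> FF (r - 1)" if "x \<in> Dt r J" "n > int k" for x r J
    using that
  proof (induction r J arbitrary: x rule: Dt.induct)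
    case (1 J)
    then show ?case by (simp add: i_simps FF_0)
  next
    case (2 r)
    then consider "x \<in> D0" | J where "x \<in> Dt r J" unfolding Dt.simps(2) by blast
    then show ?case
    proof cases
      case 1
      then show ?thesis using i_kills_D0 2 by (simp add: FF_simps)
    next
      case (2 J)
      then have "x \<in> FF r" using Dt_FF by blast
      then show ?thesis using i_FF by simp
    qed
  next
    case (3 r J)
    then obtain a b where x: "x = a + l (- int (Suc J)) b" "a \<in> Dt (Suc r) J" "b \<in> Dt r (Suc J)"
    unfolding Dt.simps(3)[of r J] by blast
    have bU: "b \<in> U" and bF: "b \<in> FF r" using x Dt_U Dt_FF by blast+
    have "i n a \<in> FF r" using 3 x by fastforce
    moreover have "l (- int (Suc J)) (i n b) \<in> FF r"
    proof (cases r)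
      case 0
      then show ?thesis using x by (simp add: i_simps l_simps FF_0)
    next
      case (Suc r')
      then show ?thesis using 3 x l_neg_FF[of "i n b" r' "Suc J"] by simp
    qed
    moreover have "i m b \<in> FF r" for m using bF i_FF by blast
    ultimately show ?case
      using bF il[OF bU] by (auto simp: x(1) i_simps intro!: FF_simps)
  qed
  then show "x \<in> FF r \<Longrightarrow> n > int k \<Longrightarrow> i n x \<in> FF (r - 1)" unfolding FF_def by blast
qed

lemma l_FF_pred: "x \<in> FF (r - 2) \<Longrightarrow> l (- int (Suc J)) x \<in> FF (r - 1)"
proof (cases "r < 2")
  case True
  then have "r - 2 = 0" "r - 1 = 0" by auto
  then show "x \<in> FF (r - 2) \<Longrightarrow> l (- int (Suc J)) x \<in> FF (r - 1)" by (simp add: FF_0 l_simps)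
next
  case False
  then have "r - 1 = Suc (r - 2)" by simp
  then show "x \<in> FF (r - 2) \<Longrightarrow> l (- int (Suc J)) x \<in> FF (r - 1)" using l_FF by simp
qed

text \<open>
  When \<open>n\<close> exceeds \<open>k + J\<close>, the new \<open>I\<^bsub>n-j\<^esub>\<close> has still an index above \<open>k\<close>, so a second degree is lost.
\<close>
lemma i_lowers_twice: "x \<in> Dt r J \<Longrightarrow> n > int k + int J \<Longrightarrow> i n x \<in> FF (r - 2)"
proof (induction r J arbitrary: x n rule: Dt.induct)
  case (1 J)
  then show ?case by (simp add: i_simps FF_0)
next
  case (2 r)
  then consider "x \<in> D0" | J where "x \<in> Dt r J" unfolding Dt.simps(2) by blast
  then show ?case
  proof cases
    case 1
    then show ?thesis using i_kills_D0 2 by (simp add: FF_simps)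
  next
    case J: (2 J)
    then have "x \<in> FF r" using Dt_FF by blast
    then show ?thesis using i_lowers[of x r n] 2 by simp
  qed
next
  case (3 r J)
  then obtain a b where x: "x = a + l (- int (Suc J)) b" "a \<in> Dt (Suc r) J" "b \<in> Dt r (Suc J)"
    unfolding Dt.simps(3)[of r J] by blast
  have bU: "b \<in> U" and bF: "b \<in> FF r" using x Dt_U Dt_FF by blast+
  have "i n a \<in> FF (Suc r - 2)" using 3 x by simp
  moreover have "l (- int (Suc J)) (i n b) \<in> FF (r - 1)"
    using 3(2)[OF x(3) 3(4)] by (rule l_FF_pred)
  moreover have "i (n - int (Suc J)) b \<in> FF (r - 1)" using i_lowers[OF bF] 3(4) by simp
  moreover have "n \<noteq> int (Suc J)" using 3(4) by simp
  moreover have e: "- int (Suc J) + n = n - int (Suc J)" by simp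
  ultimately show ?case
    using il[OF bU, of n "- int (Suc J)", unfolded e] by (auto simp: x(1) i_simps intro!: FF_simps)
qed

text \<open>
  The commutator that is left when \<open>I\<^bsub>k+j\<^esub>\<close> meets \<open>L\<^bsub>-j\<^esub>\<close>; it plays the role of \<open>q'\<close> for the
  filtration \<open>FF\<close>.
\<close>
definition q :: "nat \<Rightarrow> ('x \<Rightarrow>\<^sub>0 complex) \<Rightarrow> ('x \<Rightarrow>\<^sub>0 complex)" where
  "q j x = scale (of_nat (k + j)) (i (int k) x)
     + scale (if k = 0 then (of_nat j ^ 2 - of_nat j) * c2 else 0) x"

lemma i_l_commute: "x \<in> U \<Longrightarrow> i (int k + int j) (l (- int j) x) = l (- int j) (i (int k + int j) x) - q j x"
  by (auto simp: il q_def algebra_simps power2_eq_square)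

lemma i_q: "x \<in> U \<Longrightarrow> i n (q j x) = q j (i n x)"
  by (simp add: q_def i_simps ii[of x n "int k"])

lemma q_FF_imp:
  assumes "x \<in> U" "q (Suc j) x \<in> FF s" "k \<noteq> 0 \<Longrightarrow> i (int k) x \<in> FF s \<Longrightarrow> x \<in> FF s"
  shows "x \<in> FF s"
proof (cases "k = 0")
  case False
  then have eq: "i (int k) x = scale (inverse (of_nat (k + Suc j))) (q (Suc j) x)"
    by (simp add: q_def del: of_nat_Suc of_nat_add)
  have "i (int k) x \<in> FF s" unfolding eq by (rule pm.subspace_scale[OF sub_FF assms(2)])
  then show ?thesis using assms False by blast
next
  case True
  let ?c = "of_int (int (Suc j)) * (c0 + (of_int (int (Suc j)) - 1) * c2)"
  have "i (int k) x = scale c0 x" using True i0[OF assms(1)] by simp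
  then have *: "q (Suc j) x = scale ?c x"
    unfolding q_def if_P[OF True] using True
    by (simp add: algebra_simps power2_eq_square flip: pm.scale_left_distrib)
  have "?c \<noteq> 0"
  proof -
    have "int (Suc j) \<noteq> 0" by simp
    then show ?thesis using nonzero_0[OF True, of "int (Suc j)"] of_int_eq_0_iff[of "int (Suc j)"] mult_eq_0_iff by blast
  qed
  then have "inverse ?c * ?c = 1" by (rule left_inverse)
  then have eq: "x = scale (inverse ?c) (q (Suc j) x)" unfolding * pm.scale_scale by (simp only: pm.scale_one)
  show ?thesis by (subst eq) (rule pm.subspace_scale[OF sub_FF assms(2)])
qed

text \<open>
  \<open>I\<^sub>k\<close> is injective on the graded pieces of the filtration \<open>FF\<close>.
\<close>
definition Q :: "nat \<Rightarrow> bool" where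
  "Q s \<longleftrightarrow> (\<forall>x\<in>FF s. k \<noteq> 0 \<longrightarrow> i (int k) x \<in> FF (s - 1) \<longrightarrow> x \<in> FF (s - 1))"

text \<open>
  The analogue of \<open>triangular_E\<close> modulo \<open>FF (s - 1)\<close>: applying \<open>I\<^bsub>k+j\<^esub>\<close> reproduces the hypothesis one
  degree lower with \<open>t\<close> increased.
\<close>
lemma triangular_FF:
  assumes "\<And>s'. s' \<le> s \<Longrightarrow> Q s'" "x \<in> FF s"
    and "scale (of_nat (Suc t)) (q (Suc j) x) - l (- int (Suc j)) (i (int k + int (Suc j)) x) \<in> FF (s - 1)"
  shows "x \<in> FF (s - 1)"
  using assms
proof (induction s arbitrary: x t)
  case 0
  then show ?case by simp
next
  case (Suc s)
  let ?I = "i (int k + int (Suc j))" and ?L = "l (- int (Suc j))"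
  let ?u = "?I x"
  have xU: "x \<in> U" using Suc.prems FF_U by blast
  have u: "?u \<in> FF s" using i_lowers[OF Suc.prems(2), of "int k + int (Suc j)"] by simp
  have uU: "?u \<in> U" using u FF_U by blast
  have "?I (scale (of_nat (Suc t)) (q (Suc j) x) - ?L ?u) \<in> FF (s - 1)"
    using i_lowers[OF Suc.prems(3), of "int k + int (Suc j)"] by simp
  also have "?I (scale (of_nat (Suc t)) (q (Suc j) x) - ?L ?u) =
      scale (of_nat (Suc t)) (q (Suc j) ?u) - (?L (?I ?u) - q (Suc j) ?u)"
    unfolding i_simps i_q[OF xU] i_l_commute[OF uU] ..
  also have "\<dots> = scale (of_nat (Suc (Suc t))) (q (Suc j) ?u) - ?L (?I ?u)"
    unfolding of_nat_Suc[of "Suc t"] pm.scale_left_distrib by simp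
  finally have "?u \<in> FF (s - 1)"
    by (intro Suc.IH[where x = ?u and t = "Suc t"] u) (use Suc.prems(1) in auto)
  then have "?L ?u \<in> FF s"
    using l_FF_pred[of ?u "Suc s" j] by simp
  moreover have "scale (of_nat (Suc t)) (q (Suc j) x) - ?L ?u \<in> FF s" using Suc.prems(3) by simp
  ultimately have "scale (of_nat (Suc t)) (q (Suc j) x) - ?L ?u + ?L ?u \<in> FF s"
    by (intro FF_simps(1))
  then have "scale (of_nat (Suc t)) (q (Suc j) x) \<in> FF s" by simp
  then have "scale (inverse (of_nat (Suc t))) (scale (of_nat (Suc t)) (q (Suc j) x)) \<in> FF s"
    by (rule pm.subspace_scale[OF sub_FF])
  then have "q (Suc j) x \<in> FF s" by (simp del: of_nat_Suc)
  then have "x \<in> FF s"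
    by (rule q_FF_imp[OF xU]) (use Suc.prems(1)[of "Suc s"] Suc.prems(2) in \<open>auto simp: Q_def\<close>)
  then show ?case by simp
qed

text \<open>
  An element that loses two degrees under all \<open>I\<^bsub>k+j\<^esub>\<close> has a vanishing leading part. The factors
  \<open>L\<^bsub>-J\<^esub>\<close> are removed for decreasing \<open>J\<close>: \<open>I\<^bsub>k+J\<^esub>\<close> loses two degrees on the terms with smaller indices,
  so only the coefficient \<open>b\<close> of \<open>L\<^bsub>-J\<^esub>\<close> is tested.
\<close>
lemma lowering_detects:
  assumes "\<And>s. s \<le> Suc r \<Longrightarrow> Q s" "x \<in> FF (Suc (Suc r))"
    and "\<And>j. i (int k + int (Suc j)) x \<in> FF r"
  shows "x \<in> FF (Suc r)"
proof -
  have "x \<in> FF (Suc r)" if "x \<in> Dt (Suc (Suc r)) J" "\<And>j. i (int k + int (Suc j)) x \<in> FF r" for x J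
    using that
  proof (induction J arbitrary: x)
    case 0
    then have "x \<in> D0 \<union> FF (Suc r)" by (simp add: FF_def Dt.simps(2))
    then show ?case using D0_FF by blast
  next
    case (Suc J)
    let ?I = "i (int k + int (Suc J))" and ?L = "l (- int (Suc J))"
    obtain a b where x: "x = a + ?L b" "a \<in> Dt (Suc (Suc r)) J" "b \<in> Dt (Suc r) (Suc J)"
      using Suc.prems(1) unfolding Dt.simps(3)[of "Suc r" J] by blast
    have bU: "b \<in> U" and bF: "b \<in> FF (Suc r)" using x Dt_U Dt_FF by blast+
    have "?I a \<in> FF r" using i_lowers_twice[OF x(2), of "int k + int (Suc J)"] by simp
    then have "?I a - ?I x \<in> FF r" using Suc.prems(2) FF_simps by blast
    also have "?I a - ?I x = scale (of_nat (Suc 0)) (q (Suc J) b) - ?L (?I b)"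
      unfolding x(1) i_simps i_l_commute[OF bU] by simp
    finally have "b \<in> FF r"
      using triangular_FF[of "Suc r" b 0 J] assms(1) bF by simp
    then have lb: "?L b \<in> FF (Suc r)" by (rule l_FF)
    have "a \<in> FF (Suc r)"
    proof (rule Suc.IH[OF x(2)])
      fix j
      have "i (int k + int (Suc j)) (?L b) \<in> FF r" using i_lowers[OF lb, of "int k + int (Suc j)"] by simp
      moreover have "i (int k + int (Suc j)) a = i (int k + int (Suc j)) x - i (int k + int (Suc j)) (?L b)"
        unfolding x(1) i_simps by simp
      ultimately show "i (int k + int (Suc j)) a \<in> FF r" using Suc.prems(2)[of j] FF_simps(4) by metis
    qed
    then show ?case unfolding x(1) using lb by (rule FF_simps)
  qed
  then show ?thesis using assms(2,3) unfolding FF_def by blast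
qed

text \<open>
  If \<open>I\<^sub>k x\<close> has smaller degree than expected, then so has \<open>I\<^sub>k I\<^bsub>k+j\<^esub> x\<close>, and by induction \<open>I\<^bsub>k+j\<^esub> x\<close>; now
  \<open>lowering_detects\<close> applies to \<open>x\<close>.
\<close>
lemma Q_all: "Q s"
proof (induction s rule: less_induct)
  case (less s)
  consider "s = 0" | "s = Suc 0" | r where "s = Suc (Suc r)" by (metis not0_implies_Suc)
  then show ?case
  proof cases
    case 1
    then show ?thesis by (simp add: Q_def)
  next
    case 2
    then show ?thesis using inj_k_D0 by (auto simp: Q_def FF_Suc_0 FF_0)
  next
    case 3
    show ?thesis
      unfolding Q_def
    proof (intro ballI impI)
      fix x assume x: "x \<in> FF s" and k: "k \<noteq> 0" and ix: "i (int k) x \<in> FF (s - 1)"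
      have xU: "x \<in> U" using x FF_U by blast
      have "x \<in> FF (Suc r)"
      proof (rule lowering_detects)
        show "x \<in> FF (Suc (Suc r))" using x 3 by simp
        show "Q s'" if "s' \<le> Suc r" for s' using less that 3 by simp
        fix j
        let ?I = "i (int k + int (Suc j))"
        have "?I (i (int k) x) \<in> FF r"
          using i_lowers[OF ix, of "int k + int (Suc j)"] 3 by simp
        then have "i (int k) (?I x) \<in> FF r" using ii[OF xU] by metis
        moreover have "?I x \<in> FF (Suc r)"
          using i_lowers[OF x, of "int k + int (Suc j)"] 3 by simp
        moreover have "Q (Suc r)" using less 3 by simp
        ultimately show "?I x \<in> FF r" using k unfolding Q_def by auto
      qed
      then show "x \<in> FF (s - 1)" using 3 by simp
    qed
  qed
qed

text \<open>
  If \<open>N\<close> misses \<open>M0\<close>, it misses \<open>D0\<close>; and if it misses \<open>FF r\<close> and \<open>FF (r + 1)\<close>, then on an element of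
  \<open>FF (r + 2)\<close> in \<open>N\<close> all \<open>I\<^bsub>k+j\<^esub>\<close> give elements of \<open>FF (r + 1)\<close> in \<open>N\<close>, which are \<open>0\<close>, so that the element has smaller degree.
\<close>
theorem invariant_subspace_meets_M0:
  assumes N: "pm.subspace N" "N \<subseteq> U" "\<And>n x. x \<in> N \<Longrightarrow> l n x \<in> N" "\<And>n x. x \<in> N \<Longrightarrow> i n x \<in> N"
    and x: "x \<in> N" "x \<noteq> 0"
  shows "\<exists>v\<in>N \<inter> M0. v \<noteq> 0"
proof (rule ccontr)
  assume "\<not> ?thesis"
  then have M: "N \<inter> M0 \<subseteq> {0}" by blast
  have "N \<inter> E J C \<subseteq> {0}" for J C
    by (rule M0_meets_E[OF N(1) _ M]) (use N in \<open>auto simp: z_def\<close>)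
  then have D: "N \<inter> D0 \<subseteq> {0}" unfolding D0_def by blast
  have "N \<inter> FF r \<subseteq> {0} \<and> N \<inter> FF (Suc r) \<subseteq> {0}" for r
  proof (induction r)
    case 0
    then show ?case using D by (simp add: FF_0 FF_Suc_0)
  next
    case (Suc r)
    have "w \<in> {0}" if w: "w \<in> N" "w \<in> FF (Suc (Suc r))" for w
    proof -
      have "i (int k + int (Suc j)) w \<in> N \<inter> FF (Suc r)" for j
        using i_lowers[OF w(2), of "int k + int (Suc j)"] N(4) w by simp
      then have "i (int k + int (Suc j)) w \<in> FF r" for j
        using Suc.IH FF_simps(3) by (metis singletonD subsetD)
      then have "w \<in> FF (Suc r)" by (rule lowering_detects[OF Q_all w(2)])
      then show ?thesis using Suc.IH w by blast
    qed
    then show ?case using Suc.IH by blast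
  qed
  then show False using x N(2) U_eq by blast
qed

text \<open>
  The vectors killed by all late operators contain \<open>M0\<close> and are stable under the action, because a
  commutator with \<open>L\<^sub>n\<close> or \<open>I\<^sub>n\<close> for large \<open>n\<close> is again late and has no central term.
\<close>
lemma locally_killed:
  assumes "x \<in> U"
  shows "\<exists>n0. \<forall>n\<ge>n0. l n x = 0 \<and> i n x = 0"
proof -
  let ?Z = "{x \<in> U. \<exists>n0. \<forall>n\<ge>n0. l n x = 0 \<and> i n x = 0}"
  have "U \<subseteq> ?Z"
  proof (rule generated)
    show "pm.subspace ?Z"
    proof (rule pm.subspaceI)
      show "0 \<in> ?Z" by (simp add: U_simps l_simps i_simps)
      fix x y c assume "x \<in> ?Z"
      then obtain n0 where x: "x \<in> U" "\<And>n. n \<ge> n0 \<Longrightarrow> l n x = 0 \<and> i n x = 0" by blast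
      then show "scale c x \<in> ?Z" by (auto simp: U_simps l_simps i_simps)
      assume "y \<in> ?Z"
      then obtain n1 where y: "y \<in> U" "\<And>n. n \<ge> n1 \<Longrightarrow> l n y = 0 \<and> i n y = 0" by blast
      show "x + y \<in> ?Z"
        using x y by (auto simp: U_simps l_simps i_simps intro!: exI[of _ "max n0 n1"])
    qed
    show "M0 \<subseteq> ?Z"
      using M0_U l_kills i_kills by (auto intro!: exI[of _ "int k + int e + 1"])
    fix m x assume "x \<in> ?Z"
    then obtain n0 where x: "x \<in> U" "\<And>n. n \<ge> n0 \<Longrightarrow> l n x = 0 \<and> i n x = 0" by blast
    let ?n = "max (max n0 (n0 - m)) (\<bar>m\<bar> + 1)"
    have "l n (l m x) = 0 \<and> i n (l m x) = 0 \<and> l n (i m x) = 0 \<and> i n (i m x) = 0" if n: "n \<ge> ?n" for n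
    proof -
      have "l n x = 0" "i n x = 0" "l (n + m) x = 0" "i (n + m) x = 0" "i (m + n) x = 0"
        using n x(2)[of n] x(2)[of "n + m"] by (auto simp: add.commute)
      moreover have "n + m \<noteq> 0" "m + n \<noteq> 0" using n by auto
      ultimately show ?thesis
        by (simp add: ll[OF x(1), of n m] il[OF x(1), of n m] li[OF x(1), of n m] ii[OF x(1), of n m]
            l_simps i_simps)
    qed
    then have "\<forall>n\<ge>?n. l n (l m x) = 0 \<and> i n (l m x) = 0" "\<forall>n\<ge>?n. l n (i m x) = 0 \<and> i n (i m x) = 0"
      by simp_all
    then show "l m x \<in> ?Z" "i m x \<in> ?Z" using l_U[OF x(1)] i_U[OF x(1)] by (auto simp del: max.bounded_iff)
  qed
  then show ?thesis using assms by blast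
qed

end

section \<open>Free algebras and enveloping algebras\<close>

abbreviation words :: "'x set \<Rightarrow> 'x word set" where "words X \<equiv> {w. set (letters w) \<subseteq> X}"

lemma carrier_free_algebra: "carrier (free_algebra X) = {p. Poly_Mapping.keys p \<subseteq> words X}"
  by (auto simp: free_algebra_def)

lemma free_algebra_simps [simp]:
  "mult (free_algebra X) = (*)" "one (free_algebra X) = 1" "zero (free_algebra X) = 0"
  "add (free_algebra X) = (+)" "smult (free_algebra X) = scale"
  by (simp_all add: free_algebra_def)

lemma mult_in_free_algebra:
  assumes "p \<in> carrier (free_algebra X)" "q \<in> carrier (free_algebra X)"
  shows "p * q \<in> carrier (free_algebra X)"
proof -
  have "Poly_Mapping.keys (p * q) \<subseteq> {a + b |a b. a \<in> Poly_Mapping.keys p \<and> b \<in> Poly_Mapping.keys q}"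
    by (rule keys_mult)
  also have "\<dots> \<subseteq> words X" using assms by (fastforce simp: carrier_free_algebra plus_word_def)
  finally show ?thesis by (simp add: carrier_free_algebra)
qed

lemma subspace_free_algebra: "pm.subspace (carrier (free_algebra X))"
  unfolding carrier_free_algebra by (rule subspace_keys)

lemma one_in_free_algebra: "1 \<in> carrier (free_algebra X)"
  by (simp add: carrier_free_algebra zero_word_def)

lemma ring_free_algebra: "ring (free_algebra X)"
proof (rule ringI)
  show "abelian_group (free_algebra X)"
  proof (rule abelian_groupI)
    fix p assume p: "p \<in> carrier (free_algebra X)"
    then show "\<exists>y\<in>carrier (free_algebra X). y \<oplus>\<^bsub>free_algebra X\<^esub> p = \<zero>\<^bsub>free_algebra X\<^esub>"
      using pm.subspace_neg[OF subspace_free_algebra p] by (intro bexI[of _ "- p"]) auto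
  qed (use pm.subspace_add[OF subspace_free_algebra] pm.subspace_0[OF subspace_free_algebra] in auto)
  show "Group.monoid (free_algebra X)"
    by (rule monoidI) (auto simp: mult_in_free_algebra mult.assoc one_in_free_algebra)
qed (auto simp: algebra_simps)

lemma a_inv_free_algebra: "p \<in> carrier (free_algebra X) \<Longrightarrow> \<ominus>\<^bsub>free_algebra X\<^esub> p = - p"
  using pm.subspace_neg[OF subspace_free_algebra]
  by (intro abelian_group.minus_equality) (auto intro: ring.is_abelian_group ring_free_algebra)

lemma ideal_free_algebraI:
  assumes "pm.subspace I" "I \<subseteq> carrier (free_algebra X)"
    and "\<And>p q. p \<in> I \<Longrightarrow> q \<in> carrier (free_algebra X) \<Longrightarrow> q * p \<in> I \<and> p * q \<in> I"
  shows "ideal I (free_algebra X)"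
proof (rule idealI[OF ring_free_algebra])
  show "subgroup I (add_monoid (free_algebra X))"
  proof
    fix p assume p: "p \<in> I"
    then have "inv\<^bsub>add_monoid (free_algebra X)\<^esub> p = - p"
      using a_inv_free_algebra[of p X] assms(2) unfolding a_inv_def by blast
    then show "inv\<^bsub>add_monoid (free_algebra X)\<^esub> p \<in> I" using pm.subspace_neg[OF assms(1) p] by simp
  next
    show "\<one>\<^bsub>add_monoid (free_algebra X)\<^esub> \<in> I" by (simp add: pm.subspace_0[OF assms(1)])
  qed (use assms(2) pm.subspace_add[OF assms(1)] in auto)
qed (use assms in auto)

lemma const_in_free_algebra: "Poly_Mapping.single 0 c \<in> carrier (free_algebra X)"
  by (auto simp: carrier_free_algebra zero_word_def)

lemma subspace_of_ideal:
  assumes "ideal I (free_algebra X)"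
  shows "pm.subspace I"
proof -
  interpret ideal I "free_algebra X" by fact
  show ?thesis
  proof (rule pm.subspaceI)
    show "0 \<in> I" using additive_subgroup.zero_closed[OF is_additive_subgroup] by simp
    show "p + q \<in> I" if "p \<in> I" "q \<in> I" for p q using additive_subgroup.a_closed[OF is_additive_subgroup that] by simp
    show "scale c p \<in> I" if "p \<in> I" for c p
      using I_l_closed[OF that const_in_free_algebra[of c X]] by (simp add: scale_eq_mult)
  qed
qed

lemma a_r_coset_free_algebra: "a_r_coset (free_algebra X) I p = coset_of I p"
  by (auto simp: a_r_coset_def' coset_of_def intro!: bexI[of _ "_ - p"])

lemma letter_in_free_algebra: "x \<in> X \<Longrightarrow> letter x \<in> carrier (free_algebra X)"
  by (simp add: carrier_free_algebra)

definition lie_closed :: "'g lie_alg \<Rightarrow> bool" where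
  "lie_closed g \<longleftrightarrow> (\<forall>x\<in>carrier g. \<forall>y\<in>carrier g. x \<oplus>\<^bsub>g\<^esub> y \<in> carrier g \<and> bracket g x y \<in> carrier g) \<and>
     (\<forall>c. \<forall>x\<in>carrier g. c \<odot>\<^bsub>g\<^esub> x \<in> carrier g)"

definition env_rels :: "'g lie_alg \<Rightarrow> ('g word \<Rightarrow>\<^sub>0 complex) set" where
  "env_rels g = {letter (x \<oplus>\<^bsub>g\<^esub> y) - letter x - letter y | x y. x \<in> carrier g \<and> y \<in> carrier g} \<union>
      {letter (c \<odot>\<^bsub>g\<^esub> x) - scale c (letter x) | c x. x \<in> carrier g} \<union>
      {letter x * letter y - letter y * letter x - letter (bracket g x y) | x y.
         x \<in> carrier g \<and> y \<in> carrier g}"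

lemma env_ideal_eq: "env_ideal g = genideal (free_algebra (carrier g)) (env_rels g)"
  by (simp add: env_ideal_def env_rels_def)

text \<open>
  The enveloping algebra as the quotient of the free algebra \<open>T\<close> by the ideal \<open>I\<close>, with class map \<open>\<kappa>\<close>.
\<close>
locale envelope =
  fixes g :: "'g lie_alg"
  assumes closed: "lie_closed g"
begin

abbreviation "T \<equiv> free_algebra (carrier g)"
abbreviation "I \<equiv> env_ideal g"
abbreviation "\<kappa> \<equiv> coset_of I"

lemma letter_T: "x \<in> carrier g \<Longrightarrow> letter x \<in> carrier T"
  by (rule letter_in_free_algebra)

lemmas T_simps = pm.subspace_add[OF subspace_free_algebra[of "carrier g"]]
  pm.subspace_diff[OF subspace_free_algebra[of "carrier g"]]
  pm.subspace_scale[OF subspace_free_algebra[of "carrier g"]]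
  pm.subspace_0[OF subspace_free_algebra[of "carrier g"]]
  mult_in_free_algebra[of _ "carrier g"] letter_T

lemma env_rels_T: "env_rels g \<subseteq> carrier T"
  using closed unfolding env_rels_def lie_closed_def by (auto intro!: T_simps)

lemma ideal_I: "ideal I T"
  unfolding env_ideal_eq by (rule ring.genideal_ideal[OF ring_free_algebra env_rels_T])

lemma subspace_I: "pm.subspace I"
  by (rule subspace_of_ideal[OF ideal_I])

lemma env_rels_I: "r \<in> env_rels g \<Longrightarrow> r \<in> I"
  using ring.genideal_self[OF ring_free_algebra env_rels_T] unfolding env_ideal_eq by blast

lemma I_minimal: "ideal J T \<Longrightarrow> env_rels g \<subseteq> J \<Longrightarrow> I \<subseteq> J"
  unfolding env_ideal_eq by (rule ring.genideal_minimal[OF ring_free_algebra])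

lemma I_sub_T: "I \<subseteq> carrier T"
  using ideal.Icarr[OF ideal_I] by blast

lemma I_mult: "p \<in> I \<Longrightarrow> q \<in> carrier T \<Longrightarrow> q * p \<in> I" "p \<in> I \<Longrightarrow> q \<in> carrier T \<Longrightarrow> p * q \<in> I"
  using ideal.I_l_closed[OF ideal_I, of p q] ideal.I_r_closed[OF ideal_I, of p q] by simp_all

lemma \<kappa>_eq_iff: "\<kappa> p = \<kappa> q \<longleftrightarrow> p - q \<in> I"
  by (rule coset_of_eq_iff[OF subspace_I])

lemma env_eqs:
  "carrier (env g) = a_rcosets\<^bsub>T\<^esub> I" "mult (env g) = rcoset_mult T I" "one (env g) = I +>\<^bsub>T\<^esub> \<one>\<^bsub>T\<^esub>"
  "zero (env g) = I" "add (env g) = set_add T" "smult (env g) = (\<lambda>c A. I <+>\<^bsub>T\<^esub> (scale c ` A))"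
  by (simp_all add: env_def Let_def ring.extend_def module.fields_def FactRing_def)

lemma carrier_env: "carrier (env g) = \<kappa> ` carrier T"
  unfolding env_eqs A_RCOSETS_def' a_r_coset_free_algebra by blast

lemma mult_env: "p \<in> carrier T \<Longrightarrow> q \<in> carrier T \<Longrightarrow> \<kappa> p \<otimes>\<^bsub>env g\<^esub> \<kappa> q = \<kappa> (p * q)"
  using ideal.rcoset_mult_add[OF ideal_I, of p q]
  unfolding env_eqs a_r_coset_free_algebra by simp

lemma set_add_T: "set_add T A B = {n + q |n q. n \<in> A \<and> q \<in> B}"
  unfolding set_add_def' free_algebra_simps by blast

lemma smult_env: "c \<odot>\<^bsub>env g\<^esub> \<kappa> p = \<kappa> (scale c p)"
  unfolding env_eqs set_add_T
  by (rule coset_add_image[OF subspace_I]) (simp_all add: pm.subspace_scale[OF subspace_I] pm.linear_scale_self)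

lemma add_env: "\<kappa> p \<oplus>\<^bsub>env g\<^esub> \<kappa> q = \<kappa> (p + q)"
proof -
  have "{n + q' |n q'. n \<in> \<kappa> p \<and> q' \<in> \<kappa> q} = \<kappa> (p + q)"
  proof (rule Set.set_eqI, rule iffI)
    fix y assume "y \<in> {n + q' |n q'. n \<in> \<kappa> p \<and> q' \<in> \<kappa> q}"
    then obtain a b where y: "y = a + b" "a - p \<in> I" "b - q \<in> I" by (auto simp: coset_of_def)
    from pm.subspace_add[OF subspace_I y(2,3)] show "y \<in> \<kappa> (p + q)"
      by (simp add: coset_of_def y(1) algebra_simps)
  next
    fix y assume "y \<in> \<kappa> (p + q)"
    then have "y - q \<in> \<kappa> p" by (simp add: coset_of_def algebra_simps)
    moreover have "q \<in> \<kappa> q" by (rule self_in_coset[OF subspace_I])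
    ultimately show "y \<in> {n + q' |n q'. n \<in> \<kappa> p \<and> q' \<in> \<kappa> q}"
      by (metis (mono_tags, lifting) diff_add_cancel mem_Collect_eq)
  qed
  then show ?thesis unfolding env_eqs set_add_T .
qed

lemma env_of_eq: "env_of g x = \<kappa> (letter x)"
  by (simp add: env_of_def a_r_coset_free_algebra)

lemma env_incl_eq:
  assumes "J \<subseteq> I" "pm.subspace J"
  shows "env_incl g (coset_of J p) = \<kappa> p"
  unfolding env_incl_def set_add_T
proof (rule Set.set_eqI, rule iffI)
  fix y assume "y \<in> {n + q |n q. n \<in> I \<and> q \<in> coset_of J p}"
  then obtain a b where y: "y = a + b" "a \<in> I" "b - p \<in> I" using assms(1) by (auto simp: coset_of_def)
  from pm.subspace_add[OF subspace_I y(2,3)] show "y \<in> \<kappa> p"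
    by (simp add: coset_of_def y(1) algebra_simps)
next
  fix y assume "y \<in> \<kappa> p"
  then have "y - p \<in> I" by (simp add: coset_of_def)
  moreover have "p \<in> coset_of J p" by (rule self_in_coset[OF assms(2)])
  ultimately show "y \<in> {n + q |n q. n \<in> I \<and> q \<in> coset_of J p}"
    by (metis (mono_tags, lifting) diff_add_cancel mem_Collect_eq)
qed

end

section \<open>Modules over a Lie algebra and its enveloping algebra\<close>

lemma pm_induct [consumes 1, case_names zero step]:
  assumes "Poly_Mapping.keys p \<subseteq> X" "P 0"
    and "\<And>c x p. x \<in> X \<Longrightarrow> Poly_Mapping.keys p \<subseteq> X \<Longrightarrow> P p \<Longrightarrow> P (scale c (gen x) + p)"
  shows "P p"
proof -
  have "Poly_Mapping.keys p \<subseteq> X \<and> P p"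
    using in_span_gens[OF assms(1)]
  proof (induction rule: pm.span_induct_alt)
    case base
    then show ?case using assms(2) by simp
  next
    case (step c x y)
    then obtain x' where x: "x = gen x'" "x' \<in> X" by auto
    have "scale c x + y \<in> {p. Poly_Mapping.keys p \<subseteq> X}"
      using pm.subspace_add[OF subspace_keys[of X]] pm.subspace_scale[OF subspace_keys[of X]] x step by auto
    then show ?case using assms(3)[OF x(2)] step x by simp
  qed
  then show ?thesis by blast
qed

locale lie_module =
  fixes h :: "'g lie_alg" and V :: "('g, 'v) lie_mod"
  assumes lie_module: "is_lie_module h V"
begin

sublocale V: module complex_field V
  using lie_module by (simp add: is_lie_module_def)

lemma act_closed: "x \<in> carrier h \<Longrightarrow> v \<in> carrier V \<Longrightarrow> act V x v \<in> carrier V"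
  and act_add: "x \<in> carrier h \<Longrightarrow> v \<in> carrier V \<Longrightarrow> w \<in> carrier V \<Longrightarrow>
      act V x (v \<oplus>\<^bsub>V\<^esub> w) = act V x v \<oplus>\<^bsub>V\<^esub> act V x w"
  and act_smult: "x \<in> carrier h \<Longrightarrow> v \<in> carrier V \<Longrightarrow> act V x (c \<odot>\<^bsub>V\<^esub> v) = c \<odot>\<^bsub>V\<^esub> act V x v"
  and add_act: "x \<in> carrier h \<Longrightarrow> y \<in> carrier h \<Longrightarrow> v \<in> carrier V \<Longrightarrow>
      act V (x \<oplus>\<^bsub>h\<^esub> y) v = act V x v \<oplus>\<^bsub>V\<^esub> act V y v"
  and smult_act: "x \<in> carrier h \<Longrightarrow> v \<in> carrier V \<Longrightarrow> act V (c \<odot>\<^bsub>h\<^esub> x) v = c \<odot>\<^bsub>V\<^esub> act V x v"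
  and bracket_act: "x \<in> carrier h \<Longrightarrow> y \<in> carrier h \<Longrightarrow> v \<in> carrier V \<Longrightarrow>
      act V (bracket h x y) v = act V x (act V y v) \<ominus>\<^bsub>V\<^esub> act V y (act V x v)"
  using lie_module by (simp_all add: is_lie_module_def)

lemma smult_simps [simp]:
  "v \<in> carrier V \<Longrightarrow> c \<odot>\<^bsub>V\<^esub> v \<in> carrier V" "v \<in> carrier V \<Longrightarrow> 0 \<odot>\<^bsub>V\<^esub> v = \<zero>\<^bsub>V\<^esub>"
  "v \<in> carrier V \<Longrightarrow> 1 \<odot>\<^bsub>V\<^esub> v = v" "c \<odot>\<^bsub>V\<^esub> \<zero>\<^bsub>V\<^esub> = \<zero>\<^bsub>V\<^esub>"
  using V.smult_closed[of c v] V.smult_l_null[of v] V.smult_one[of v] V.smult_r_null[of c] by simp_all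

lemma smult_minus_1: "v \<in> carrier V \<Longrightarrow> (-1) \<odot>\<^bsub>V\<^esub> v = \<ominus>\<^bsub>V\<^esub> v"
proof -
  assume v: "v \<in> carrier V"
  have "\<ominus>\<^bsub>complex_field\<^esub> (1 :: complex) = -1"
    by (rule abelian_group.minus_equality)
       (auto intro: ring.is_abelian_group cring.axioms cring_complex_field)
  then show ?thesis using V.smult_l_minus[of 1 v] v by simp
qed

lemma smult_add_left: "v \<in> carrier V \<Longrightarrow> (a + b) \<odot>\<^bsub>V\<^esub> v = a \<odot>\<^bsub>V\<^esub> v \<oplus>\<^bsub>V\<^esub> b \<odot>\<^bsub>V\<^esub> v"
  using V.smult_l_distr[of a b v] by simp

lemma smult_add_right: "v \<in> carrier V \<Longrightarrow> w \<in> carrier V \<Longrightarrow> c \<odot>\<^bsub>V\<^esub> (v \<oplus>\<^bsub>V\<^esub> w) = c \<odot>\<^bsub>V\<^esub> v \<oplus>\<^bsub>V\<^esub> c \<odot>\<^bsub>V\<^esub> w"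
  using V.smult_r_distr[of c v w] by simp

lemma smult_smult: "v \<in> carrier V \<Longrightarrow> a \<odot>\<^bsub>V\<^esub> (b \<odot>\<^bsub>V\<^esub> v) = (a * b) \<odot>\<^bsub>V\<^esub> v"
  using V.smult_assoc1[of a b v] by simp

lemma act_zero: "x \<in> carrier h \<Longrightarrow> act V x \<zero>\<^bsub>V\<^esub> = \<zero>\<^bsub>V\<^esub>"
  using act_smult[of x "\<zero>\<^bsub>V\<^esub>" 0] act_closed by simp

text \<open>
  The map out of the free space that is given on generators by \<open>t\<close>, for values in a carrier set.
\<close>
definition lincomb :: "('a \<Rightarrow>\<^sub>0 complex) \<Rightarrow> ('a \<Rightarrow> 'v) \<Rightarrow> 'v" where
  "lincomb p t = (\<Oplus>\<^bsub>V\<^esub>w\<in>Poly_Mapping.keys p. Poly_Mapping.lookup p w \<odot>\<^bsub>V\<^esub> t w)"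

lemma lincomb_superset:
  assumes "finite S" "Poly_Mapping.keys p \<subseteq> S" "\<And>w. w \<in> S \<Longrightarrow> t w \<in> carrier V"
  shows "lincomb p t = (\<Oplus>\<^bsub>V\<^esub>w\<in>S. Poly_Mapping.lookup p w \<odot>\<^bsub>V\<^esub> t w)"
  unfolding lincomb_def
  by (rule V.add.finprod_mono_neutral_cong_left) (use assms in \<open>auto simp: in_keys_iff\<close>)

lemma lincomb_closed: "(\<And>w. w \<in> Poly_Mapping.keys p \<Longrightarrow> t w \<in> carrier V) \<Longrightarrow> lincomb p t \<in> carrier V"
  unfolding lincomb_def by (rule V.finsum_closed) auto

lemma lincomb_0: "lincomb 0 t = \<zero>\<^bsub>V\<^esub>"
  by (simp add: lincomb_def)

lemma lincomb_gen: "t w \<in> carrier V \<Longrightarrow> lincomb (gen w) t = t w"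
  by (simp add: lincomb_def)

lemma lincomb_add:
  assumes "\<And>w. w \<in> Poly_Mapping.keys p \<union> Poly_Mapping.keys q \<Longrightarrow> t w \<in> carrier V"
  shows "lincomb (p + q) t = lincomb p t \<oplus>\<^bsub>V\<^esub> lincomb q t"
proof -
  let ?S = "Poly_Mapping.keys p \<union> Poly_Mapping.keys q"
  have "lincomb (p + q) t = (\<Oplus>\<^bsub>V\<^esub>w\<in>?S. Poly_Mapping.lookup (p + q) w \<odot>\<^bsub>V\<^esub> t w)"
    by (rule lincomb_superset) (use assms Poly_Mapping.keys_add[of p q] in auto)
  also have "\<dots> = (\<Oplus>\<^bsub>V\<^esub>w\<in>?S. Poly_Mapping.lookup p w \<odot>\<^bsub>V\<^esub> t w \<oplus>\<^bsub>V\<^esub> Poly_Mapping.lookup q w \<odot>\<^bsub>V\<^esub> t w)"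
    by (rule V.finsum_cong') (use assms in \<open>auto simp: lookup_add smult_add_left\<close>)
  also have "\<dots> = (\<Oplus>\<^bsub>V\<^esub>w\<in>?S. Poly_Mapping.lookup p w \<odot>\<^bsub>V\<^esub> t w) \<oplus>\<^bsub>V\<^esub> (\<Oplus>\<^bsub>V\<^esub>w\<in>?S. Poly_Mapping.lookup q w \<odot>\<^bsub>V\<^esub> t w)"
    by (rule V.finsum_addf) (use assms in auto)
  also have "\<dots> = lincomb p t \<oplus>\<^bsub>V\<^esub> lincomb q t"
    using lincomb_superset[of ?S p t] lincomb_superset[of ?S q t] assms by simp
  finally show ?thesis .
qed

lemma lincomb_scale:
  assumes "\<And>w. w \<in> Poly_Mapping.keys p \<Longrightarrow> t w \<in> carrier V"
  shows "lincomb (scale c p) t = c \<odot>\<^bsub>V\<^esub> lincomb p t"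
proof -
  have "lincomb (scale c p) t = (\<Oplus>\<^bsub>V\<^esub>w\<in>Poly_Mapping.keys p. Poly_Mapping.lookup (scale c p) w \<odot>\<^bsub>V\<^esub> t w)"
    by (rule lincomb_superset) (use assms keys_scale[of c p] in auto)
  also have "\<dots> = (\<Oplus>\<^bsub>V\<^esub>w\<in>Poly_Mapping.keys p. c \<odot>\<^bsub>V\<^esub> (Poly_Mapping.lookup p w \<odot>\<^bsub>V\<^esub> t w))"
    by (rule V.finsum_cong') (use assms in \<open>auto simp: smult_smult\<close>)
  also have "\<dots> = c \<odot>\<^bsub>V\<^esub> lincomb p t"
  proof -
    have "(\<Oplus>\<^bsub>V\<^esub>w\<in>F. c \<odot>\<^bsub>V\<^esub> s w) = c \<odot>\<^bsub>V\<^esub> (\<Oplus>\<^bsub>V\<^esub>w\<in>F. s w)"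
      if "finite F" "\<And>w. w \<in> F \<Longrightarrow> s w \<in> carrier V" for s and F :: "'a set"
      using that
    proof (induction F)
      case (insert x F)
      have 1: "s \<in> F \<rightarrow> carrier V" "(\<lambda>w. c \<odot>\<^bsub>V\<^esub> s w) \<in> F \<rightarrow> carrier V" using insert by auto
      show ?case using insert 1 by (simp add: smult_add_right V.finsum_insert)
    qed simp
    then show ?thesis unfolding lincomb_def using assms by simp
  qed
  finally show ?thesis .
qed

text \<open>
  \<open>V\<close> is the quotient of the free space on its carrier by the kernel \<open>?K\<close> of evaluation, so a functional that separates
  \<open>v0\<close> from \<open>?K\<close> descends to \<open>V\<close>.
\<close>
lemma functional_exists:
  assumes "v0 \<in> carrier V" "v0 \<noteq> \<zero>\<^bsub>V\<^esub>"
  shows "\<exists>\<xi> :: 'v \<Rightarrow> complex. (\<forall>v\<in>carrier V. \<forall>w\<in>carrier V. \<xi> (v \<oplus>\<^bsub>V\<^esub> w) = \<xi> v + \<xi> w) \<and>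
     (\<forall>c. \<forall>v\<in>carrier V. \<xi> (c \<odot>\<^bsub>V\<^esub> v) = c * \<xi> v) \<and> \<xi> v0 \<noteq> 0"
proof -
  let ?K = "{p. Poly_Mapping.keys p \<subseteq> carrier V \<and> lincomb p (\<lambda>v. v) = \<zero>\<^bsub>V\<^esub>}"
  note add = pm.subspace_add[OF subspace_keys[of "carrier V"], simplified]
  note scl = pm.subspace_scale[OF subspace_keys[of "carrier V"], simplified]
  have ladd: "lincomb (p + q) (\<lambda>v. v) = lincomb p (\<lambda>v. v) \<oplus>\<^bsub>V\<^esub> lincomb q (\<lambda>v. v)"
    if "Poly_Mapping.keys p \<subseteq> carrier V" "Poly_Mapping.keys q \<subseteq> carrier V" for p q
    by (rule lincomb_add) (use that in auto)
  have lscl: "lincomb (scale c p) (\<lambda>v. v) = c \<odot>\<^bsub>V\<^esub> lincomb p (\<lambda>v. v)"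
    if "Poly_Mapping.keys p \<subseteq> carrier V" for c p
    by (rule lincomb_scale) (use that in auto)
  have K: "pm.subspace ?K"
    by (rule pm.subspaceI) (auto simp: lincomb_0 ladd lscl dest: add scl)
  have lgen: "lincomb (gen v) (\<lambda>v. v) = v" if "v \<in> carrier V" for v
    by (rule lincomb_gen) (rule that)
  have "gen v0 \<notin> ?K" using assms by (simp add: lgen)
  then obtain \<phi> where \<phi>: "functional \<phi>" "\<And>q. q \<in> ?K \<Longrightarrow> \<phi> q = 0" "\<phi> (gen v0) \<noteq> 0"
    using functional_separates[OF K] by blast
  have gk: "Poly_Mapping.keys (gen v) \<subseteq> carrier V" if "v \<in> carrier V" for v :: 'v using that by simp
  have neg: "lincomb (scale (-1) p) (\<lambda>v. v) = \<ominus>\<^bsub>V\<^esub> lincomb p (\<lambda>v. v)"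
    if "Poly_Mapping.keys p \<subseteq> carrier V" for p
    using lscl[OF that, of "-1"] smult_minus_1 lincomb_closed[of p "\<lambda>v. v"] that by auto
  have "\<phi> (gen (v \<oplus>\<^bsub>V\<^esub> w)) = \<phi> (gen v) + \<phi> (gen w)" if "v \<in> carrier V" "w \<in> carrier V" for v w
  proof -
    let ?p = "gen (v \<oplus>\<^bsub>V\<^esub> w) + scale (-1) (gen v + gen w)"
    have k: "Poly_Mapping.keys (gen v + gen w) \<subseteq> carrier V" using add gk that by blast
    have "lincomb ?p (\<lambda>v. v) = (v \<oplus>\<^bsub>V\<^esub> w) \<oplus>\<^bsub>V\<^esub> (\<ominus>\<^bsub>V\<^esub> (v \<oplus>\<^bsub>V\<^esub> w))"
      using that by (simp only: ladd gk scl k neg lgen V.a_closed)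
    moreover have "Poly_Mapping.keys ?p \<subseteq> carrier V" using that by (intro add gk scl k) auto
    ultimately have "?p \<in> ?K" using that by (simp only: mem_Collect_eq V.r_neg V.a_closed smult_simps simp_thms)
    then have "\<phi> ?p = 0" by (rule \<phi>(2))
    then show ?thesis
      unfolding pmc.linear_add[OF \<phi>(1)] pmc.linear_scale[OF \<phi>(1)] mult_minus1 by (metis add_eq_0_iff2 minus_minus)
  qed
  moreover have "\<phi> (gen (c \<odot>\<^bsub>V\<^esub> v)) = c * \<phi> (gen v)" if "v \<in> carrier V" for c v
  proof -
    let ?p = "gen (c \<odot>\<^bsub>V\<^esub> v) + scale (-1) (scale c (gen v))"
    have k: "Poly_Mapping.keys (scale c (gen v)) \<subseteq> carrier V" using scl gk that by blast
    have "lincomb ?p (\<lambda>v. v) = (c \<odot>\<^bsub>V\<^esub> v) \<oplus>\<^bsub>V\<^esub> (\<ominus>\<^bsub>V\<^esub> (c \<odot>\<^bsub>V\<^esub> v))"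
      using that by (simp only: ladd gk scl k neg lgen lscl smult_simps smult_minus_1)
    moreover have "Poly_Mapping.keys ?p \<subseteq> carrier V" using that by (intro add gk scl k) auto
    ultimately have "?p \<in> ?K" using that by (simp only: mem_Collect_eq V.r_neg V.a_closed smult_simps simp_thms)
    then have "\<phi> ?p = 0" by (rule \<phi>(2))
    then show ?thesis
      unfolding pmc.linear_add[OF \<phi>(1)] pmc.linear_scale[OF \<phi>(1)] mult_minus1 by (metis add_eq_0_iff2 minus_minus)
  qed
  ultimately show ?thesis using \<phi>(3) by (intro exI[of _ "\<lambda>v. \<phi> (gen v)"]) auto
qed

lemma foldr_closed: "set w \<subseteq> carrier h \<Longrightarrow> v \<in> carrier V \<Longrightarrow> foldr (act V) w v \<in> carrier V"
  by (induction w) (auto simp: act_closed)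

lemma foldr_add: "set w \<subseteq> carrier h \<Longrightarrow> u \<in> carrier V \<Longrightarrow> v \<in> carrier V \<Longrightarrow>
    foldr (act V) w (u \<oplus>\<^bsub>V\<^esub> v) = foldr (act V) w u \<oplus>\<^bsub>V\<^esub> foldr (act V) w v"
  by (induction w) (auto simp: act_add foldr_closed)

lemma foldr_smult: "set w \<subseteq> carrier h \<Longrightarrow> v \<in> carrier V \<Longrightarrow>
    foldr (act V) w (c \<odot>\<^bsub>V\<^esub> v) = c \<odot>\<^bsub>V\<^esub> foldr (act V) w v"
  by (induction w) (auto simp: act_smult foldr_closed)

lemma foldr_zero: "set w \<subseteq> carrier h \<Longrightarrow> foldr (act V) w \<zero>\<^bsub>V\<^esub> = \<zero>\<^bsub>V\<^esub>"
  by (induction w) (auto simp: act_zero)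

abbreviation "Th \<equiv> carrier (free_algebra (carrier h))"

lemma free_act_lincomb: "free_act V p v = lincomb p (\<lambda>w. foldr (act V) (letters w) v)"
  by (simp add: free_act_def lincomb_def)

lemma Th_keys: "p \<in> Th \<longleftrightarrow> Poly_Mapping.keys p \<subseteq> words (carrier h)"
  by (simp add: carrier_free_algebra)

lemma free_act_closed: "p \<in> Th \<Longrightarrow> v \<in> carrier V \<Longrightarrow> free_act V p v \<in> carrier V"
  unfolding free_act_lincomb Th_keys by (rule lincomb_closed) (auto intro: foldr_closed)

lemma free_act_add: "p \<in> Th \<Longrightarrow> q \<in> Th \<Longrightarrow> v \<in> carrier V \<Longrightarrow>
    free_act V (p + q) v = free_act V p v \<oplus>\<^bsub>V\<^esub> free_act V q v"
  unfolding free_act_lincomb Th_keys by (rule lincomb_add) (auto intro: foldr_closed)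

lemma free_act_scale: "p \<in> Th \<Longrightarrow> v \<in> carrier V \<Longrightarrow> free_act V (scale c p) v = c \<odot>\<^bsub>V\<^esub> free_act V p v"
  unfolding free_act_lincomb Th_keys by (rule lincomb_scale) (auto intro: foldr_closed)

lemma free_act_0: "free_act V 0 v = \<zero>\<^bsub>V\<^esub>"
  unfolding free_act_lincomb by (rule lincomb_0)

lemma free_act_gen: "w \<in> words (carrier h) \<Longrightarrow> v \<in> carrier V \<Longrightarrow>
    free_act V (gen w) v = foldr (act V) (letters w) v"
  unfolding free_act_lincomb by (rule lincomb_gen) (auto intro: foldr_closed)

lemma free_act_letter: "x \<in> carrier h \<Longrightarrow> v \<in> carrier V \<Longrightarrow> free_act V (letter x) v = act V x v"
  by (simp add: free_act_gen)

lemma free_act_diff: "p \<in> Th \<Longrightarrow> q \<in> Th \<Longrightarrow> v \<in> carrier V \<Longrightarrow>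
    free_act V (p - q) v = free_act V p v \<ominus>\<^bsub>V\<^esub> free_act V q v"
proof -
  assume a: "p \<in> Th" "q \<in> Th" "v \<in> carrier V"
  have "p - q = p + scale (-1) q" by (simp add: pm.scale_minus_left)
  then show ?thesis
    using a free_act_add[of p "scale (-1) q" v] free_act_scale[of q v "-1"]
      pm.subspace_scale[OF subspace_free_algebra a(2), of "-1"] free_act_closed smult_minus_1
    by (simp add: a_minus_def)
qed

lemma free_act_gen_mult:
  assumes "w \<in> words (carrier h)" "q \<in> Th" "v \<in> carrier V"
  shows "free_act V (gen w * q) v = foldr (act V) (letters w) (free_act V q v)"
proof -
  have "Poly_Mapping.keys q \<subseteq> words (carrier h)" using assms(2) by (simp add: Th_keys)
  then show ?thesis
  proof (induction rule: pm_induct)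
    case zero
    then show ?case using assms(1) by (simp add: free_act_0 foldr_zero)
  next
    case (step c x p)
    have p: "p \<in> Th" "gen x \<in> Th" "gen w \<in> Th" using step assms(1) by (auto simp: Th_keys)
    have gx: "gen w * gen x = gen (w + x)" by (simp add: mult_single)
    have wx: "w + x \<in> words (carrier h)" using step(1) assms(1) by (auto simp: plus_word_def)
    have sp: "scale c (gen x) \<in> Th" using pm.subspace_scale[OF subspace_free_algebra p(2)] .
    have sp2: "scale c (gen (w + x)) \<in> Th"
      by (rule pm.subspace_scale[OF subspace_free_algebra]) (use wx in \<open>simp add: Th_keys\<close>)
    have "free_act V (gen w * (scale c (gen x) + p)) v = free_act V (scale c (gen (w + x)) + gen w * p) v"
      by (simp only: distrib_left scale_mult_right gx)
    also have "\<dots> = c \<odot>\<^bsub>V\<^esub> foldr (act V) (letters (w + x)) v \<oplus>\<^bsub>V\<^esub> foldr (act V) (letters w) (free_act V p v)"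
      using free_act_add[OF sp2 mult_in_free_algebra[OF p(3,1)] assms(3)] free_act_scale[of "gen (w + x)" v c]
        free_act_gen[OF wx assms(3)] wx assms(3) step(3) by (simp add: Th_keys)
    also have "\<dots> = foldr (act V) (letters w) (c \<odot>\<^bsub>V\<^esub> free_act V (gen x) v \<oplus>\<^bsub>V\<^esub> free_act V p v)"
      using assms p step free_act_closed by (simp add: foldr_add foldr_smult plus_word_def free_act_gen foldr_closed)
    also have "\<dots> = foldr (act V) (letters w) (free_act V (scale c (gen x) + p) v)"
      using free_act_add[OF sp p(1) assms(3)] free_act_scale[OF p(2) assms(3)] by simp
    finally show ?case .
  qed
qed

lemma free_act_mult:
  assumes "p \<in> Th" "q \<in> Th" "v \<in> carrier V"
  shows "free_act V (p * q) v = free_act V p (free_act V q v)"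
proof -
  have "Poly_Mapping.keys p \<subseteq> words (carrier h)" using assms(1) by (simp add: Th_keys)
  then show ?thesis
  proof (induction rule: pm_induct)
    case zero
    then show ?case by (simp add: free_act_0)
  next
    case (step c x p)
    have p: "p \<in> Th" "gen x \<in> Th" using step by (auto simp: Th_keys)
    have sp: "scale c (gen x) \<in> Th" using pm.subspace_scale[OF subspace_free_algebra p(2)] .
    have gq: "gen x * q \<in> Th" "p * q \<in> Th" using mult_in_free_algebra p assms(2) by blast+
    have sq: "scale c (gen x * q) \<in> Th" using pm.subspace_scale[OF subspace_free_algebra gq(1)] .
    have c: "free_act V q v \<in> carrier V" using free_act_closed assms by blast
    have "free_act V ((scale c (gen x) + p) * q) v = free_act V (scale c (gen x * q) + p * q) v"
      by (simp only: distrib_right scale_mult_left)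
    also have "\<dots> = c \<odot>\<^bsub>V\<^esub> foldr (act V) (letters x) (free_act V q v) \<oplus>\<^bsub>V\<^esub> free_act V p (free_act V q v)"
      using free_act_add[OF sq gq(2) assms(3)] free_act_scale[OF gq(1) assms(3)]
        free_act_gen_mult[OF step(1) assms(2,3)] step(3) by simp
    also have "\<dots> = free_act V (scale c (gen x) + p) (free_act V q v)"
      using free_act_add[OF sp p(1) c] free_act_scale[OF p(2) c] free_act_gen[OF step(1) c] by simp
    finally show ?case .
  qed
qed

text \<open>
  The elements that act as \<open>0\<close> form an ideal which contains the defining relations. This makes the action of
  the enveloping algebra well defined.
\<close>
lemma free_act_env_ideal:
  assumes "lie_closed h" "p \<in> env_ideal h" "v \<in> carrier V"
  shows "free_act V p v = \<zero>\<^bsub>V\<^esub>"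
proof -
  interpret envelope h by unfold_locales fact
  let ?K = "{p \<in> Th. \<forall>v\<in>carrier V. free_act V p v = \<zero>\<^bsub>V\<^esub>}"
  have "ideal ?K T"
  proof (rule ideal_free_algebraI)
    show "pm.subspace ?K"
      using T_simps by (intro pm.subspaceI) (auto simp: free_act_0 free_act_add free_act_scale)
    fix p q assume "p \<in> ?K" "q \<in> carrier T"
    moreover from this have "free_act V q \<zero>\<^bsub>V\<^esub> = \<zero>\<^bsub>V\<^esub>"
      using free_act_mult[of q 0 "\<zero>\<^bsub>V\<^esub>"] T_simps(4) by (simp add: free_act_0)
    ultimately show "q * p \<in> ?K \<and> p * q \<in> ?K"
      using T_simps(5) free_act_closed by (auto simp: free_act_mult)
  qed auto
  moreover have "env_rels h \<subseteq> ?K"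
  proof
    fix r assume r: "r \<in> env_rels h"
    then have rT: "r \<in> Th" using env_rels_T by blast
    have "free_act V r v = \<zero>\<^bsub>V\<^esub>" if v: "v \<in> carrier V" for v
    proof -
      have neg: "a \<ominus>\<^bsub>V\<^esub> a = \<zero>\<^bsub>V\<^esub>" if "a \<in> carrier V" for a using that by (simp add: a_minus_def V.r_neg)
      from r consider (1) x y where "x \<in> carrier h" "y \<in> carrier h" "r = letter (x \<oplus>\<^bsub>h\<^esub> y) - (letter x + letter y)"
        | (2) c x where "x \<in> carrier h" "r = letter (c \<odot>\<^bsub>h\<^esub> x) - scale c (letter x)"
        | (3) x y where "x \<in> carrier h" "y \<in> carrier h" "r = (letter x * letter y - letter y * letter x) - letter (bracket h x y)"
        unfolding env_rels_def by (auto simp: algebra_simps)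
      then show ?thesis
      proof cases
        case 1
        then have *: "x \<oplus>\<^bsub>h\<^esub> y \<in> carrier h" using assms(1) by (simp add: lie_closed_def)
        show ?thesis using 1 * v neg by (simp add: free_act_diff free_act_add free_act_letter T_simps act_closed add_act)
      next
        case 2
        then have *: "c \<odot>\<^bsub>h\<^esub> x \<in> carrier h" using assms(1) by (simp add: lie_closed_def)
        show ?thesis using 2 * v neg by (simp add: free_act_diff free_act_scale free_act_letter T_simps act_closed smult_act)
      next
        case 3
        then have *: "bracket h x y \<in> carrier h" using assms(1) by (simp add: lie_closed_def)
        show ?thesis using 3 * v neg
          by (simp add: free_act_diff free_act_mult free_act_letter T_simps act_closed bracket_act)
      qed
    qed
    then show "r \<in> ?K" using rT by blast
  qed
  ultimately have "env_ideal h \<subseteq> ?K" by (rule I_minimal)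
  then show ?thesis using assms by blast
qed

lemma env_act_eq:
  assumes "lie_closed h" "p \<in> Th" "v \<in> carrier V"
  shows "env_act V (coset_of (env_ideal h) p) v = free_act V p v"
proof -
  interpret envelope h by unfold_locales fact
  have "free_act V q v = free_act V p v" if "q \<in> \<kappa> p" for q
  proof -
    have d: "q - p \<in> I" using that by (simp add: coset_of_def)
    then have qp: "q - p \<in> Th" using I_sub_T by blast
    have "free_act V ((q - p) + p) v = free_act V (q - p) v \<oplus>\<^bsub>V\<^esub> free_act V p v"
      by (rule free_act_add[OF qp assms(2,3)])
    then show ?thesis using free_act_env_ideal[OF assms(1) d assms(3)] free_act_closed[OF assms(2,3)] by simp
  qed
  then have "(\<lambda>q. free_act V q v) ` \<kappa> p = (\<lambda>q. free_act V p v) ` \<kappa> p"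
    by (rule image_cong[OF refl])
  also have "\<dots> = {free_act V p v}"
    by (rule image_constant[OF self_in_coset[OF subspace_I]])
  finally show ?thesis by (simp add: env_act_def)
qed

end

section \<open>Induced modules\<close>

locale induced = G: envelope g + H: envelope h + L: lie_module h V
  for g :: "'g lie_alg" and h :: "'g lie_alg" and V :: "('g, 'v) lie_mod" +
  assumes sub: "carrier h \<subseteq> carrier g" and add_h: "add h = add g" and smult_h: "smult h = smult g"
    and bracket_h: "bracket h = bracket g"
begin

abbreviation "gens \<equiv> carrier (env g) \<times> carrier V"
abbreviation "rels \<equiv> bilinear_relations (env g) V \<union>
      {gen (u \<otimes>\<^bsub>env g\<^esub> env_incl g a, v) - gen (u, env_act V a v) | u a v.
         u \<in> carrier (env g) \<and> a \<in> carrier (env h) \<and> v \<in> carrier V}"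
abbreviation "ind_act \<equiv> \<lambda>x (u, v). gen (env_of g x \<otimes>\<^bsub>env g\<^esub> u, v)"

text \<open>
  The pure tensor of the class of \<open>p\<close> with \<open>v\<close>. With representatives \<open>p\<close> in the free algebra the
  defining relations become identities between such tensors.
\<close>
definition j :: "('g word \<Rightarrow>\<^sub>0 complex) \<Rightarrow> 'v \<Rightarrow> (('g word \<Rightarrow>\<^sub>0 complex) set \<times> 'v \<Rightarrow>\<^sub>0 complex)" where
  "j p v = gen (G.\<kappa> p, v)"

lemma HT_sub: "carrier H.T \<subseteq> carrier G.T"
  using sub by (auto simp: carrier_free_algebra)

lemma H_I_sub: "H.I \<subseteq> G.I"
proof -
  have "H.I \<subseteq> G.I \<inter> carrier H.T"
  proof (rule H.I_minimal)
    show "ideal (G.I \<inter> carrier H.T) H.T"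
    proof (rule ideal_free_algebraI)
      show "pm.subspace (G.I \<inter> carrier H.T)"
        by (rule pm.subspace_inter[OF G.subspace_I subspace_free_algebra])
      show "q * p \<in> G.I \<inter> carrier H.T \<and> p * q \<in> G.I \<inter> carrier H.T"
        if "p \<in> G.I \<inter> carrier H.T" "q \<in> carrier H.T" for p q
        using that G.I_mult[of p q] HT_sub H.T_simps(5) by blast
    qed auto
    have "env_rels h \<subseteq> env_rels g"
      using sub unfolding env_rels_def add_h smult_h bracket_h by blast
    then show "env_rels h \<subseteq> G.I \<inter> carrier H.T"
      using H.env_rels_T G.env_rels_I by blast
  qed
  then show ?thesis by blast
qed

lemma incl_mult:
  assumes "p \<in> carrier G.T" "a \<in> carrier H.T"
  shows "G.\<kappa> p \<otimes>\<^bsub>env g\<^esub> env_incl g (H.\<kappa> a) = G.\<kappa> (p * a)"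
  using G.mult_env[OF assms(1)] assms(2) HT_sub by (auto simp: G.env_incl_eq[OF H_I_sub H.subspace_I])

lemma rels_cases:
  assumes "r \<in> rels"
  obtains (left_add) p q v where "p \<in> carrier G.T" "q \<in> carrier G.T" "v \<in> carrier V" "r = j (p + q) v - j p v - j q v"
  | (right_add) p v w where "p \<in> carrier G.T" "v \<in> carrier V" "w \<in> carrier V" "r = j p (v \<oplus>\<^bsub>V\<^esub> w) - j p v - j p w"
  | (left_scale) p c v where "p \<in> carrier G.T" "v \<in> carrier V" "r = j (scale c p) v - scale c (j p v)"
  | (right_scale) p c v where "p \<in> carrier G.T" "v \<in> carrier V" "r = j p (c \<odot>\<^bsub>V\<^esub> v) - scale c (j p v)"
  | (balanced) p a v where "p \<in> carrier G.T" "a \<in> carrier H.T" "v \<in> carrier V" "r = j (p * a) v - j p (free_act V a v)"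
proof -
  consider (1) u u' w where "r = gen (u \<oplus>\<^bsub>env g\<^esub> u', w) - gen (u, w) - gen (u', w)" "u \<in> carrier (env g)" "u' \<in> carrier (env g)" "w \<in> carrier V"
    | (2) u v w where "r = gen (u, v \<oplus>\<^bsub>V\<^esub> w) - gen (u, v) - gen (u, w)" "u \<in> carrier (env g)" "v \<in> carrier V" "w \<in> carrier V"
    | (3) c u w where "r = gen (c \<odot>\<^bsub>env g\<^esub> u, w) - scale c (gen (u, w))" "u \<in> carrier (env g)" "w \<in> carrier V"
    | (4) c u w where "r = gen (u, c \<odot>\<^bsub>V\<^esub> w) - scale c (gen (u, w))" "u \<in> carrier (env g)" "w \<in> carrier V"
    | (5) u a v where "r = gen (u \<otimes>\<^bsub>env g\<^esub> env_incl g a, v) - gen (u, env_act V a v)" "u \<in> carrier (env g)" "a \<in> carrier (env h)" "v \<in> carrier V"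
    using assms unfolding bilinear_relations_def by blast
  then show thesis
  proof cases
    case 1
    then obtain p q where "u = G.\<kappa> p" "u' = G.\<kappa> q" "p \<in> carrier G.T" "q \<in> carrier G.T"
      unfolding G.carrier_env by blast
    then show thesis using 1 left_add by (simp add: G.add_env j_def)
  next
    case 2
    then obtain p where "u = G.\<kappa> p" "p \<in> carrier G.T" unfolding G.carrier_env by blast
    then show thesis using 2 right_add by (simp add: j_def)
  next
    case 3
    then obtain p where "u = G.\<kappa> p" "p \<in> carrier G.T" unfolding G.carrier_env by blast
    then show thesis using 3 left_scale by (simp add: j_def G.smult_env)
  next
    case 4
    then obtain p where "u = G.\<kappa> p" "p \<in> carrier G.T" unfolding G.carrier_env by blast
    then show thesis using 4 right_scale by (simp add: j_def)
  next
    case 5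
    then obtain p where p: "u = G.\<kappa> p" "p \<in> carrier G.T" unfolding G.carrier_env by blast
    obtain q where q: "a = H.\<kappa> q" "q \<in> carrier H.T" using 5 unfolding H.carrier_env by blast
    show thesis
      by (rule balanced[OF p(2) q(2) 5(4)])
         (simp add: 5(1) p(1) q(1) j_def incl_mult[OF p(2) q(2)] L.env_act_eq[OF H.closed q(2) 5(4)])
  qed
qed

lemma \<kappa>_in_env: "p \<in> carrier G.T \<Longrightarrow> G.\<kappa> p \<in> carrier (env g)"
  by (simp add: G.carrier_env)

lemma rel_left_add: "p \<in> carrier G.T \<Longrightarrow> q \<in> carrier G.T \<Longrightarrow> v \<in> carrier V \<Longrightarrow> j (p + q) v - j p v - j q v \<in> rels"
  unfolding bilinear_relations_def j_def G.add_env[symmetric] using \<kappa>_in_env by blast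

lemma rel_right_add: "p \<in> carrier G.T \<Longrightarrow> v \<in> carrier V \<Longrightarrow> w \<in> carrier V \<Longrightarrow> j p (v \<oplus>\<^bsub>V\<^esub> w) - j p v - j p w \<in> rels"
  unfolding bilinear_relations_def j_def using \<kappa>_in_env by blast

lemma rel_left_scale: "p \<in> carrier G.T \<Longrightarrow> v \<in> carrier V \<Longrightarrow> j (scale c p) v - scale c (j p v) \<in> rels"
  unfolding bilinear_relations_def j_def G.smult_env[symmetric] using \<kappa>_in_env by blast

lemma rel_right_scale: "p \<in> carrier G.T \<Longrightarrow> v \<in> carrier V \<Longrightarrow> j p (c \<odot>\<^bsub>V\<^esub> v) - scale c (j p v) \<in> rels"
  unfolding bilinear_relations_def j_def using \<kappa>_in_env by blast

lemma rel_balanced: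
  assumes "p \<in> carrier G.T" "a \<in> carrier H.T" "v \<in> carrier V"
  shows "j (p * a) v - j p (free_act V a v) \<in> rels"
proof -
  have "gen (G.\<kappa> p \<otimes>\<^bsub>env g\<^esub> env_incl g (H.\<kappa> a), v) - gen (G.\<kappa> p, env_act V (H.\<kappa> a) v) \<in> rels"
    using \<kappa>_in_env[OF assms(1)] assms(2,3) H.carrier_env by blast
  then show ?thesis
    by (simp only: j_def incl_mult[OF assms(1,2)] L.env_act_eq[OF H.closed assms(2,3)])
qed

lemma keys_j: "p \<in> carrier G.T \<Longrightarrow> v \<in> carrier V \<Longrightarrow> Poly_Mapping.keys (j p v) \<subseteq> gens"
  by (simp add: j_def \<kappa>_in_env)

lemma ind_act_j: "x \<in> carrier g \<Longrightarrow> p \<in> carrier G.T \<Longrightarrow> ind_act x (G.\<kappa> p, v) = j (letter x * p) v"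
  by (simp add: j_def G.env_of_eq G.mult_env G.letter_T)

lemma lin_ext_ind_act_j: "x \<in> carrier g \<Longrightarrow> p \<in> carrier G.T \<Longrightarrow> lin_ext (ind_act x) (j p v) = j (letter x * p) v"
  using ind_act_j[of x p v] by (simp only: j_def lin_ext_gen)

lemma T_letter_mult: "x \<in> carrier g \<Longrightarrow> p \<in> carrier G.T \<Longrightarrow> letter x * p \<in> carrier G.T"
  using G.T_simps(5,6) by blast

sublocale pres: presentation g gens rels ind_act
proof
  fix r assume "r \<in> rels"
  note diff = pm.subspace_diff[OF subspace_keys[of gens], simplified]
  note scl = pm.subspace_scale[OF subspace_keys[of gens], simplified]
  from \<open>r \<in> rels\<close> show "Poly_Mapping.keys r \<subseteq> gens"
  proof (cases rule: rels_cases)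
    case left_add then show ?thesis by (simp only:) (intro diff keys_j G.T_simps; assumption)
  next
    case right_add then show ?thesis by (simp only:) (intro diff keys_j L.V.a_closed; assumption)
  next
    case left_scale then show ?thesis by (simp only:) (intro diff scl keys_j G.T_simps; assumption)
  next
    case right_scale then show ?thesis by (simp only:) (intro diff scl keys_j L.smult_simps; assumption)
  next
    case (balanced p a v)
    have "a \<in> carrier G.T" using balanced HT_sub by blast
    then show ?thesis using balanced by (simp only:) (intro diff keys_j G.T_simps L.free_act_closed; assumption)
  qed
next
  fix x u assume x: "x \<in> carrier g" and "u \<in> gens"
  then obtain p v where u: "u = (G.\<kappa> p, v)" "p \<in> carrier G.T" "v \<in> carrier V"
    unfolding G.carrier_env by blast
  show "Poly_Mapping.keys (ind_act x u) \<subseteq> gens"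
    unfolding u(1) ind_act_j[OF x u(2)] by (rule keys_j[OF T_letter_mult[OF x u(2)] u(3)])
next
  fix x r assume x: "x \<in> carrier g" and "r \<in> rels"
  note L = lin_ext_diff lin_ext_scale lin_ext_ind_act_j[OF x]
  note T = T_letter_mult[OF x]
  from \<open>r \<in> rels\<close> have "lin_ext (ind_act x) r \<in> rels"
  proof (cases rule: rels_cases)
    case left_add
    then show ?thesis using rel_left_add[OF T T] by (simp only: L G.T_simps distrib_left)
  next
    case right_add
    then show ?thesis using rel_right_add[OF T] by (simp only: L)
  next
    case left_scale
    then show ?thesis using rel_left_scale[OF T] by (simp only: L G.T_simps scale_mult_right)
  next
    case right_scale
    then show ?thesis using rel_right_scale[OF T] by (simp only: L)
  next
    case (balanced p a v)
    have "a \<in> carrier G.T" using balanced HT_sub by blast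
    then show ?thesis using balanced rel_balanced[OF T] by (simp only: L G.T_simps mult.assoc[symmetric])
  qed
  then show "lin_ext (ind_act x) r \<in> pm.span rels" by (rule pm.span_base)
qed

lemma induced_module_eq: "induced_module g h V = pres.P"
  by (simp add: induced_module_def)

lemma j_add_left: "p \<in> carrier G.T \<Longrightarrow> q \<in> carrier G.T \<Longrightarrow> v \<in> carrier V \<Longrightarrow> j (p + q) v - (j p v + j q v) \<in> pres.N"
  using pm.span_base[OF rel_left_add] by (simp only: diff_diff_eq)

lemma j_scale_left: "p \<in> carrier G.T \<Longrightarrow> v \<in> carrier V \<Longrightarrow> j (scale c p) v - scale c (j p v) \<in> pres.N"
  using pm.span_base[OF rel_left_scale] .

lemma j_diff_left:
  assumes "p \<in> carrier G.T" "q \<in> carrier G.T" "v \<in> carrier V"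
  shows "j (p - q) v - (j p v - j q v) \<in> pres.N"
proof -
  have "j ((p - q) + q) v - (j (p - q) v + j q v) \<in> pres.N"
    by (rule j_add_left) (use assms G.T_simps in auto)
  then have "- (j ((p - q) + q) v - (j (p - q) v + j q v)) \<in> pres.N" by (rule pm.span_neg)
  then show ?thesis by (simp add: algebra_simps)
qed

lemma j_cong: "p - q \<in> G.I \<Longrightarrow> j p v = j q v"
  using G.\<kappa>_eq_iff[of p q] by (simp add: j_def)

lemma is_lie_module_ind: "is_lie_module g pres.P"
proof (rule pres.is_lie_module_P)
  note C = G.closed[unfolded lie_closed_def]
  show "a \<oplus>\<^bsub>g\<^esub> b \<in> carrier g" if "a \<in> carrier g" "b \<in> carrier g" for a b using C that by blast
  show "bracket g a b \<in> carrier g" if "a \<in> carrier g" "b \<in> carrier g" for a b using C that by blast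
  show "c \<odot>\<^bsub>g\<^esub> a \<in> carrier g" if "a \<in> carrier g" for a c using C that by blast
next
  fix a b x assume ab: "a \<in> carrier g" "b \<in> carrier g" and "x \<in> gens"
  then obtain p v where x: "x = (G.\<kappa> p, v)" "p \<in> carrier G.T" "v \<in> carrier V"
    unfolding G.carrier_env by blast
  note C = G.closed[unfolded lie_closed_def]
  have cl: "a \<oplus>\<^bsub>g\<^esub> b \<in> carrier g" "bracket g a b \<in> carrier g" using C ab by blast+
  have "(letter (a \<oplus>\<^bsub>g\<^esub> b) - letter a - letter b) * p \<in> G.I"
    by (rule G.I_mult(2)[OF G.env_rels_I x(2)]) (unfold env_rels_def, use ab in blast)
  then have "j (letter (a \<oplus>\<^bsub>g\<^esub> b) * p) v = j (letter a * p + letter b * p) v"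
    by (intro j_cong) (simp add: algebra_simps)
  then show "ind_act (a \<oplus>\<^bsub>g\<^esub> b) x - (ind_act a x + ind_act b x) \<in> pres.N"
    unfolding x(1) using j_add_left[OF T_letter_mult[OF ab(1) x(2)] T_letter_mult[OF ab(2) x(2)] x(3)]
    by (simp only: ind_act_j ab x(2) cl)
  have "(letter a * letter b - letter b * letter a - letter (bracket g a b)) * p \<in> G.I"
    by (rule G.I_mult(2)[OF G.env_rels_I x(2)]) (unfold env_rels_def, use ab in blast)
  then have "- ((letter a * letter b - letter b * letter a - letter (bracket g a b)) * p) \<in> G.I"
    by (rule pm.subspace_neg[OF G.subspace_I])
  then have "j (letter (bracket g a b) * p) v = j (letter a * (letter b * p) - letter b * (letter a * p)) v"
    by (intro j_cong) (simp add: algebra_simps)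
  then show "ind_act (bracket g a b) x - (lin_ext (ind_act a) (ind_act b x) - lin_ext (ind_act b) (ind_act a x)) \<in> pres.N"
    unfolding x(1) using j_diff_left[OF T_letter_mult[OF ab(1) T_letter_mult[OF ab(2) x(2)]] T_letter_mult[OF ab(2) T_letter_mult[OF ab(1) x(2)]] x(3)]
    by (simp only: ind_act_j ab x(2) cl lin_ext_ind_act_j T_letter_mult)
next
  fix a c x assume a: "a \<in> carrier g" and "x \<in> gens"
  then obtain p v where x: "x = (G.\<kappa> p, v)" "p \<in> carrier G.T" "v \<in> carrier V"
    unfolding G.carrier_env by blast
  have cl: "c \<odot>\<^bsub>g\<^esub> a \<in> carrier g" using G.closed a by (simp add: lie_closed_def)
  have "(letter (c \<odot>\<^bsub>g\<^esub> a) - scale c (letter a)) * p \<in> G.I"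
    by (rule G.I_mult(2)[OF G.env_rels_I x(2)]) (unfold env_rels_def, use a in blast)
  then have "j (letter (c \<odot>\<^bsub>g\<^esub> a) * p) v = j (scale c (letter a * p)) v"
    by (intro j_cong) (simp add: left_diff_distrib scale_mult_left)
  then show "ind_act (c \<odot>\<^bsub>g\<^esub> a) x - scale c (ind_act a x) \<in> pres.N"
    unfolding x(1) using j_scale_left[OF T_letter_mult[OF a x(2)] x(3)]
    by (simp only: ind_act_j a x(2) cl)
qed

end

section \<open>Nonvanishing of induced modules\<close>

text \<open>
  An algebra with a basis indexed by \<open>'b\<close>, in which the basis elements of nonnegative rank span the subalgebra: the setting of
  locale \<open>pbw\<close>, with the linear functionals on \<open>V\<close> as \<open>Fn\<close>.
\<close>
locale induced_basis = induced g h V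
  for g h :: "('b \<Rightarrow>\<^sub>0 complex) lie_alg" and V :: "('b \<Rightarrow>\<^sub>0 complex, 'v) lie_mod" +
  fixes br :: "'b \<Rightarrow> 'b \<Rightarrow> ('b \<Rightarrow>\<^sub>0 complex)" and rank :: "'b \<Rightarrow> int"
  assumes g_carrier: "carrier g = UNIV" and g_add: "add g = (+)" and g_smult: "smult g = scale"
    and g_bracket: "bracket g x y = lin_ext (\<lambda>a. lin_ext (br a) y) x"
    and h_carrier: "carrier h = {x. Poly_Mapping.keys x \<subseteq> {b. rank b \<ge> 0}}"
    and rank_inj: "rank a = rank b \<Longrightarrow> a = b"
    and br_anti: "br a b = - br b a"
    and jacobi: "lin_ext (\<lambda>d. br d a) (br c b) - lin_ext (\<lambda>d. br d b) (br c a) + lin_ext (\<lambda>d. br d c) (br b a) = 0"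
begin

definition lin_fns :: "('v \<Rightarrow> complex) set" where
  "lin_fns = {\<phi>. (\<forall>v\<in>carrier V. \<forall>w\<in>carrier V. \<phi> (v \<oplus>\<^bsub>V\<^esub> w) = \<phi> v + \<phi> w) \<and>
     (\<forall>c. \<forall>v\<in>carrier V. \<phi> (c \<odot>\<^bsub>V\<^esub> v) = c * \<phi> v)}"

lemma gen_in_h: "rank b \<ge> 0 \<Longrightarrow> gen b \<in> carrier h"
  by (simp add: h_carrier)

lemma lin_fns_zero: "\<phi> \<in> lin_fns \<Longrightarrow> \<phi> \<zero>\<^bsub>V\<^esub> = 0"
proof -
  assume "\<phi> \<in> lin_fns"
  then have "\<phi> (0 \<odot>\<^bsub>V\<^esub> \<zero>\<^bsub>V\<^esub>) = 0 * \<phi> \<zero>\<^bsub>V\<^esub>" unfolding lin_fns_def by blast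
  then show ?thesis by simp
qed

lemma lin_fns_minus: "\<phi> \<in> lin_fns \<Longrightarrow> v \<in> carrier V \<Longrightarrow> w \<in> carrier V \<Longrightarrow> \<phi> (v \<ominus>\<^bsub>V\<^esub> w) = \<phi> v - \<phi> w"
proof -
  assume \<phi>: "\<phi> \<in> lin_fns" and vw: "v \<in> carrier V" "w \<in> carrier V"
  have "v \<ominus>\<^bsub>V\<^esub> w = v \<oplus>\<^bsub>V\<^esub> (-1) \<odot>\<^bsub>V\<^esub> w" using vw L.smult_minus_1 by (simp add: a_minus_def)
  then have "\<phi> (v \<ominus>\<^bsub>V\<^esub> w) = \<phi> v + (-1) * \<phi> w" using \<phi> vw unfolding lin_fns_def by simp
  then show ?thesis by simp
qed

lemma lin_fns_act:
  assumes "\<phi> \<in> lin_fns" "x \<in> carrier h" "v \<in> carrier V"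
  shows "\<phi> (act V x v) = fun_ext (\<lambda>b. \<phi> (act V (gen b) v)) x"
proof -
  have "Poly_Mapping.keys x \<subseteq> {b. rank b \<ge> 0}" using assms(2) by (simp add: h_carrier)
  then show ?thesis
  proof (induction rule: pm_induct)
    case zero
    have "act V (0 \<odot>\<^bsub>h\<^esub> x) v = 0 \<odot>\<^bsub>V\<^esub> act V x v" by (rule L.smult_act) (use assms in auto)
    then have "act V 0 v = \<zero>\<^bsub>V\<^esub>" using assms L.act_closed by (simp add: smult_h g_smult)
    then show ?case using lin_fns_zero[OF assms(1)] by simp
  next
    case (step c b p)
    have h: "gen b \<in> carrier h" "p \<in> carrier h" using step by (auto simp: h_carrier)
    have sc: "scale c (gen b) \<in> carrier h" using H.closed h unfolding lie_closed_def smult_h g_smult by blast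
    have "act V (scale c (gen b) \<oplus>\<^bsub>h\<^esub> p) v = act V (c \<odot>\<^bsub>h\<^esub> gen b) v \<oplus>\<^bsub>V\<^esub> act V p v"
      using L.add_act[OF sc h(2) assms(3)] by (simp add: smult_h g_smult)
    also have "\<dots> = c \<odot>\<^bsub>V\<^esub> act V (gen b) v \<oplus>\<^bsub>V\<^esub> act V p v"
      by (simp only: L.smult_act[OF h(1) assms(3)])
    finally have "\<phi> (act V (scale c (gen b) + p) v) = \<phi> (c \<odot>\<^bsub>V\<^esub> act V (gen b) v \<oplus>\<^bsub>V\<^esub> act V p v)"
      by (simp add: add_h g_add)
    also have "\<dots> = c * \<phi> (act V (gen b) v) + \<phi> (act V p v)"
      using assms(1,3) h L.act_closed unfolding lin_fns_def by simp
    finally show ?case using step(3) by (simp add: fun_ext_add fun_ext_scale)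
  qed
qed

lemma pbw_locale:
  assumes "\<xi> \<in> lin_fns"
  shows "pbw br rank (carrier V) (\<lambda>b. act V (gen b)) lin_fns \<xi>"
proof
  fix a b c d and v \<phi> \<psi> t
  show "rank a = rank b \<Longrightarrow> a = b" by (rule rank_inj)
  show "br a b = - br b a" by (rule br_anti)
  show "lin_ext (\<lambda>d. br d a) (br c b) - lin_ext (\<lambda>d. br d b) (br c a) + lin_ext (\<lambda>d. br d c) (br b a) = 0"
    by (rule jacobi)
  have gb: "bracket h (gen a) (gen b) = br a b" for a b by (simp add: bracket_h g_bracket)
  have br_h: "br a b \<in> carrier h" if "rank a \<ge> 0" "rank b \<ge> 0" for a b
    using H.closed gen_in_h[OF that(1)] gen_in_h[OF that(2)] unfolding lie_closed_def gb[symmetric] by blast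
  show "0 \<le> rank a \<Longrightarrow> 0 \<le> rank b \<Longrightarrow> d \<in> Poly_Mapping.keys (br a b) \<Longrightarrow> 0 \<le> rank d"
    using br_h[of a b] by (auto simp: h_carrier)
  show "v \<in> carrier V \<Longrightarrow> 0 \<le> rank c \<Longrightarrow> act V (gen c) v \<in> carrier V"
    by (rule L.act_closed[OF gen_in_h])
  show "(\<lambda>_. 0) \<in> lin_fns" by (simp add: lin_fns_def)
  show "\<phi> \<in> lin_fns \<Longrightarrow> \<psi> \<in> lin_fns \<Longrightarrow> (\<lambda>v. \<phi> v + \<psi> v) \<in> lin_fns"
    by (simp add: lin_fns_def algebra_simps)
  show "\<phi> \<in> lin_fns \<Longrightarrow> (\<lambda>v. t * \<phi> v) \<in> lin_fns"
    by (simp add: lin_fns_def algebra_simps)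
  show "\<phi> \<in> lin_fns \<Longrightarrow> 0 \<le> rank c \<Longrightarrow> (\<lambda>v. \<phi> (act V (gen c) v)) \<in> lin_fns"
    using gen_in_h[of c] L.act_closed by (simp add: lin_fns_def L.act_add L.act_smult)
  show "\<phi> (act V (gen b) (act V (gen a) v)) - \<phi> (act V (gen a) (act V (gen b) v)) = fun_ext (\<lambda>d. \<phi> (act V (gen d) v)) (br b a)"
    if "\<phi> \<in> lin_fns" "0 \<le> rank a" "0 \<le> rank b" "v \<in> carrier V"
  proof -
    note ga = gen_in_h[OF that(2)] and gbb = gen_in_h[OF that(3)]
    have "\<phi> (act V (br b a) v) = \<phi> (act V (gen b) (act V (gen a) v)) - \<phi> (act V (gen a) (act V (gen b) v))"
      using L.bracket_act[OF gbb ga that(4)] lin_fns_minus[OF that(1)] L.act_closed ga gbb that(4) by (simp add: gb)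
    then show ?thesis using lin_fns_act[OF that(1) br_h[OF that(3,2)] that(4)] by simp
  qed
qed (rule assms)

text \<open>
  Multilinear expansion of a word in arbitrary elements of the algebra into words in basis
  elements.
\<close>
definition expand :: "(('b \<Rightarrow>\<^sub>0 complex) word \<Rightarrow>\<^sub>0 complex) \<Rightarrow> ('b word \<Rightarrow>\<^sub>0 complex)" where
  "expand = lin_ext (\<lambda>w. prod_list (map emb (letters w)))"

lemma plinear_expand: "plinear expand" by (simp add: expand_def plinear_lin_ext)

lemmas expand_simps = pm2.linear_add[OF plinear_expand] pm2.linear_diff[OF plinear_expand]
  pm2.linear_scale[OF plinear_expand] pm2.linear_0[OF plinear_expand]

lemma expand_gen: "expand (gen w) = prod_list (map emb (letters w))"
  by (simp add: expand_def)

lemma expand_mult: "expand (p * q) = expand p * expand q"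
proof -
  have 1: "expand (gen u * q) = expand (gen u) * expand q" for u q
  proof (rule plinear_eqI[of "\<lambda>q. expand (gen u * q)" "\<lambda>q. expand (gen u) * expand q" UNIV])
    show "plinear (\<lambda>q. expand (gen u * q))" "plinear (\<lambda>q. expand (gen u) * expand q)"
      by (rule plinearI; simp add: distrib_left scale_mult_right expand_simps)+
    show "expand (gen u * gen x) = expand (gen u) * expand (gen x)" for x
      by (simp add: mult_single expand_gen plus_word_def)
  qed auto
  show ?thesis
  proof (rule plinear_eqI[of "\<lambda>p. expand (p * q)" "\<lambda>p. expand p * expand q" UNIV])
    show "plinear (\<lambda>p. expand (p * q))" "plinear (\<lambda>p. expand p * expand q)"
      by (rule plinearI; simp add: distrib_right scale_mult_left expand_simps)+
  qed (use 1 in auto)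
qed

lemma expand_letter: "expand (letter x) = emb x"
  by (simp add: expand_gen)

lemma expand_1: "expand 1 = 1"
  using expand_gen[of "Word []"] by (simp add: word_Nil)

text \<open>
  With \<open>\<xi> v0 \<noteq> 0\<close>, the functional \<open>p \<otimes> v \<mapsto> EE (expand p) v\<close> respects all relations of the induced module
  and has the value \<open>\<xi> v0\<close> at \<open>1 \<otimes> v0\<close>.
\<close>
lemma nonvanishing:
  assumes "v0 \<in> carrier V" "v0 \<noteq> \<zero>\<^bsub>V\<^esub>"
  shows "j 1 v0 \<notin> pres.N"
proof -
  obtain \<xi> where \<xi>: "\<xi> \<in> lin_fns" "\<xi> v0 \<noteq> 0"
    using L.functional_exists[OF assms] unfolding lin_fns_def by blast
  interpret pbw br rank "carrier V" "\<lambda>b. act V (gen b)" lin_fns \<xi>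
    by (rule pbw_locale[OF \<xi>(1)])
  have sw: "swap_rel w" "end_rel w" "Xi w \<in> lin_fns" for w using all_good[of w] by (simp_all add: good_def)
  let ?K = "{q. \<forall>p r. \<forall>v\<in>carrier V. EE (p * q * r) v = 0}"
  have subK: "pm.subspace ?K"
    by (rule pm.subspaceI) (auto simp: distrib_left distrib_right scale_mult_left scale_mult_right EE_simps)
  have comm: "emb x * emb y - emb y * emb x - emb (bracket g x y) \<in> ?K" for x y
  proof -
    let ?c = "\<lambda>y. emb x * emb y - emb y * emb x - emb (bracket g x y)"
    have lin_b: "lin_ext (\<lambda>a. lin_ext (br a) (y + y')) x = lin_ext (\<lambda>a. lin_ext (br a) y) x + lin_ext (\<lambda>a. lin_ext (br a) y') x"
      "lin_ext (\<lambda>a. lin_ext (br a) (scale c y)) x = scale c (lin_ext (\<lambda>a. lin_ext (br a) y) x)" for y y' c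
      by (simp_all add: lin_ext_def[of _ x] lin_ext_add lin_ext_scale pm.scale_right_distrib sum.distrib
          pm.scale_sum_right mult.commute)
    note S = distrib_left distrib_right left_diff_distrib right_diff_distrib scale_mult_left scale_mult_right
      pm2.linear_add[OF plinear_emb] pm2.linear_scale[OF plinear_emb] EE_simps lin_b
    have 1: "EE (word u * ?c (gen a) * word u') v = 0" if "v \<in> carrier V" for u u' a v
      using EE_commutator_emb[OF sw(1) that, of u x a u'] by (simp add: g_bracket)
    have 2: "EE (word u * ?c y * word u') v = 0" if "v \<in> carrier V" for u u' v y
      by (rule functional_eqI[of "\<lambda>y. EE (word u * ?c y * word u') v" "\<lambda>_. 0" UNIV])
         (use 1 that in \<open>auto intro!: functionalI simp: g_bracket S\<close>)
    have 3: "EE (p * ?c y * word u') v = 0" if "v \<in> carrier V" for p u' v y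
      by (rule functional_eqI[of "\<lambda>p. EE (p * ?c y * word u') v" "\<lambda>_. 0" UNIV])
         (use 2[of v "letters _"] that in \<open>auto intro!: functionalI simp: distrib_right scale_mult_left EE_simps\<close>)
    have 4: "EE (p * ?c y * r) v = 0" if "v \<in> carrier V" for p r v y
      by (rule functional_eqI[of "\<lambda>r. EE (p * ?c y * r) v" "\<lambda>_. 0" UNIV])
         (use 3[of v _ _ "letters _"] that in \<open>auto intro!: functionalI simp: distrib_left scale_mult_right EE_simps\<close>)
    then show ?thesis by blast
  qed
  \<comment> \<open>The subspace \<open>?K\<close> is a two-sided ideal, so the ideal generated by the defining relations of the enveloping
    algebra is mapped into it.\<close>
  have I_K: "expand p \<in> ?K" if "p \<in> G.I" for p
  proof -
    have "G.I \<subseteq> {p \<in> carrier G.T. expand p \<in> ?K}"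
    proof (rule G.I_minimal)
      show "ideal {p \<in> carrier G.T. expand p \<in> ?K} G.T"
      proof (rule ideal_free_algebraI)
        have eq: "{p \<in> carrier G.T. expand p \<in> K} = carrier G.T \<inter> {p. expand p \<in> K}" for K by blast
        show "pm.subspace {p \<in> carrier G.T. expand p \<in> ?K}"
          unfolding eq by (rule pm.subspace_inter[OF subspace_free_algebra subspace_preimage[OF plinear_expand subK]])
        fix p q assume p: "p \<in> {p \<in> carrier G.T. expand p \<in> ?K}" and q: "q \<in> carrier G.T"
        have "EE (a * (expand q * expand p) * b) v = 0" "EE (a * (expand p * expand q) * b) v = 0"
          if "v \<in> carrier V" for a b v
        proof -
          have *: "EE (a * expand p * b) v = 0" for a b using p that by blast
          show "EE (a * (expand q * expand p) * b) v = 0" "EE (a * (expand p * expand q) * b) v = 0"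
            using *[of "a * expand q" b] *[of a "expand q * b"] by (simp_all only: mult.assoc)
        qed
        then show "q * p \<in> {p \<in> carrier G.T. expand p \<in> ?K} \<and> p * q \<in> {p \<in> carrier G.T. expand p \<in> ?K}"
          using p q G.T_simps(5) by (simp add: expand_mult)
      qed auto
      show "env_rels g \<subseteq> {p \<in> carrier G.T. expand p \<in> ?K}"
      proof
        fix r assume r: "r \<in> env_rels g"
        note ex = expand_simps expand_letter expand_mult pm2.linear_add[OF plinear_emb] pm2.linear_scale[OF plinear_emb]
        from r consider (1) x y where "r = letter (x + y) - letter x - letter y"
          | (2) c x where "r = letter (scale c x) - scale c (letter x)"
          | (3) x y where "r = letter x * letter y - letter y * letter x - letter (bracket g x y)"
          unfolding env_rels_def g_add g_smult by blast
        then have "expand r \<in> ?K"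
        proof cases
          case 1
          then have "expand r = 0" by (simp add: ex)
          then show ?thesis using pm.subspace_0[OF subK] by simp
        next
          case 2
          then have "expand r = 0" by (simp add: ex)
          then show ?thesis using pm.subspace_0[OF subK] by simp
        next
          case (3 x y)
          then show ?thesis using comm[of x y] by (simp only: ex)
        qed
        then show "r \<in> {p \<in> carrier G.T. expand p \<in> ?K}" using r G.env_rels_T by blast
      qed
    qed
    then show ?thesis using that by blast
  qed
  have EE_lin: "EE q \<in> lin_fns" for q
  proof -
    have "(\<lambda>v. fun_ext (\<lambda>w. Xi (letters w) v) q) \<in> lin_fns"
      by (rule fun_ext_Fn) (rule sw(3))
    then show ?thesis unfolding EE_def[abs_def] .
  qed
  have end_gen: "EE (q * word [b]) v = EE q (act V (gen b) v)" if "v \<in> carrier V" "rank b \<ge> 0" for q b v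
    by (rule functional_eqI[of "\<lambda>q. EE (q * word [b]) v" "\<lambda>q. EE q (act V (gen b) v)" UNIV])
       (use that sw(2) in \<open>auto intro!: functionalI simp: distrib_right scale_mult_left EE_simps mult_single plus_word_def
          EE_def end_rel_def fun_ext_add fun_ext_scale\<close>)
  have end_x: "EE (q * emb x) v = EE q (act V x v)" if "v \<in> carrier V" "x \<in> carrier h" for q x v
  proof -
    have "EE (q * emb x) v = fun_ext (\<lambda>b. EE q (act V (gen b) v)) x"
      by (rule functional_eqI[OF functional_slot[of q 1 v, simplified] functional_fun_ext, of "{b. rank b \<ge> 0}"])
         (use end_gen that h_carrier in auto)
    then show ?thesis using lin_fns_act[OF EE_lin that(2,1)] by simp
  qed
  have end_word: "EE (q * prod_list (map emb xs)) v = EE q (foldr (act V) xs v)"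
    if "v \<in> carrier V" "set xs \<subseteq> carrier h" for q xs v
    using that(2)
  proof (induction xs arbitrary: q)
    case (Cons x xs)
    have "EE (q * prod_list (map emb (x # xs))) v = EE ((q * emb x) * prod_list (map emb xs)) v" by (simp add: mult.assoc)
    also have "\<dots> = EE (q * emb x) (foldr (act V) xs v)" using Cons by simp
    also have "\<dots> = EE q (act V x (foldr (act V) xs v))"
      using Cons.prems L.foldr_closed[of xs v] that(1) by (intro end_x) auto
    finally show ?case by simp
  qed simp
  have end_a: "EE (q * expand a) v = EE q (free_act V a v)" if v: "v \<in> carrier V" and a: "a \<in> carrier H.T" for q a v
  proof -
    have "Poly_Mapping.keys a \<subseteq> words (carrier h)" using a by (simp add: carrier_free_algebra)
    then show ?thesis
    proof (induction rule: pm_induct)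
      case zero
      then show ?case using lin_fns_zero[OF EE_lin] by (simp add: expand_simps EE_simps L.free_act_0)
    next
      case (step c w p)
      have p: "p \<in> carrier H.T" "gen w \<in> carrier H.T" using step by (auto simp: carrier_free_algebra)
      have "EE (q * expand (scale c (gen w) + p)) v = c * EE q (foldr (act V) (letters w) v) + EE q (free_act V p v)"
        using step end_word[OF v, of "letters w" q]
        by (simp add: expand_simps distrib_left scale_mult_right EE_simps expand_gen)
      also have "\<dots> = EE q (c \<odot>\<^bsub>V\<^esub> free_act V (gen w) v \<oplus>\<^bsub>V\<^esub> free_act V p v)"
        using EE_lin[of q] L.free_act_closed[OF p(1) v] L.free_act_closed[OF p(2) v] L.free_act_gen[OF step(1) v]
        unfolding lin_fns_def by simp
      also have "\<dots> = EE q (free_act V (scale c (gen w) + p) v)"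
        using L.free_act_add[OF _ p(1) v, of "scale c (gen w)"] L.free_act_scale[OF p(2) v, of c] H.T_simps(3)[OF p(2), of c] by simp
      finally show ?case .
    qed
  qed
  \<comment> \<open>The value at a class is computed from an arbitrary representative, which \<open>I_K\<close> justifies.\<close>
  define \<Psi> where "\<Psi> = fun_ext (\<lambda>(A, v). EE (expand (SOME p. p \<in> A)) v)"
  have \<Psi>_lin: "functional \<Psi>" unfolding \<Psi>_def by (rule functional_fun_ext)
  have \<Psi>_j: "\<Psi> (j p v) = EE (expand p) v" if "v \<in> carrier V" for p v
  proof -
    have "(SOME q. q \<in> G.\<kappa> p) \<in> G.\<kappa> p" using self_in_coset[OF G.subspace_I] by (rule someI)
    then have "(SOME q. q \<in> G.\<kappa> p) - p \<in> G.I" by (simp add: coset_of_def)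
    from I_K[OF this] have "EE (1 * expand ((SOME q. q \<in> G.\<kappa> p) - p) * 1) v = 0" using that by blast
    then show ?thesis by (simp add: \<Psi>_def j_def expand_simps EE_simps)
  qed
  note \<Psi>S = pmc.linear_diff[OF \<Psi>_lin] pmc.linear_scale[OF \<Psi>_lin]
  have "\<Psi> r = 0" if "r \<in> rels" for r
    using that
  proof (cases rule: rels_cases)
    case left_add then show ?thesis by (simp add: \<Psi>S \<Psi>_j expand_simps EE_simps)
  next
    case (right_add p v w) then show ?thesis
      using EE_lin[of "expand p"] unfolding lin_fns_def by (simp add: \<Psi>S \<Psi>_j)
  next
    case left_scale then show ?thesis by (simp add: \<Psi>S \<Psi>_j expand_simps EE_simps)
  next
    case (right_scale p c v) then show ?thesis
      using EE_lin[of "expand p"] unfolding lin_fns_def by (simp add: \<Psi>S \<Psi>_j)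
  next
    case balanced then show ?thesis by (simp add: \<Psi>S \<Psi>_j L.free_act_closed end_a expand_mult)
  qed
  then have N0: "\<Psi> r = 0" if "r \<in> pres.N" for r
    using pmc.linear_eq_0_on_span[OF \<Psi>_lin _ that] by blast
  have "Xi [] v0 = \<xi> v0" by (subst Xi.simps) (simp add: is_descent_def)
  then have "\<Psi> (j 1 v0) = \<xi> v0"
    using \<Psi>_j[OF assms(1), of 1] EE_word[of "[]" v0] unfolding expand_1 word_Nil by simp
  then show ?thesis using \<xi>(2) N0 by auto
qed

end

section \<open>Presented modules inside the free space\<close>

context presentation
begin

lemma module_congruences:
  assumes "is_lie_module g P" "p \<in> F" "a \<in> carrier g" "b \<in> carrier g"
  shows "a \<oplus>\<^bsub>g\<^esub> b \<in> carrier g \<Longrightarrow> lin_ext (f (a \<oplus>\<^bsub>g\<^esub> b)) p - (lin_ext (f a) p + lin_ext (f b) p) \<in> N"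
    and "c \<odot>\<^bsub>g\<^esub> a \<in> carrier g \<Longrightarrow> lin_ext (f (c \<odot>\<^bsub>g\<^esub> a)) p - scale c (lin_ext (f a) p) \<in> N"
    and "bracket g a b \<in> carrier g \<Longrightarrow>
      lin_ext (f (bracket g a b)) p - (lin_ext (f a) (lin_ext (f b) p) - lin_ext (f b) (lin_ext (f a) p)) \<in> N"
proof -
  interpret L: lie_module g P by unfold_locales (rule assms(1))
  note c = cs_in_P[OF assms(2)]
  show "a \<oplus>\<^bsub>g\<^esub> b \<in> carrier g \<Longrightarrow> lin_ext (f (a \<oplus>\<^bsub>g\<^esub> b)) p - (lin_ext (f a) p + lin_ext (f b) p) \<in> N"
    using L.add_act[OF assms(3,4) c] by (simp only: act_P assms add_P cs_eq_iff)
  show "c \<odot>\<^bsub>g\<^esub> a \<in> carrier g \<Longrightarrow> lin_ext (f (c \<odot>\<^bsub>g\<^esub> a)) p - scale c (lin_ext (f a) p) \<in> N"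
    using L.smult_act[OF assms(3) c, of c] by (simp only: act_P assms smult_P cs_eq_iff)
  show "bracket g a b \<in> carrier g \<Longrightarrow>
      lin_ext (f (bracket g a b)) p - (lin_ext (f a) (lin_ext (f b) p) - lin_ext (f b) (lin_ext (f a) p)) \<in> N"
    using L.bracket_act[OF assms(3,4) c] by (simp only: act_P assms minus_P f_F cs_eq_iff)
qed

text \<open>
  The module \<open>P\<close> transported to a subspace \<open>U\<close> of the free space by the projection along \<open>N\<close>, with
  action \<open>rho\<close>.
\<close>
definition U :: "('x \<Rightarrow>\<^sub>0 complex) set" where "U = proj N ` F"

definition rho :: "'g \<Rightarrow> ('x \<Rightarrow>\<^sub>0 complex) \<Rightarrow> ('x \<Rightarrow>\<^sub>0 complex)" where
  "rho a p = proj N (lin_ext (f a) p)"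

lemmas proj_N = plinear_proj[OF pm.subspace_span[of R]] proj_eq_0_iff[OF pm.subspace_span[of R]]
  diff_proj[OF pm.subspace_span[of R]] proj_eq_iff[OF pm.subspace_span[of R]]

lemmas proj_simps = pm2.linear_add[OF proj_N(1)] pm2.linear_scale[OF proj_N(1)] pm2.linear_0[OF proj_N(1)]
  pm2.linear_diff[OF proj_N(1)]

lemma plinear_rho: "plinear (rho a)"
  by (rule plinearI) (simp_all add: rho_def lin_ext_add lin_ext_scale proj_simps)

lemma sub_U: "pm.subspace U"
  unfolding U_def by (rule pm2.linear_subspace_image[OF proj_N(1) subspace_keys])

lemma rho_proj: "a \<in> carrier g \<Longrightarrow> rho a (proj N p) = proj N (lin_ext (f a) p)"
proof -
  assume a: "a \<in> carrier g"
  have "lin_ext (f a) (p - proj N p) \<in> N" by (rule f_N[OF a proj_N(3)])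
  then have "proj N (lin_ext (f a) (p - proj N p)) = 0" by (simp only: proj_N(2))
  then show ?thesis by (simp add: rho_def lin_ext_diff proj_simps)
qed

lemma rho_U: "a \<in> carrier g \<Longrightarrow> u \<in> U \<Longrightarrow> rho a u \<in> U"
  unfolding U_def using rho_proj f_F by blast

lemma proj_0_iff_cs: "proj N p = 0 \<longleftrightarrow> cs p = \<zero>\<^bsub>P\<^esub>"
  by (simp add: proj_N(2) zero_P cs_eq_iff)

lemma rho_module:
  assumes "is_lie_module g P" "u \<in> U" "a \<in> carrier g" "b \<in> carrier g"
  shows "a \<oplus>\<^bsub>g\<^esub> b \<in> carrier g \<Longrightarrow> rho (a \<oplus>\<^bsub>g\<^esub> b) u = rho a u + rho b u"
    and "c \<odot>\<^bsub>g\<^esub> a \<in> carrier g \<Longrightarrow> rho (c \<odot>\<^bsub>g\<^esub> a) u = scale c (rho a u)"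
    and "bracket g a b \<in> carrier g \<Longrightarrow> rho (bracket g a b) u = rho a (rho b u) - rho b (rho a u)"
proof -
  obtain p where p: "u = proj N p" "p \<in> F" using assms(2) unfolding U_def by blast
  note c = module_congruences[OF assms(1) p(2) assms(3,4), folded proj_N(4)]
  show "a \<oplus>\<^bsub>g\<^esub> b \<in> carrier g \<Longrightarrow> rho (a \<oplus>\<^bsub>g\<^esub> b) u = rho a u + rho b u"
    using c(1) by (simp add: p(1) rho_proj assms(3,4) proj_simps)
  show "c \<odot>\<^bsub>g\<^esub> a \<in> carrier g \<Longrightarrow> rho (c \<odot>\<^bsub>g\<^esub> a) u = scale c (rho a u)"
    using c(2) by (simp add: p(1) rho_proj assms(3,4) proj_simps)
  show "bracket g a b \<in> carrier g \<Longrightarrow> rho (bracket g a b) u = rho a (rho b u) - rho b (rho a u)"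
    using c(3) by (simp add: p(1) rho_proj assms(3,4) proj_simps)
qed

lemma simple_P_model:
  assumes "is_lie_module g P" "\<exists>u\<in>U. u \<noteq> 0"
    and inv: "\<And>S. pm.subspace S \<Longrightarrow> S \<subseteq> U \<Longrightarrow> (\<And>a u. a \<in> carrier g \<Longrightarrow> u \<in> S \<Longrightarrow> rho a u \<in> S) \<Longrightarrow>
      \<exists>u\<in>S. u \<noteq> 0 \<Longrightarrow> U \<subseteq> S"
  shows "simple_lie_module g P"
proof (rule simple_P[OF assms(1)])
  show "\<not> F \<subseteq> N"
  proof
    assume "F \<subseteq> N"
    then have "U \<subseteq> {0}" unfolding U_def using proj_N(2) by blast
    then show False using assms(2) by blast
  qed
  fix S assume S: "pm.subspace S" "N \<subseteq> S" "S \<subseteq> F" "\<And>a p. a \<in> carrier g \<Longrightarrow> p \<in> S \<Longrightarrow> lin_ext (f a) p \<in> S"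
  have pS: "proj N p \<in> S \<longleftrightarrow> p \<in> S" for p
  proof -
    have d: "p - proj N p \<in> S" using proj_N(3) S(2) by blast
    show ?thesis
      using pm.subspace_add[OF S(1) _ d, of "proj N p"] pm.subspace_diff[OF S(1) _ d, of p] by auto
  qed
  let ?S = "proj N ` S"
  show "S \<subseteq> N \<or> F \<subseteq> S"
  proof (cases "S \<subseteq> N")
    case False
    have "U \<subseteq> ?S"
    proof (rule inv)
      show "pm.subspace ?S" by (rule pm2.linear_subspace_image[OF proj_N(1) S(1)])
      show "?S \<subseteq> U" unfolding U_def using S(3) by blast
      show "rho a u \<in> ?S" if a: "a \<in> carrier g" and u: "u \<in> ?S" for a u
      proof -
        obtain p where p: "u = proj N p" "p \<in> S" using u by (rule imageE)
        show ?thesis unfolding p(1) rho_proj[OF a] by (rule imageI[OF S(4)[OF a p(2)]])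
      qed
      obtain p where p: "p \<in> S" "p \<notin> N" using False by (meson subsetI)
      show "\<exists>u\<in>?S. u \<noteq> 0" using p proj_N(2)[of p] by (intro bexI[of _ "proj N p"]) auto
    qed
    then have US: "proj N ` F \<subseteq> ?S" unfolding U_def .
    have "p \<in> S" if p: "p \<in> F" for p
    proof -
      have "proj N p \<in> ?S" by (rule subsetD[OF US imageI[OF p]])
      then obtain q where q: "q \<in> S" "proj N p = proj N q" by (rule imageE)
      then show ?thesis using pS[of p] pS[of q] by simp
    qed
    then show ?thesis by (intro disjI2 subsetI)
  qed blast
qed

end

section \<open>Induced modules of the twisted Heisenberg-Virasoro algebra\<close>

lemma hv_alg_simps [simp]:
  "carrier hv_alg = UNIV" "zero hv_alg = 0" "add hv_alg = (+)" "smult hv_alg = scale"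
  by (simp_all add: hv_alg_def)

lemma hv_bracket: "bracket hv_alg x y = lin_ext (\<lambda>a. lin_ext (basis_bracket a) y) x"
  by (simp add: hv_alg_def)

lemma hv_bracket_gen [simp]: "bracket hv_alg (gen a) (gen b) = basis_bracket a b"
  by (simp add: hv_bracket)

lemma hv_sub_simps [simp]:
  "zero (hv_sub e) = 0" "add (hv_sub e) = (+)" "smult (hv_sub e) = scale" "bracket (hv_sub e) = bracket hv_alg"
  by (simp_all add: hv_sub_def hv_alg_def)

text \<open>
  An injective rank that is nonnegative exactly on the basis of the subalgebra \<open>H\<^sub>e\<close>: residues modulo
  \<open>5\<close> tell the five kinds of basis elements apart.
\<close>
fun hv_rank :: "nat \<Rightarrow> hv_basis \<Rightarrow> int" where
  "hv_rank e (BL m) = 5 * m"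
| "hv_rank e (BI m) = 5 * (m + int e) + 1"
| "hv_rank e BC1 = 2"
| "hv_rank e BC2 = 3"
| "hv_rank e BC3 = 4"

lemma hv_rank_inj: "hv_rank e a = hv_rank e b \<Longrightarrow> a = b"
  by (cases a; cases b; simp; presburger)

lemma carrier_hv_sub: "carrier (hv_sub e) = {x. Poly_Mapping.keys x \<subseteq> {b. hv_rank e b \<ge> 0}}"
proof -
  have "{BL m | m. 0 \<le> m} \<union> {BI (m - int e) | m. 0 \<le> m} \<union> {BC1, BC2, BC3} = {b. hv_rank e b \<ge> 0}"
  proof (rule Set.set_eqI)
    fix b show "b \<in> {BL m | m. 0 \<le> m} \<union> {BI (m - int e) | m. 0 \<le> m} \<union> {BC1, BC2, BC3} \<longleftrightarrow> b \<in> {b. hv_rank e b \<ge> 0}"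
    proof (cases b)
      case (BI m)
      have "(\<exists>m'. m = m' - int e \<and> 0 \<le> m') \<longleftrightarrow> 0 \<le> m + int e"
        by (auto intro: exI[of _ "m + int e"])
      also have "\<dots> \<longleftrightarrow> 0 \<le> 5 * (m + int e) + 1" by presburger
      finally show ?thesis using BI by simp
    qed auto
  qed
  then show ?thesis by (simp add: hv_sub_def)
qed

lemma basis_bracket_closed:
  "basis_bracket (BL m) (BL n) = scale (of_int n - of_int m) (L_elt (m + n)) +
     scale (if m + n = 0 then (of_int m ^ 3 - of_int m) / 12 else 0) C1_elt"
  "basis_bracket (BL m) (BI n) = scale (of_int n) (I_elt (m + n)) +
     scale (if m + n = 0 then of_int m ^ 2 + of_int m else 0) C2_elt"
  "basis_bracket (BI n) (BL m) = - (scale (of_int n) (I_elt (m + n)) +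
     scale (if m + n = 0 then of_int m ^ 2 + of_int m else 0) C2_elt)"
  "basis_bracket (BI m) (BI n) = scale (if m + n = 0 then of_int n else 0) C3_elt"
  by simp_all

lemma basis_bracket_anti: "basis_bracket a b = - basis_bracket b a"
proof -
  have 1: "basis_bracket (BL m) (BL n) = - basis_bracket (BL n) (BL m)" for m n
  proof (cases "m + n = 0")
    case True
    then have "n = - m" by simp
    then show ?thesis
      by (simp add: power3_eq_cube flip: pm.scale_minus_left add: pm.scale_left_distrib[symmetric])
         (simp add: diff_divide_distrib)
  next
    case False
    then have "n + m \<noteq> 0" by simp
    with False show ?thesis by (simp add: add.commute flip: pm.scale_minus_left)
  qed
  have 2: "basis_bracket (BI m) (BI n) = - basis_bracket (BI n) (BI m)" for m n
  proof (cases "m + n = 0")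
    case True
    then have "n = - m" by simp
    then show ?thesis by (simp flip: pm.scale_minus_left)
  qed (simp add: add.commute)
  show ?thesis by (cases a; cases b; simp only: 1[symmetric] 2[symmetric]; simp)
qed

text \<open>
  The Jacobi expression is alternating, which leaves four combinations of kinds of non-central elements to be
  computed. The central terms appear only when the indices add up to \<open>0\<close>.
\<close>
lemma basis_bracket_jacobi:
  "lin_ext (\<lambda>d. basis_bracket d a) (basis_bracket c b) - lin_ext (\<lambda>d. basis_bracket d b) (basis_bracket c a)
     + lin_ext (\<lambda>d. basis_bracket d c) (basis_bracket b a) = 0"
proof -
  define J where "J a b c = lin_ext (\<lambda>d. basis_bracket d a) (basis_bracket c b)
     - lin_ext (\<lambda>d. basis_bracket d b) (basis_bracket c a)
     + lin_ext (\<lambda>d. basis_bracket d c) (basis_bracket b a)" for a b c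
  note S = basis_bracket_closed lin_ext_add lin_ext_neg lin_ext_diff lin_ext_scale lin_ext_gen basis_bracket.simps(5-)
    lookup_add lookup_minus lookup_uminus lookup_scale lookup_zero lookup_single when_def
  have s12: "J b a c = - J a b c" for a b c
    using basis_bracket_anti[of b a] by (simp add: J_def lin_ext_neg)
  have s23: "J a c b = - J a b c" for a b c
    using basis_bracket_anti[of b c] by (simp add: J_def lin_ext_neg)
  have LLL: "J (BL a) (BL b) (BL c) = 0" for a b c
  proof (cases "a + b + c = 0")
    case True
    then have c: "c = - a - b" by simp
    show ?thesis unfolding J_def c
      by (rule poly_mapping_eqI) (simp add: S del: basis_bracket.simps(1-4), simp add: field_simps power3_eq_cube)
  next
    case False
    then have n: "c + b + a \<noteq> 0" "c + a + b \<noteq> 0" "b + a + c \<noteq> 0" by simp_all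
    have e: "c + a + b = c + b + a" "b + a + c = c + b + a" by simp_all
    show ?thesis unfolding J_def
      by (rule poly_mapping_eqI) (simp add: S n e del: basis_bracket.simps(1-4), simp add: algebra_simps)
  qed
  have LLI: "J (BL a) (BL b) (BI c) = 0" for a b c
  proof (cases "a + b + c = 0")
    case True
    then have c: "c = - a - b" by simp
    show ?thesis unfolding J_def c
      by (rule poly_mapping_eqI) (simp add: S del: basis_bracket.simps(1-4), simp add: field_simps power2_eq_square)
  next
    case False
    then have n: "a + (b + c) \<noteq> 0" "b + (a + c) \<noteq> 0" "b + a + c \<noteq> 0" by simp_all
    have e: "a + (b + c) = b + a + c" "b + (a + c) = b + a + c" by simp_all
    show ?thesis unfolding J_def
      by (rule poly_mapping_eqI) (simp add: S n e del: basis_bracket.simps(1-4), simp add: algebra_simps)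
  qed
  have LII: "J (BL a) (BI b) (BI c) = 0" for a b c
    unfolding J_def
    by (rule poly_mapping_eqI) (simp add: S algebra_simps del: basis_bracket.simps(1-4))
  have III: "J (BI a) (BI b) (BI c) = 0" for a b c
    unfolding J_def by (simp add: S del: basis_bracket.simps(1-4))
  have LIL: "J (BL a) (BI b) (BL c) = 0" for a b c using LLI s23[of "BL a" "BL c" "BI b"] by simp
  have ILL: "J (BI a) (BL b) (BL c) = 0" for a b c using LIL s12[of "BL b" "BI a" "BL c"] by simp
  have ILI: "J (BI a) (BL b) (BI c) = 0" for a b c using LII s12[of "BL b" "BI a" "BI c"] by simp
  have IIL: "J (BI a) (BI b) (BL c) = 0" for a b c using ILI s23[of "BI a" "BL c" "BI b"] by simp
  have center: "basis_bracket x d = 0" "basis_bracket d x = 0" if "x \<in> {BC1, BC2, BC3}" for x d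
    using that by (cases d; auto)+
  have z: "lin_ext (\<lambda>d. 0) p = 0" for p :: hv by (simp add: lin_ext_def)
  have cc: "J x b c = 0" "J b x c = 0" "J b c x = 0" if "x \<in> {BC1, BC2, BC3}" for x b c
    using center[OF that] by (simp_all add: J_def z)
  have "J a b c = 0"
  proof (cases "a \<in> {BC1, BC2, BC3} \<or> b \<in> {BC1, BC2, BC3} \<or> c \<in> {BC1, BC2, BC3}")
    case True
    then show ?thesis using cc(1)[of a b c] cc(2)[of b a c] cc(3)[of c a b] by blast
  next
    case False
    then have "(\<exists>m. a = BL m) \<or> (\<exists>m. a = BI m)" "(\<exists>m. b = BL m) \<or> (\<exists>m. b = BI m)"
      "(\<exists>m. c = BL m) \<or> (\<exists>m. c = BI m)"
      by (cases a, simp_all) (cases b, simp_all, cases c, simp_all)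
    then show ?thesis
      by (elim disjE exE) (simp_all only: LLL LLI LII III LIL ILL ILI IIL)
  qed
  then show ?thesis by (simp only: J_def)
qed

lemma basis_bracket_rank:
  "hv_rank e a \<ge> 0 \<Longrightarrow> hv_rank e b \<ge> 0 \<Longrightarrow> Poly_Mapping.keys (basis_bracket a b) \<subseteq> {b. hv_rank e b \<ge> 0}"
proof -
  assume ab: "hv_rank e a \<ge> 0" "hv_rank e b \<ge> 0"
  let ?S = "{p :: hv. Poly_Mapping.keys p \<subseteq> {b. hv_rank e b \<ge> 0}}"
  note S = pm.subspace_add[OF subspace_keys] pm.subspace_scale[OF subspace_keys] pm.subspace_0[OF subspace_keys]
    pm.subspace_neg[OF subspace_keys]
  have g: "scale c (gen d) \<in> ?S" if "hv_rank e d \<ge> 0" for c d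
    by (rule pm.subspace_scale[OF subspace_keys]) (use that in auto)
  have "basis_bracket a b \<in> ?S"
  proof (cases a; cases b)
    fix m n assume "a = BL m" "b = BL n"
    then show ?thesis using ab by (simp only: basis_bracket_closed) (intro S g; simp)
  next
    fix m n assume "a = BL m" "b = BI n"
    then show ?thesis using ab by (simp only: basis_bracket_closed) (intro S g; simp)
  next
    fix m n assume "a = BI m" "b = BL n"
    then show ?thesis using ab by (simp only: basis_bracket_closed) (intro S g; simp)
  next
    fix m n assume "a = BI m" "b = BI n"
    then show ?thesis using ab by (simp only: basis_bracket_closed) (intro S g; simp)
  qed auto
  then show ?thesis by simp
qed

lemma lie_closed_hv_alg: "lie_closed hv_alg"
  by (simp add: lie_closed_def)

lemma lie_closed_hv_sub: "lie_closed (hv_sub e)"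
proof -
  let ?S = "{p :: hv. Poly_Mapping.keys p \<subseteq> {b. hv_rank e b \<ge> 0}}"
  note sub = subspace_keys[of "{b. hv_rank e b \<ge> 0}"]
  have "bracket hv_alg x y \<in> ?S" if "x \<in> ?S" "y \<in> ?S" for x y
  proof -
    have "lin_ext (basis_bracket a) y \<in> ?S" if "hv_rank e a \<ge> 0" for a
      unfolding lin_ext_def
      by (rule pm.subspace_sum[OF sub], rule pm.subspace_scale[OF sub])
         (use that \<open>y \<in> ?S\<close> basis_bracket_rank in blast)
    then show ?thesis
      unfolding hv_bracket lin_ext_def[of _ x]
      by (intro pm.subspace_sum[OF sub] pm.subspace_scale[OF sub]) (use \<open>x \<in> ?S\<close> in blast)
  qed
  moreover have "x + y \<in> ?S" if "x \<in> ?S" "y \<in> ?S" for x y by (rule pm.subspace_add[OF sub that])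
  moreover have "scale c x \<in> ?S" if "x \<in> ?S" for c x by (rule pm.subspace_scale[OF sub that])
  ultimately show ?thesis unfolding lie_closed_def carrier_hv_sub hv_sub_simps by blast
qed

text \<open>
  The module \<open>M\<close> and the scalars for a fixed \<open>k\<close>, with the value \<open>c\<^sub>3 = 0\<close> inserted.
\<close>
locale hv_induced =
  fixes e :: nat and M :: "(hv, 'v) lie_mod" and c0 c1 c2 :: complex and k :: nat
  assumes M_simple: "simple_lie_module (hv_sub e) M"
    and I0: "\<And>v. v \<in> carrier M \<Longrightarrow> act M (I_elt 0) v = c0 \<odot>\<^bsub>M\<^esub> v"
    and C1: "\<And>v. v \<in> carrier M \<Longrightarrow> act M C1_elt v = c1 \<odot>\<^bsub>M\<^esub> v"
    and C2: "\<And>v. v \<in> carrier M \<Longrightarrow> act M C2_elt v = c2 \<odot>\<^bsub>M\<^esub> v"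
    and C3: "\<And>v. v \<in> carrier M \<Longrightarrow> act M C3_elt v = 0 \<odot>\<^bsub>M\<^esub> v"
    and inj_I: "k \<noteq> 0 \<Longrightarrow> inj_on (act M (I_elt (int k))) (carrier M)"
    and nz: "k = 0 \<Longrightarrow> n \<noteq> (0 :: int) \<Longrightarrow> c0 + (of_int n - 1) * c2 \<noteq> 0"
    and I_kill: "n > int k \<Longrightarrow> v \<in> carrier M \<Longrightarrow> act M (I_elt n) v = \<zero>\<^bsub>M\<^esub>"
    and L_kill: "n > int k + int e \<Longrightarrow> v \<in> carrier M \<Longrightarrow> act M (L_elt n) v = \<zero>\<^bsub>M\<^esub>"
begin

lemma is_lie_module_M: "is_lie_module (hv_sub e) M"
  using M_simple by (simp add: simple_lie_module_def)

sublocale ib: induced_basis hv_alg "hv_sub e" M basis_bracket "hv_rank e"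
proof unfold_locales
  show "lie_closed hv_alg" by (rule lie_closed_hv_alg)
  show "lie_closed (hv_sub e)" by (rule lie_closed_hv_sub)
  show "is_lie_module (hv_sub e) M" by (rule is_lie_module_M)
  show "carrier (hv_sub e) = {x. Poly_Mapping.keys x \<subseteq> {b. hv_rank e b \<ge> 0}}" by (rule carrier_hv_sub)
  show "hv_rank e a = hv_rank e b \<Longrightarrow> a = b" for a b by (rule hv_rank_inj)
  show "basis_bracket a b = - basis_bracket b a" for a b by (rule basis_bracket_anti)
  show "lin_ext (\<lambda>d. basis_bracket d a) (basis_bracket c b) - lin_ext (\<lambda>d. basis_bracket d b) (basis_bracket c a)
     + lin_ext (\<lambda>d. basis_bracket d c) (basis_bracket b a) = 0" for a b c by (rule basis_bracket_jacobi)
qed (simp_all add: hv_bracket)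

abbreviation "U \<equiv> ib.pres.U"
abbreviation "rho \<equiv> ib.pres.rho"
abbreviation "\<pi> \<equiv> proj ib.pres.N"

text \<open>
  The canonical map from \<open>M\<close> to the induced module.
\<close>
definition \<iota> :: "'v \<Rightarrow> _" where "\<iota> v = \<pi> (ib.j 1 v)"

definition "M0 = \<iota> ` carrier M"

lemmas rho_lin = pm2.linear_add[OF ib.pres.plinear_rho] pm2.linear_scale[OF ib.pres.plinear_rho]
  pm2.linear_0[OF ib.pres.plinear_rho] pm2.linear_diff[OF ib.pres.plinear_rho]
  pm2.linear_neg[OF ib.pres.plinear_rho]

lemma rho_add: "u \<in> U \<Longrightarrow> rho (a + b) u = rho a u + rho b u"
  and rho_scale: "u \<in> U \<Longrightarrow> rho (scale c a) u = scale c (rho a u)"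
  and rho_bracket: "u \<in> U \<Longrightarrow> rho (bracket hv_alg a b) u = rho a (rho b u) - rho b (rho a u)"
  using ib.pres.rho_module[OF ib.is_lie_module_ind, of u a b] ib.pres.rho_module(2)[OF ib.is_lie_module_ind, of u a a c]
  by simp_all

lemma rho_zero: "u \<in> U \<Longrightarrow> rho 0 u = 0"
  using rho_scale[of u 0 0] by simp

lemma rho_U: "u \<in> U \<Longrightarrow> rho a u \<in> U"
  using ib.pres.rho_U[of a u] by simp

lemma one_T: "1 \<in> carrier ib.G.T" "1 \<in> carrier ib.H.T"
  by (rule one_in_free_algebra)+

lemma j_F: "p \<in> carrier ib.G.T \<Longrightarrow> v \<in> carrier M \<Longrightarrow> ib.j p v \<in> ib.pres.F"
  using ib.keys_j by blast

lemma \<iota>_U: "v \<in> carrier M \<Longrightarrow> \<iota> v \<in> U"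
  unfolding \<iota>_def ib.pres.U_def by (intro imageI j_F one_T)

lemma rho_j: "p \<in> carrier ib.G.T \<Longrightarrow> rho a (\<pi> (ib.j p v)) = \<pi> (ib.j (letter a * p) v)"
  using ib.pres.rho_proj[of a "ib.j p v"] ib.lin_ext_ind_act_j[of a p v] by simp

lemma \<iota>_add: "v \<in> carrier M \<Longrightarrow> w \<in> carrier M \<Longrightarrow> \<iota> (v \<oplus>\<^bsub>M\<^esub> w) = \<iota> v + \<iota> w"
proof -
  assume vw: "v \<in> carrier M" "w \<in> carrier M"
  have "ib.j 1 (v \<oplus>\<^bsub>M\<^esub> w) - ib.j 1 v - ib.j 1 w \<in> ib.pres.N"
    by (rule pm.span_base[OF ib.rel_right_add[OF one_T(1) vw]])
  then have "ib.j 1 (v \<oplus>\<^bsub>M\<^esub> w) - (ib.j 1 v + ib.j 1 w) \<in> ib.pres.N" by (simp only: diff_diff_eq)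
  then show ?thesis
    unfolding \<iota>_def by (simp only: ib.pres.proj_N(4)[symmetric] ib.pres.proj_simps)
qed

lemma \<iota>_smult: "v \<in> carrier M \<Longrightarrow> \<iota> (c \<odot>\<^bsub>M\<^esub> v) = scale c (\<iota> v)"
  using pm.span_base[OF ib.rel_right_scale[OF one_T(1), of v c]]
  unfolding \<iota>_def by (simp only: ib.pres.proj_N(4)[symmetric] ib.pres.proj_simps)

lemma \<iota>_act: "x \<in> carrier (hv_sub e) \<Longrightarrow> v \<in> carrier M \<Longrightarrow> rho x (\<iota> v) = \<iota> (act M x v)"
proof -
  assume xv: "x \<in> carrier (hv_sub e)" "v \<in> carrier M"
  have l: "letter x \<in> carrier ib.H.T" by (rule ib.H.letter_T[OF xv(1)])
  have "rho x (\<iota> v) = \<pi> (ib.j (1 * letter x) v)" unfolding \<iota>_def rho_j[OF one_T(1)] by simp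
  also have "\<dots> = \<pi> (ib.j 1 (free_act M (letter x) v))"
    using pm.span_base[OF ib.rel_balanced[OF one_T(1) l xv(2)]] by (simp only: ib.pres.proj_N(4)[symmetric])
  also have "free_act M (letter x) v = act M x v" by (rule ib.L.free_act_letter[OF xv])
  finally show ?thesis by (simp only: \<iota>_def)
qed

lemma \<iota>_zero: "\<iota> \<zero>\<^bsub>M\<^esub> = 0"
  using \<iota>_smult[of "\<zero>\<^bsub>M\<^esub>" 0] by simp

text \<open>
  The embedding of \<open>M\<close>, by the Poincare-Birkhoff-Witt argument.
\<close>
lemma \<iota>_eq_0: "v \<in> carrier M \<Longrightarrow> \<iota> v = 0 \<longleftrightarrow> v = \<zero>\<^bsub>M\<^esub>"
  using ib.nonvanishing[of v] \<iota>_zero ib.pres.proj_N(2) unfolding \<iota>_def by blast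

lemma generated_rho:
  assumes "pm.subspace Z" "M0 \<subseteq> Z" "\<And>b u. u \<in> Z \<Longrightarrow> u \<in> U \<Longrightarrow> rho (gen b) u \<in> Z"
  shows "U \<subseteq> Z"
proof -
  let ?Z = "Z \<inter> U"
  have subZ: "pm.subspace ?Z" by (rule pm.subspace_inter[OF assms(1) ib.pres.sub_U])
  have rZ: "rho x u \<in> ?Z" if u: "u \<in> ?Z" for x u
  proof -
    have "Poly_Mapping.keys x \<subseteq> UNIV" by simp
    then show ?thesis
    proof (induction rule: pm_induct)
      case zero
      then show ?case using u rho_zero pm.subspace_0[OF subZ] by simp
    next
      case (step c b p)
      have "rho (gen b) u \<in> ?Z" using assms(3) u rho_U by blast
      then show ?case
        using step u pm.subspace_add[OF subZ] pm.subspace_scale[OF subZ] by (simp only: rho_add rho_scale Int_iff)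
    qed
  qed
  have words: "\<pi> (ib.j (word xs) v) \<in> ?Z" if v: "v \<in> carrier M" for xs v
  proof (induction xs)
    case Nil
    then show ?case using assms(2) \<iota>_U[OF v] v unfolding M0_def \<iota>_def word_Nil by blast
  next
    case (Cons x xs)
    have "word xs \<in> carrier ib.G.T" by (simp add: carrier_free_algebra)
    then have "rho x (\<pi> (ib.j (word xs) v)) = \<pi> (ib.j (letter x * word xs) v)" by (rule rho_j)
    then show ?case using rZ[OF Cons, of x] by (simp only: word_mult append.simps)
  qed
  have all: "\<pi> (ib.j p v) \<in> ?Z" if v: "v \<in> carrier M" for p v
  proof -
    have T: "q \<in> carrier ib.G.T" for q by (simp add: carrier_free_algebra)
    have "Poly_Mapping.keys p \<subseteq> UNIV" by simp
    then show ?thesis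
    proof (induction rule: pm_induct)
      case zero
      have "\<pi> (ib.j (scale 0 1) v) = scale 0 (\<pi> (ib.j 1 v))"
        using ib.j_scale_left[OF T v, of 0 1] by (simp only: ib.pres.proj_N(4)[symmetric] ib.pres.proj_simps)
      then show ?case using pm.subspace_0[OF subZ] by simp
    next
      case (step c w p)
      have "\<pi> (ib.j (scale c (gen w) + p) v) = \<pi> (ib.j (scale c (gen w)) v) + \<pi> (ib.j p v)"
        using ib.j_add_left[OF T T v] by (simp only: ib.pres.proj_N(4)[symmetric] ib.pres.proj_simps)
      also have "\<pi> (ib.j (scale c (gen w)) v) = scale c (\<pi> (ib.j (gen w) v))"
        using ib.j_scale_left[OF T v] by (simp only: ib.pres.proj_N(4)[symmetric] ib.pres.proj_simps)
      finally have eq: "\<pi> (ib.j (scale c (gen w) + p) v) = scale c (\<pi> (ib.j (gen w) v)) + \<pi> (ib.j p v)" .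
      have "\<pi> (ib.j (gen w) v) \<in> ?Z" using words[OF v, of "letters w"] by simp
      then show ?case unfolding eq by (intro pm.subspace_add[OF subZ] pm.subspace_scale[OF subZ] step(3))
    qed
  qed
  have "\<pi> p \<in> ?Z" if p: "p \<in> ib.pres.F" for p
  proof -
    have "Poly_Mapping.keys p \<subseteq> ib.gens" using p by simp
    then show ?thesis
    proof (induction rule: pm_induct)
      case zero
      then show ?case using pm.subspace_0[OF subZ] by (simp add: ib.pres.proj_simps)
    next
      case (step c x p)
      obtain A v where x: "x = (A, v)" "A \<in> carrier (env hv_alg)" "v \<in> carrier M" using step(1) by (rule SigmaE) blast
      then obtain q where q: "x = (ib.G.\<kappa> q, v)" unfolding ib.G.carrier_env by blast
      have "\<pi> (gen x) \<in> ?Z" using all[OF x(3), of q] unfolding q ib.j_def .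
      then show ?case
        unfolding ib.pres.proj_simps by (intro pm.subspace_add[OF subZ] pm.subspace_scale[OF subZ] step(3))
    qed
  qed
  then show ?thesis unfolding ib.pres.U_def by blast
qed

text \<open>
  A central element that acts on \<open>M\<close> by a scalar acts on the whole module by it, since the vectors on which it
  does form a submodule that contains \<open>M\<close>.
\<close>
lemma scalar_on_U:
  assumes "c_elt \<in> carrier (hv_sub e)" "\<And>b. bracket hv_alg c_elt (gen b) = 0"
    and "\<And>v. v \<in> carrier M \<Longrightarrow> act M c_elt v = c \<odot>\<^bsub>M\<^esub> v" and "u \<in> U"
  shows "rho c_elt u = scale c u"
proof -
  let ?Z = "{u \<in> U. rho c_elt u = scale c u}"
  have "U \<subseteq> ?Z"
  proof (rule generated_rho)
    show "pm.subspace ?Z"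
    proof (rule pm.subspaceI)
      show "0 \<in> ?Z" using pm.subspace_0[OF ib.pres.sub_U] by (simp add: rho_lin)
      show "x + y \<in> ?Z" if "x \<in> ?Z" "y \<in> ?Z" for x y
        using that pm.subspace_add[OF ib.pres.sub_U, of x y] by (simp add: rho_lin pm.scale_right_distrib)
      show "scale t x \<in> ?Z" if "x \<in> ?Z" for t x
        using that pm.subspace_scale[OF ib.pres.sub_U, of x t] by (simp add: rho_lin mult.commute)
    qed
    show "M0 \<subseteq> ?Z"
      using assms(1,3) by (auto simp: M0_def \<iota>_act \<iota>_smult \<iota>_U)
    fix b x assume "x \<in> ?Z" and x: "x \<in> U"
    then have "rho c_elt x = scale c x" by simp
    moreover have "0 = rho c_elt (rho (gen b) x) - rho (gen b) (rho c_elt x)"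
      using rho_bracket[OF x, of c_elt "gen b"] rho_zero[OF x] by (simp add: assms(2))
    ultimately show "rho (gen b) x \<in> ?Z"
      using rho_U[OF x] by (simp add: rho_lin)
  qed
  then show ?thesis using assms(4) by blast
qed

lemma in_sub: "hv_rank e b \<ge> 0 \<Longrightarrow> gen b \<in> carrier (hv_sub e)"
  by (simp add: carrier_hv_sub)

lemma rho_C1: "u \<in> U \<Longrightarrow> rho C1_elt u = scale c1 u"
  by (rule scalar_on_U[OF in_sub]) (use C1 in auto)

lemma rho_C2: "u \<in> U \<Longrightarrow> rho C2_elt u = scale c2 u"
  by (rule scalar_on_U[OF in_sub]) (use C2 in auto)

lemma rho_C3: "u \<in> U \<Longrightarrow> rho C3_elt u = 0"
proof -
  assume "u \<in> U"
  then have "rho C3_elt u = scale 0 u" by (intro scalar_on_U[OF in_sub]) (use C3 in auto)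
  then show ?thesis by simp
qed

lemma rho_I0: "u \<in> U \<Longrightarrow> rho (I_elt 0) u = scale c0 u"
proof (rule scalar_on_U[OF in_sub])
  show "bracket hv_alg (I_elt 0) (gen b) = 0" for b
    unfolding hv_bracket_gen by (cases b) auto
qed (use I0 in auto)

sublocale low: lowering U M0 "\<lambda>n. rho (L_elt n)" "\<lambda>n. rho (I_elt n)" k e c0 c1 c2
proof (rule lowering.intro)
  show "pm.subspace U" by (rule ib.pres.sub_U)
  show "plinear (rho (L_elt n))" "plinear (rho (I_elt n))" for n by (rule ib.pres.plinear_rho)+
  show "rho (L_elt n) x \<in> U" "rho (I_elt n) x \<in> U" if "x \<in> U" for n x using rho_U[OF that] by simp_all
  show "rho (L_elt a) (rho (L_elt b) x) = rho (L_elt b) (rho (L_elt a) x) + scale (of_int (b - a)) (rho (L_elt (a + b)) x)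
      + (if a + b = 0 then scale ((of_int a ^ 3 - of_int a) / 12 * c1) x else 0)" if x: "x \<in> U" for a b x
  proof -
    have "rho (L_elt a) (rho (L_elt b) x) - rho (L_elt b) (rho (L_elt a) x) = rho (basis_bracket (BL a) (BL b)) x"
      using rho_bracket[OF x, of "L_elt a" "L_elt b"] by (simp only: hv_bracket_gen)
    also have "\<dots> = scale (of_int (b - a)) (rho (L_elt (a + b)) x)
        + (if a + b = 0 then scale ((of_int a ^ 3 - of_int a) / 12 * c1) x else 0)"
      unfolding basis_bracket.simps(1) rho_add[OF x] by (auto simp: rho_scale[OF x] rho_zero[OF x] rho_C1[OF x])
    finally show ?thesis by (simp add: algebra_simps)
  qed
  show "rho (L_elt a) (rho (I_elt b) x) = rho (I_elt b) (rho (L_elt a) x) + scale (of_int b) (rho (I_elt (a + b)) x)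
      + (if a + b = 0 then scale ((of_int a ^ 2 + of_int a) * c2) x else 0)" if x: "x \<in> U" for a b x
  proof -
    have "rho (L_elt a) (rho (I_elt b) x) - rho (I_elt b) (rho (L_elt a) x) = rho (basis_bracket (BL a) (BI b)) x"
      using rho_bracket[OF x, of "L_elt a" "I_elt b"] by (simp only: hv_bracket_gen)
    also have "\<dots> = scale (of_int b) (rho (I_elt (a + b)) x)
        + (if a + b = 0 then scale ((of_int a ^ 2 + of_int a) * c2) x else 0)"
      unfolding basis_bracket.simps(2) rho_add[OF x] by (auto simp: rho_scale[OF x] rho_zero[OF x] rho_C2[OF x])
    finally show ?thesis by (simp add: algebra_simps)
  qed
  show "rho (I_elt a) (rho (I_elt b) x) = rho (I_elt b) (rho (I_elt a) x)" if x: "x \<in> U" for a b x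
  proof -
    have "rho (I_elt a) (rho (I_elt b) x) - rho (I_elt b) (rho (I_elt a) x) = rho (basis_bracket (BI a) (BI b)) x"
      using rho_bracket[OF x, of "I_elt a" "I_elt b"] by (simp only: hv_bracket_gen)
    also have "\<dots> = 0"
      unfolding basis_bracket.simps(4) by (auto simp: rho_scale[OF x] rho_zero[OF x] rho_C3[OF x])
    finally show ?thesis by simp
  qed
  show "rho (I_elt 0) x = scale c0 x" if "x \<in> U" for x by (rule rho_I0[OF that])
  show "pm.subspace M0"
  proof (rule pm.subspaceI)
    show "0 \<in> M0" unfolding M0_def using \<iota>_zero by (metis image_eqI ib.L.V.zero_closed)
    show "x + y \<in> M0" if xy: "x \<in> M0" "y \<in> M0" for x y
    proof -
      obtain v w where "x = \<iota> v" "y = \<iota> w" "v \<in> carrier M" "w \<in> carrier M" using xy unfolding M0_def by blast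
      then show ?thesis unfolding M0_def by (metis \<iota>_add image_eqI ib.L.V.a_closed)
    qed
    show "scale c x \<in> M0" if x: "x \<in> M0" for c x
    proof -
      obtain v where "x = \<iota> v" "v \<in> carrier M" using x unfolding M0_def by blast
      then show ?thesis unfolding M0_def by (metis \<iota>_smult image_eqI ib.L.smult_simps(1))
    qed
  qed
  show "M0 \<subseteq> U" unfolding M0_def using \<iota>_U by blast
  have act_M0: "rho (gen b) v \<in> M0" if "v \<in> M0" "hv_rank e b \<ge> 0" for b v
  proof -
    obtain w where w: "v = \<iota> w" "w \<in> carrier M" using \<open>v \<in> M0\<close> unfolding M0_def by blast
    show ?thesis
      unfolding w(1) \<iota>_act[OF in_sub[OF that(2)] w(2)] M0_def
      by (rule imageI) (rule ib.L.act_closed[OF in_sub[OF that(2)] w(2)])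
  qed
  show "rho (L_elt n) v \<in> M0" if "v \<in> M0" "n \<ge> 0" for n v
    by (rule act_M0) (use that in auto)
  show "rho (I_elt n) v \<in> M0" if "v \<in> M0" "n \<ge> - int e" for n v
    by (rule act_M0) (use that in auto)
  show "rho (I_elt n) v = 0" if v: "v \<in> M0" and n: "n > int k" for n v
  proof -
    obtain w where w: "v = \<iota> w" "w \<in> carrier M" using v unfolding M0_def by blast
    have "hv_rank e (BI n) \<ge> 0" using n by simp
    then show ?thesis using \<iota>_act[OF in_sub w(2)] I_kill[OF n w(2)] by (simp only: w(1) \<iota>_zero)
  qed
  show "rho (L_elt n) v = 0" if v: "v \<in> M0" and n: "n > int k + int e" for n v
  proof -
    obtain w where w: "v = \<iota> w" "w \<in> carrier M" using v unfolding M0_def by blast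
    have "hv_rank e (BL n) \<ge> 0" using n by simp
    then show ?thesis using \<iota>_act[OF in_sub w(2)] L_kill[OF n w(2)] by (simp only: w(1) \<iota>_zero)
  qed
  show "v = 0" if k0: "k \<noteq> 0" and v: "v \<in> M0" "rho (I_elt (int k)) v = 0" for v
  proof -
    obtain w where w: "v = \<iota> w" "w \<in> carrier M" using v unfolding M0_def by blast
    have s: "I_elt (int k) \<in> carrier (hv_sub e)" by (rule in_sub) simp
    have "\<iota> (act M (I_elt (int k)) w) = 0" using \<iota>_act[OF s w(2)] v(2) by (simp only: w(1))
    then have "act M (I_elt (int k)) w = \<zero>\<^bsub>M\<^esub>"
      using \<iota>_eq_0 ib.L.act_closed[OF s w(2)] by blast
    also have "\<dots> = act M (I_elt (int k)) \<zero>\<^bsub>M\<^esub>" by (rule ib.L.act_zero[OF s, symmetric])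
    finally have "w = \<zero>\<^bsub>M\<^esub>" using inj_onD[OF inj_I[OF k0]] w(2) by blast
    then show ?thesis by (simp only: w(1) \<iota>_zero)
  qed
  show "c0 + (of_int n - 1) * c2 \<noteq> 0" if "k = 0" "n \<noteq> 0" for n :: int
    by (rule nz[OF that])
  show "U \<subseteq> Z" if Z: "pm.subspace Z" "M0 \<subseteq> Z" "\<And>n x. x \<in> Z \<Longrightarrow> x \<in> U \<Longrightarrow> rho (L_elt n) x \<in> Z"
      "\<And>n x. x \<in> Z \<Longrightarrow> x \<in> U \<Longrightarrow> rho (I_elt n) x \<in> Z" for Z
  proof (rule generated_rho[OF Z(1,2)])
    fix b u assume u: "u \<in> Z" "u \<in> U"
    then show "rho (gen b) u \<in> Z"
      using Z(3,4)[OF u] pm.subspace_scale[OF Z(1) u(1)] pm.subspace_0[OF Z(1)]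
      by (cases b) (simp_all add: rho_C1 rho_C2 rho_C3)
  qed
qed

text \<open>
  A nonzero submodule meets the image of \<open>M\<close> in a nonzero submodule for the subalgebra, that is, in all of it, and \<open>M\<close>
  generates the induced module.
\<close>
theorem simple_induced: "simple_lie_module hv_alg (induced_module hv_alg (hv_sub e) M)"
  unfolding ib.induced_module_eq
proof (rule ib.pres.simple_P_model[OF ib.is_lie_module_ind])
  obtain v where v: "v \<in> carrier M" "v \<noteq> \<zero>\<^bsub>M\<^esub>"
    using M_simple ib.L.V.zero_closed unfolding simple_lie_module_def by blast
  then show "\<exists>u\<in>U. u \<noteq> 0" using \<iota>_U \<iota>_eq_0 by blast
  fix S assume S: "pm.subspace S" "S \<subseteq> U" "\<And>a u. a \<in> carrier hv_alg \<Longrightarrow> u \<in> S \<Longrightarrow> rho a u \<in> S" "\<exists>u\<in>S. u \<noteq> 0"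
  have S3: "rho a u \<in> S" if "u \<in> S" for a u using S(3)[of a u] that by simp
  obtain u where u: "u \<in> S" "u \<noteq> 0" using S(4) by blast
  obtain m where m: "m \<in> S" "m \<in> M0" "m \<noteq> 0"
    using low.invariant_subspace_meets_M0[OF S(1,2) S3 S3 u] by blast
  let ?V = "{v \<in> carrier M. \<iota> v \<in> S}"
  have "is_lie_submodule (hv_sub e) M ?V"
    unfolding is_lie_submodule_def
  proof (intro conjI ballI)
    show "submodule ?V complex_field M"
    proof (rule ib.L.V.submoduleI)
      show "\<zero>\<^bsub>M\<^esub> \<in> ?V" using \<iota>_zero pm.subspace_0[OF S(1)] by simp
      show sc: "c \<odot>\<^bsub>M\<^esub> v \<in> ?V" if "v \<in> ?V" for c v
        using that pm.subspace_scale[OF S(1), of "\<iota> v" c] by (simp add: \<iota>_smult)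
      show "\<ominus>\<^bsub>M\<^esub> v \<in> ?V" if "v \<in> ?V" for v
        using sc[OF that, of "-1"] that ib.L.smult_minus_1[of v] by simp
      show "v \<oplus>\<^bsub>M\<^esub> w \<in> ?V" if "v \<in> ?V" "w \<in> ?V" for v w
        using that pm.subspace_add[OF S(1), of "\<iota> v" "\<iota> w"] by (simp add: \<iota>_add)
    qed auto
    show "act M x v \<in> ?V" if "x \<in> carrier (hv_sub e)" "v \<in> ?V" for x v
      using that S3[of "\<iota> v" x] ib.L.act_closed[of x v] by (simp add: \<iota>_act)
  qed
  then have "?V = {\<zero>\<^bsub>M\<^esub>} \<or> ?V = carrier M"
    using M_simple unfolding simple_lie_module_def by blast
  moreover obtain w where w: "m = \<iota> w" "w \<in> carrier M" using m(2) unfolding M0_def by blast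
  then have "w \<in> ?V" "w \<noteq> \<zero>\<^bsub>M\<^esub>" using m \<iota>_zero by auto
  ultimately have "?V = carrier M" by blast
  then have "M0 \<subseteq> S" unfolding M0_def by blast
  then show "U \<subseteq> S" by (rule generated_rho[OF S(1)]) (rule S3)
qed

theorem induced_locally_killed:
  assumes "w \<in> carrier (induced_module hv_alg (hv_sub e) M)"
  shows "\<exists>n0. \<forall>n\<ge>n0. act (induced_module hv_alg (hv_sub e) M) (L_elt n) w = \<zero>\<^bsub>induced_module hv_alg (hv_sub e) M\<^esub>
     \<and> act (induced_module hv_alg (hv_sub e) M) (I_elt n) w = \<zero>\<^bsub>induced_module hv_alg (hv_sub e) M\<^esub>"
proof -
  obtain p where p: "w = ib.pres.cs p" "p \<in> ib.pres.F"
    using assms unfolding ib.induced_module_eq ib.pres.carrier_P by blast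
  have "\<pi> p \<in> U" unfolding ib.pres.U_def by (rule imageI[OF p(2)])
  then obtain n0 where n0: "\<And>n. n \<ge> n0 \<Longrightarrow> rho (L_elt n) (\<pi> p) = 0 \<and> rho (I_elt n) (\<pi> p) = 0"
    using low.locally_killed by blast
  have "act ib.pres.P a w = \<zero>\<^bsub>ib.pres.P\<^esub>" if "rho a (\<pi> p) = 0" for a
    using that ib.pres.rho_proj[of a p] ib.pres.act_P[of a p]
    by (simp only: p(1) ib.pres.proj_0_iff_cs hv_alg_simps UNIV_I simp_thms)
  then show ?thesis unfolding ib.induced_module_eq using n0 by blast
qed

end

section \<open>Linear independence of exponential polynomials\<close>

lemma poly_zero_from_nats:
  fixes p :: "complex poly"
  assumes "\<And>n. n \<ge> n0 \<Longrightarrow> poly p (of_nat n) = 0"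
  shows "p = 0"
proof (rule ccontr)
  assume "p \<noteq> 0"
  then have "finite {x. poly p x = 0}" by (rule poly_roots_finite)
  moreover have "of_nat ` {n0..} \<subseteq> {x. poly p x = 0}" using assms by auto
  ultimately have "finite (of_nat ` {n0..} :: complex set)" by (rule finite_subset[rotated])
  then have "finite {n0..}" by (rule finite_imageD) (simp add: inj_on_def)
  then show False using infinite_Ici[of n0] by simp
qed

lemma degree_difference_less:
  fixes p :: "complex poly"
  assumes "degree p > 0"
  shows "degree (pcompose p [:1, 1:] - p) < degree p"
proof -
  have d: "degree (pcompose p [:1, 1:]) = degree p" by (simp add: degree_pcompose)
  have lc: "coeff (pcompose p [:1, 1:]) (degree p) = coeff p (degree p)"
    using lead_coeff_comp[of "[:1, 1:]" p] d by simp
  have "degree (pcompose p [:1, 1:] - p) \<le> degree p" using degree_diff_le_max[of "pcompose p [:1, 1:]" p] d by simp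
  moreover have "degree (pcompose p [:1, 1:] - p) \<noteq> degree p"
  proof
    assume e: "degree (pcompose p [:1, 1:] - p) = degree p"
    then have "lead_coeff (pcompose p [:1, 1:] - p) = 0" using lc by simp
    then show False using e assms by (metis degree_0 leading_coeff_0_iff less_irrefl)
  qed
  ultimately show ?thesis by simp
qed

text \<open>
  The operator \<open>a\<^bsub>n\<^esub> \<mapsto> a\<^bsub>n+1\<^esub> - \<lambda>\<^sub>j a\<^bsub>n\<^esub>\<close> lowers the degree of the coefficient of \<open>\<lambda>\<^sub>j\<^sup>n\<close> and keeps the degrees of the
  others, because their leading coefficients are multiplied by \<open>\<lambda>\<^sub>i - \<lambda>\<^sub>j \<noteq> 0\<close>. Induction on that degree
  removes \<open>\<lambda>\<^sub>j\<close>, after which the induction on the number of summands applies.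
\<close>
lemma exponential_polynomial_zero:
  fixes lam :: "'i \<Rightarrow> complex" and p :: "'i \<Rightarrow> complex poly"
  assumes "finite S" "inj_on lam S" "\<And>i. i \<in> S \<Longrightarrow> lam i \<noteq> 0"
    and "\<And>n. n \<ge> n0 \<Longrightarrow> (\<Sum>i\<in>S. lam i ^ n * poly (p i) (of_nat n)) = 0"
  shows "\<forall>i\<in>S. p i = 0"
  using assms
proof (induction S arbitrary: p rule: finite_induct)
  case (insert j S)
  have "p j = 0 \<longrightarrow> (\<forall>i\<in>insert j S. p i = 0)" if "\<And>n. n \<ge> n0 \<Longrightarrow> (\<Sum>i\<in>insert j S. lam i ^ n * poly (p i) (of_nat n)) = 0" for p
    using insert.IH[of p] insert.prems(1,2) insert.hyps that by auto
  moreover have "p j = 0" if "\<And>n. n \<ge> n0 \<Longrightarrow> (\<Sum>i\<in>insert j S. lam i ^ n * poly (p i) (of_nat n)) = 0" for p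
    using that
  proof (induction "if p j = 0 then 0 else Suc (degree (p j))" arbitrary: p rule: less_induct)
    case less
    \<comment> \<open>The coefficients of the sequence after the operator has been applied.\<close>
    define r where "r i = Polynomial.smult (lam i) (pcompose (p i) [:1, 1:]) - Polynomial.smult (lam j) (p i)" for i
    have r0: "(\<Sum>i\<in>insert j S. lam i ^ n * poly (r i) (of_nat n)) = 0" if "n \<ge> n0" for n
    proof -
      have "(\<Sum>i\<in>insert j S. lam i ^ n * poly (r i) (of_nat n)) =
        (\<Sum>i\<in>insert j S. lam i ^ Suc n * poly (p i) (of_nat (Suc n))) - lam j * (\<Sum>i\<in>insert j S. lam i ^ n * poly (p i) (of_nat n))"
        unfolding sum_distrib_left sum_subtractf[symmetric]
        by (rule sum.cong) (simp_all add: r_def poly_pcompose algebra_simps)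
      then show ?thesis using less.prems[of n] less.prems[of "Suc n"] that by simp
    qed
    have rj: "r j = Polynomial.smult (lam j) (pcompose (p j) [:1, 1:] - p j)"
      by (simp add: r_def smult_diff_right)
    show ?case
    proof (rule ccontr)
      assume pj: "p j \<noteq> 0"
      have lj: "lam j \<noteq> 0" using insert.prems by simp
      have "r j = 0"
      proof (cases "degree (p j) = 0")
        case True
        then obtain c where "p j = [:c:]" by (rule degree_eq_zeroE)
        then show ?thesis by (simp add: rj)
      next
        case False
        then have "degree (r j) < degree (p j)" using degree_difference_less[of "p j"] lj by (simp add: rj)
        then show ?thesis using less.hyps[of r] r0 pj by auto
      qed
      then have "(\<Sum>i\<in>S. lam i ^ n * poly (r i) (of_nat n)) = 0" if "n \<ge> n0" for n
        using r0[OF that] insert.hyps by simp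
      then have rS: "\<forall>i\<in>S. r i = 0" using insert.IH[of r] insert.prems by auto
      have pS: "p i = 0" if i: "i \<in> S" for i
      proof (rule ccontr)
        assume pi: "p i \<noteq> 0"
        have ne: "lam i \<noteq> lam j" using insert.prems(1) insert.hyps i by (auto simp: inj_on_def)
        have "lead_coeff (pcompose (p i) [:1, 1:]) = lead_coeff (p i)"
          using lead_coeff_comp[of "[:1, 1:]" "p i"] by simp
        then have "coeff (r i) (degree (p i)) = (lam i - lam j) * lead_coeff (p i)"
          by (simp add: r_def degree_pcompose algebra_simps)
        then show False using rS i ne pi by simp
      qed
      have "poly (p j) (of_nat n) = 0" if "n \<ge> n0" for n
        using less.prems[OF that] insert.hyps pS lj by simp
      then show False using poly_zero_from_nats pj by blast
    qed
  qed
  ultimately show ?case using insert.prems(3) by blast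
qed simp

lemma exponential_polynomial_coefficients:
  fixes lam :: "'i \<Rightarrow> complex" and w :: "'i \<Rightarrow> nat \<Rightarrow> ('x \<Rightarrow>\<^sub>0 complex)"
  assumes "finite S" "inj_on lam S" "\<And>i. i \<in> S \<Longrightarrow> lam i \<noteq> 0"
    and z: "\<And>n. n \<ge> n0 \<Longrightarrow> (\<Sum>i\<in>S. \<Sum>t\<le>d. scale (lam i ^ n * of_nat n ^ t) (w i t)) = 0"
    and "i \<in> S" "t \<le> d"
  shows "w i t = 0"
proof (rule poly_mapping_eqI)
  fix x
  define p where "p i = (\<Sum>t\<le>d. monom (Poly_Mapping.lookup (w i t) x) t)" for i
  have E: "(\<Sum>i\<in>S. lam i ^ n * poly (p i) (of_nat n)) = 0" if "n \<ge> n0" for n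
  proof -
    have "Poly_Mapping.lookup (\<Sum>i\<in>S. \<Sum>t\<le>d. scale (lam i ^ n * of_nat n ^ t) (w i t)) x = 0"
      using z[OF that] by simp
    then show ?thesis
      by (simp add: lookup_sum p_def poly_sum poly_monom sum_distrib_left mult.assoc mult.commute mult.left_commute)
  qed
  have "\<forall>i\<in>S. p i = 0" by (rule exponential_polynomial_zero[OF assms(1,2)], rule assms(3), assumption, rule E, assumption)
  then have "coeff (p i) t = 0" using assms(5) by simp
  then show "Poly_Mapping.lookup (w i t) x = Poly_Mapping.lookup 0 x"
    using assms(6) by (simp add: p_def coeff_sum if_distrib cong: if_cong)
qed

section \<open>Relations in tensor products with the modules of polynomials\<close>

lemma omega_simps [simp]:
  "carrier (omega l a b) = UNIV" "zero (omega l a b) = 0" "add (omega l a b) = (+)" "smult (omega l a b) = Polynomial.smult"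
  by (simp_all add: omega_def)

lemma omega_act_gen_monom: "act (omega l a b) (gen x) (Polynomial.monom 1 n) = omega_monom l a b x n"
proof -
  have "(\<Sum>k\<le>n. Polynomial.smult (coeff (Polynomial.monom 1 n) k) (omega_monom l a b x k)) =
     (\<Sum>k\<le>n. if k = n then omega_monom l a b x k else 0)"
    by (rule sum.cong) auto
  then show ?thesis by (simp add: omega_def degree_monom_eq)
qed

lemma poly_smult_sum: "Polynomial.smult c (\<Sum>i\<in>S. f i) = (\<Sum>i\<in>S. Polynomial.smult c (f i))"
  by (induction S rule: infinite_finite_induct) (auto simp: smult_add_right)

text \<open>
  The coefficient of \<open>k\<^sup>t\<close> in \<open>(\<partial> - k)\<^sup>n\<close>.
\<close>
definition shift_coeff :: "nat \<Rightarrow> nat \<Rightarrow> complex poly" where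
  "shift_coeff t n = Polynomial.smult ((-1) ^ t * of_nat (n choose t)) (Polynomial.monom 1 (n - t))"

lemma shift_power:
  assumes "n \<le> d"
  shows "[:- x, 1:] ^ n = (\<Sum>t\<le>d. Polynomial.smult (x ^ t) (shift_coeff t n))"
proof -
  have "[:- x, 1:] ^ n = ([:- x:] + Polynomial.monom 1 1) ^ n" by (simp add: monom_altdef)
  also have "\<dots> = (\<Sum>t\<le>n. of_nat (n choose t) * [:- x:] ^ t * Polynomial.monom 1 1 ^ (n - t))"
    by (rule binomial_ring)
  also have "\<dots> = (\<Sum>t\<le>n. Polynomial.smult (x ^ t) (shift_coeff t n))"
  proof (rule sum.cong)
    fix t
    have "[:- x:] ^ t = [:(- x) ^ t:]" by (induction t) auto
    moreover have "(- x) ^ t = (-1) ^ t * x ^ t" by (metis mult_minus1 power_mult_distrib)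
    ultimately show "of_nat (n choose t) * [:- x:] ^ t * Polynomial.monom 1 1 ^ (n - t) = Polynomial.smult (x ^ t) (shift_coeff t n)"
      by (simp add: shift_coeff_def of_nat_poly monom_power mult.commute mult.left_commute)
  qed simp
  also have "\<dots> = (\<Sum>t\<le>d. Polynomial.smult (x ^ t) (shift_coeff t n))"
    by (rule sum.mono_neutral_left) (use assms in \<open>auto simp: shift_coeff_def\<close>)
  finally show ?thesis .
qed

text \<open>
  The coefficient of \<open>k\<^sup>t\<close> in \<open>(\<partial> + k \<alpha>) (\<partial> - k)\<^sup>n\<close>.
\<close>
definition L_coeff :: "complex \<Rightarrow> nat \<Rightarrow> nat \<Rightarrow> complex poly" where
  "L_coeff \<alpha> t n = Polynomial.monom 1 1 * shift_coeff t n + (if t = 0 then 0 else Polynomial.smult \<alpha> (shift_coeff (t - 1) n))"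

lemma L_coeff_expansion:
  assumes "n \<le> d"
  shows "[:x * \<alpha>, 1:] * [:- x, 1:] ^ n = (\<Sum>t\<le>Suc d. Polynomial.smult (x ^ t) (L_coeff \<alpha> t n))"
proof -
  have 0: "shift_coeff (Suc d) n = 0" using assms by (simp add: shift_coeff_def)
  have "[:x * \<alpha>, 1:] = Polynomial.monom 1 1 + [:x * \<alpha>:]" by (simp add: monom_altdef)
  then have "[:x * \<alpha>, 1:] * [:- x, 1:] ^ n = (\<Sum>t\<le>d. Polynomial.smult (x ^ t) (Polynomial.monom 1 1 * shift_coeff t n))
      + (\<Sum>t\<le>d. Polynomial.smult (x ^ Suc t) (Polynomial.smult \<alpha> (shift_coeff t n)))"
    unfolding shift_power[OF assms]
    by (simp add: distrib_left distrib_right sum_distrib_left smult_add_right sum.distrib mult_ac)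
  also have "(\<Sum>t\<le>d. Polynomial.smult (x ^ t) (Polynomial.monom 1 1 * shift_coeff t n)) =
      (\<Sum>t\<le>Suc d. Polynomial.smult (x ^ t) (Polynomial.monom 1 1 * shift_coeff t n))"
    using 0 by simp
  also have "(\<Sum>t\<le>d. Polynomial.smult (x ^ Suc t) (Polynomial.smult \<alpha> (shift_coeff t n))) =
      (\<Sum>t\<le>Suc d. Polynomial.smult (x ^ t) (if t = 0 then 0 else Polynomial.smult \<alpha> (shift_coeff (t - 1) n)))"
    by (subst sum.atMost_Suc_shift) simp
  finally show ?thesis by (simp add: L_coeff_def smult_add_right sum.distrib)
qed

lemma shift_coeff_top: "n \<le> d \<Longrightarrow> shift_coeff d n = (if n = d then [:(-1) ^ d:] else 0)"
  by (auto simp: shift_coeff_def monom_0)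

lemma L_coeff_0: "L_coeff \<alpha> 0 n = Polynomial.monom 1 (Suc n)"
  by (simp add: L_coeff_def shift_coeff_def mult_monom)

lemma L_coeff_top: "n \<le> d \<Longrightarrow> L_coeff \<alpha> (Suc d) n = (if n = d then [:\<alpha> * (-1) ^ d:] else 0)"
  using shift_coeff_top[of n d] by (auto simp: L_coeff_def shift_coeff_def[of "Suc d"])

lemma omega_monom_L:
  assumes "n \<le> d"
  shows "omega_monom l \<alpha> \<beta> (BL (int k)) n =
    Polynomial.smult (l ^ k) (\<Sum>t\<le>Suc d. Polynomial.smult (of_nat k ^ t) (L_coeff \<alpha> t n))"
  unfolding L_coeff_expansion[OF assms, symmetric] by (simp only: omega_monom.simps power_int_of_nat of_int_of_nat_eq)

lemma omega_monom_I:
  assumes "n \<le> d"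
  shows "omega_monom l \<alpha> \<beta> (BI (int k)) n =
    Polynomial.smult (l ^ k) (\<Sum>t\<le>d. Polynomial.smult (of_nat k ^ t) (Polynomial.smult \<beta> (shift_coeff t n)))"
proof -
  have "omega_monom l \<alpha> \<beta> (BI (int k)) n = Polynomial.smult (l ^ k) (Polynomial.smult \<beta> ([:- of_nat k, 1:] ^ n))" by simp
  also have "\<dots> = Polynomial.smult (l ^ k) (\<Sum>t\<le>d. Polynomial.smult (of_nat k ^ t) (Polynomial.smult \<beta> (shift_coeff t n)))"
    unfolding shift_power[OF assms] by (simp add: poly_smult_sum mult.commute)
  finally show ?thesis .
qed

text \<open>
  The variables are replaced by monomials one at a time.
\<close>
lemma multilinear_in_subspace:
  fixes \<tau> :: "('i \<Rightarrow> complex poly) \<Rightarrow> ('x \<Rightarrow>\<^sub>0 complex)"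
  assumes fin: "finite J"
    and add: "\<And>f i p q. f \<in> (\<Pi>\<^sub>E i\<in>J. UNIV) \<Longrightarrow> i \<in> J \<Longrightarrow> \<tau> (f(i := p + q)) = \<tau> (f(i := p)) + \<tau> (f(i := q))"
    and smult: "\<And>f i c p. f \<in> (\<Pi>\<^sub>E i\<in>J. UNIV) \<Longrightarrow> i \<in> J \<Longrightarrow> \<tau> (f(i := Polynomial.smult c p)) = scale c (\<tau> (f(i := p)))"
    and Z: "pm.subspace Z" and mons: "\<And>a. \<tau> (\<lambda>i\<in>J. Polynomial.monom 1 (a i)) \<in> Z"
    and f: "f \<in> (\<Pi>\<^sub>E i\<in>J. UNIV)"
  shows "\<tau> f \<in> Z"
proof -
  have "\<tau> f \<in> Z" if "finite K" "K \<subseteq> J" "f \<in> (\<Pi>\<^sub>E i\<in>J. UNIV)" "\<forall>i\<in>J - K. \<exists>n. f i = Polynomial.monom 1 n" for K f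
    using that
  proof (induction K arbitrary: f rule: finite_induct)
    case empty
    then have "\<forall>i\<in>J. \<exists>n. f i = Polynomial.monom 1 n" by simp
    then obtain a where "\<And>i. i \<in> J \<Longrightarrow> f i = Polynomial.monom 1 (a i)" by metis
    then have "f = (\<lambda>i\<in>J. Polynomial.monom 1 (a i))" using empty(2) by (intro ext) (auto simp: PiE_def extensional_def)
    then show ?case by (simp only: mons)
  next
    case (insert i K)
    have i: "i \<in> J" using insert by simp
    have upd: "f(i := p) \<in> (\<Pi>\<^sub>E i\<in>J. UNIV)" for p using insert.prems(2) i by (auto simp: PiE_def extensional_def)
    note fP = insert.prems(2)
    have mono_Z: "\<tau> (f(i := Polynomial.monom 1 n)) \<in> Z" for n
      by (rule insert.IH) (use insert.prems upd in auto)
    have sum_Z: "\<tau> (f(i := (\<Sum>n\<in>S. Polynomial.smult (c n) (Polynomial.monom 1 n)))) \<in> Z" if "finite S" for S c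
      using that
    proof induction
      case empty
      have "\<tau> (f(i := 0)) = 0" using smult[OF fP i, of 0 0] by simp
      then show ?case by (simp only: sum.empty pm.subspace_0[OF Z])
    next
      case (insert n S)
      show ?case
        unfolding sum.insert[OF insert(1,2)] add[OF fP i] smult[OF fP i]
        by (intro pm.subspace_add[OF Z] pm.subspace_scale[OF Z] mono_Z insert(3))
    qed
    have "f i = (\<Sum>n\<in>{..degree (f i)}. Polynomial.smult (coeff (f i) n) (Polynomial.monom 1 n))"
      using poly_as_sum_of_monoms[of "f i"] by (simp add: smult_monom)
    then have "\<tau> (f(i := f i)) \<in> Z" using sum_Z[of "{..degree (f i)}" "coeff (f i)"] by simp
    then show ?case by simp
  qed
  from this[OF fin _ f] show ?thesis by simp
qed

text \<open>
  \<open>\<tau> f v\<close> is the class of \<open>f \<otimes> v\<close> modulo a submodule of the tensor product. The assumption \<open>\<tau>_inv\<close>, that every algebra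
  element \<open>x\<close> maps a relation between such classes to a relation, is all that remains of the submodule.
\<close>
locale omega_tensor =
  fixes J :: "nat set" and lam \<alpha> \<beta> :: "nat \<Rightarrow> complex" and V :: "(hv, 'w) lie_mod"
    and \<tau> :: "(nat \<Rightarrow> complex poly) \<Rightarrow> 'w \<Rightarrow> ('x \<Rightarrow>\<^sub>0 complex)"
  assumes fin: "finite J" and inj: "inj_on lam J" and lam0: "i \<in> J \<Longrightarrow> lam i \<noteq> 0"
    and ab: "i \<in> J \<Longrightarrow> \<beta> i \<noteq> 0 \<or> \<alpha> i \<noteq> 0"
    and simple: "simple_lie_module hv_alg V"
    and killed: "w \<in> carrier V \<Longrightarrow> \<exists>n0. \<forall>n\<ge>n0. act V (L_elt n) w = \<zero>\<^bsub>V\<^esub> \<and> act V (I_elt n) w = \<zero>\<^bsub>V\<^esub>"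
    and \<tau>_add: "f \<in> (\<Pi>\<^sub>E i\<in>J. UNIV) \<Longrightarrow> i \<in> J \<Longrightarrow> v \<in> carrier V \<Longrightarrow> \<tau> (f(i := p + q)) v = \<tau> (f(i := p)) v + \<tau> (f(i := q)) v"
    and \<tau>_smult: "f \<in> (\<Pi>\<^sub>E i\<in>J. UNIV) \<Longrightarrow> i \<in> J \<Longrightarrow> v \<in> carrier V \<Longrightarrow> \<tau> (f(i := Polynomial.smult c p)) v = scale c (\<tau> (f(i := p)) v)"
    and \<tau>_add_right: "f \<in> (\<Pi>\<^sub>E i\<in>J. UNIV) \<Longrightarrow> v \<in> carrier V \<Longrightarrow> w \<in> carrier V \<Longrightarrow> \<tau> f (v \<oplus>\<^bsub>V\<^esub> w) = \<tau> f v + \<tau> f w"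
    and \<tau>_smult_right: "f \<in> (\<Pi>\<^sub>E i\<in>J. UNIV) \<Longrightarrow> v \<in> carrier V \<Longrightarrow> \<tau> f (c \<odot>\<^bsub>V\<^esub> v) = scale c (\<tau> f v)"
    and \<tau>_inv: "finite (A :: (nat \<Rightarrow> nat) set) \<Longrightarrow> (\<And>s. s \<in> A \<Longrightarrow> F s \<in> (\<Pi>\<^sub>E i\<in>J. UNIV)) \<Longrightarrow> (\<And>s. s \<in> A \<Longrightarrow> u s \<in> carrier V) \<Longrightarrow>
      (\<Sum>s\<in>A. \<tau> (F s) (u s)) = 0 \<Longrightarrow>
      (\<Sum>s\<in>A. (\<Sum>i\<in>J. \<tau> ((F s)(i := act (omega (lam i) (\<alpha> i) (\<beta> i)) x (F s i))) (u s)) + \<tau> (F s) (act V x (u s))) = 0"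
begin

lemma is_lie_module_V: "is_lie_module hv_alg V"
  using simple by (simp add: simple_lie_module_def)

sublocale V: lie_module hv_alg V
  by unfold_locales (rule is_lie_module_V)

definition mon :: "(nat \<Rightarrow> nat) \<Rightarrow> nat \<Rightarrow> complex poly" where
  "mon a = (\<lambda>i\<in>J. Polynomial.monom 1 (a i))"

lemma mon_PiE: "mon a \<in> (\<Pi>\<^sub>E i\<in>J. UNIV)" by (simp add: mon_def)

lemma mon_upd: "i \<in> J \<Longrightarrow> (mon a)(i := Polynomial.monom 1 n) = mon (a(i := n))"
  by (auto simp: mon_def fun_eq_iff)

lemma \<tau>_zero: "f \<in> (\<Pi>\<^sub>E i\<in>J. UNIV) \<Longrightarrow> i \<in> J \<Longrightarrow> v \<in> carrier V \<Longrightarrow> \<tau> (f(i := 0)) v = 0"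
  using \<tau>_smult[of f i v 0 0] by simp

lemma \<tau>_sum:
  assumes "f \<in> (\<Pi>\<^sub>E i\<in>J. UNIV)" "i \<in> J" "v \<in> carrier V" "finite S"
  shows "\<tau> (f(i := (\<Sum>t\<in>S. Polynomial.smult (c t) (p t)))) v = (\<Sum>t\<in>S. scale (c t) (\<tau> (f(i := p t)) v))"
  using assms(4)
proof induction
  case empty
  show ?case by (simp only: sum.empty \<tau>_zero[OF assms(1-3)])
next
  case (insert t S)
  show ?case
    by (simp only: insert(3) sum.insert[OF insert(1,2)] \<tau>_add[OF assms(1-3)] \<tau>_smult[OF assms(1-3)])
qed

lemma \<tau>_zero_right: "f \<in> (\<Pi>\<^sub>E i\<in>J. UNIV) \<Longrightarrow> \<tau> f \<zero>\<^bsub>V\<^esub> = 0"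
  using \<tau>_smult_right[of f "\<zero>\<^bsub>V\<^esub>" 0] by simp

context
  fixes A :: "(nat \<Rightarrow> nat) set" and ex :: "(nat \<Rightarrow> nat) \<Rightarrow> nat \<Rightarrow> nat" and v :: "(nat \<Rightarrow> nat) \<Rightarrow> 'w"
  assumes finA: "finite A" and vV: "s \<in> A \<Longrightarrow> v s \<in> carrier V"
    and sum0: "(\<Sum>s\<in>A. \<tau> (mon (ex s)) (v s)) = 0"
begin

lemma all_killed: "\<exists>n0 :: nat. \<forall>n\<ge>n0. \<forall>s\<in>A. act V (L_elt (int n)) (v s) = \<zero>\<^bsub>V\<^esub> \<and> act V (I_elt (int n)) (v s) = \<zero>\<^bsub>V\<^esub>"
proof -
  have "\<forall>s\<in>A. \<exists>n0. \<forall>n\<ge>n0. act V (L_elt n) (v s) = \<zero>\<^bsub>V\<^esub> \<and> act V (I_elt n) (v s) = \<zero>\<^bsub>V\<^esub>"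
    using killed vV by blast
  then obtain n0 where n0: "\<And>s n. s \<in> A \<Longrightarrow> n \<ge> n0 s \<Longrightarrow> act V (L_elt n) (v s) = \<zero>\<^bsub>V\<^esub> \<and> act V (I_elt n) (v s) = \<zero>\<^bsub>V\<^esub>"
    by metis
  let ?m = "\<Sum>s\<in>A. nat (n0 s)"
  have "int n \<ge> n0 s" if "n \<ge> ?m" "s \<in> A" for n s
  proof -
    have "nat (n0 s) \<le> ?m" using finA that(2) by (intro member_le_sum) auto
    then show ?thesis using that by linarith
  qed
  then show ?thesis using n0 by blast
qed

text \<open>
  Late operators act on a relation only through the polynomial factors and give exponential polynomials in
  \<open>n\<close> with vector coefficients, whose coefficients vanish separately.
\<close>
lemma coefficient_sum:
  fixes c :: "nat \<Rightarrow> complex" and P :: "nat \<Rightarrow> nat \<Rightarrow> nat \<Rightarrow> complex poly" and x :: "nat \<Rightarrow> hv_basis"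
  assumes P: "\<And>n i s. s \<in> A \<Longrightarrow> i \<in> J \<Longrightarrow> omega_monom (lam i) (\<alpha> i) (\<beta> i) (x n) (ex s i) =
      Polynomial.smult (lam i ^ n) (\<Sum>t\<le>d. Polynomial.smult (of_nat n ^ t) (P i t (ex s i)))"
    and kill: "\<And>n s. n \<ge> start \<Longrightarrow> s \<in> A \<Longrightarrow> act V (gen (x n)) (v s) = \<zero>\<^bsub>V\<^esub>"
    and "i \<in> J" "t \<le> d"
  shows "(\<Sum>s\<in>A. \<tau> ((mon (ex s))(i := P i t (ex s i))) (v s)) = 0"
proof -
  define w where "w i t = (\<Sum>s\<in>A. \<tau> ((mon (ex s))(i := P i t (ex s i))) (v s))" for i t
  have Z: "(\<Sum>i\<in>J. \<Sum>t\<le>d. scale (lam i ^ n * of_nat n ^ t) (w i t)) = 0" if n: "n \<ge> start" for n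
  proof -
    have "(\<Sum>s\<in>A. (\<Sum>i\<in>J. \<tau> ((mon (ex s))(i := act (omega (lam i) (\<alpha> i) (\<beta> i)) (gen (x n)) (mon (ex s) i))) (v s)) +
        \<tau> (mon (ex s)) (act V (gen (x n)) (v s))) = 0"
      by (rule \<tau>_inv[OF finA mon_PiE vV sum0])
    also have "(\<Sum>s\<in>A. (\<Sum>i\<in>J. \<tau> ((mon (ex s))(i := act (omega (lam i) (\<alpha> i) (\<beta> i)) (gen (x n)) (mon (ex s) i))) (v s)) +
        \<tau> (mon (ex s)) (act V (gen (x n)) (v s))) =
      (\<Sum>s\<in>A. \<Sum>i\<in>J. \<Sum>t\<le>d. scale (lam i ^ n * of_nat n ^ t) (\<tau> ((mon (ex s))(i := P i t (ex s i))) (v s)))"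
    proof (rule sum.cong[OF refl])
      fix s assume s: "s \<in> A"
      have "\<tau> ((mon (ex s))(i := act (omega (lam i) (\<alpha> i) (\<beta> i)) (gen (x n)) (mon (ex s) i))) (v s) =
          (\<Sum>t\<le>d. scale (lam i ^ n * of_nat n ^ t) (\<tau> ((mon (ex s))(i := P i t (ex s i))) (v s)))" if i: "i \<in> J" for i
      proof -
        have "mon (ex s) i = Polynomial.monom 1 (ex s i)" using i by (simp add: mon_def)
        then show ?thesis
          using \<tau>_sum[OF mon_PiE i vV[OF s], of "{..d}" "ex s" "\<lambda>t. lam i ^ n * of_nat n ^ t" "\<lambda>t. P i t (ex s i)"]
          by (simp only: omega_act_gen_monom P[OF s i] poly_smult_sum smult_smult finite_atMost)
      qed
      then show "(\<Sum>i\<in>J. \<tau> ((mon (ex s))(i := act (omega (lam i) (\<alpha> i) (\<beta> i)) (gen (x n)) (mon (ex s) i))) (v s)) +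
        \<tau> (mon (ex s)) (act V (gen (x n)) (v s)) = (\<Sum>i\<in>J. \<Sum>t\<le>d. scale (lam i ^ n * of_nat n ^ t) (\<tau> ((mon (ex s))(i := P i t (ex s i))) (v s)))"
        using kill[OF n s] \<tau>_zero_right[OF mon_PiE] by simp
    qed
    also have "\<dots> = (\<Sum>i\<in>J. \<Sum>t\<le>d. scale (lam i ^ n * of_nat n ^ t) (w i t))"
      unfolding w_def pm.scale_sum_right
      by (subst sum.swap) (rule sum.cong[OF refl], subst sum.swap, rule refl)
    finally show ?thesis by simp
  qed
  have "w i t = 0"
    by (rule exponential_polynomial_coefficients[OF fin inj _ _ assms(3,4)], rule lam0, assumption, rule Z, assumption)
  then show ?thesis by (simp add: w_def)
qed

text \<open>
  The coefficient of \<open>\<lambda>\<^sub>i\<^sup>n n\<^sup>0\<close> in the action of \<open>L\<^sub>n\<close>.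
\<close>
lemma raise_exponent:
  assumes i: "i \<in> J"
  shows "(\<Sum>s\<in>A. \<tau> (mon ((ex s)(i := Suc (ex s i)))) (v s)) = 0"
proof -
  obtain n0 :: nat where n0: "\<And>n s. n \<ge> n0 \<Longrightarrow> s \<in> A \<Longrightarrow> act V (L_elt (int n)) (v s) = \<zero>\<^bsub>V\<^esub>"
    using all_killed by blast
  define d where "d = (\<Sum>s\<in>A. \<Sum>i\<in>J. ex s i)"
  have d: "ex s i \<le> d" if "s \<in> A" "i \<in> J" for s i
  proof -
    have "ex s i \<le> (\<Sum>i\<in>J. ex s i)" using fin that by (intro member_le_sum) auto
    also have "\<dots> \<le> d" unfolding d_def using finA that by (intro member_le_sum[of s A "\<lambda>s. \<Sum>i\<in>J. ex s i"]) auto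
    finally show ?thesis .
  qed
  have "(\<Sum>s\<in>A. \<tau> ((mon (ex s))(i := L_coeff (\<alpha> i) 0 (ex s i))) (v s)) = 0"
    by (rule coefficient_sum[where x = "\<lambda>n. BL (int n)" and P = "\<lambda>i. L_coeff (\<alpha> i)" and d = "Suc d" and start = n0])
       (use d n0 i in \<open>simp_all only: omega_monom_L zero_le\<close>)
  then show ?thesis by (simp add: L_coeff_0 mon_upd[OF i])
qed

text \<open>
  With \<open>d\<close> the largest exponent of the variable \<open>i\<close>, the highest power of \<open>n\<close> that occurs together with \<open>\<lambda>\<^sub>i\<^sup>n\<close> is \<open>n\<^sup>d\<close> for \<open>I\<^sub>n\<close> and
  \<open>n\<^sup>d\<^sup>+\<^sup>1\<close> for \<open>L\<^sub>n\<close>. Its coefficients are \<open>\<beta>\<^sub>i (-1)\<^sup>d\<close> and \<open>\<alpha>\<^sub>i (-1)\<^sup>d\<close>, and terms with a smaller exponent do not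
  contribute.
\<close>
lemma top_exponent:
  assumes i: "i \<in> J" and d: "\<And>s. s \<in> A \<Longrightarrow> ex s i \<le> d"
  shows "(\<Sum>s | s \<in> A \<and> ex s i = d. \<tau> (mon ((ex s)(i := 0))) (v s)) = 0"
proof -
  obtain n0 :: nat where n0: "\<And>n s. n \<ge> n0 \<Longrightarrow> s \<in> A \<Longrightarrow> act V (L_elt (int n)) (v s) = \<zero>\<^bsub>V\<^esub>"
      "\<And>n s. n \<ge> n0 \<Longrightarrow> s \<in> A \<Longrightarrow> act V (I_elt (int n)) (v s) = \<zero>\<^bsub>V\<^esub>"
    using all_killed by blast
  define D where "D = d + (\<Sum>s\<in>A. \<Sum>i\<in>J. ex s i)"
  have D: "ex s i \<le> D" if "s \<in> A" "i \<in> J" for s i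
  proof -
    have "ex s i \<le> (\<Sum>i\<in>J. ex s i)" using fin that by (intro member_le_sum) auto
    also have "\<dots> \<le> (\<Sum>s\<in>A. \<Sum>i\<in>J. ex s i)" using finA that by (intro member_le_sum[of s A "\<lambda>s. \<Sum>i\<in>J. ex s i"]) auto
    finally show ?thesis by (simp add: D_def)
  qed
  have *: "(\<Sum>s\<in>A. \<tau> ((mon (ex s))(i := (if ex s i = d then [:c:] else 0))) (v s)) =
      scale c (\<Sum>s | s \<in> A \<and> ex s i = d. \<tau> (mon ((ex s)(i := 0))) (v s))" for c
  proof -
    have "\<tau> ((mon (ex s))(i := (if ex s i = d then [:c:] else 0))) (v s) =
        (if ex s i = d then scale c (\<tau> (mon ((ex s)(i := 0))) (v s)) else 0)" if "s \<in> A" for s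
      using \<tau>_smult[OF mon_PiE i vV[OF that], of "ex s" c 1] \<tau>_zero[OF mon_PiE i vV[OF that]] mon_upd[OF i, of "ex s" 0]
      by (auto simp: monom_0 one_pCons)
    then have "(\<Sum>s\<in>A. \<tau> ((mon (ex s))(i := (if ex s i = d then [:c:] else 0))) (v s)) =
        (\<Sum>s\<in>A. if ex s i = d then scale c (\<tau> (mon ((ex s)(i := 0))) (v s)) else 0)"
      by (intro sum.cong) auto
    also have "\<dots> = (\<Sum>s | s \<in> A \<and> ex s i = d. scale c (\<tau> (mon ((ex s)(i := 0))) (v s)))"
      using finA by (simp add: sum.inter_filter)
    finally show ?thesis by (simp add: pm.scale_sum_right)
  qed
  show ?thesis
  proof (cases "\<beta> i = 0")
    case True
    then have a: "\<alpha> i \<noteq> 0" using ab i by blast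
    have "(\<Sum>s\<in>A. \<tau> ((mon (ex s))(i := L_coeff (\<alpha> i) (Suc d) (ex s i))) (v s)) = 0"
    proof (rule coefficient_sum[where x = "\<lambda>n. BL (int n)" and P = "\<lambda>i. L_coeff (\<alpha> i)" and d = "Suc D" and start = n0])
      show "Suc d \<le> Suc D" by (simp add: D_def)
    qed (use D n0 i in \<open>simp_all only: omega_monom_L\<close>)
    also have "(\<Sum>s\<in>A. \<tau> ((mon (ex s))(i := L_coeff (\<alpha> i) (Suc d) (ex s i))) (v s)) =
        (\<Sum>s\<in>A. \<tau> ((mon (ex s))(i := (if ex s i = d then [:\<alpha> i * (-1) ^ d:] else 0))) (v s))"
      by (intro sum.cong) (use d in \<open>auto simp: L_coeff_top\<close>)
    finally show ?thesis using a by (simp only: *) simp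
  next
    case False
    have "(\<Sum>s\<in>A. \<tau> ((mon (ex s))(i := Polynomial.smult (\<beta> i) (shift_coeff d (ex s i)))) (v s)) = 0"
    proof (rule coefficient_sum[where x = "\<lambda>n. BI (int n)" and P = "\<lambda>i t m. Polynomial.smult (\<beta> i) (shift_coeff t m)" and d = D and start = n0])
      show "d \<le> D" by (simp add: D_def)
    qed (use D n0 i in \<open>simp_all only: omega_monom_I\<close>)
    also have "(\<Sum>s\<in>A. \<tau> ((mon (ex s))(i := Polynomial.smult (\<beta> i) (shift_coeff d (ex s i)))) (v s)) =
        (\<Sum>s\<in>A. \<tau> ((mon (ex s))(i := (if ex s i = d then [:\<beta> i * (-1) ^ d:] else 0))) (v s))"
      by (intro sum.cong) (use d in \<open>auto simp: shift_coeff_top\<close>)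
    finally show ?thesis using False by (simp only: *) simp
  qed
qed

end

text \<open>
  Multiplication by variables leads from \<open>1\<close> to all monomials.
\<close>
lemma vanish_all:
  assumes v: "v \<in> carrier V" and z: "\<tau> (mon (\<lambda>_. 0)) v = 0" and f: "f \<in> (\<Pi>\<^sub>E i\<in>J. UNIV)"
  shows "\<tau> f v = 0"
proof -
  have up: "\<tau> (mon (a(i := Suc (a i)))) v = 0" if "\<tau> (mon a) v = 0" "i \<in> J" for a i
    using raise_exponent[of "{a}" "\<lambda>_. v" "\<lambda>s. s" i] that v by simp
  have mons: "\<tau> (mon a) v = 0" for a
  proof (induction "\<Sum>i\<in>J. a i" arbitrary: a)
    case 0
    then have "\<forall>i\<in>J. a i = 0" using fin by simp
    then have "mon a = mon (\<lambda>_. 0)" by (auto simp: mon_def)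
    then show ?case using z by simp
  next
    case (Suc n)
    then obtain i where i: "i \<in> J" "a i \<noteq> 0" by (metis Zero_not_Suc sum.neutral)
    let ?a = "a(i := a i - 1)"
    have "(\<Sum>i\<in>J. a i) = a i + (\<Sum>i\<in>J - {i}. a i)" using fin i by (simp add: sum.remove)
    moreover have "(\<Sum>i\<in>J. ?a i) = (a i - 1) + (\<Sum>i\<in>J - {i}. a i)"
      using fin i by (subst sum.remove[of J i]) auto
    ultimately have "n = (\<Sum>i\<in>J. ?a i)" using Suc.hyps(2) i by linarith
    then have "\<tau> (mon ?a) v = 0" by (rule Suc.hyps(1))
    from up[OF this i(1)] show ?case using i by simp
  qed
  have "\<tau> f v \<in> {0}"
    by (rule multilinear_in_subspace[OF fin, where \<tau> = "\<lambda>f. \<tau> f v"])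
       (use v f \<tau>_add \<tau>_smult mons in \<open>auto simp: mon_def\<close>)
  then show ?thesis by simp
qed

text \<open>
  \<open>top_exponent\<close> is applied to one variable after the other. Each application keeps a nonempty set of terms that agree in the variables
  treated so far, so in the end one term \<open>1 \<otimes> v\<close> with \<open>v \<noteq> 0\<close> is left. The vectors \<open>v\<close> with
  \<open>\<tau> f v = 0\<close> for all \<open>f\<close> form a submodule of the simple module \<open>V\<close>.
\<close>
theorem relation_forces_zero:
  assumes A: "finite A" "A \<noteq> {}" "A \<subseteq> extensional J"
    and v: "\<And>a. a \<in> A \<Longrightarrow> v a \<in> carrier V" "\<And>a. a \<in> A \<Longrightarrow> v a \<noteq> \<zero>\<^bsub>V\<^esub>"
    and z: "(\<Sum>a\<in>A. \<tau> (mon a) (v a)) = 0"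
    and f: "f \<in> (\<Pi>\<^sub>E i\<in>J. UNIV)" and w: "w \<in> carrier V"
  shows "\<tau> f w = 0"
proof -
  have "\<exists>B\<subseteq>A. B \<noteq> {} \<and> (\<forall>a\<in>B. \<forall>b\<in>B. \<forall>i\<in>K. a i = b i) \<and>
      (\<Sum>a\<in>B. \<tau> (mon (\<lambda>i. if i \<in> K then 0 else a i)) (v a)) = 0" if "finite K" "K \<subseteq> J" for K
    using that
  proof (induction K rule: finite_induct)
    case empty
    then show ?case using A z by (intro exI[of _ A]) simp
  next
    case (insert i K)
    then obtain B where B: "B \<subseteq> A" "B \<noteq> {}" "\<forall>a\<in>B. \<forall>b\<in>B. \<forall>i\<in>K. a i = b i"
      "(\<Sum>a\<in>B. \<tau> (mon (\<lambda>i. if i \<in> K then 0 else a i)) (v a)) = 0" by auto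
    let ?ex = "\<lambda>a i. if i \<in> K then 0 else a i :: nat"
    have finB: "finite B" using B A finite_subset by blast
    define d where "d = Max ((\<lambda>a. a i) ` B)"
    have dle: "a i \<le> d" if "a \<in> B" for a unfolding d_def using finB that by simp
    have "d \<in> (\<lambda>a. a i) ` B" unfolding d_def using finB B(2) by (intro Max_in) auto
    then obtain b where b: "b \<in> B" "b i = d" by auto
    let ?B = "{a \<in> B. ?ex a i = d}"
    have iK: "i \<notin> K" using insert by simp
    have X: "(\<Sum>a\<in>?B. \<tau> (mon ((?ex a)(i := 0))) (v a)) = 0"
      by (rule top_exponent[OF finB _ B(4)]) (use B v insert.prems dle iK in auto)
    have eq: "(?ex a)(i := 0) = (\<lambda>j. if j \<in> insert i K then 0 else a j)" for a by auto
    have "(\<Sum>a\<in>?B. \<tau> (mon (\<lambda>j. if j \<in> insert i K then 0 else a j)) (v a)) = 0"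
      using X unfolding eq .
    moreover have "b \<in> ?B" using b iK by simp
    moreover have "\<forall>a\<in>?B. \<forall>b\<in>?B. \<forall>j\<in>insert i K. a j = b j" using B(3) iK by auto
    moreover have "?B \<subseteq> A" using B(1) by auto
    ultimately show ?case by (intro exI[of _ ?B] conjI) (assumption | blast)+
  qed
  from this[OF fin subset_refl] obtain B where B: "B \<subseteq> A" "B \<noteq> {}" "\<forall>a\<in>B. \<forall>b\<in>B. \<forall>i\<in>J. a i = b i"
      "(\<Sum>a\<in>B. \<tau> (mon (\<lambda>i. if i \<in> J then 0 else a i)) (v a)) = 0" by blast
  obtain b where b: "b \<in> B" using B(2) by blast
  have "a = b" if "a \<in> B" for a
    using that b B(1,3) A(3) by (intro extensionalityI[of a J b]) blast+
  then have Bb: "B = {b}" using b by blast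
  have eq: "mon (\<lambda>i. if i \<in> J then 0 else b i) = mon (\<lambda>_. 0)" by (auto simp: mon_def)
  have "(\<Sum>a\<in>{b}. g a) = g b" for g :: "_ \<Rightarrow> ('x \<Rightarrow>\<^sub>0 complex)" by simp
  from B(4)[unfolded Bb this eq] have vb: "\<tau> (mon (\<lambda>_. 0)) (v b) = 0" .
  have bA: "b \<in> A" using b B by blast
  let ?V = "{u \<in> carrier V. \<forall>f \<in> (\<Pi>\<^sub>E i\<in>J. UNIV). \<tau> f u = 0}"
  have vbV: "v b \<in> ?V" using vanish_all[OF v(1)[OF bA] vb] v(1)[OF bA] by blast
  have "is_lie_submodule hv_alg V ?V"
    unfolding is_lie_submodule_def
  proof (intro conjI ballI)
    show "submodule ?V complex_field V"
    proof (rule V.V.submoduleI)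
      show "\<zero>\<^bsub>V\<^esub> \<in> ?V" using \<tau>_zero_right by simp
      show sc: "c \<odot>\<^bsub>V\<^esub> u \<in> ?V" if "u \<in> ?V" for c u using that by (simp add: \<tau>_smult_right)
      show "\<ominus>\<^bsub>V\<^esub> u \<in> ?V" if "u \<in> ?V" for u
        using sc[OF that, of "-1"] that V.smult_minus_1[of u] by simp
      show "u \<oplus>\<^bsub>V\<^esub> u' \<in> ?V" if "u \<in> ?V" "u' \<in> ?V" for u u'
        using that by (simp add: \<tau>_add_right)
    qed auto
    fix x u assume u: "u \<in> ?V"
    have "\<tau> f (act V x u) = 0" if f: "f \<in> (\<Pi>\<^sub>E i\<in>J. UNIV)" for f
    proof -
      have upd: "f(i := p) \<in> (\<Pi>\<^sub>E i\<in>J. UNIV)" if "i \<in> J" for i p using f that by (auto simp: PiE_def extensional_def)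
      have one: "(\<Sum>s\<in>{\<lambda>_. 0}. g) = g" for g :: "'x \<Rightarrow>\<^sub>0 complex" by simp
      have "\<tau> f u = 0" using u f by blast
      then have "(\<Sum>i\<in>J. \<tau> (f(i := act (omega (lam i) (\<alpha> i) (\<beta> i)) x (f i))) u) + \<tau> f (act V x u) = 0"
        using \<tau>_inv[of "{\<lambda>_. 0}" "\<lambda>_. f" "\<lambda>_. u" x, unfolded one] f u by blast
      moreover have "(\<Sum>i\<in>J. \<tau> (f(i := act (omega (lam i) (\<alpha> i) (\<beta> i)) x (f i))) u) = 0"
        by (rule sum.neutral) (use u upd in blast)
      ultimately show ?thesis by simp
    qed
    then show "act V x u \<in> ?V" using u V.act_closed[of x u] by simp
  qed
  then have "?V = {\<zero>\<^bsub>V\<^esub>} \<or> ?V = carrier V"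
    using simple unfolding simple_lie_module_def by blast
  then have "?V = carrier V" using vbV v(2)[OF bA] by blast
  then show ?thesis using w f by blast
qed

end

section \<open>The modules of polynomials as Lie modules\<close>

text \<open>
  The action written with polynomial functions, \<open>f(x) \<mapsto> \<lambda>\<^sup>k (x + k \<alpha>) f(x - k)\<close> for \<open>L\<^sub>k\<close>. Evaluation at
  points reduces the module laws to identities between complex numbers.
\<close>
fun omega_eval :: "complex \<Rightarrow> complex \<Rightarrow> complex \<Rightarrow> hv_basis \<Rightarrow> complex poly \<Rightarrow> complex \<Rightarrow> complex" where
  "omega_eval l \<alpha> \<beta> (BL k) p x = l powi k * (x + of_int k * \<alpha>) * poly p (x - of_int k)"
| "omega_eval l \<alpha> \<beta> (BI k) p x = l powi k * \<beta> * poly p (x - of_int k)"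
| "omega_eval l \<alpha> \<beta> _ p x = 0"

lemma omega_monom_eval: "(\<Sum>n\<le>degree p. coeff p n * poly (omega_monom l \<alpha> \<beta> b n) x) = omega_eval l \<alpha> \<beta> b p x"
proof (cases b)
  case (BL k)
  have "poly p (x - of_int k) = (\<Sum>n\<le>degree p. coeff p n * (x - of_int k) ^ n)" by (rule poly_altdef)
  then show ?thesis by (simp add: BL poly_power sum_distrib_left algebra_simps)
next
  case (BI k)
  have "poly p (x - of_int k) = (\<Sum>n\<le>degree p. coeff p n * (x - of_int k) ^ n)" by (rule poly_altdef)
  then show ?thesis by (simp add: BI poly_power sum_distrib_left algebra_simps)
qed simp_all

lemma poly_omega_act: "poly (act (omega l \<alpha> \<beta>) y p) x = fun_ext (\<lambda>b. omega_eval l \<alpha> \<beta> b p x) y"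
proof -
  have "poly (act (omega l \<alpha> \<beta>) y p) x =
     (\<Sum>b\<in>Poly_Mapping.keys y. Poly_Mapping.lookup y b * (\<Sum>n\<le>degree p. coeff p n * poly (omega_monom l \<alpha> \<beta> b n) x))"
    by (simp add: omega_def poly_sum sum_distrib_left mult.assoc)
  then show ?thesis by (simp add: omega_monom_eval fun_ext_def)
qed

lemma omega_eval_add: "omega_eval l \<alpha> \<beta> b (p + q) x = omega_eval l \<alpha> \<beta> b p x + omega_eval l \<alpha> \<beta> b q x"
  and omega_eval_smult: "omega_eval l \<alpha> \<beta> b (Polynomial.smult c p) x = c * omega_eval l \<alpha> \<beta> b p x"
  by (cases b; simp add: algebra_simps)+

lemma fun_ext_fun_add: "fun_ext (\<lambda>b. f b + g b) y = fun_ext f y + fun_ext g y"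
  and fun_ext_fun_mult: "fun_ext (\<lambda>b. c * f b) y = c * fun_ext f y"
  by (simp_all add: fun_ext_def distrib_left sum.distrib sum_distrib_left mult.left_commute)

lemma omega_eval_act_add:
    "omega_eval l \<alpha> \<beta> b (act (omega l \<alpha> \<beta>) (z + z') p) x =
      omega_eval l \<alpha> \<beta> b (act (omega l \<alpha> \<beta>) z p) x + omega_eval l \<alpha> \<beta> b (act (omega l \<alpha> \<beta>) z' p) x"
  and omega_eval_act_scale:
    "omega_eval l \<alpha> \<beta> b (act (omega l \<alpha> \<beta>) (scale c z) p) x = c * omega_eval l \<alpha> \<beta> b (act (omega l \<alpha> \<beta>) z p) x"
  by (cases b; simp add: poly_omega_act fun_ext_add fun_ext_scale algebra_simps)+

lemma omega_bracket_gen: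
  assumes "l \<noteq> 0"
  shows "fun_ext (\<lambda>d. omega_eval l \<alpha> \<beta> d p x) (basis_bracket a b) =
    omega_eval l \<alpha> \<beta> a (act (omega l \<alpha> \<beta>) (gen b) p) x - omega_eval l \<alpha> \<beta> b (act (omega l \<alpha> \<beta>) (gen a) p) x"
  by (cases a; cases b;
      simp add: basis_bracket_closed fun_ext_add fun_ext_scale fun_ext_neg fun_ext_diff poly_omega_act power_int_add assms
        del: basis_bracket.simps(1-4);
      (simp add: algebra_simps)?)

lemma module_omega: "module complex_field (omega l \<alpha> \<beta>)"
proof (rule moduleI[OF cring_complex_field])
  show "abelian_group (omega l \<alpha> \<beta>)"
    by (rule abelian_groupI) (auto simp: algebra_simps intro: exI[of _ "- _"])
qed (auto simp: smult_add_left smult_add_right)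

lemma a_minus_omega: "p \<ominus>\<^bsub>omega l \<alpha> \<beta>\<^esub> q = p - q"
proof -
  have "\<ominus>\<^bsub>omega l \<alpha> \<beta>\<^esub> q = - q"
    by (rule abelian_group.minus_equality) (use module_omega in \<open>auto simp: module_def\<close>)
  then show ?thesis by (simp add: a_minus_def)
qed

lemma is_lie_module_omega:
  assumes "l \<noteq> 0"
  shows "is_lie_module hv_alg (omega l \<alpha> \<beta>)"
proof -
  let ?a = "act (omega l \<alpha> \<beta>)"
  have eqI: "p = q" if "\<And>x. poly p x = poly q x" for p q :: "complex poly"
  proof -
    have "poly p = poly q" using that by (rule ext)
    then show ?thesis by (simp only: poly_eq_poly_eq_iff)
  qed
  have br: "?a (bracket hv_alg y z) p = ?a y (?a z p) - ?a z (?a y p)" for y z p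
  proof (rule eqI)
    fix x
    let ?B = "\<lambda>y z. fun_ext (\<lambda>a. omega_eval l \<alpha> \<beta> a (?a z p) x) y"
    have lin: "functional (?B y)" for y
      by (rule functionalI) (simp_all add: omega_eval_act_add omega_eval_act_scale fun_ext_fun_add fun_ext_fun_mult)
    have lin': "functional (\<lambda>y. ?B y z)" for z by (rule functional_fun_ext)
    have br_lin: "bracket hv_alg (y + y') z = bracket hv_alg y z + bracket hv_alg y' z"
      "bracket hv_alg (scale c y) z = scale c (bracket hv_alg y z)"
      "bracket hv_alg y (z + z') = bracket hv_alg y z + bracket hv_alg y z'"
      "bracket hv_alg y (scale c z) = scale c (bracket hv_alg y z)" for y y' z z' c
      by (simp_all add: hv_bracket lin_ext_add lin_ext_scale)
         (simp_all add: lin_ext_def[of _ y] lin_ext_add lin_ext_scale pm.scale_right_distrib sum.distrib pm.scale_sum_right mult.commute)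
    note S = br_lin omega_eval_act_add omega_eval_act_scale fun_ext_fun_add fun_ext_fun_mult fun_ext_add fun_ext_scale pmc.linear_add[OF lin] pmc.linear_scale[OF lin]
    let ?E = "\<lambda>y z. fun_ext (\<lambda>d. omega_eval l \<alpha> \<beta> d p x) (bracket hv_alg y z) - (?B y z - ?B z y)"
    have 1: "?E (gen a) (gen b) = 0" for a b
      using omega_bracket_gen[OF assms] by simp
    have 2: "?E (gen a) z = 0" for a z
      by (rule functional_eqI[of "?E (gen a)" "\<lambda>_. 0" UNIV]) (use 1 in \<open>auto intro!: functionalI simp: S algebra_simps\<close>)
    have 3: "?E y z = 0" for y z
      by (rule functional_eqI[of "\<lambda>y. ?E y z" "\<lambda>_. 0" UNIV]) (use 2 in \<open>auto intro!: functionalI simp: S algebra_simps\<close>)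
    then show "poly (?a (bracket hv_alg y z) p) x = poly (?a y (?a z p) - ?a z (?a y p)) x"
      by (simp add: poly_omega_act)
  qed
  show ?thesis
    unfolding is_lie_module_def
  proof (intro conjI ballI allI module_omega)
    fix x y :: hv and p q :: "complex poly" and c
    show "?a x p \<in> carrier (omega l \<alpha> \<beta>)" by simp
    show "?a x (p \<oplus>\<^bsub>omega l \<alpha> \<beta>\<^esub> q) = ?a x p \<oplus>\<^bsub>omega l \<alpha> \<beta>\<^esub> ?a x q"
      by (rule eqI) (simp add: poly_omega_act omega_eval_add fun_ext_fun_add)
    show "?a x (c \<odot>\<^bsub>omega l \<alpha> \<beta>\<^esub> p) = c \<odot>\<^bsub>omega l \<alpha> \<beta>\<^esub> ?a x p"
      by (rule eqI) (simp add: poly_omega_act omega_eval_smult fun_ext_fun_mult)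
    show "?a (x \<oplus>\<^bsub>hv_alg\<^esub> y) p = ?a x p \<oplus>\<^bsub>omega l \<alpha> \<beta>\<^esub> ?a y p"
      by (rule eqI) (simp add: poly_omega_act fun_ext_add)
    show "?a (c \<odot>\<^bsub>hv_alg\<^esub> x) p = c \<odot>\<^bsub>omega l \<alpha> \<beta>\<^esub> ?a x p"
      by (rule eqI) (simp add: poly_omega_act fun_ext_scale)
    show "?a (bracket hv_alg x y) p = ?a x (?a y p) \<ominus>\<^bsub>omega l \<alpha> \<beta>\<^esub> ?a y (?a x p)"
      by (simp add: a_minus_omega br)
  qed
qed

section \<open>Tensor products of Lie modules\<close>

locale tensor_of_family =
  fixes g :: "'g lie_alg" and J :: "'i set" and V :: "'i \<Rightarrow> ('g, 'v) lie_mod"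
  assumes closed_g: "lie_closed g" and fin: "finite J" and lie_modules: "i \<in> J \<Longrightarrow> is_lie_module g (V i)"
begin

abbreviation "fam \<equiv> \<Pi>\<^sub>E i\<in>J. carrier (V i)"
abbreviation "fam_rels \<equiv> multilinear_relations J V"
definition fam_act :: "'g \<Rightarrow> ('i \<Rightarrow> 'v) \<Rightarrow> (('i \<Rightarrow> 'v) \<Rightarrow>\<^sub>0 complex)" where
  "fam_act x v = (\<Sum>j\<in>J. gen (v(j := act (V j) x (v j))))"

lemma V_lie: "i \<in> J \<Longrightarrow> lie_module g (V i)"
  by unfold_locales (rule lie_modules)

lemma V_module: "i \<in> J \<Longrightarrow> module complex_field (V i)"
  using lie_modules by (simp add: is_lie_module_def)

lemma fam_upd: "v \<in> fam \<Longrightarrow> j \<in> J \<Longrightarrow> u \<in> carrier (V j) \<Longrightarrow> v(j := u) \<in> fam"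
  by (auto simp: PiE_def extensional_def)

lemma fam_mem: "v \<in> fam \<Longrightarrow> j \<in> J \<Longrightarrow> v j \<in> carrier (V j)"
  by (rule PiE_mem)

lemma rel_add: "v \<in> fam \<Longrightarrow> j \<in> J \<Longrightarrow> u \<in> carrier (V j) \<Longrightarrow> u' \<in> carrier (V j) \<Longrightarrow>
    gen (v(j := u \<oplus>\<^bsub>V j\<^esub> u')) - gen (v(j := u)) - gen (v(j := u')) \<in> fam_rels"
  unfolding multilinear_relations_def by blast

lemma rel_smult: "v \<in> fam \<Longrightarrow> j \<in> J \<Longrightarrow> u \<in> carrier (V j) \<Longrightarrow>
    gen (v(j := c \<odot>\<^bsub>V j\<^esub> u)) - scale c (gen (v(j := u))) \<in> fam_rels"
  unfolding multilinear_relations_def by blast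

lemma fam_rels_cases:
  assumes "r \<in> fam_rels"
  obtains (add) v j u u' where "v \<in> fam" "j \<in> J" "u \<in> carrier (V j)" "u' \<in> carrier (V j)"
      "r = gen (v(j := u \<oplus>\<^bsub>V j\<^esub> u')) - gen (v(j := u)) - gen (v(j := u'))"
  | (smult) v j c u where "v \<in> fam" "j \<in> J" "u \<in> carrier (V j)" "r = gen (v(j := c \<odot>\<^bsub>V j\<^esub> u)) - scale c (gen (v(j := u)))"
  using assms unfolding multilinear_relations_def by blast

text \<open>
  Separates the term in which \<open>x\<close> acts on the changed entry from those in which it acts elsewhere.
\<close>
lemma fam_act_upd:
  assumes "j \<in> J"
  shows "fam_act x (v(j := u)) = gen (v(j := act (V j) x u)) + (\<Sum>i\<in>J - {j}. gen ((v(i := act (V i) x (v i)))(j := u)))"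
proof -
  have "fam_act x (v(j := u)) = gen ((v(j := u))(j := act (V j) x ((v(j := u)) j))) +
      (\<Sum>i\<in>J - {j}. gen ((v(j := u))(i := act (V i) x ((v(j := u)) i))))"
    unfolding fam_act_def by (rule sum.remove[OF fin assms])
  also have "(\<Sum>i\<in>J - {j}. gen ((v(j := u))(i := act (V i) x ((v(j := u)) i)))) =
      (\<Sum>i\<in>J - {j}. gen ((v(i := act (V i) x (v i)))(j := u)))"
    by (rule sum.cong) (auto simp: fun_upd_twist)
  finally show ?thesis by (simp only: fun_upd_same fun_upd_upd)
qed

sublocale pres: presentation g fam fam_rels fam_act
proof
  fix r assume "r \<in> fam_rels"
  then show "Poly_Mapping.keys r \<subseteq> fam"
  proof (cases rule: fam_rels_cases)
    case (add v j u u')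
    interpret Vj: module complex_field "V j" by (rule V_module[OF add(2)])
    have "r \<in> {p. Poly_Mapping.keys p \<subseteq> fam}"
      unfolding add(5) by (intro pm.subspace_diff[OF subspace_keys]) (use fam_upd[OF add(1,2)] add(3,4) in auto)
    then show ?thesis by simp
  next
    case (smult v j c u)
    interpret Vj: lie_module g "V j" by (rule V_lie[OF smult(2)])
    have "r \<in> {p. Poly_Mapping.keys p \<subseteq> fam}"
      unfolding smult(4) by (intro pm.subspace_diff[OF subspace_keys] pm.subspace_scale[OF subspace_keys])
        (use fam_upd[OF smult(1,2)] smult(3) Vj.smult_simps(1) in auto)
    then show ?thesis by simp
  qed
next
  fix x v assume x: "x \<in> carrier g" and v: "v \<in> fam"
  have "fam_act x v \<in> {p. Poly_Mapping.keys p \<subseteq> fam}"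
    unfolding fam_act_def
  proof (rule pm.subspace_sum[OF subspace_keys])
    fix j assume j: "j \<in> J"
    interpret Vj: lie_module g "V j" by (rule V_lie[OF j])
    show "gen (v(j := act (V j) x (v j))) \<in> {p. Poly_Mapping.keys p \<subseteq> fam}"
      using fam_upd[OF v j Vj.act_closed[OF x fam_mem[OF v j]]] by simp
  qed
  then show "Poly_Mapping.keys (fam_act x v) \<subseteq> fam" by simp
next
  fix x r assume x: "x \<in> carrier g" and "r \<in> fam_rels"
  from \<open>r \<in> fam_rels\<close> show "lin_ext (fam_act x) r \<in> pm.span fam_rels"
  proof (cases rule: fam_rels_cases)
    case (add v j u u')
    interpret Vj: lie_module g "V j" by (rule V_lie[OF add(2)])
    let ?D = "\<lambda>v a b. gen (v(j := a \<oplus>\<^bsub>V j\<^esub> b)) - gen (v(j := a)) - gen (v(j := b))"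
    have "lin_ext (fam_act x) r = ?D v (act (V j) x u) (act (V j) x u') + (\<Sum>i\<in>J - {j}. ?D (v(i := act (V i) x (v i))) u u')"
      unfolding add(5) by (simp only: lin_ext_diff lin_ext_gen fam_act_upd[OF add(2)] Vj.act_add[OF x add(3,4)] sum_subtractf) simp
    also have "\<dots> \<in> pm.span fam_rels"
    proof (intro pm.span_add pm.span_sum)
      show "?D v (act (V j) x u) (act (V j) x u') \<in> pm.span fam_rels"
        by (intro pm.span_base rel_add add Vj.act_closed x)
      fix i assume i: "i \<in> J - {j}"
      interpret Vi: lie_module g "V i" using V_lie i by simp
      show "?D (v(i := act (V i) x (v i))) u u' \<in> pm.span fam_rels"
        by (intro pm.span_base rel_add add fam_upd Vi.act_closed x fam_mem) (use i in auto)
    qed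
    finally show ?thesis .
  next
    case (smult v j c u)
    interpret Vj: lie_module g "V j" by (rule V_lie[OF smult(2)])
    let ?D = "\<lambda>v a. gen (v(j := c \<odot>\<^bsub>V j\<^esub> a)) - scale c (gen (v(j := a)))"
    have "lin_ext (fam_act x) r = ?D v (act (V j) x u) + (\<Sum>i\<in>J - {j}. ?D (v(i := act (V i) x (v i))) u)"
      unfolding smult(4)
      by (simp only: lin_ext_diff lin_ext_scale lin_ext_gen fam_act_upd[OF smult(2)] Vj.act_smult[OF x smult(3)] sum_subtractf
          pm.scale_right_distrib pm.scale_sum_right) simp
    also have "\<dots> \<in> pm.span fam_rels"
    proof (intro pm.span_add pm.span_sum)
      show "?D v (act (V j) x u) \<in> pm.span fam_rels"
        by (intro pm.span_base rel_smult smult Vj.act_closed x)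
      fix i assume i: "i \<in> J - {j}"
      interpret Vi: lie_module g "V i" using V_lie i by simp
      show "?D (v(i := act (V i) x (v i))) u \<in> pm.span fam_rels"
        by (intro pm.span_base rel_smult smult fam_upd Vi.act_closed x fam_mem) (use i in auto)
    qed
    finally show ?thesis .
  qed
qed

lemma tensor_family_eq: "tensor_family J V = pres.P"
  by (simp add: tensor_family_def fam_act_def[abs_def])

lemma gen_add: "v \<in> fam \<Longrightarrow> j \<in> J \<Longrightarrow> u \<in> carrier (V j) \<Longrightarrow> u' \<in> carrier (V j) \<Longrightarrow>
    gen (v(j := u \<oplus>\<^bsub>V j\<^esub> u')) - (gen (v(j := u)) + gen (v(j := u'))) \<in> pres.N"
  using pm.span_base[OF rel_add] by (simp only: diff_diff_eq)

lemma gen_minus: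
  assumes "v \<in> fam" "j \<in> J" "u \<in> carrier (V j)" "u' \<in> carrier (V j)"
  shows "gen (v(j := u \<ominus>\<^bsub>V j\<^esub> u')) - (gen (v(j := u)) - gen (v(j := u'))) \<in> pres.N"
proof -
  interpret Vj: lie_module g "V j" by (rule V_lie[OF assms(2)])
  have "u \<ominus>\<^bsub>V j\<^esub> u' \<oplus>\<^bsub>V j\<^esub> u' = u"
    using assms(3,4) by (simp add: a_minus_def Vj.V.a_assoc Vj.V.l_neg)
  then have "gen (v(j := u)) - (gen (v(j := u \<ominus>\<^bsub>V j\<^esub> u')) + gen (v(j := u'))) \<in> pres.N"
    using gen_add[OF assms(1,2), of "u \<ominus>\<^bsub>V j\<^esub> u'" u'] assms(3,4) by simp
  then have "- (gen (v(j := u)) - (gen (v(j := u \<ominus>\<^bsub>V j\<^esub> u')) + gen (v(j := u')))) \<in> pres.N" by (rule pm.span_neg)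
  then show ?thesis by (simp add: algebra_simps)
qed

lemma is_lie_module_tensor_family: "is_lie_module g pres.P"
proof (rule pres.is_lie_module_P)
  note C = closed_g[unfolded lie_closed_def]
  show "a \<oplus>\<^bsub>g\<^esub> b \<in> carrier g" if "a \<in> carrier g" "b \<in> carrier g" for a b using C that by blast
  show "bracket g a b \<in> carrier g" if "a \<in> carrier g" "b \<in> carrier g" for a b using C that by blast
  show "c \<odot>\<^bsub>g\<^esub> a \<in> carrier g" if "a \<in> carrier g" for a c using C that by blast
next
  fix a b v assume ab: "a \<in> carrier g" "b \<in> carrier g" and v: "v \<in> fam"
  have "fam_act (a \<oplus>\<^bsub>g\<^esub> b) v - (fam_act a v + fam_act b v) =
      (\<Sum>j\<in>J. gen (v(j := act (V j) (a \<oplus>\<^bsub>g\<^esub> b) (v j))) - (gen (v(j := act (V j) a (v j))) + gen (v(j := act (V j) b (v j)))))"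
    by (simp only: fam_act_def sum.distrib sum_subtractf)
  also have "\<dots> \<in> pres.N"
  proof (rule pm.span_sum)
    fix j assume j: "j \<in> J"
    interpret Vj: lie_module g "V j" by (rule V_lie[OF j])
    show "gen (v(j := act (V j) (a \<oplus>\<^bsub>g\<^esub> b) (v j))) - (gen (v(j := act (V j) a (v j))) + gen (v(j := act (V j) b (v j)))) \<in> pres.N"
      unfolding Vj.add_act[OF ab fam_mem[OF v j]]
      by (intro gen_add v j Vj.act_closed ab fam_mem)
  qed
  finally show "fam_act (a \<oplus>\<^bsub>g\<^esub> b) v - (fam_act a v + fam_act b v) \<in> pres.N" .
  let ?O = "\<lambda>a b. \<Sum>j\<in>J. \<Sum>i\<in>J - {j}. gen ((v(i := act (V i) a (v i)))(j := act (V j) b (v j)))"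
  have comp: "lin_ext (fam_act a) (fam_act b v) = (\<Sum>j\<in>J. gen (v(j := act (V j) a (act (V j) b (v j))))) + ?O a b" for a b
  proof -
    have "lin_ext (fam_act a) (fam_act b v) = (\<Sum>j\<in>J. fam_act a (v(j := act (V j) b (v j))))"
      by (simp only: fam_act_def[of b] lin_ext_sum lin_ext_gen)
    also have "\<dots> = (\<Sum>j\<in>J. gen (v(j := act (V j) a (act (V j) b (v j)))) +
        (\<Sum>i\<in>J - {j}. gen ((v(i := act (V i) a (v i)))(j := act (V j) b (v j)))))"
      by (rule sum.cong[OF refl]) (rule fam_act_upd)
    finally show ?thesis by (simp only: sum.distrib)
  qed
  \<comment> \<open>The terms in which the two elements act on different factors are symmetric and cancel in the
    commutator.\<close>
  have O: "?O a b = ?O b a"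
  proof -
    have "?O a b = (\<Sum>(j, i) \<in> (SIGMA j:J. J - {j}). gen ((v(i := act (V i) a (v i)))(j := act (V j) b (v j))))"
      by (rule sum.Sigma) (use fin in auto)
    also have "\<dots> = (\<Sum>(j, i) \<in> (SIGMA j:J. J - {j}). gen ((v(i := act (V i) b (v i)))(j := act (V j) a (v j))))"
      by (rule sum.reindex_bij_witness[of _ "\<lambda>(i, j). (j, i)" "\<lambda>(i, j). (j, i)"]) (auto intro!: arg_cong[where f = "\<lambda>u. gen u"] fun_upd_twist)
    also have "\<dots> = ?O b a" by (rule sum.Sigma[symmetric]) (use fin in auto)
    finally show ?thesis .
  qed
  have "fam_act (bracket g a b) v - (lin_ext (fam_act a) (fam_act b v) - lin_ext (fam_act b) (fam_act a v)) =
      (\<Sum>j\<in>J. gen (v(j := act (V j) (bracket g a b) (v j))) -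
         (gen (v(j := act (V j) a (act (V j) b (v j)))) - gen (v(j := act (V j) b (act (V j) a (v j))))))"
    unfolding comp O by (simp add: fam_act_def sum_subtractf)
  also have "\<dots> \<in> pres.N"
  proof (rule pm.span_sum)
    fix j assume j: "j \<in> J"
    interpret Vj: lie_module g "V j" by (rule V_lie[OF j])
    show "gen (v(j := act (V j) (bracket g a b) (v j))) -
         (gen (v(j := act (V j) a (act (V j) b (v j)))) - gen (v(j := act (V j) b (act (V j) a (v j))))) \<in> pres.N"
      unfolding Vj.bracket_act[OF ab fam_mem[OF v j]]
      by (intro gen_minus v j Vj.act_closed ab fam_mem)
  qed
  finally show "fam_act (bracket g a b) v - (lin_ext (fam_act a) (fam_act b v) - lin_ext (fam_act b) (fam_act a v)) \<in> pres.N" .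
next
  fix a c v assume a: "a \<in> carrier g" and v: "v \<in> fam"
  have "fam_act (c \<odot>\<^bsub>g\<^esub> a) v - scale c (fam_act a v) =
      (\<Sum>j\<in>J. gen (v(j := act (V j) (c \<odot>\<^bsub>g\<^esub> a) (v j))) - scale c (gen (v(j := act (V j) a (v j)))))"
    by (simp only: fam_act_def pm.scale_sum_right sum_subtractf)
  also have "\<dots> \<in> pres.N"
  proof (rule pm.span_sum)
    fix j assume j: "j \<in> J"
    interpret Vj: lie_module g "V j" by (rule V_lie[OF j])
    show "gen (v(j := act (V j) (c \<odot>\<^bsub>g\<^esub> a) (v j))) - scale c (gen (v(j := act (V j) a (v j)))) \<in> pres.N"
      unfolding Vj.smult_act[OF a fam_mem[OF v j]]
      by (intro pm.span_base rel_smult v j Vj.act_closed a fam_mem)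
  qed
  finally show "fam_act (c \<odot>\<^bsub>g\<^esub> a) v - scale c (fam_act a v) \<in> pres.N" .
qed

end

locale tensor_of_two = A: lie_module g A + B: lie_module g B
  for g :: "'g lie_alg" and A :: "('g, 'v) lie_mod" and B :: "('g, 'w) lie_mod" +
  assumes closed_g: "lie_closed g"
begin

abbreviation "pairs \<equiv> carrier A \<times> carrier B"
abbreviation "pair_rels \<equiv> bilinear_relations A B"
definition t :: "'v \<Rightarrow> 'w \<Rightarrow> ('v \<times> 'w \<Rightarrow>\<^sub>0 complex)" where "t v w = gen (v, w)"
definition pair_act :: "'g \<Rightarrow> 'v \<times> 'w \<Rightarrow> ('v \<times> 'w \<Rightarrow>\<^sub>0 complex)" where
  "pair_act = (\<lambda>x (v, w). gen (act A x v, w) + gen (v, act B x w))"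

lemma pair_act_t: "lin_ext (pair_act x) (t v w) = t (act A x v) w + t v (act B x w)"
  by (simp add: t_def pair_act_def)

lemma rel_add_left:
  assumes "v \<in> carrier A" "v' \<in> carrier A" "w \<in> carrier B"
  shows "t (v \<oplus>\<^bsub>A\<^esub> v') w - t v w - t v' w \<in> pair_rels"
  unfolding bilinear_relations_def t_def using assms by blast

lemma rel_add_right:
  assumes "v \<in> carrier A" "w \<in> carrier B" "w' \<in> carrier B"
  shows "t v (w \<oplus>\<^bsub>B\<^esub> w') - t v w - t v w' \<in> pair_rels"
  unfolding bilinear_relations_def t_def using assms by blast

lemma rel_smult_left:
  assumes "v \<in> carrier A" "w \<in> carrier B"
  shows "t (c \<odot>\<^bsub>A\<^esub> v) w - scale c (t v w) \<in> pair_rels"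
  unfolding bilinear_relations_def t_def using assms by blast

lemma rel_smult_right:
  assumes "v \<in> carrier A" "w \<in> carrier B"
  shows "t v (c \<odot>\<^bsub>B\<^esub> w) - scale c (t v w) \<in> pair_rels"
  unfolding bilinear_relations_def t_def using assms by blast

lemma pair_rels_cases:
  assumes "r \<in> pair_rels"
  obtains (left_add) v v' w where "v \<in> carrier A" "v' \<in> carrier A" "w \<in> carrier B" "r = t (v \<oplus>\<^bsub>A\<^esub> v') w - t v w - t v' w"
  | (right_add) v w w' where "v \<in> carrier A" "w \<in> carrier B" "w' \<in> carrier B" "r = t v (w \<oplus>\<^bsub>B\<^esub> w') - t v w - t v w'"
  | (left_scale) c v w where "v \<in> carrier A" "w \<in> carrier B" "r = t (c \<odot>\<^bsub>A\<^esub> v) w - scale c (t v w)"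
  | (right_scale) c v w where "v \<in> carrier A" "w \<in> carrier B" "r = t v (c \<odot>\<^bsub>B\<^esub> w) - scale c (t v w)"
proof -
  consider (1) v v' w where "r = gen (v \<oplus>\<^bsub>A\<^esub> v', w) - gen (v, w) - gen (v', w)" "v \<in> carrier A" "v' \<in> carrier A" "w \<in> carrier B"
    | (2) v w w' where "r = gen (v, w \<oplus>\<^bsub>B\<^esub> w') - gen (v, w) - gen (v, w')" "v \<in> carrier A" "w \<in> carrier B" "w' \<in> carrier B"
    | (3) c v w where "r = gen (c \<odot>\<^bsub>A\<^esub> v, w) - scale c (gen (v, w))" "v \<in> carrier A" "w \<in> carrier B"
    | (4) c v w where "r = gen (v, c \<odot>\<^bsub>B\<^esub> w) - scale c (gen (v, w))" "v \<in> carrier A" "w \<in> carrier B"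
    using assms unfolding bilinear_relations_def by blast
  then show thesis
  proof cases
    case 1 then show thesis using left_add unfolding t_def by metis
  next
    case 2 then show thesis using right_add unfolding t_def by metis
  next
    case 3 then show thesis using left_scale unfolding t_def by metis
  next
    case 4 then show thesis using right_scale unfolding t_def by metis
  qed
qed

lemma keys_t: "v \<in> carrier A \<Longrightarrow> w \<in> carrier B \<Longrightarrow> t v w \<in> {p. Poly_Mapping.keys p \<subseteq> pairs}"
  by (simp add: t_def)

sublocale pres: presentation g pairs pair_rels pair_act
proof
  note K = pm.subspace_diff[OF subspace_keys[of pairs]] pm.subspace_scale[OF subspace_keys[of pairs]]
  fix r assume "r \<in> pair_rels"
  then have "r \<in> {p. Poly_Mapping.keys p \<subseteq> pairs}"
  proof (cases rule: pair_rels_cases)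
    case left_add then show ?thesis by (simp only:) (intro K keys_t A.V.a_closed; assumption)
  next
    case right_add then show ?thesis by (simp only:) (intro K keys_t B.V.a_closed; assumption)
  next
    case left_scale then show ?thesis by (simp only:) (intro K keys_t A.smult_simps; assumption)
  next
    case right_scale then show ?thesis by (simp only:) (intro K keys_t B.smult_simps; assumption)
  qed
  then show "Poly_Mapping.keys r \<subseteq> pairs" by simp
next
  fix x u assume x: "x \<in> carrier g" and "u \<in> pairs"
  then obtain v w where u: "u = (v, w)" "v \<in> carrier A" "w \<in> carrier B" by blast
  have "t (act A x v) w + t v (act B x w) \<in> {p. Poly_Mapping.keys p \<subseteq> pairs}"
    by (intro pm.subspace_add[OF subspace_keys] keys_t A.act_closed B.act_closed x u)
  then show "Poly_Mapping.keys (pair_act x u) \<subseteq> pairs" by (simp add: u pair_act_def t_def)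
next
  fix x r assume x: "x \<in> carrier g" and "r \<in> pair_rels"
  note S = lin_ext_diff lin_ext_scale pair_act_t
  note I = pm.span_add pm.span_base
  note m = A.act_closed[OF x] B.act_closed[OF x]
  from \<open>r \<in> pair_rels\<close> show "lin_ext (pair_act x) r \<in> pm.span pair_rels"
  proof (cases rule: pair_rels_cases)
    case (left_add v v' w)
    have "lin_ext (pair_act x) r = (t (act A x v \<oplus>\<^bsub>A\<^esub> act A x v') w - t (act A x v) w - t (act A x v') w)
       + (t (v \<oplus>\<^bsub>A\<^esub> v') (act B x w) - t v (act B x w) - t v' (act B x w))"
      by (simp add: left_add S A.act_add x)
    also have "\<dots> \<in> pm.span pair_rels" by (intro I rel_add_left m left_add)
    finally show ?thesis .
  next
    case (right_add v w w')
    have "lin_ext (pair_act x) r = (t (act A x v) (w \<oplus>\<^bsub>B\<^esub> w') - t (act A x v) w - t (act A x v) w')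
       + (t v (act B x w \<oplus>\<^bsub>B\<^esub> act B x w') - t v (act B x w) - t v (act B x w'))"
      by (simp add: right_add S B.act_add x)
    also have "\<dots> \<in> pm.span pair_rels" by (intro I rel_add_right m right_add)
    finally show ?thesis .
  next
    case (left_scale c v w)
    have "lin_ext (pair_act x) r = (t (c \<odot>\<^bsub>A\<^esub> act A x v) w - scale c (t (act A x v) w))
       + (t (c \<odot>\<^bsub>A\<^esub> v) (act B x w) - scale c (t v (act B x w)))"
      by (simp add: left_scale S A.act_smult x pm.scale_right_distrib)
    also have "\<dots> \<in> pm.span pair_rels" by (intro I rel_smult_left m left_scale)
    finally show ?thesis .
  next
    case (right_scale c v w)
    have "lin_ext (pair_act x) r = (t (act A x v) (c \<odot>\<^bsub>B\<^esub> w) - scale c (t (act A x v) w))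
       + (t v (c \<odot>\<^bsub>B\<^esub> act B x w) - scale c (t v (act B x w)))"
      by (simp add: right_scale S B.act_smult x pm.scale_right_distrib)
    also have "\<dots> \<in> pm.span pair_rels" by (intro I rel_smult_right m right_scale)
    finally show ?thesis .
  qed
qed

lemma tensor_eq: "tensor A B = pres.P"
  by (simp add: tensor_def pair_act_def)

lemma t_congs:
  "v \<in> carrier A \<Longrightarrow> v' \<in> carrier A \<Longrightarrow> w \<in> carrier B \<Longrightarrow> t (v \<oplus>\<^bsub>A\<^esub> v') w - (t v w + t v' w) \<in> pres.N"
  "v \<in> carrier A \<Longrightarrow> w \<in> carrier B \<Longrightarrow> w' \<in> carrier B \<Longrightarrow> t v (w \<oplus>\<^bsub>B\<^esub> w') - (t v w + t v w') \<in> pres.N"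
  "v \<in> carrier A \<Longrightarrow> w \<in> carrier B \<Longrightarrow> t (c \<odot>\<^bsub>A\<^esub> v) w - scale c (t v w) \<in> pres.N"
  "v \<in> carrier A \<Longrightarrow> w \<in> carrier B \<Longrightarrow> t v (c \<odot>\<^bsub>B\<^esub> w) - scale c (t v w) \<in> pres.N"
  using pm.span_base[OF rel_add_left] pm.span_base[OF rel_add_right] pm.span_base[OF rel_smult_left]
    pm.span_base[OF rel_smult_right] by (simp_all only: diff_diff_eq)

lemma t_minus_left:
  assumes "v \<in> carrier A" "v' \<in> carrier A" "w \<in> carrier B"
  shows "t (v \<ominus>\<^bsub>A\<^esub> v') w - (t v w - t v' w) \<in> pres.N"
proof -
  have "v \<ominus>\<^bsub>A\<^esub> v' \<oplus>\<^bsub>A\<^esub> v' = v" using assms by (simp add: a_minus_def A.V.a_assoc A.V.l_neg)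
  then have "- (t v w - (t (v \<ominus>\<^bsub>A\<^esub> v') w + t v' w)) \<in> pres.N"
    using t_congs(1)[of "v \<ominus>\<^bsub>A\<^esub> v'" v' w] assms by (intro pm.span_neg) simp
  then show ?thesis by (simp add: algebra_simps)
qed

lemma t_minus_right:
  assumes "v \<in> carrier A" "w \<in> carrier B" "w' \<in> carrier B"
  shows "t v (w \<ominus>\<^bsub>B\<^esub> w') - (t v w - t v w') \<in> pres.N"
proof -
  have "w \<ominus>\<^bsub>B\<^esub> w' \<oplus>\<^bsub>B\<^esub> w' = w" using assms by (simp add: a_minus_def B.V.a_assoc B.V.l_neg)
  then have "- (t v w - (t v (w \<ominus>\<^bsub>B\<^esub> w') + t v w')) \<in> pres.N"
    using t_congs(2)[of v "w \<ominus>\<^bsub>B\<^esub> w'" w'] assms by (intro pm.span_neg) simp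
  then show ?thesis by (simp add: algebra_simps)
qed

lemma is_lie_module_tensor: "is_lie_module g pres.P"
proof (rule pres.is_lie_module_P)
  note C = closed_g[unfolded lie_closed_def]
  show "a \<oplus>\<^bsub>g\<^esub> b \<in> carrier g" if "a \<in> carrier g" "b \<in> carrier g" for a b using C that by blast
  show "bracket g a b \<in> carrier g" if "a \<in> carrier g" "b \<in> carrier g" for a b using C that by blast
  show "c \<odot>\<^bsub>g\<^esub> a \<in> carrier g" if "a \<in> carrier g" for a c using C that by blast
next
  fix a b u assume ab: "a \<in> carrier g" "b \<in> carrier g" and "u \<in> pairs"
  then obtain v w where u: "u = (v, w)" "v \<in> carrier A" "w \<in> carrier B" by blast
  have pa: "pair_act x (v, w) = t (act A x v) w + t v (act B x w)" for x by (simp add: pair_act_def t_def)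
  have "pair_act (a \<oplus>\<^bsub>g\<^esub> b) u - (pair_act a u + pair_act b u) =
     (t (act A a v \<oplus>\<^bsub>A\<^esub> act A b v) w - (t (act A a v) w + t (act A b v) w)) +
     (t v (act B a w \<oplus>\<^bsub>B\<^esub> act B b w) - (t v (act B a w) + t v (act B b w)))"
    by (simp add: pa A.add_act B.add_act ab u algebra_simps)
  also have "\<dots> \<in> pres.N" by (intro pm.span_add t_congs A.act_closed B.act_closed ab u)
  finally show "pair_act (a \<oplus>\<^bsub>g\<^esub> b) u - (pair_act a u + pair_act b u) \<in> pres.N" .
  have "pair_act (bracket g a b) u - (lin_ext (pair_act a) (pair_act b u) - lin_ext (pair_act b) (pair_act a u)) =
     (t (act A a (act A b v) \<ominus>\<^bsub>A\<^esub> act A b (act A a v)) w - (t (act A a (act A b v)) w - t (act A b (act A a v)) w)) +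
     (t v (act B a (act B b w) \<ominus>\<^bsub>B\<^esub> act B b (act B a w)) - (t v (act B a (act B b w)) - t v (act B b (act B a w))))"
    by (simp add: pa lin_ext_add pair_act_t A.bracket_act B.bracket_act ab u algebra_simps)
  also have "\<dots> \<in> pres.N" by (intro pm.span_add t_minus_left t_minus_right A.act_closed B.act_closed ab u)
  finally show "pair_act (bracket g a b) u - (lin_ext (pair_act a) (pair_act b u) - lin_ext (pair_act b) (pair_act a u)) \<in> pres.N" .
next
  fix a c u assume a: "a \<in> carrier g" and "u \<in> pairs"
  then obtain v w where u: "u = (v, w)" "v \<in> carrier A" "w \<in> carrier B" by blast
  have pa: "pair_act x (v, w) = t (act A x v) w + t v (act B x w)" for x by (simp add: pair_act_def t_def)
  have "pair_act (c \<odot>\<^bsub>g\<^esub> a) u - scale c (pair_act a u) =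
     (t (c \<odot>\<^bsub>A\<^esub> act A a v) w - scale c (t (act A a v) w)) + (t v (c \<odot>\<^bsub>B\<^esub> act B a w) - scale c (t v (act B a w)))"
    by (simp add: pa A.smult_act B.smult_act a u pm.scale_right_distrib)
  also have "\<dots> \<in> pres.N" by (intro pm.span_add t_congs A.act_closed B.act_closed a u)
  finally show "pair_act (c \<odot>\<^bsub>g\<^esub> a) u - scale c (pair_act a u) \<in> pres.N" .
qed

end

section \<open>Simplicity of the tensor product\<close>

text \<open>
  \<open>V\<close> takes the place of \<open>Ind(M)\<close>: a simple module in which every vector is killed by \<open>L\<^sub>n\<close> and \<open>I\<^sub>n\<close> for large \<open>n\<close>.
\<close>
locale omega_tensor_simple =
  fixes J :: "nat set" and lam \<alpha> \<beta> :: "nat \<Rightarrow> complex" and V :: "(hv, 'w) lie_mod"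
  assumes fin: "finite J" and inj: "inj_on lam J" and lam0: "i \<in> J \<Longrightarrow> lam i \<noteq> 0"
    and ab: "i \<in> J \<Longrightarrow> \<beta> i \<noteq> 0 \<or> \<alpha> i \<noteq> 0"
    and simple: "simple_lie_module hv_alg V"
    and killed: "w \<in> carrier V \<Longrightarrow> \<exists>n0. \<forall>n\<ge>n0. act V (L_elt n) w = \<zero>\<^bsub>V\<^esub> \<and> act V (I_elt n) w = \<zero>\<^bsub>V\<^esub>"
begin

abbreviation "\<Omega> \<equiv> \<lambda>i. omega (lam i) (\<alpha> i) (\<beta> i)"

sublocale Om: tensor_of_family hv_alg J \<Omega>
  by unfold_locales (use lie_closed_hv_alg fin is_lie_module_omega lam0 in auto)

sublocale T: tensor_of_two hv_alg Om.pres.P V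
  by unfold_locales
     (use Om.is_lie_module_tensor_family simple lie_closed_hv_alg in \<open>simp_all add: simple_lie_module_def\<close>)

lemma fam_eq: "Om.fam = (\<Pi>\<^sub>E i\<in>J. UNIV)" by simp

definition pure :: "(nat \<Rightarrow> complex poly) \<Rightarrow> ((nat \<Rightarrow> complex poly) \<Rightarrow>\<^sub>0 complex) set" where
  "pure f = Om.pres.cs (gen f)"

lemma cs_carrier: "p \<in> Om.pres.F \<Longrightarrow> Om.pres.cs p \<in> carrier Om.pres.P"
  by (rule Om.pres.cs_in_P)

lemma pure_carrier: "f \<in> Om.fam \<Longrightarrow> pure f \<in> carrier Om.pres.P"
  unfolding pure_def by (rule cs_carrier) simp

lemma pure_add: "f \<in> Om.fam \<Longrightarrow> i \<in> J \<Longrightarrow> pure (f(i := p + q)) = pure (f(i := p)) \<oplus>\<^bsub>Om.pres.P\<^esub> pure (f(i := q))"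
proof -
  assume f: "f \<in> Om.fam" and i: "i \<in> J"
  have "gen (f(i := p \<oplus>\<^bsub>\<Omega> i\<^esub> q)) - (gen (f(i := p)) + gen (f(i := q))) \<in> Om.pres.N"
    by (rule Om.gen_add[OF f i]) simp_all
  then show ?thesis unfolding pure_def Om.pres.add_P Om.pres.cs_eq_iff by (simp only: omega_simps(3))
qed

lemma pure_smult: "f \<in> Om.fam \<Longrightarrow> i \<in> J \<Longrightarrow> pure (f(i := Polynomial.smult c p)) = c \<odot>\<^bsub>Om.pres.P\<^esub> pure (f(i := p))"
proof -
  assume f: "f \<in> Om.fam" and i: "i \<in> J"
  have "gen (f(i := c \<odot>\<^bsub>\<Omega> i\<^esub> p)) - scale c (gen (f(i := p))) \<in> Om.pres.N"
    by (rule pm.span_base, rule Om.rel_smult[OF f i]) simp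
  then show ?thesis unfolding pure_def Om.pres.smult_P Om.pres.cs_eq_iff by (simp only: omega_simps(4))
qed

context
  fixes S :: "(((nat \<Rightarrow> complex poly) \<Rightarrow>\<^sub>0 complex) set \<times> 'w \<Rightarrow>\<^sub>0 complex) set"
  assumes subS: "pm.subspace S" and NS: "T.pres.N \<subseteq> S"
begin

text \<open>
  The classes of pure tensors modulo a subspace \<open>S\<close> that contains the relations. Both \<open>S = T.pres.N\<close> and a proper
  submodule \<open>S\<close> occur below: the first shows when an element is nonzero, the second carries the relation.
\<close>
definition \<tau> :: "(nat \<Rightarrow> complex poly) \<Rightarrow> 'w \<Rightarrow> _" where
  "\<tau> f w = proj S (T.t (pure f) w)"

lemma proj_cong: "p - q \<in> T.pres.N \<Longrightarrow> proj S p = proj S q"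
  using NS proj_eq_iff[OF subS] by blast

lemmas pS = pm2.linear_add[OF plinear_proj[OF subS]] pm2.linear_scale[OF plinear_proj[OF subS]]
  pm2.linear_0[OF plinear_proj[OF subS]] pm2.linear_sum[OF plinear_proj[OF subS]]

lemma \<tau>_add: "f \<in> Om.fam \<Longrightarrow> i \<in> J \<Longrightarrow> w \<in> carrier V \<Longrightarrow> \<tau> (f(i := p + q)) w = \<tau> (f(i := p)) w + \<tau> (f(i := q)) w"
proof -
  assume f: "f \<in> Om.fam" and i: "i \<in> J" and w: "w \<in> carrier V"
  have c: "pure (f(i := p)) \<in> carrier Om.pres.P" for p
    by (rule pure_carrier[OF Om.fam_upd[OF f i]]) simp
  show ?thesis
    unfolding \<tau>_def pure_add[OF f i] using proj_cong[OF T.t_congs(1)[OF c c w]] by (simp only: pS)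
qed

lemma \<tau>_smult: "f \<in> Om.fam \<Longrightarrow> i \<in> J \<Longrightarrow> w \<in> carrier V \<Longrightarrow> \<tau> (f(i := Polynomial.smult c p)) w = scale c (\<tau> (f(i := p)) w)"
proof -
  assume f: "f \<in> Om.fam" and i: "i \<in> J" and w: "w \<in> carrier V"
  have c: "pure (f(i := p)) \<in> carrier Om.pres.P" for p
    by (rule pure_carrier[OF Om.fam_upd[OF f i]]) simp
  show ?thesis
    unfolding \<tau>_def pure_smult[OF f i] using proj_cong[OF T.t_congs(3)[OF c w]] by (simp only: pS)
qed

lemma \<tau>_add_right: "f \<in> Om.fam \<Longrightarrow> v \<in> carrier V \<Longrightarrow> w \<in> carrier V \<Longrightarrow> \<tau> f (v \<oplus>\<^bsub>V\<^esub> w) = \<tau> f v + \<tau> f w"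
  unfolding \<tau>_def using proj_cong[OF T.t_congs(2)[OF pure_carrier]] by (simp only: pS)

lemma \<tau>_smult_right: "f \<in> Om.fam \<Longrightarrow> v \<in> carrier V \<Longrightarrow> \<tau> f (c \<odot>\<^bsub>V\<^esub> v) = scale c (\<tau> f v)"
  unfolding \<tau>_def using proj_cong[OF T.t_congs(4)[OF pure_carrier]] by (simp only: pS)

lemma \<tau>_zero_right: "f \<in> Om.fam \<Longrightarrow> \<tau> f \<zero>\<^bsub>V\<^esub> = 0"
  using \<tau>_smult_right[of f "\<zero>\<^bsub>V\<^esub>" 0] by simp

lemma proj_t_cs:
  assumes "p \<in> Om.pres.F" "w \<in> carrier V"
  shows "proj S (T.t (Om.pres.cs p) w) = lin_ext (\<lambda>f. \<tau> f w) p"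
proof -
  have "Poly_Mapping.keys p \<subseteq> Om.fam" using assms(1) by simp
  then show ?thesis
  proof (induction rule: pm_induct)
    case zero
    have c: "Om.pres.cs 0 \<in> carrier Om.pres.P" by (rule cs_carrier) simp
    have "0 \<odot>\<^bsub>Om.pres.P\<^esub> Om.pres.cs 0 = Om.pres.cs 0" by (simp only: Om.pres.smult_P pm.scale_zero_right)
    then have "proj S (T.t (Om.pres.cs 0) w) = scale 0 (proj S (T.t (Om.pres.cs 0) w))"
      using proj_cong[OF T.t_congs(3)[OF c assms(2), of 0]] by (simp only: pS)
    then show ?case by simp
  next
    case (step c f p)
    have f: "pure f \<in> carrier Om.pres.P" by (rule pure_carrier[OF step(1)])
    have p: "Om.pres.cs p \<in> carrier Om.pres.P" by (rule cs_carrier) (use step(2) in blast)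
    have "Om.pres.cs (scale c (gen f) + p) = (c \<odot>\<^bsub>Om.pres.P\<^esub> pure f) \<oplus>\<^bsub>Om.pres.P\<^esub> Om.pres.cs p"
      by (simp only: pure_def Om.pres.smult_P Om.pres.add_P)
    then have "proj S (T.t (Om.pres.cs (scale c (gen f) + p)) w) =
        proj S (T.t (c \<odot>\<^bsub>Om.pres.P\<^esub> pure f) w) + proj S (T.t (Om.pres.cs p) w)"
      using proj_cong[OF T.t_congs(1)[OF T.A.smult_simps(1)[OF f, of c] p assms(2)]] by (simp only: pS)
    also have "proj S (T.t (c \<odot>\<^bsub>Om.pres.P\<^esub> pure f) w) = scale c (\<tau> f w)"
      using proj_cong[OF T.t_congs(3)[OF f assms(2), of c]] by (simp only: pS \<tau>_def)
    finally show ?case using step(3) by (simp only: lin_ext_add lin_ext_scale lin_ext_gen)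
  qed
qed

lemma \<tau>_invariant:
  assumes inv: "\<And>x p. p \<in> S \<Longrightarrow> lin_ext (T.pair_act x) p \<in> S"
    and "finite A" "\<And>s. s \<in> A \<Longrightarrow> F s \<in> Om.fam" "\<And>s. s \<in> A \<Longrightarrow> u s \<in> carrier V"
    and zero: "(\<Sum>s\<in>A. \<tau> (F s) (u s)) = 0"
  shows "(\<Sum>s\<in>A. (\<Sum>i\<in>J. \<tau> ((F s)(i := act (\<Omega> i) x (F s i))) (u s)) + \<tau> (F s) (act V x (u s))) = 0"
proof -
  let ?q = "\<Sum>s\<in>A. T.t (pure (F s)) (u s)"
  have "proj S ?q = 0" using zero by (simp only: pS \<tau>_def)
  then have "?q \<in> S" using proj_eq_0_iff[OF subS] by blast
  then have "proj S (lin_ext (T.pair_act x) ?q) = 0" using inv proj_eq_0_iff[OF subS] by blast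
  also have "proj S (lin_ext (T.pair_act x) ?q) =
      (\<Sum>s\<in>A. proj S (T.t (act Om.pres.P x (pure (F s))) (u s)) + \<tau> (F s) (act V x (u s)))"
    by (simp only: lin_ext_sum T.pair_act_t pS \<tau>_def)
  also have "\<dots> = (\<Sum>s\<in>A. (\<Sum>i\<in>J. \<tau> ((F s)(i := act (\<Omega> i) x (F s i))) (u s)) + \<tau> (F s) (act V x (u s)))"
  proof (rule sum.cong[OF refl])
    fix s assume s: "s \<in> A"
    have "Om.fam_act x (F s) \<in> Om.pres.F"
      using Om.pres.f_keys[of x "F s"] assms(3)[OF s] by simp
    then have "proj S (T.t (Om.pres.cs (Om.fam_act x (F s))) (u s)) = (\<Sum>i\<in>J. \<tau> ((F s)(i := act (\<Omega> i) x (F s i))) (u s))"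
      using proj_t_cs assms(4)[OF s] by (simp only: Om.fam_act_def lin_ext_sum lin_ext_gen)
    moreover have "act Om.pres.P x (pure (F s)) = Om.pres.cs (Om.fam_act x (F s))"
      using Om.pres.act_P[of x "gen (F s)"] by (simp add: pure_def)
    ultimately show "proj S (T.t (act Om.pres.P x (pure (F s))) (u s)) + \<tau> (F s) (act V x (u s)) =
        (\<Sum>i\<in>J. \<tau> ((F s)(i := act (\<Omega> i) x (F s i))) (u s)) + \<tau> (F s) (act V x (u s))" by (simp only:)
  qed
  finally show ?thesis .
qed

lemma omega_tensor_S:
  assumes inv: "\<And>x p. p \<in> S \<Longrightarrow> lin_ext (T.pair_act x) p \<in> S"
  shows "omega_tensor J lam \<alpha> \<beta> V \<tau>"
proof (rule omega_tensor.intro)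
  show "finite J" "inj_on lam J" by (fact fin inj)+
  show "i \<in> J \<Longrightarrow> lam i \<noteq> 0" for i by (rule lam0)
  show "i \<in> J \<Longrightarrow> \<beta> i \<noteq> 0 \<or> \<alpha> i \<noteq> 0" for i by (rule ab)
  show "simple_lie_module hv_alg V" by (rule simple)
  show "w \<in> carrier V \<Longrightarrow> \<exists>n0. \<forall>n\<ge>n0. act V (L_elt n) w = \<zero>\<^bsub>V\<^esub> \<and> act V (I_elt n) w = \<zero>\<^bsub>V\<^esub>" for w by (rule killed)
  fix f i v w p q c x F u
  fix A :: "(nat \<Rightarrow> nat) set"
  note E = fam_eq[symmetric]
  show "f \<in> (\<Pi>\<^sub>E i\<in>J. UNIV) \<Longrightarrow> i \<in> J \<Longrightarrow> v \<in> carrier V \<Longrightarrow> \<tau> (f(i := p + q)) v = \<tau> (f(i := p)) v + \<tau> (f(i := q)) v"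
    unfolding E by (rule \<tau>_add)
  show "f \<in> (\<Pi>\<^sub>E i\<in>J. UNIV) \<Longrightarrow> i \<in> J \<Longrightarrow> v \<in> carrier V \<Longrightarrow> \<tau> (f(i := Polynomial.smult c p)) v = scale c (\<tau> (f(i := p)) v)"
    unfolding E by (rule \<tau>_smult)
  show "f \<in> (\<Pi>\<^sub>E i\<in>J. UNIV) \<Longrightarrow> v \<in> carrier V \<Longrightarrow> w \<in> carrier V \<Longrightarrow> \<tau> f (v \<oplus>\<^bsub>V\<^esub> w) = \<tau> f v + \<tau> f w"
    unfolding E by (rule \<tau>_add_right)
  show "f \<in> (\<Pi>\<^sub>E i\<in>J. UNIV) \<Longrightarrow> v \<in> carrier V \<Longrightarrow> \<tau> f (c \<odot>\<^bsub>V\<^esub> v) = scale c (\<tau> f v)"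
    unfolding E by (rule \<tau>_smult_right)
  assume A: "finite A" "\<And>s. s \<in> A \<Longrightarrow> F s \<in> (\<Pi>\<^sub>E i\<in>J. UNIV)" "\<And>s. s \<in> A \<Longrightarrow> u s \<in> carrier V"
    "(\<Sum>s\<in>A. \<tau> (F s) (u s)) = 0"
  show "(\<Sum>s\<in>A. (\<Sum>i\<in>J. \<tau> ((F s)(i := act (\<Omega> i) x (F s i))) (u s)) + \<tau> (F s) (act V x (u s))) = 0"
  proof (rule \<tau>_invariant)
    show "lin_ext (T.pair_act x) p \<in> S" if "p \<in> S" for x p using that by (rule inv)
    show "F s \<in> Om.fam" if "s \<in> A" for s unfolding fam_eq using that by (rule A(2))
    show "u s \<in> carrier V" if "s \<in> A" for s using that by (rule A(3))
  qed (fact A(1,4))+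
qed

text \<open>
  Every element is a sum of tensors of distinct monomials in the variables with vectors of \<open>V\<close>.
\<close>
lemma monomial_form:
  assumes "p \<in> T.pres.F"
  shows "\<exists>A v. finite A \<and> A \<subseteq> extensional J \<and> (\<forall>a. v a \<in> carrier V) \<and> (\<forall>a. a \<notin> A \<longrightarrow> v a = \<zero>\<^bsub>V\<^esub>) \<and>
     proj S p = (\<Sum>a\<in>A. \<tau> (\<lambda>i\<in>J. Polynomial.monom 1 (a i)) (v a))"
proof -
  let ?m = "\<lambda>a. \<lambda>i\<in>J. Polynomial.monom 1 (a i)"
  define Z where "Z = {x. \<exists>A v. finite A \<and> A \<subseteq> extensional J \<and> (\<forall>a. v a \<in> carrier V) \<and> (\<forall>a. a \<notin> A \<longrightarrow> v a = \<zero>\<^bsub>V\<^esub>) \<and>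
     x = (\<Sum>a\<in>A. \<tau> (?m a) (v a))}"
  have m: "?m a \<in> Om.fam" for a by simp
  have subZ: "pm.subspace Z"
  proof (rule pm.subspaceI)
    show "0 \<in> Z" unfolding Z_def by (intro CollectI exI[of _ "{}"] exI[of _ "\<lambda>_. \<zero>\<^bsub>V\<^esub>"]) simp
    fix x y c assume "x \<in> Z"
    then obtain A v where x: "finite A" "A \<subseteq> extensional J" "\<And>a. v a \<in> carrier V" "\<And>a. a \<notin> A \<Longrightarrow> v a = \<zero>\<^bsub>V\<^esub>"
      "x = (\<Sum>a\<in>A. \<tau> (?m a) (v a))" unfolding Z_def by blast
    have "scale c x = (\<Sum>a\<in>A. \<tau> (?m a) (c \<odot>\<^bsub>V\<^esub> v a))"
      by (simp only: x(5) pm.scale_sum_right \<tau>_smult_right[OF m x(3)])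
    then show "scale c x \<in> Z" unfolding Z_def
      using x(1-4) by (intro CollectI exI[of _ A] exI[of _ "\<lambda>a. c \<odot>\<^bsub>V\<^esub> v a"]) simp
    assume "y \<in> Z"
    then obtain B w where y: "finite B" "B \<subseteq> extensional J" "\<And>a. w a \<in> carrier V" "\<And>a. a \<notin> B \<Longrightarrow> w a = \<zero>\<^bsub>V\<^esub>"
      "y = (\<Sum>a\<in>B. \<tau> (?m a) (w a))" unfolding Z_def by blast
    have "x = (\<Sum>a\<in>A \<union> B. \<tau> (?m a) (v a))"
    proof (unfold x(5), rule sum.mono_neutral_left)
      show "finite (A \<union> B)" using x(1) y(1) by simp
      show "A \<subseteq> A \<union> B" by blast
      show "\<forall>a\<in>A \<union> B - A. \<tau> (?m a) (v a) = 0" using x(4) \<tau>_zero_right[OF m] by simp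
    qed
    moreover have "y = (\<Sum>a\<in>A \<union> B. \<tau> (?m a) (w a))"
    proof (unfold y(5), rule sum.mono_neutral_left)
      show "finite (A \<union> B)" using x(1) y(1) by simp
      show "B \<subseteq> A \<union> B" by blast
      show "\<forall>a\<in>A \<union> B - B. \<tau> (?m a) (w a) = 0" using y(4) \<tau>_zero_right[OF m] by simp
    qed
    ultimately have "x + y = (\<Sum>a\<in>A \<union> B. \<tau> (?m a) (v a \<oplus>\<^bsub>V\<^esub> w a))"
      by (simp only: \<tau>_add_right[OF m x(3) y(3)] sum.distrib)
    then show "x + y \<in> Z" unfolding Z_def
      using x(1-4) y(1-4) by (intro CollectI exI[of _ "A \<union> B"] exI[of _ "\<lambda>a. v a \<oplus>\<^bsub>V\<^esub> w a"]) simp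
  qed
  have mZ: "\<tau> (?m a) w \<in> Z" if w: "w \<in> carrier V" for a w
  proof -
    define a' where "a' = restrict a J"
    have "?m a = ?m a'" by (auto simp: a'_def restrict_def)
    then have "\<tau> (?m a) w = \<tau> (?m a') w" by (rule arg_cong[where f = "\<lambda>f. \<tau> f w"])
    also have "\<dots> = (\<Sum>b\<in>{a'}. \<tau> (?m b) (if b = a' then w else \<zero>\<^bsub>V\<^esub>))" by simp
    finally have "\<tau> (?m a) w = (\<Sum>b\<in>{a'}. \<tau> (?m b) (if b = a' then w else \<zero>\<^bsub>V\<^esub>))" .
    moreover have "a' \<in> extensional J" by (simp add: a'_def)
    ultimately show ?thesis unfolding Z_def
      by (intro CollectI exI[of _ "{a'}"] exI[of _ "\<lambda>b. if b = a' then w else \<zero>\<^bsub>V\<^esub>"] conjI) (simp_all add: w)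
  qed
  have fZ: "\<tau> f w \<in> Z" if f: "f \<in> Om.fam" and w: "w \<in> carrier V" for f w
    by (rule multilinear_in_subspace[OF fin _ _ subZ, where \<tau> = "\<lambda>f. \<tau> f w"])
       (use f w \<tau>_add \<tau>_smult mZ in \<open>simp_all only: fam_eq\<close>)
  have "proj S p \<in> Z"
  proof -
    have "Poly_Mapping.keys p \<subseteq> T.pairs" using assms by simp
    then show ?thesis
    proof (induction rule: pm_induct)
      case zero
      then show ?case using pm.subspace_0[OF subZ] by (simp only: pS)
    next
      case (step c x p)
      obtain C w where x: "x = (C, w)" "C \<in> carrier Om.pres.P" "w \<in> carrier V" using step(1) by (rule SigmaE) blast
      obtain q where q: "C = Om.pres.cs q" "q \<in> Om.pres.F" using x(2) unfolding Om.pres.carrier_P by blast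
      have "proj S (gen x) = lin_ext (\<lambda>f. \<tau> f w) q"
        using proj_t_cs[OF q(2) x(3)] by (simp only: x(1) q(1) T.t_def)
      also have "\<dots> \<in> Z"
        unfolding lin_ext_def
        by (rule pm.subspace_sum[OF subZ], rule pm.subspace_scale[OF subZ], rule fZ[OF _ x(3)]) (use q(2) in blast)
      finally have gx: "proj S (gen x) \<in> Z" .
      show ?case unfolding pS by (intro pm.subspace_add[OF subZ] pm.subspace_scale[OF subZ] gx step(3))
    qed
  qed
  then show ?thesis unfolding Z_def by blast
qed

end

text \<open>
  The product of the constant coefficients of the polynomials and a functional on \<open>V\<close> with \<open>\<zeta> w0 \<noteq> 0\<close> give a functional on the tensor product whose
  value at \<open>1 \<otimes> w0\<close> is not \<open>0\<close>.
\<close>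
lemma nonzero: "\<not> T.pres.F \<subseteq> T.pres.N"
proof -
  obtain w0 where w0: "w0 \<in> carrier V" "w0 \<noteq> \<zero>\<^bsub>V\<^esub>"
    using simple T.B.V.zero_closed unfolding simple_lie_module_def by blast
  obtain \<zeta> :: "'w \<Rightarrow> complex" where \<zeta>: "\<And>v w. v \<in> carrier V \<Longrightarrow> w \<in> carrier V \<Longrightarrow> \<zeta> (v \<oplus>\<^bsub>V\<^esub> w) = \<zeta> v + \<zeta> w"
      "\<And>c v. v \<in> carrier V \<Longrightarrow> \<zeta> (c \<odot>\<^bsub>V\<^esub> v) = c * \<zeta> v" "\<zeta> w0 \<noteq> 0"
    using T.B.functional_exists[OF w0] by blast
  define \<eta> where "\<eta> = fun_ext (\<lambda>f :: nat \<Rightarrow> complex poly. \<Prod>i\<in>J. coeff (f i) 0)"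
  have \<eta>: "functional \<eta>" unfolding \<eta>_def by (rule functional_fun_ext)
  have upd: "(\<Prod>i\<in>J. coeff ((f(j := p)) i) 0) = coeff p 0 * (\<Prod>i\<in>J - {j}. coeff (f i) 0)" if "j \<in> J" for f j and p :: "complex poly"
  proof -
    have "(\<Prod>i\<in>J. coeff ((f(j := p)) i) 0) = coeff ((f(j := p)) j) 0 * (\<Prod>i\<in>J - {j}. coeff ((f(j := p)) i) 0)"
      by (rule prod.remove[OF fin that])
    also have "(\<Prod>i\<in>J - {j}. coeff ((f(j := p)) i) 0) = (\<Prod>i\<in>J - {j}. coeff (f i) 0)" by (rule prod.cong) auto
    finally show ?thesis by simp
  qed
  have "\<eta> r = 0" if "r \<in> Om.fam_rels" for r
    using that
    by (cases rule: Om.fam_rels_cases)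
       (simp_all only: \<eta>_def fun_ext_diff fun_ext_scale fun_ext_gen upd omega_simps, simp_all add: algebra_simps)
  then have \<eta>N: "\<eta> r = 0" if "r \<in> Om.pres.N" for r
    using pmc.linear_eq_0_on_span[OF \<eta> _ that] by blast
  define \<Psi> where "\<Psi> = fun_ext (\<lambda>(C, w). \<eta> (SOME p. p \<in> C) * \<zeta> w)"
  have \<Psi>: "functional \<Psi>" unfolding \<Psi>_def by (rule functional_fun_ext)
  have \<Psi>_t: "\<Psi> (T.t (Om.pres.cs p) w) = \<eta> p * \<zeta> w" for p w
  proof -
    have "(SOME q. q \<in> Om.pres.cs p) \<in> Om.pres.cs p" using self_in_coset[OF pm.subspace_span] by (rule someI)
    then have "\<eta> ((SOME q. q \<in> Om.pres.cs p) - p) = 0" by (intro \<eta>N) (simp add: coset_of_def)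
    then have "\<eta> (SOME q. q \<in> Om.pres.cs p) = \<eta> p" by (simp only: pmc.linear_diff[OF \<eta>] eq_iff_diff_eq_0[symmetric])
    then show ?thesis by (simp add: \<Psi>_def T.t_def)
  qed
  note S = pmc.linear_diff[OF \<Psi>] pmc.linear_scale[OF \<Psi>] \<Psi>_t pmc.linear_add[OF \<eta>] pmc.linear_scale[OF \<eta>]
    Om.pres.add_P Om.pres.smult_P
  have "\<Psi> r = 0" if "r \<in> T.pair_rels" for r
    using that
  proof (cases rule: T.pair_rels_cases)
    case (left_add v v' w)
    then obtain p q where pq: "v = Om.pres.cs p" "v' = Om.pres.cs q" unfolding Om.pres.carrier_P by blast
    show ?thesis unfolding left_add(4) pq S by (simp add: algebra_simps)
  next
    case (right_add v w w')
    then obtain p where pq: "v = Om.pres.cs p" unfolding Om.pres.carrier_P by blast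
    show ?thesis unfolding right_add(4) pq S \<zeta>(1)[OF right_add(2,3)] by (simp add: algebra_simps)
  next
    case (left_scale c v w)
    then obtain p where pq: "v = Om.pres.cs p" unfolding Om.pres.carrier_P by blast
    show ?thesis unfolding left_scale(3) pq S by (simp add: algebra_simps)
  next
    case (right_scale c v w)
    then obtain p where pq: "v = Om.pres.cs p" unfolding Om.pres.carrier_P by blast
    show ?thesis unfolding right_scale(3) pq S \<zeta>(2)[OF right_scale(2)] by (simp add: algebra_simps)
  qed
  then have N: "\<Psi> r = 0" if "r \<in> T.pres.N" for r
    using pmc.linear_eq_0_on_span[OF \<Psi> _ that] by blast
  let ?f = "\<lambda>i\<in>J. 1 :: complex poly"
  have "\<Psi> (T.t (pure ?f) w0) = \<zeta> w0" unfolding pure_def \<Psi>_t by (simp add: \<eta>_def)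
  then have nz: "\<Psi> (T.t (pure ?f) w0) \<noteq> 0" using \<zeta>(3) by (simp only: not_False_eq_True)
  have F: "T.t (pure ?f) w0 \<in> T.pres.F" by (intro T.keys_t pure_carrier w0) simp
  show ?thesis
  proof
    assume "T.pres.F \<subseteq> T.pres.N"
    then have "T.t (pure ?f) w0 \<in> T.pres.N" using F by (rule subsetD)
    then have "\<Psi> (T.t (pure ?f) w0) = 0" by (rule N)
    with nz show False by (rule notE)
  qed
qed

text \<open>
  An element of \<open>S\<close> outside \<open>T.pres.N\<close> is written as a sum of monomial tensors; not all of its coefficients are zero, and it
  is a relation between classes modulo \<open>S\<close>. Hence all classes modulo \<open>S\<close> vanish.
\<close>
theorem simple_tensor: "simple_lie_module hv_alg (tensor (tensor_family J \<Omega>) V)"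
  unfolding Om.tensor_family_eq T.tensor_eq
proof (rule T.pres.simple_P[OF T.is_lie_module_tensor nonzero])
  fix S assume S: "pm.subspace S" "T.pres.N \<subseteq> S" "S \<subseteq> T.pres.F"
    "\<And>a p. a \<in> carrier hv_alg \<Longrightarrow> p \<in> S \<Longrightarrow> lin_ext (T.pair_act a) p \<in> S"
  have inv: "\<And>x p. p \<in> S \<Longrightarrow> lin_ext (T.pair_act x) p \<in> S" using S(4) by simp
  note subN = pm.subspace_span[of T.pair_rels]
  let ?m = "\<lambda>a. \<lambda>i\<in>J. Polynomial.monom 1 (a i) :: complex poly"
  show "S \<subseteq> T.pres.N \<or> T.pres.F \<subseteq> S"
  proof (cases "S \<subseteq> T.pres.N")
    case False
    have "\<exists>p. p \<in> A \<and> p \<notin> B" if "\<not> A \<subseteq> B" for A B :: "(((nat \<Rightarrow> complex poly) \<Rightarrow>\<^sub>0 complex) set \<times> 'w \<Rightarrow>\<^sub>0 complex) set" using that by blast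
    from this[OF False] obtain p where p: "p \<in> S" "p \<notin> T.pres.N" by (elim exE conjE) (rule that)
    from monomial_form[OF subN subset_refl subsetD[OF S(3) p(1)]]
    obtain A v where A: "finite A" "A \<subseteq> extensional J" "\<forall>a. v a \<in> carrier V"
      "proj T.pres.N p = (\<Sum>a\<in>A. \<tau> T.pres.N (?m a) (v a))"
      by (elim exE conjE) (rule that)
    have vV: "v a \<in> carrier V" for a using A(3) by (rule spec)
    let ?q = "\<Sum>a\<in>A. T.t (pure (?m a)) (v a)"
    have "proj T.pres.N p = proj T.pres.N ?q"
      using A(4) by (simp only: \<tau>_def[OF subN subset_refl] pm2.linear_sum[OF plinear_proj[OF subN]])
    then have pq: "p - ?q \<in> T.pres.N" by (simp only: proj_eq_iff[OF subN])
    then have "p - (p - ?q) \<in> S" by (intro pm.subspace_diff[OF S(1)] p(1) subsetD[OF S(2)])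
    moreover have "p - (p - ?q) = ?q" by (rule diff_diff_eq2[THEN trans]) (rule add_diff_cancel_left')
    ultimately have "proj S ?q = 0" by (simp only: proj_eq_0_iff[OF S(1)])
    then have z: "(\<Sum>a\<in>A. \<tau> S (?m a) (v a)) = 0"
      by (simp only: \<tau>_def[OF S(1,2)] pm2.linear_sum[OF plinear_proj[OF S(1)]])
    interpret OT: omega_tensor J lam \<alpha> \<beta> V "\<tau> S"
      by (rule omega_tensor_S[OF S(1,2) inv])
    let ?A = "{a \<in> A. v a \<noteq> \<zero>\<^bsub>V\<^esub>}"
    have m: "?m a \<in> Om.fam" for a by simp
    have z': "(\<Sum>a\<in>?A. \<tau> S (?m a) (v a)) = 0"
      unfolding z[symmetric]
      by (rule sum.mono_neutral_left) (use A(1) in \<open>simp_all add: \<tau>_zero_right[OF S(1,2) m]\<close>)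
    have nonempty: "?A \<noteq> {}"
    proof
      assume "?A = {}"
      then have "\<And>a. a \<in> A \<Longrightarrow> v a = \<zero>\<^bsub>V\<^esub>" by blast
      then have "proj T.pres.N p = 0" unfolding A(4)
        by (intro sum.neutral ballI) (simp only: \<tau>_zero_right[OF subN subset_refl m])
      with p(2) show False by (simp only: proj_eq_0_iff[OF subN])
    qed
    have all: "\<tau> S f w = 0" if "f \<in> Om.fam" "w \<in> carrier V" for f w
    proof (rule OT.relation_forces_zero)
      show "finite ?A" using A(1) by simp
      show "?A \<subseteq> extensional J" using A(2) by (rule order_trans[rotated]) (rule Collect_restrict)
      show "v a \<in> carrier V" for a by (rule vV)
      show "v a \<noteq> \<zero>\<^bsub>V\<^esub>" if "a \<in> ?A" for a using that by simp
      show "(\<Sum>a\<in>?A. \<tau> S (OT.mon a) (v a)) = 0" unfolding OT.mon_def by (rule z')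
      show "f \<in> (\<Pi>\<^sub>E i\<in>J. UNIV)" unfolding fam_eq[symmetric] by (rule that)
    qed (fact nonempty that(2))+
    have "T.pres.F \<subseteq> S"
    proof
      fix r assume "r \<in> T.pres.F"
      from monomial_form[OF S(1,2) this] obtain A v where A: "\<forall>a. v a \<in> carrier V"
          "proj S r = (\<Sum>a\<in>A. \<tau> S (?m a) (v a))"
        by (elim exE conjE) (rule that)
      have "proj S r = 0" unfolding A(2) by (intro sum.neutral ballI all m A(1)[THEN spec])
      then show "r \<in> S" by (simp only: proj_eq_0_iff[OF S(1)])
    qed
    then show ?thesis by (rule disjI2)
  qed (rule disjI1)
qed

end

theorem theorem4p4:
  fixes m e :: nat
    and S' :: "nat set"
    and lam \<alpha> \<beta> :: "nat \<Rightarrow> complex"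
    and M :: "(hv, 'v) lie_mod"
    and c0 c1 c2 c3 :: complex
  assumes m_pos: "1 \<le> m"
    and S'_sub: "S' \<subseteq> {1..m}"
    and lam_nonzero: "\<And>i. i \<in> {1..m} \<Longrightarrow> lam i \<noteq> 0"
    and lam_distinct: "inj_on lam {1..m}"
    and in_S': "\<And>i. i \<in> S' \<Longrightarrow> \<beta> i \<noteq> 0"
    and not_in_S': "\<And>j. j \<in> {1..m} - S' \<Longrightarrow> \<alpha> j \<noteq> 0 \<and> \<beta> j = 0"
    and M_simple: "simple_lie_module (hv_sub e) M"
    and I0_scalar: "\<And>v. v \<in> carrier M \<Longrightarrow> act M (I_elt 0) v = c0 \<odot>\<^bsub>M\<^esub> v"
    and C1_scalar: "\<And>v. v \<in> carrier M \<Longrightarrow> act M C1_elt v = c1 \<odot>\<^bsub>M\<^esub> v"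
    and C2_scalar: "\<And>v. v \<in> carrier M \<Longrightarrow> act M C2_elt v = c2 \<odot>\<^bsub>M\<^esub> v"
    and C3_scalar: "\<And>v. v \<in> carrier M \<Longrightarrow> act M C3_elt v = c3 \<odot>\<^bsub>M\<^esub> v"
    and c3_zero: "c3 = 0"
    and ex_k: "\<exists>k::nat.
      (k \<noteq> 0 \<longrightarrow> inj_on (act M (I_elt (int k))) (carrier M)) \<and>
      (k = 0 \<longrightarrow> (\<forall>n::int. n \<noteq> 0 \<longrightarrow> c0 + (of_int n - 1) * c2 \<noteq> 0)) \<and>
      (\<forall>n>int k. \<forall>v\<in>carrier M. act M (I_elt n) v = \<zero>\<^bsub>M\<^esub>) \<and>
      (\<forall>n'>int k + int e. \<forall>v\<in>carrier M. act M (L_elt n') v = \<zero>\<^bsub>M\<^esub>)"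
  shows "simple_lie_module hv_alg
    (tensor (tensor_family {1..m} (\<lambda>i. omega (lam i) (\<alpha> i) (\<beta> i)))
            (induced_module hv_alg (hv_sub e) M))"
proof -
  from ex_k obtain k :: nat where k: "k \<noteq> 0 \<longrightarrow> inj_on (act M (I_elt (int k))) (carrier M)"
    "k = 0 \<longrightarrow> (\<forall>n::int. n \<noteq> 0 \<longrightarrow> c0 + (of_int n - 1) * c2 \<noteq> 0)"
    "\<forall>n>int k. \<forall>v\<in>carrier M. act M (I_elt n) v = \<zero>\<^bsub>M\<^esub>"
    "\<forall>n'>int k + int e. \<forall>v\<in>carrier M. act M (L_elt n') v = \<zero>\<^bsub>M\<^esub>"
    by (elim exE conjE) (rule that)
  interpret hv_induced e M c0 c1 c2 k
  proof (rule hv_induced.intro)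
    show "act M C3_elt v = 0 \<odot>\<^bsub>M\<^esub> v" if "v \<in> carrier M" for v
      using C3_scalar[OF that] c3_zero by simp
    show "inj_on (act M (I_elt (int k))) (carrier M)" if "k \<noteq> 0" using k(1) that by simp
    show "c0 + (of_int n - 1) * c2 \<noteq> 0" if "k = 0" "n \<noteq> 0" for n :: int using k(2) that by simp
    show "act M (I_elt n) v = \<zero>\<^bsub>M\<^esub>" if "n > int k" "v \<in> carrier M" for n v using k(3) that by simp
    show "act M (L_elt n) v = \<zero>\<^bsub>M\<^esub>" if "n > int k + int e" "v \<in> carrier M" for n v using k(4) that by simp
  qed (fact M_simple I0_scalar C1_scalar C2_scalar)+
  interpret omega_tensor_simple "{1..m}" lam \<alpha> \<beta> "induced_module hv_alg (hv_sub e) M"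
  proof (rule omega_tensor_simple.intro)
    show "\<beta> i \<noteq> 0 \<or> \<alpha> i \<noteq> 0" if "i \<in> {1..m}" for i
      using in_S' not_in_S' that by (cases "i \<in> S'") auto
    show "\<exists>n0. \<forall>n\<ge>n0. act (induced_module hv_alg (hv_sub e) M) (L_elt n) w = \<zero>\<^bsub>induced_module hv_alg (hv_sub e) M\<^esub> \<and>
        act (induced_module hv_alg (hv_sub e) M) (I_elt n) w = \<zero>\<^bsub>induced_module hv_alg (hv_sub e) M\<^esub>"
      if "w \<in> carrier (induced_module hv_alg (hv_sub e) M)" for w
      using that by (rule induced_locally_killed)
    show "finite {1..m}" by simp
    show "lam i \<noteq> 0" if "i \<in> {1..m}" for i using that by (rule lam_nonzero)
  qed (fact lam_distinct simple_induced)+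
  show ?thesis by (rule simple_tensor)
qed

end
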